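(* Let $\sigma\in(0,1)$ and $n=2$. Every minimizing cone $(\bar u,\bar E)$ in $\mathbb{R}^2$ is trivial, that is, $\bar E$ is a half-plane and $\bar u\equiv0$.
   Context: $B_r$ is the open ball of radius $r$ centered at $0$ in $\mathbb{R}^n$, and $E^c=\mathbb{R}^n\setminus E$. For measurable $A,B\subset\mathbb{R}^n$ let $L(A,B)=\int_A\int_B\frac{dx\,dy}{|x-y|^{n+\sigma}}$. For a bounded domain $\Omega\subset\mathbb{R}^n$ and measurable $E\subset\mathbb{R}^n$, the fractional perimeter is $\mathrm{Per}_\sigma(E,\Omega)=L(E\cap\Omega,E^c)+L(E\setminus\Omega,\Omega\setminus E)$. The energy is $J_\Omega(u,E)=\int_\Omega|\nabla u|^2dx+\mathrm{Per}_\sigma(E,\Omega)$. Given $\varphi\in H^1(\Omega)$ and $E_0\subset\Omega^c$, a pair $(u,E)$ is admissible (for the data $\varphi,E_0$) if $u-\varphi\in H^1_0(\Omega)$, $E\cap\Omega^c=E_0$, $u\ge0$ a.e. in $E\cap\Omega$ and $u\le 0$ a.e. in $E^c\cap\Omega$. A pair $(u,E)$ is a minimizing pair in $\Omega$ if it has finite energy and minimizes $J_\Omega$ among all admissible pairs with the same data (i.e. $\varphi=u$, $E_0=E\setminus\Omega$); it is minimizing in $\mathbb{R}^n$ if it is minimizing in every ball. Convention: sets are modified on a null set so that $\partial E=\{x:\ 0<|E\cap B_r(x)|<|B_r(x)|\ \text{for all } r>0\}$. A minimizing cone is a pair $(\bar u,\bar E)$ that is minimizing in $\mathbb{R}^n$,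 with $0\in\partial\bar E$, such that $\bar u$ is homogeneous of degree $1-\frac\sigma2$ and $\bar E$ is a cone with vertex $0$ ($t\bar E=\bar E$ for all $t>0$; equivalently, the extension $\bar U(\cdot,z)=(\chi_{\bar E}-\chi_{\bar E^c})*P(\cdot,z)$, $P(x,z)=\tilde c_{n,\sigma}z^\sigma(|x|^2+z^2)^{-(n+\sigma)/2}$ normalized to integral $1$ in $x$, is homogeneous of degree $0$). *)

theory Defs
  imports "HOL-Analysis.Analysis"
begin

section \<open>Sobolev spaces\<close>

text \<open>All functions are total; in every notion relative to \<open>\<Omega>\<close> only their restriction to
  \<open>\<Omega>\<close> matters.  Elements of the Sobolev spaces are represented by functions, to be
  identified when they agree almost everywhere.\<close>

primrec Ck :: "nat \<Rightarrow> ('a::euclidean_space \<Rightarrow> real) \<Rightarrow> bool" where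
  "Ck 0 f \<longleftrightarrow> continuous_on UNIV f"
| "Ck (Suc k) f \<longleftrightarrow> (\<forall>x. f differentiable (at x)) \<and>
     (\<forall>b\<in>Basis. Ck k (\<lambda>x. frechet_derivative f (at x) b))"

definition test_fun :: "'a::euclidean_space set \<Rightarrow> ('a \<Rightarrow> real) \<Rightarrow> bool" where
  "test_fun \<Omega> \<phi> \<longleftrightarrow> (\<forall>k. Ck k \<phi>) \<and>
     compact (closure {x. \<phi> x \<noteq> 0}) \<and> closure {x. \<phi> x \<noteq> 0} \<subseteq> \<Omega>"

definition L2 :: "'a::euclidean_space set \<Rightarrow> ('a \<Rightarrow> 'b::euclidean_space) \<Rightarrow> bool" where
  "L2 \<Omega> f \<longleftrightarrow> f \<in> borel_measurable (lebesgue_on \<Omega>) \<and>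
     integrable (lebesgue_on \<Omega>) (\<lambda>x. (norm (f x))\<^sup>2)"

definition is_weak_grad ::
    "'a::euclidean_space set \<Rightarrow> ('a \<Rightarrow> real) \<Rightarrow> ('a \<Rightarrow> 'a) \<Rightarrow> bool" where
  "is_weak_grad \<Omega> u g \<longleftrightarrow> L2 \<Omega> g \<and> (\<forall>\<phi>. test_fun \<Omega> \<phi> \<longrightarrow> (\<forall>b\<in>Basis.
     integral\<^sup>L (lebesgue_on \<Omega>) (\<lambda>x. u x * frechet_derivative \<phi> (at x) b) =
     - integral\<^sup>L (lebesgue_on \<Omega>) (\<lambda>x. (g x \<bullet> b) * \<phi> x)))"

definition H1 :: "'a::euclidean_space set \<Rightarrow> ('a \<Rightarrow> real) set" where
  "H1 \<Omega> = {u. L2 \<Omega> u \<and> (\<exists>g. is_weak_grad \<Omega> u g)}"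

text \<open>For \<open>u \<in> H1 \<Omega>\<close> and open \<open>\<Omega>\<close> the weak gradient is unique up to a null set,
  so nothing below depends on the choice.\<close>

definition weak_grad :: "'a::euclidean_space set \<Rightarrow> ('a \<Rightarrow> real) \<Rightarrow> 'a \<Rightarrow> 'a" where
  "weak_grad \<Omega> u = (SOME g. is_weak_grad \<Omega> u g)"

definition H1_norm :: "'a::euclidean_space set \<Rightarrow> ('a \<Rightarrow> real) \<Rightarrow> real" where
  "H1_norm \<Omega> u = sqrt (integral\<^sup>L (lebesgue_on \<Omega>) (\<lambda>x. (u x)\<^sup>2) +
     integral\<^sup>L (lebesgue_on \<Omega>) (\<lambda>x. (norm (weak_grad \<Omega> u x))\<^sup>2))"

definition H10 :: "'a::euclidean_space set \<Rightarrow> ('a \<Rightarrow> real) set" where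
  "H10 \<Omega> = {u \<in> H1 \<Omega>. \<exists>\<phi> :: nat \<Rightarrow> 'a \<Rightarrow> real. (\<forall>k. test_fun \<Omega> (\<phi> k)) \<and>
     (\<lambda>k. H1_norm \<Omega> (\<lambda>x. u x - \<phi> k x)) \<longlonglongrightarrow> 0}"


section \<open>The energy\<close>

text \<open>On the diagonal the kernel takes the value \<open>0\<close> here instead of \<open>\<infinity>\<close>; below it is only
  integrated over products of disjoint sets.\<close>

definition interaction :: "real \<Rightarrow> 'a::euclidean_space set \<Rightarrow> 'a set \<Rightarrow> ennreal" where
  "interaction \<sigma> A B = (\<integral>\<^sup>+x\<in>A. (\<integral>\<^sup>+y\<in>B.
     ennreal (1 / norm (x - y) powr (real DIM('a) + \<sigma>)) \<partial>lebesgue) \<partial>lebesgue)"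

definition frac_perimeter :: "real \<Rightarrow> 'a::euclidean_space set \<Rightarrow> 'a set \<Rightarrow> ennreal" where
  "frac_perimeter \<sigma> E \<Omega> = interaction \<sigma> (E \<inter> \<Omega>) (- E) + interaction \<sigma> (E - \<Omega>) (\<Omega> - E)"

definition energy ::
    "real \<Rightarrow> 'a::euclidean_space set \<Rightarrow> ('a \<Rightarrow> real) \<Rightarrow> 'a set \<Rightarrow> ennreal" where
  "energy \<sigma> \<Omega> u E =
     (\<integral>\<^sup>+x\<in>\<Omega>. ennreal ((norm (weak_grad \<Omega> u x))\<^sup>2) \<partial>lebesgue) + frac_perimeter \<sigma> E \<Omega>"

definition admissible ::
    "'a::euclidean_space set \<Rightarrow> ('a \<Rightarrow> real) \<Rightarrow> 'a set \<Rightarrow> ('a \<Rightarrow> real) \<Rightarrow> 'a set \<Rightarrow> bool" where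
  "admissible \<Omega> \<phi> E0 u E \<longleftrightarrow>
     \<phi> \<in> H1 \<Omega> \<and> E0 \<subseteq> - \<Omega> \<and>
     (\<lambda>x. u x - \<phi> x) \<in> H10 \<Omega> \<and> E \<in> sets lebesgue \<and> E \<inter> - \<Omega> = E0 \<and>
     (AE x in lebesgue. x \<in> E \<inter> \<Omega> \<longrightarrow> u x \<ge> 0) \<and>
     (AE x in lebesgue. x \<in> - E \<inter> \<Omega> \<longrightarrow> u x \<le> 0)"

definition minimizing_pair ::
    "real \<Rightarrow> 'a::euclidean_space set \<Rightarrow> ('a \<Rightarrow> real) \<Rightarrow> 'a set \<Rightarrow> bool" where
  "minimizing_pair \<sigma> \<Omega> u E \<longleftrightarrow>
     admissible \<Omega> u (E - \<Omega>) u E \<and> energy \<sigma> \<Omega> u E < \<infinity> \<and>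
     (\<forall>v F. admissible \<Omega> u (E - \<Omega>) v F \<longrightarrow> energy \<sigma> \<Omega> u E \<le> energy \<sigma> \<Omega> v F)"

definition minimizing_global ::
    "real \<Rightarrow> ('a::euclidean_space \<Rightarrow> real) \<Rightarrow> 'a set \<Rightarrow> bool" where
  "minimizing_global \<sigma> u E \<longleftrightarrow> (\<forall>x r. r > 0 \<longrightarrow> minimizing_pair \<sigma> (ball x r) u E)"


section \<open>Cones\<close>

definition normalized :: "'a::euclidean_space set \<Rightarrow> bool" where
  "normalized E \<longleftrightarrow> frontier E = {x. \<forall>r>0.
     0 < emeasure lebesgue (E \<inter> ball x r) \<and>
     emeasure lebesgue (E \<inter> ball x r) < emeasure lebesgue (ball x r)}"

text \<open>Since \<open>u\<close> is determined only up to a null set, its homogeneity is required almost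
  everywhere.  The library's \<^const>\<open>cone\<close> is not suitable for \<open>E\<close>: it also allows the factor \<open>0\<close>
  and so excludes nonempty cones without their vertex.\<close>

definition minimizing_cone ::
    "real \<Rightarrow> ('a::euclidean_space \<Rightarrow> real) \<Rightarrow> 'a set \<Rightarrow> bool" where
  "minimizing_cone \<sigma> u E \<longleftrightarrow>
     minimizing_global \<sigma> u E \<and> normalized E \<and> 0 \<in> frontier E \<and>
     (\<forall>t>0. AE x in lebesgue. u (t *\<^sub>R x) = t powr (1 - \<sigma> / 2) * u x) \<and>
     (\<forall>t>0. (\<lambda>x. t *\<^sub>R x) ` E = E)"

text \<open>A normalized set is determined only up to its null boundary, so which points of the
  bounding hyperplane belong to a half-space is left open.\<close>

definition is_halfspace :: "'a::euclidean_space set \<Rightarrow> bool" where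
  "is_halfspace E \<longleftrightarrow> (\<exists>e c. e \<noteq> 0 \<and> {x. e \<bullet> x > c} \<subseteq> E \<and> E \<subseteq> {x. e \<bullet> x \<ge> c})"

end

theory Submission
  imports Defs
begin

text \<open>The proof works directly with the nonlocal energy, without the extension.  Let \<open>\<Phi>\<^sub>t x = x + t \<psi>(x) e\<close>
  with a cutoff \<open>\<psi>\<close> equal to 1 on the unit ball.  Transporting \<open>(u, E)\<close> by \<open>\<Phi>\<^sub>t\<close> and by \<open>\<Phi>\<^sub>-\<^sub>t\<close> produces
  competitors whose energies add up to at most \<open>(2 + C t\<^sup>2) J(u, E)\<close>.  Comparing \<open>(u, E)\<close> also with
  the maximum and the minimum of \<open>(u, E)\<close> and \<open>(u\<^sub>t, E\<^sub>t)\<close>, the strict submodularity of the fractional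
  perimeter gives \<open>L(E - E\<^sub>t, E\<^sub>t - E) \<le> C t\<^sup>2 J(u, E)\<close>.  In a ball of radius \<open>\<rho> t\<close> the left side scales like
  \<open>t\<close> to the power \<open>2 - \<sigma>\<close>, because \<open>E\<close> is a cone in the plane, so it vanishes for \<open>E + e\<close> in
  place of \<open>E\<^sub>t\<close>: for every \<open>e\<close>, either \<open>E + e\<close> is contained in \<open>E\<close> or conversely, up to null sets.  The vectors \<open>e\<close> with
  \<open>E + e \<subseteq> E\<close> form a convex cone \<open>K\<close> with \<open>K \<union> -K\<close> everything, hence \<open>K\<close> contains an open half-plane and
  \<open>E\<close> is a half-plane.  On each of the two half-planes \<open>u\<close> is then of one sign, vanishes on the
  boundary, and is homogeneous of degree less than 1; testing with a truncation of the linear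
  function vanishing on the boundary forces \<open>u = 0\<close>.\<close>

text \<open>The dimension enters through one exponent. For a cone in dimension n the interaction
  inside a ball of radius \<open>\<rho> t\<close> is of order t to the power n - \<sigma>, which
  dominates the error \<open>C t\<^sup>2\<close> for small t only if n - \<sigma> < 2, that is, for
  n \<le> 2. This margin is why one fixed cutoff is enough. The obstacle is that nothing is known
  about the regularity of \<open>E\<close>, so the energy cannot be differentiated along the flow.
  Instead the transported energies are pulled back to a fixed domain of integration, where comparing
  \<open>t\<close> with \<open>-t\<close> becomes a pointwise inequality between integrands: every
  first-order term is odd in \<open>t\<close> and cancels. The competitor transported by
  \<open>-t\<close> serves only to bound the energy of the one transported by \<open>t\<close> from
  above, by \<open>(1 + C t\<^sup>2) J\<close>. In the last step only \<open>u\<close> is varied.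
  The linear function vanishing on the boundary is positive and harmonic in the half-plane, of
  degree 1; the degree \<open>1 - \<sigma> / 2\<close> of \<open>u\<close> is smaller, and this gap
  fixes the sign of the decisive integral.\<close>

lemma Ck_SucI:
  assumes "\<And>x. (f has_derivative f' x) (at x)" and "\<And>b. b \<in> Basis \<Longrightarrow> Ck k (\<lambda>x. f' x b)"
  shows "Ck (Suc k) f"
proof -
  have "frechet_derivative f (at x) = f' x" for x
    by (rule frechet_derivative_at[OF assms(1), symmetric])
  then show ?thesis
    using assms by (auto simp: differentiable_def)
qed

lemma Ck_has_derivative:
  assumes "Ck (Suc k) f"
  shows "(f has_derivative frechet_derivative f (at x)) (at x)"
  using assms frechet_derivative_works by (auto)

lemma Ck_SucD:
  assumes "Ck (Suc k) f"
  shows "Ck k f"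
  using assms
proof (induction k arbitrary: f)
  case 0
  then show ?case
    by (auto intro!: differentiable_imp_continuous_on simp: differentiable_on_def differentiable_at_withinI)
next
  case (Suc k)
  then show ?case
    by (metis Ck.simps(2))
qed

lemma Ck_continuous:
  assumes "Ck k f"
  shows "continuous_on UNIV f"
proof -
  have "Ck k f \<Longrightarrow> Ck 0 f"
    by (induction k) (use Ck_SucD in blast)+
  then show ?thesis using assms by simp
qed

named_theorems smooth_intros

lemma Ck_const [smooth_intros]: "Ck k (\<lambda>x. c)"
proof (induction k arbitrary: c)
  case (Suc k)
  show ?case
    by (rule Ck_SucI[where f' = "\<lambda>_ _. 0"]) (auto intro: Suc)
qed auto

lemma Ck_inner [smooth_intros]: "Ck k (\<lambda>x. x \<bullet> c)"
proof (cases k)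
  case (Suc m)
  show ?thesis
    unfolding Suc by (rule Ck_SucI[where f' = "\<lambda>_ h. h \<bullet> c"]) (auto intro!: derivative_eq_intros Ck_const)
qed (auto intro!: continuous_intros)

lemma Ck_add [smooth_intros]:
  assumes "Ck k f" "Ck k g"
  shows "Ck k (\<lambda>x. f x + g x)"
  using assms
proof (induction k arbitrary: f g)
  case 0
  then show ?case by (auto intro!: continuous_intros)
next
  case (Suc k)
  show ?case
    by (rule Ck_SucI[OF has_derivative_add[OF Ck_has_derivative[OF Suc(2)] Ck_has_derivative[OF Suc(3)]]])
       (use Suc in \<open>auto intro!: smooth_intros\<close>)
qed

lemma Ck_mult [smooth_intros]:
  assumes "Ck k f" "Ck k g"
  shows "Ck k (\<lambda>x. f x * g x)"
  using assms
proof (induction k arbitrary: f g)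
  case 0
  then show ?case by (auto intro!: continuous_intros)
next
  case (Suc k)
  show ?case
    by (rule Ck_SucI[OF has_derivative_mult[OF Ck_has_derivative[OF Suc(2)] Ck_has_derivative[OF Suc(3)]]])
       (use Suc Ck_SucD[OF Suc(2)] Ck_SucD[OF Suc(3)] in \<open>auto intro!: smooth_intros\<close>)
qed

lemma Ck_cmult: "Ck k f \<Longrightarrow> Ck k (\<lambda>x. c * f x)"
  by (intro smooth_intros)

lemma Ck_minus [smooth_intros]: "Ck k f \<Longrightarrow> Ck k (\<lambda>x. - f x)"
  using Ck_cmult[of k f "-1"] by simp

lemma Ck_diff [smooth_intros]: "Ck k f \<Longrightarrow> Ck k g \<Longrightarrow> Ck k (\<lambda>x. f x - g x)"
  using Ck_add[of k f "\<lambda>x. - g x"] Ck_minus by auto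

lemma Ck_sum [smooth_intros]: "(\<And>i. i \<in> I \<Longrightarrow> Ck k (f i)) \<Longrightarrow> Ck k (\<lambda>x. \<Sum>i\<in>I. f i x)"
  by (induction I rule: infinite_finite_induct) (auto intro: smooth_intros)

lemma Ck_reflect:
  assumes "Ck k f"
  shows "Ck k (\<lambda>y. f (x - y))"
  using assms
proof (induction k arbitrary: f)
  case 0
  then show ?case by (auto intro!: continuous_on_compose2[of UNIV f] continuous_intros)
next
  case (Suc k)
  have "((\<lambda>y. f (x - y)) has_derivative (\<lambda>h. frechet_derivative f (at (x - y)) (- h))) (at y)" for y
    by (rule has_derivative_compose[of "\<lambda>y. x - y" "\<lambda>h. - h" y UNIV f])
       (use Ck_has_derivative[OF Suc(2)] in \<open>auto intro!: derivative_eq_intros\<close>)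
  moreover have "frechet_derivative f (at z) (- h) = - frechet_derivative f (at z) h" for z h
    using Ck_has_derivative[OF Suc(2)] linear_neg has_derivative_linear by blast
  ultimately have d: "((\<lambda>y. f (x - y)) has_derivative (\<lambda>h. - frechet_derivative f (at (x - y)) h)) (at y)" for y
    by simp
  have "Ck k (\<lambda>y. - frechet_derivative f (at (x - y)) b)" if "b \<in> Basis" for b
    by (rule Ck_minus, rule Suc.IH[of "\<lambda>z. frechet_derivative f (at z) b"]) (use Suc.prems that in simp)
  then show ?case
    by (rule Ck_SucI[OF d])
qed

section \<open>Smooth functions and their directional derivatives\<close>

definition smooth :: "('a::euclidean_space \<Rightarrow> real) \<Rightarrow> bool" where
  "smooth f \<longleftrightarrow> (\<forall>k. Ck k f)"

abbreviation pd :: "('a::euclidean_space \<Rightarrow> real) \<Rightarrow> 'a \<Rightarrow> 'a \<Rightarrow> real" where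
  "pd f x \<equiv> frechet_derivative f (at x)"

lemma smooth_has_derivative: "smooth f \<Longrightarrow> (f has_derivative pd f x) (at x)"
  using Ck_has_derivative smooth_def by blast

lemma pd_eqI: "(f has_derivative f') (at x) \<Longrightarrow> pd f x = f'"
  using frechet_derivative_at by fastforce

lemma smooth_continuous: "smooth f \<Longrightarrow> continuous_on S f"
  using Ck_continuous smooth_def continuous_on_subset by blast

lemma smooth_linear_pd: "smooth f \<Longrightarrow> linear (pd f x)"
  using smooth_has_derivative has_derivative_linear by blast

lemma pd_expand: "smooth f \<Longrightarrow> pd f x e = (\<Sum>b\<in>Basis. (e \<bullet> b) * pd f x b)"
proof -
  assume "smooth f"
  then have "linear (pd f x)" by (rule smooth_linear_pd)
  then have "pd f x (\<Sum>b\<in>Basis. (e \<bullet> b) *\<^sub>R b) = (\<Sum>b\<in>Basis. (e \<bullet> b) * pd f x b)"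
    by (simp add: linear_sum linear_cmul)
  then show ?thesis by (simp add: euclidean_representation)
qed

lemma smooth_pd [smooth_intros]:
  assumes "smooth f"
  shows "smooth (\<lambda>x. pd f x e)"
proof -
  have "Ck k (\<lambda>x. pd f x b)" if "b \<in> Basis" for b k
    using assms that unfolding smooth_def by (metis Ck.simps(2))
  then have "smooth (\<lambda>x. \<Sum>b\<in>Basis. (e \<bullet> b) * pd f x b)"
    unfolding smooth_def by (auto intro!: smooth_intros)
  moreover have "(\<lambda>x. pd f x e) = (\<lambda>x. \<Sum>b\<in>Basis. (e \<bullet> b) * pd f x b)"
    by (rule ext, rule pd_expand[OF assms])
  ultimately show ?thesis by simp
qed

lemma smooth_const [smooth_intros]: "smooth (\<lambda>x. c)"
  and smooth_inner [smooth_intros]: "smooth (\<lambda>x. x \<bullet> d)"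
  and smooth_add [smooth_intros]: "smooth f \<Longrightarrow> smooth g \<Longrightarrow> smooth (\<lambda>x. f x + g x)"
  and smooth_mult [smooth_intros]: "smooth f \<Longrightarrow> smooth g \<Longrightarrow> smooth (\<lambda>x. f x * g x)"
  and smooth_diff [smooth_intros]: "smooth f \<Longrightarrow> smooth g \<Longrightarrow> smooth (\<lambda>x. f x - g x)"
  and smooth_sum [smooth_intros]: "(\<And>i. i \<in> I \<Longrightarrow> smooth (F i)) \<Longrightarrow> smooth (\<lambda>x. \<Sum>i\<in>I. F i x)"
  and smooth_reflect: "smooth f \<Longrightarrow> smooth (\<lambda>y. f (x - y))"
  unfolding smooth_def by (simp_all add: Ck_const Ck_inner Ck_add Ck_mult Ck_minus Ck_diff Ck_reflect Ck_sum)

lemma smooth_inner_self [smooth_intros]: "smooth (\<lambda>x. x \<bullet> x)"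
  by (simp add: euclidean_inner[of x x for x]) (intro smooth_intros)

section \<open>Test functions\<close>

lemma test_funI:
  assumes "smooth \<phi>" "compact K" "K \<subseteq> \<Omega>" "\<And>x. x \<notin> K \<Longrightarrow> \<phi> x = 0"
  shows "test_fun \<Omega> \<phi>"
proof -
  have "closure {x. \<phi> x \<noteq> 0} \<subseteq> K"
    using assms by (intro closure_minimal compact_imp_closed) auto
  then show ?thesis
    using assms bounded_subset[OF compact_imp_bounded[OF assms(2)], of "closure {x. \<phi> x \<noteq> 0}"]
    unfolding test_fun_def smooth_def by (simp add: compact_eq_bounded_closed)
qed

lemma test_funE:
  assumes "test_fun \<Omega> \<phi>"
  obtains K where "smooth \<phi>" "compact K" "K \<subseteq> \<Omega>" "\<And>x. x \<notin> K \<Longrightarrow> \<phi> x = 0"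
    "\<And>x e. x \<notin> K \<Longrightarrow> pd \<phi> x e = 0"
proof
  let ?K = "closure {x. \<phi> x \<noteq> 0}"
  show "smooth \<phi>" "compact ?K" "?K \<subseteq> \<Omega>"
    using assms by (auto simp: test_fun_def smooth_def)
  show z: "\<phi> x = 0" if "x \<notin> ?K" for x
    using that closure_subset[of "{x. \<phi> x \<noteq> 0}"] by auto
  show "pd \<phi> x e = 0" if "x \<notin> ?K" for x e
  proof -
    have "(\<phi> has_derivative (\<lambda>h. 0)) (at x)"
    proof (rule has_derivative_transform_within_open)
      show "((\<lambda>x. 0) has_derivative (\<lambda>h. 0)) (at x)" by simp
      show "open (- ?K)" "x \<in> - ?K" using that by auto
      show "0 = \<phi> y" if "y \<in> - ?K" for y using z[of y] that by simp
    qed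
    from pd_eqI[OF this] show ?thesis by simp
  qed
qed

lemma test_fun_smooth: "test_fun \<Omega> \<phi> \<Longrightarrow> smooth \<phi>"
  by (auto simp: test_fun_def smooth_def)

lemma test_fun_pd: "test_fun \<Omega> \<phi> \<Longrightarrow> test_fun \<Omega> (\<lambda>x. pd \<phi> x e)"
  by (erule test_funE, rule test_funI) (auto intro: smooth_intros)

lemma test_fun_mono: "test_fun \<Omega> \<phi> \<Longrightarrow> \<Omega> \<subseteq> \<Omega>' \<Longrightarrow> test_fun \<Omega>' \<phi>"
  by (auto simp: test_fun_def)

lemma test_fun_mult: "test_fun \<Omega> \<phi> \<Longrightarrow> smooth f \<Longrightarrow> test_fun \<Omega> (\<lambda>x. f x * \<phi> x)"
  by (erule test_funE, rule test_funI) (auto intro: smooth_intros)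

lemma test_fun_reflect:
  assumes "test_fun UNIV \<phi>"
  shows "test_fun UNIV (\<lambda>y. \<phi> (x - y))"
proof -
  obtain K where K: "smooth \<phi>" "compact K" "\<And>x. x \<notin> K \<Longrightarrow> \<phi> x = 0"
    using assms by (metis test_funE)
  have "compact ((\<lambda>y. x - y) ` K)"
    using K by (intro compact_continuous_image continuous_intros)
  moreover have "\<phi> (x - y) = 0" if "y \<notin> (\<lambda>y. x - y) ` K" for y
    using that K(3)[of "x - y"] by (force simp: image_iff algebra_simps)
  ultimately show ?thesis
    using K by (intro test_funI[where K = "(\<lambda>y. x - y) ` K"] smooth_reflect) auto
qed

lemma test_fun_bounded:
  assumes "test_fun \<Omega> \<phi>"
  obtains C where "C > 0" "\<And>x. \<bar>\<phi> x\<bar> \<le> C"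
proof -
  obtain K where K: "smooth \<phi>" "compact K" "\<And>x. x \<notin> K \<Longrightarrow> \<phi> x = 0"
    using assms by (metis test_funE)
  have "compact (\<phi> ` K)"
    using K smooth_continuous by (intro compact_continuous_image) auto
  then obtain C where "\<forall>y\<in>\<phi> ` K. norm y \<le> C"
    using compact_imp_bounded bounded_iff by metis
  then have "\<bar>\<phi> x\<bar> \<le> \<bar>C\<bar> + 1" for x
    using K(3)[of x] by (cases "x \<in> K") force+
  then show thesis using that[of "\<bar>C\<bar> + 1"] by auto
qed

section \<open>A bump function\<close>

text \<open>The case \<open>m = 0\<close> is the classical function that is flat at 0. The powers of
  \<open>s\<close> in the denominator are included because the family is then closed under
  differentiation, up to linear combinations.\<close>

definition flat :: "nat \<Rightarrow> real \<Rightarrow> real" where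
  "flat m s = (if s > 0 then exp (- 1 / s) / s ^ m else 0)"

lemma flat_nonneg: "flat m s \<ge> 0" and flat_pos: "s > 0 \<Longrightarrow> flat m s > 0"
  and flat_0: "s \<le> 0 \<Longrightarrow> flat m s = 0"
  by (auto simp: flat_def)

lemma flat_tendsto_0: "(flat m \<longlongrightarrow> 0) (at 0)"
proof -
  have "((\<lambda>s. inverse s ^ m / exp (inverse s)) \<longlongrightarrow> 0) (at_right (0::real))"
    using filterlim_compose[OF tendsto_power_div_exp_0 filterlim_inverse_at_top_right] by blast
  moreover have "eventually (\<lambda>s::real. inverse s ^ m / exp (inverse s) = flat m s) (at_right 0)"
    by (auto simp: eventually_at_right_field flat_def exp_minus divide_simps intro!: exI[of _ 1])
  ultimately have "(flat m \<longlongrightarrow> 0) (at_right 0)"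
    using tendsto_cong by force
  moreover have "eventually (\<lambda>s::real. 0 = flat m s) (at_left 0)"
    by (auto simp: eventually_at_left_field flat_def intro!: exI[of _ "-1"])
  then have "(flat m \<longlongrightarrow> 0) (at_left 0)"
    using tendsto_cong tendsto_const by force
  ultimately show ?thesis
    using filterlim_split_at by blast
qed

lemma flat_has_derivative:
  "(flat m has_real_derivative (flat (m + 2) s - m * flat (m + 1) s)) (at s)"
proof -
  consider "s < 0" | "s = 0" | "s > 0" by linarith
  then show ?thesis
  proof cases
    case 1
    have "((\<lambda>_. 0) has_real_derivative 0) (at s)" by simp
    then have "(flat m has_real_derivative 0) (at s)"
      by (rule DERIV_cong_ev[THEN iffD1, rotated 3, OF _])
         (use 1 in \<open>auto simp: flat_def eventually_nhds intro!: exI[of _ "{..<0}"]\<close>)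
    then show ?thesis using 1 by (simp add: flat_def)
  next
    case 2
    \<comment> \<open>The difference quotient at 0 is again a member of the family, so its limit is
      already known.\<close>
    have "(\<lambda>h. (flat m (0 + h) - flat m 0) / h) = flat (m + 1)"
      by (auto simp: flat_def fun_eq_iff)
    then have "(flat m has_real_derivative 0) (at 0)"
      unfolding DERIV_def using flat_tendsto_0 by simp
    then show ?thesis using 2 by (simp add: flat_def)
  next
    case 3
    have "((\<lambda>s. exp (- 1 / s) * inverse s ^ m) has_real_derivative
        (flat (m + 2) s - m * flat (m + 1) s)) (at s)"
      apply (rule derivative_eq_intros refl | use 3 in simp; fail)+
      using 3 by (cases m) (auto simp: flat_def field_simps)
    then show ?thesis
      by (rule DERIV_cong_ev[THEN iffD1, rotated 3, OF _])
         (use 3 in \<open>auto simp: flat_def eventually_nhds divide_simps intro!: exI[of _ "{0<..}"]\<close>)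
  qed
qed

text \<open>Induction on \<open>k\<close> with \<open>m\<close> free: differentiating raises
  \<open>m\<close> to \<open>m + 1\<close> and \<open>m + 2\<close>.\<close>

lemma Ck_flat:
  assumes "Ck k q"
  shows "Ck k (\<lambda>x. flat m (q x))"
  using assms
proof (induction k arbitrary: m)
  case 0
  have "isCont (flat m) s" for s
    using flat_has_derivative DERIV_isCont by blast
  then have "continuous_on UNIV (flat m)"
    by (simp add: continuous_at_imp_continuous_on)
  then show ?case using 0 by (auto intro!: continuous_on_compose2[of UNIV "flat m"])
next
  case (Suc k)
  have d: "((\<lambda>x. flat m (q x)) has_derivative
     (\<lambda>h. (flat (m + 2) (q x) - m * flat (m + 1) (q x)) * pd q x h)) (at x)" for x
    using has_derivative_compose[OF Ck_has_derivative[OF Suc(2)] flat_has_derivative[of m, unfolded has_field_derivative_def]]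
    by simp
  show ?case
    by (rule Ck_SucI[OF d]) (use Suc Ck_SucD[OF Suc(2)] in \<open>auto intro!: smooth_intros\<close>)
qed

lemma smooth_flat [smooth_intros]: "smooth q \<Longrightarrow> smooth (\<lambda>x. flat m (q x))"
  by (simp add: smooth_def Ck_flat)

lemma test_fun_flat:
  "test_fun UNIV (\<lambda>x::'a::euclidean_space. flat m (r\<^sup>2 - x \<bullet> x))"
proof (rule test_funI)
  show "smooth (\<lambda>x::'a. flat m (r\<^sup>2 - x \<bullet> x))"
    by (intro smooth_intros)
  show "flat m (r\<^sup>2 - x \<bullet> x) = 0" if "x \<notin> cball (0::'a) \<bar>r\<bar>" for x
  proof (rule flat_0)
    have "\<bar>r\<bar> \<le> norm x" using that by simp
    then show "r\<^sup>2 - x \<bullet> x \<le> 0"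
      using power_mono[of "\<bar>r\<bar>" "norm x" 2] by (simp add: dot_square_norm)
  qed
qed auto

section \<open>Lebesgue measure\<close>

text \<open>Makes the theorems of Tonelli and Fubini available for products of the completed
  measure.\<close>

lemma sigma_finite_lebesgue: "sigma_finite_measure (lebesgue :: 'a::euclidean_space measure)"
proof
  obtain A :: "'a set set" where A: "countable A" "A \<subseteq> sets lborel" "\<Union>A = space lborel"
      "\<forall>a\<in>A. emeasure lborel a \<noteq> \<infinity>"
    using lborel.sigma_finite_countable by metis
  then show "\<exists>A::'a set set. countable A \<and> A \<subseteq> sets lebesgue \<and> \<Union> A = space lebesgue \<and>
      (\<forall>a\<in>A. emeasure lebesgue a \<noteq> \<infinity>)"
    by (intro exI[of _ A]) auto
qed

interpretation lebesgue: sigma_finite_measure "lebesgue :: 'a::euclidean_space measure"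
  by (rule sigma_finite_lebesgue)

interpretation lebesgue_pair: pair_sigma_finite "lebesgue :: 'a::euclidean_space measure" "lebesgue :: 'b::euclidean_space measure" ..

lemma borel_imp_lebesgue: "f \<in> borel_measurable borel \<Longrightarrow> f \<in> borel_measurable lebesgue"
  by (simp add: measurable_completion)

lemma continuous_imp_lebesgue:
  "continuous_on UNIV f \<Longrightarrow> (f::'a::euclidean_space \<Rightarrow> 'b::real_normed_vector) \<in> borel_measurable lebesgue"
  by (intro borel_imp_lebesgue borel_measurable_continuous_onI)

lemma smooth_measurable: "smooth f \<Longrightarrow> f \<in> borel_measurable lebesgue"
  by (intro continuous_imp_lebesgue smooth_continuous)

lemma pair_fst_borel [measurable]: "fst \<in> borel_measurable (lebesgue \<Otimes>\<^sub>M lebesgue)"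
  and pair_snd_borel [measurable]: "snd \<in> borel_measurable (lebesgue \<Otimes>\<^sub>M lebesgue)"
  using measurable_compose[OF measurable_fst id_borel_measurable_lebesgue]
    measurable_compose[OF measurable_snd id_borel_measurable_lebesgue] by auto

lemma
  fixes t :: "'a::euclidean_space"
  assumes "c \<noteq> 0"
  shows affine_measurable_lebesgue: "(\<lambda>x. t + c *\<^sub>R x) \<in> lebesgue \<rightarrow>\<^sub>M lebesgue"
    and lebesgue_eq_affine:
      "lebesgue = density (distr lebesgue lebesgue (\<lambda>x. t + c *\<^sub>R x)) (\<lambda>_. ennreal (\<bar>c\<bar> ^ DIM('a)))"
proof -
  have eq: "t + (\<Sum>j\<in>Basis. (c * (x \<bullet> j)) *\<^sub>R j) = t + c *\<^sub>R x" for x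
    by (simp add: euclidean_representation flip: scaleR_scaleR scaleR_sum_right)
  show "(\<lambda>x. t + c *\<^sub>R x) \<in> lebesgue \<rightarrow>\<^sub>M lebesgue"
    using lebesgue_affine_measurable[of "\<lambda>_::'a. c" t] assms unfolding eq by simp
  show "lebesgue = density (distr lebesgue lebesgue (\<lambda>x. t + c *\<^sub>R x)) (\<lambda>_. ennreal (\<bar>c\<bar> ^ DIM('a)))"
    using lebesgue_affine_euclidean[of "\<lambda>_::'a. c" t] assms unfolding eq by simp
qed

lemma nn_integral_affine:
  fixes t :: "'a::euclidean_space"
  assumes [measurable]: "f \<in> borel_measurable lebesgue" and c: "c \<noteq> 0"
  shows "(\<integral>\<^sup>+x. f x \<partial>lebesgue) = ennreal (\<bar>c\<bar> ^ DIM('a)) * (\<integral>\<^sup>+x. f (t + c *\<^sub>R x) \<partial>lebesgue)"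
proof -
  note [measurable] = affine_measurable_lebesgue[OF c, of t]
  show ?thesis
    by (subst lebesgue_eq_affine[OF c, of t])
       (simp add: nn_integral_density nn_integral_distr nn_integral_cmult)
qed

lemma AE_affine:
  fixes t :: "'a::euclidean_space"
  assumes "AE x in lebesgue. P x" and c: "c \<noteq> 0"
  shows "AE x in lebesgue. P (t + c *\<^sub>R x)"
proof -
  let ?T = "\<lambda>x::'a. t + c *\<^sub>R x"
  note T [measurable] = affine_measurable_lebesgue[OF c, of t]
  obtain N where N: "N \<in> null_sets lebesgue" "{x. \<not> P x} \<subseteq> N"
    using assms(1) by (auto simp: eventually_ae_filter)
  have "(\<integral>\<^sup>+x. indicator N x \<partial>lebesgue) = ennreal (\<bar>c\<bar> ^ DIM('a)) * (\<integral>\<^sup>+x. indicator N (?T x) \<partial>lebesgue)"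
    using N by (intro nn_integral_affine c) auto
  moreover have "(\<integral>\<^sup>+x. indicator N x \<partial>lebesgue) = 0"
    using N by (simp add: null_sets_def)
  ultimately have "(\<integral>\<^sup>+x. indicator N (?T x) \<partial>lebesgue) = 0"
    using c by simp
  moreover have "(\<lambda>x. indicator N (?T x) :: ennreal) \<in> borel_measurable lebesgue"
    using N by (intro measurable_compose[OF T]) auto
  ultimately have "AE x in lebesgue. indicator N (?T x) = (0::ennreal)"
    by (simp add: nn_integral_0_iff_AE)
  then show ?thesis
    by (rule eventually_mono) (use N(2) in \<open>auto split: split_indicator_asm\<close>)
qed

lemma integral_reflect:
  fixes f :: "'a::euclidean_space \<Rightarrow> real"
  assumes "f \<in> borel_measurable lebesgue"
  shows "(\<integral>y. f (x - y) \<partial>lebesgue) = (\<integral>y. f y \<partial>lebesgue)"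
proof -
  have "lebesgue = distr lebesgue lebesgue (\<lambda>y. x + (-1) *\<^sub>R y)"
    by (subst lebesgue_eq_affine[of "-1" x]) (auto simp: density_1)
  then have "(\<integral>y. f y \<partial>lebesgue) = (\<integral>y. f y \<partial>distr lebesgue lebesgue (\<lambda>y. x + (-1) *\<^sub>R y))"
    by simp
  also have "\<dots> = (\<integral>y. f (x + (-1) *\<^sub>R y) \<partial>lebesgue)"
    using assms affine_measurable_lebesgue[of "-1" x] by (intro integral_distr) auto
  finally show ?thesis by simp
qed

lemma nn_integral_reflect:
  fixes x :: "'a::euclidean_space"
  assumes "f \<in> borel_measurable lebesgue"
  shows "(\<integral>\<^sup>+y. f (x - y) \<partial>lebesgue) = (\<integral>\<^sup>+y. f y \<partial>lebesgue)"
  using nn_integral_affine[OF assms, of "-1" x] by simp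

section \<open>Square integrability\<close>

lemma L2_UNIV_iff:
  "L2 UNIV f \<longleftrightarrow> f \<in> borel_measurable lebesgue \<and> (\<integral>\<^sup>+x. ennreal ((norm (f x))\<^sup>2) \<partial>lebesgue) < \<infinity>"
  unfolding L2_def lebesgue_on_UNIV_eq
  by (auto simp: integrable_iff_bounded)

text \<open>Trades square integrability on \<open>\<Omega>\<close> for that of the extension by
  zero, so that estimates and measurability arguments run under the single measure
  \<open>lebesgue\<close>.\<close>

lemma L2_iff_indicator:
  fixes f :: "'a::euclidean_space \<Rightarrow> 'b::euclidean_space"
  assumes "\<Omega> \<in> sets lebesgue"
  shows "L2 \<Omega> f \<longleftrightarrow> L2 UNIV (\<lambda>x. indicator \<Omega> x *\<^sub>R f x)"
proof -
  have "(\<lambda>x. indicator \<Omega> x *\<^sub>R (norm (f x))\<^sup>2) = (\<lambda>x. (norm (indicator \<Omega> x *\<^sub>R f x))\<^sup>2)"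
    by (auto split: split_indicator)
  then show ?thesis
    using assms unfolding L2_def lebesgue_on_UNIV_eq
    by (simp add: integrable_restrict_space borel_measurable_restrict_space_iff)
qed

lemma compact_subset_cball:
  assumes "compact (K :: 'a::real_normed_vector set)"
  obtains r where "r > 0" "K \<subseteq> cball 0 r"
  using compact_imp_bounded[OF assms] by (auto simp: bounded_pos subset_eq)

lemma L2_borel: "L2 UNIV f \<Longrightarrow> f \<in> borel_measurable lebesgue"
  by (simp add: L2_UNIV_iff)

lemma L2_bound:
  assumes "L2 UNIV g" "f \<in> borel_measurable lebesgue" "AE x in lebesgue. norm (f x) \<le> C * norm (g x)"
  shows "L2 UNIV f"
proof -
  have "integrable lebesgue (\<lambda>x. C\<^sup>2 * (norm (g x))\<^sup>2)"
    using assms(1) by (simp add: L2_def lebesgue_on_UNIV_eq)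
  moreover have "AE x in lebesgue. (norm (f x))\<^sup>2 \<le> C\<^sup>2 * (norm (g x))\<^sup>2"
    using assms(3)
  proof eventually_elim
    case (elim x)
    then show ?case
      using power_mono[OF elim, of 2] by (simp add: power_mult_distrib)
  qed
  moreover have "(\<lambda>x. (norm (f x))\<^sup>2) \<in> borel_measurable lebesgue"
    using assms(2) by simp
  ultimately have "integrable lebesgue (\<lambda>x. (norm (f x))\<^sup>2)"
    by (rule_tac Bochner_Integration.integrable_bound[of _ "\<lambda>x. C\<^sup>2 * (norm (g x))\<^sup>2"])
       (auto elim!: eventually_mono)
  then show ?thesis
    using assms(2) by (simp add: L2_def lebesgue_on_UNIV_eq)
qed

lemma square_add_le: "((a::real) + b)\<^sup>2 \<le> 2 * a\<^sup>2 + 2 * b\<^sup>2"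
  using zero_le_power2[of "a - b"] by (simp add: power2_eq_square algebra_simps)

lemma norm_add_square_le: "(norm (a + b))\<^sup>2 \<le> 2 * (norm a)\<^sup>2 + 2 * (norm b)\<^sup>2"
  by (rule order_trans[OF power_mono[OF norm_triangle_ineq] square_add_le]) simp

lemma L2_add:
  assumes "L2 \<Omega> f" "L2 \<Omega> g"
  shows "L2 \<Omega> (\<lambda>x. f x + g x)"
proof -
  have [measurable]: "f \<in> borel_measurable (lebesgue_on \<Omega>)" "g \<in> borel_measurable (lebesgue_on \<Omega>)"
    using assms by (auto simp: L2_def)
  have "integrable (lebesgue_on \<Omega>) (\<lambda>x. 2 * (norm (f x))\<^sup>2 + 2 * (norm (g x))\<^sup>2)"
    using assms by (simp add: L2_def)
  then have "integrable (lebesgue_on \<Omega>) (\<lambda>x. (norm (f x + g x))\<^sup>2)"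
    by (rule Bochner_Integration.integrable_bound) (use norm_add_square_le[of "f x" "g x" for x] in auto)
  then show ?thesis by (simp add: L2_def)
qed

lemma L2_scaleR:
  assumes "L2 \<Omega> f"
  shows "L2 \<Omega> (\<lambda>x. c *\<^sub>R f x)"
  using assms by (simp add: L2_def power_mult_distrib borel_measurable_scaleR)

lemma L2_cmult:
  fixes f :: "_ \<Rightarrow> real"
  shows "L2 \<Omega> f \<Longrightarrow> L2 \<Omega> (\<lambda>x. c * f x)"
  using L2_scaleR[of \<Omega> f c] by simp

lemma L2_diff:
  assumes "L2 \<Omega> f" "L2 \<Omega> g"
  shows "L2 \<Omega> (\<lambda>x. f x - g x)"
  using L2_add[OF assms(1) L2_scaleR[OF assms(2), of "-1"]] by simp

lemma L2_mult_integrable: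
  fixes f g :: "_ \<Rightarrow> real"
  assumes "L2 \<Omega> f" "L2 \<Omega> g"
  shows "integrable (lebesgue_on \<Omega>) (\<lambda>x. f x * g x)"
proof -
  have [measurable]: "f \<in> borel_measurable (lebesgue_on \<Omega>)" "g \<in> borel_measurable (lebesgue_on \<Omega>)"
    using assms by (auto simp: L2_def)
  have b: "\<bar>f x * g x\<bar> \<le> (f x)\<^sup>2 + (g x)\<^sup>2" for x
    using zero_le_power2[of "\<bar>f x\<bar> - \<bar>g x\<bar>"] mult_nonneg_nonneg[OF abs_ge_zero[of "f x"] abs_ge_zero[of "g x"]]
    unfolding power2_diff abs_mult power2_abs by linarith
  have "integrable (lebesgue_on \<Omega>) (\<lambda>x. (f x)\<^sup>2 + (g x)\<^sup>2)"
    using assms by (simp add: L2_def)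
  then show ?thesis
    by (rule Bochner_Integration.integrable_bound) (use b in auto)
qed

lemma L2_inner:
  fixes G :: "'a::euclidean_space \<Rightarrow> 'b::euclidean_space"
  assumes "L2 \<Omega> G"
  shows "L2 \<Omega> (\<lambda>x. G x \<bullet> e)"
proof -
  have [measurable]: "G \<in> borel_measurable (lebesgue_on \<Omega>)"
    using assms by (auto simp: L2_def)
  have b: "(G x \<bullet> e)\<^sup>2 \<le> (norm e)\<^sup>2 * (norm (G x))\<^sup>2" for x
    using power_mono[OF Cauchy_Schwarz_ineq2[of "G x" e], of 2] by (simp add: power_mult_distrib mult.commute)
  have "integrable (lebesgue_on \<Omega>) (\<lambda>x. (norm e)\<^sup>2 * (norm (G x))\<^sup>2)"
    using assms by (simp add: L2_def)
  then have "integrable (lebesgue_on \<Omega>) (\<lambda>x. (G x \<bullet> e)\<^sup>2)"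
    by (rule Bochner_Integration.integrable_bound) (use b in auto)
  then show ?thesis by (simp add: L2_def)
qed

lemma L2_bounded_support:
  fixes f :: "'a::euclidean_space \<Rightarrow> real"
  assumes "f \<in> borel_measurable lebesgue" "\<And>x. \<bar>f x\<bar> \<le> C" "\<And>x. x \<notin> cball 0 r \<Longrightarrow> f x = 0"
  shows "L2 UNIV f"
proof -
  have "L2 UNIV (indicator (cball 0 r) :: 'a \<Rightarrow> real)"
  proof -
    have "((indicator (cball 0 r) x)::real)\<^sup>2 = indicator (cball 0 r) x" for x :: 'a
      by (auto split: split_indicator)
    then show ?thesis
      unfolding L2_def lebesgue_on_UNIV_eq
      using emeasure_lborel_cball_finite[of "0::'a" r]
      by (auto intro!: borel_measurable_indicator integrable_real_indicator simp: less_top)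
  qed
  then show ?thesis
    by (rule L2_bound[where C=C]) (use assms in \<open>auto split: split_indicator\<close>)
qed

lemma test_fun_L2:
  assumes "test_fun \<Omega> \<phi>"
  shows "L2 UNIV \<phi>"
proof -
  obtain K where K: "smooth \<phi>" "compact K" "\<And>x. x \<notin> K \<Longrightarrow> \<phi> x = 0"
    using assms by (metis test_funE)
  obtain r where "K \<subseteq> cball 0 r"
    using compact_subset_cball[OF K(2)] by metis
  moreover obtain C where "\<And>x. \<bar>\<phi> x\<bar> \<le> C"
    using test_fun_bounded assms by metis
  ultimately show ?thesis
    using K by (intro L2_bounded_support[of _ C r] smooth_measurable) blast+
qed

lemma compact_L2_integrable:
  fixes f :: "'a::euclidean_space \<Rightarrow> real"
  assumes "L2 UNIV f" "\<And>x. x \<notin> cball 0 r \<Longrightarrow> f x = 0"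
  shows "integrable lebesgue f"
proof -
  have "L2 UNIV (indicator (cball 0 r) :: 'a \<Rightarrow> real)"
    by (rule L2_bounded_support[of _ 1 r]) (auto intro!: borel_measurable_indicator)
  from L2_mult_integrable[OF assms(1) this]
  have "integrable lebesgue (\<lambda>x. f x * indicator (cball 0 r) x)"
    by (simp add: lebesgue_on_UNIV_eq)
  moreover have "(\<lambda>x. f x * indicator (cball 0 r) x) = f"
    using assms(2) by (auto simp: fun_eq_iff split: split_indicator)
  ultimately show ?thesis by simp
qed

lemma test_fun_integrable:
  fixes \<phi> :: "'a::euclidean_space \<Rightarrow> real"
  assumes "test_fun \<Omega> \<phi>" shows "integrable lebesgue \<phi>"
proof -
  obtain K where K: "compact K" "\<And>x. x \<notin> K \<Longrightarrow> \<phi> x = 0"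
    using assms by (metis test_funE)
  obtain r where "K \<subseteq> cball 0 r"
    using compact_subset_cball[OF K(1)] by metis
  then show ?thesis
    using compact_L2_integrable[OF test_fun_L2[OF assms]] K by blast
qed

section \<open>Convolution with a test function\<close>

definition conv :: "('a::euclidean_space \<Rightarrow> real) \<Rightarrow> ('a \<Rightarrow> real) \<Rightarrow> 'a \<Rightarrow> real" where
  "conv \<rho> f x = (\<integral>y. f y * \<rho> (x - y) \<partial>lebesgue)"

lemma test_fun_pd_bound:
  assumes "test_fun \<Omega> \<phi>"
  obtains L where "L > 0" "\<And>x h. \<bar>pd \<phi> x h\<bar> \<le> L * norm h"
proof -
  have "\<forall>b. \<exists>C>0. \<forall>x. \<bar>pd \<phi> x b\<bar> \<le> C"
    using test_fun_pd[OF assms] test_fun_bounded by metis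
  then obtain C where C: "\<And>b. C b > 0" "\<And>b x. \<bar>pd \<phi> x b\<bar> \<le> C b" by metis
  have "\<bar>pd \<phi> x h\<bar> \<le> (1 + (\<Sum>b\<in>Basis. C b)) * norm h" for x h
  proof -
    have "\<bar>pd \<phi> x h\<bar> = \<bar>\<Sum>b\<in>Basis. (h \<bullet> b) * pd \<phi> x b\<bar>"
      by (subst pd_expand[OF test_fun_smooth[OF assms]]) simp
    also have "\<dots> \<le> (\<Sum>b\<in>Basis. \<bar>(h \<bullet> b) * pd \<phi> x b\<bar>)" by (rule sum_abs)
    also have "\<dots> \<le> (\<Sum>b\<in>Basis. norm h * C b)"
      by (intro sum_mono) (auto simp: abs_mult Basis_le_norm C intro!: mult_mono)
    also have "\<dots> \<le> (1 + (\<Sum>b\<in>Basis. C b)) * norm h"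
      by (simp add: sum_distrib_right sum_distrib_left algebra_simps)
    finally show ?thesis .
  qed
  moreover have "1 + (\<Sum>b\<in>Basis. C b) > 0"
    using sum_nonneg[of Basis C] C(1) by (smt (verit))
  ultimately show thesis using that by blast
qed

lemma test_fun_lipschitz:
  assumes "test_fun \<Omega> \<phi>"
  obtains L where "L > 0" "\<And>x y. \<bar>\<phi> x - \<phi> y\<bar> \<le> L * norm (x - y)"
proof -
  obtain L where L: "L > 0" "\<And>x h. \<bar>pd \<phi> x h\<bar> \<le> L * norm h"
    using test_fun_pd_bound[OF assms] by blast
  have "norm (\<phi> x - \<phi> y) \<le> L * norm (x - y)" for x y
  proof (rule differentiable_bound[of UNIV])
    show "(\<phi> has_derivative pd \<phi> z) (at z within UNIV)" for z
      using smooth_has_derivative[OF test_fun_smooth[OF assms]] by simp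
    show "onorm (pd \<phi> z) \<le> L" for z
      by (rule onorm_bound) (use L in auto)
  qed auto
  then show thesis using that[of L] L by simp
qed

text \<open>The remainder is uniform in \<open>x\<close> and can therefore be integrated against any
  integrable function. It comes from the Lipschitz bound for each partial derivative and the mean
  value inequality on the ball of radius \<open>norm h\<close>.\<close>

lemma test_fun_taylor:
  assumes "test_fun \<Omega> \<phi>"
  obtains L where "L > 0" "\<And>x h. \<bar>\<phi> (x + h) - \<phi> x - pd \<phi> x h\<bar> \<le> L * (norm h)\<^sup>2"
proof -
  have sm: "smooth \<phi>" using assms by (rule test_fun_smooth)
  have "\<forall>b. \<exists>L>0. \<forall>x y. \<bar>pd \<phi> x b - pd \<phi> y b\<bar> \<le> L * norm (x - y)"
  proof
    fix b
    obtain L where "L > 0" "\<And>x y. \<bar>pd \<phi> x b - pd \<phi> y b\<bar> \<le> L * norm (x - y)"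
      using test_fun_lipschitz[OF test_fun_pd[OF assms, of b]] by blast
    then show "\<exists>L>0. \<forall>x y. \<bar>pd \<phi> x b - pd \<phi> y b\<bar> \<le> L * norm (x - y)" by blast
  qed
  then obtain C where C: "\<And>b. C b > 0" "\<And>b x y. \<bar>pd \<phi> x b - pd \<phi> y b\<bar> \<le> C b * norm (x - y)"
    by metis
  define L where "L = 1 + (\<Sum>b\<in>Basis. C b)"
  have L: "L > 0"
    using sum_nonneg[of Basis C] C(1) unfolding L_def by (smt (verit))
  have on: "\<bar>pd \<phi> x h - pd \<phi> y h\<bar> \<le> L * norm (x - y) * norm h" for x y h
  proof -
    have "pd \<phi> x h - pd \<phi> y h = (\<Sum>b\<in>Basis. (h \<bullet> b) * (pd \<phi> x b - pd \<phi> y b))"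
      unfolding pd_expand[OF sm, of x h] pd_expand[OF sm, of y h]
      by (simp add: sum_subtractf right_diff_distrib)
    then have "\<bar>pd \<phi> x h - pd \<phi> y h\<bar> \<le> (\<Sum>b\<in>Basis. \<bar>(h \<bullet> b) * (pd \<phi> x b - pd \<phi> y b)\<bar>)"
      by (simp add: sum_abs)
    also have "\<dots> \<le> (\<Sum>b\<in>Basis. norm h * (C b * norm (x - y)))"
      by (intro sum_mono) (auto simp: abs_mult Basis_le_norm C intro!: mult_mono)
    also have "\<dots> = (\<Sum>b\<in>Basis. C b) * (norm (x - y) * norm h)"
      by (subst sum_distrib_right) (simp add: mult_ac)
    also have "\<dots> \<le> L * norm (x - y) * norm h"
      by (simp add: L_def mult.assoc mult_right_mono)
    finally show ?thesis .
  qed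
  have "\<bar>\<phi> (x + h) - \<phi> x - pd \<phi> x h\<bar> \<le> L * (norm h)\<^sup>2" for x h
  proof -
    have "norm (\<phi> (x + h) - \<phi> x - pd \<phi> x ((x + h) - x)) \<le> norm ((x + h) - x) * (L * norm h)"
    proof (rule differentiable_bound_linearization[where S = "cball x (norm h)"])
      show "x + t *\<^sub>R (x + h - x) \<in> cball x (norm h)" if "t \<in> {0..1}" for t
        using that by (auto simp: dist_norm mult_left_le_one_le)
      show "(\<phi> has_derivative pd \<phi> z) (at z within cball x (norm h))" for z
        using smooth_has_derivative[OF sm] has_derivative_at_withinI by blast
      show "onorm (pd \<phi> z - pd \<phi> x) \<le> L * norm h" if "z \<in> cball x (norm h)" for z
      proof (rule onorm_bound)
        have z: "norm (z - x) \<le> norm h" using that by (simp add: dist_norm norm_minus_commute)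
        show "norm ((pd \<phi> z - pd \<phi> x) k) \<le> L * norm h * norm k" for k
          using L by (auto intro!: order_trans[OF on[of z k x]] mult_right_mono mult_left_mono z)
        show "0 \<le> L * norm h" using L by simp
      qed
    qed simp
    then show ?thesis by (simp add: power2_eq_square mult_ac)
  qed
  with L show thesis using that by blast
qed

lemma conv_integrable:
  fixes f :: "'a::euclidean_space \<Rightarrow> real"
  assumes "integrable lebesgue f" "test_fun UNIV \<rho>"
  shows "integrable lebesgue (\<lambda>y. f y * \<rho> (x - y))"
proof -
  obtain C where C: "C > 0" "\<And>x. \<bar>\<rho> x\<bar> \<le> C" using test_fun_bounded[OF assms(2)] by blast
  have m: "(\<lambda>y. \<rho> (x - y)) \<in> borel_measurable lebesgue"
    by (rule smooth_measurable[OF test_fun_smooth[OF test_fun_reflect[OF assms(2)]]])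
  show ?thesis
  proof (rule Bochner_Integration.integrable_bound[of _ "\<lambda>y. C * f y"])
    show "AE y in lebesgue. norm (f y * \<rho> (x - y)) \<le> norm (C * f y)"
      using C mult_right_mono[OF C(2) abs_ge_zero] by (intro AE_I2) (simp add: abs_mult mult.commute)
  qed (use assms m in auto)
qed

text \<open>The derivative falls on \<open>\<rho>\<close>. After integration the uniform Taylor
  remainder is at most \<open>L\<close> times the integral of \<open>\<bar>f\<bar>\<close> times
  \<open>(norm h)\<^sup>2\<close>, which gives differentiability directly.\<close>

lemma conv_has_derivative:
  fixes f :: "'a::euclidean_space \<Rightarrow> real"
  assumes f: "integrable lebesgue f" and \<rho>: "test_fun UNIV \<rho>"
  shows "(conv \<rho> f has_derivative (\<lambda>h. conv (\<lambda>z. pd \<rho> z h) f x)) (at x)"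
proof -
  have sm: "smooth \<rho>" using \<rho> by (rule test_fun_smooth)
  note i1 = conv_integrable[OF f \<rho>] and i2 = conv_integrable[OF f test_fun_pd[OF \<rho>]]
  obtain L where L: "L > 0" "\<And>x h. \<bar>\<rho> (x + h) - \<rho> x - pd \<rho> x h\<bar> \<le> L * (norm h)\<^sup>2"
    using test_fun_taylor[OF \<rho>] by blast
  obtain C where C: "C > 0" "\<And>x h. \<bar>pd \<rho> x h\<bar> \<le> C * norm h"
    using test_fun_pd_bound[OF \<rho>] by blast
  let ?D = "\<lambda>h. conv (\<lambda>z. pd \<rho> z h) f x"
  let ?I = "\<integral>y. \<bar>f y\<bar> \<partial>lebesgue"
  have I0: "?I \<ge> 0" by simp
  have lin: "linear ?D"
  proof (rule linearI)
    show "?D (a + b) = ?D a + ?D b" for a b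
      using i2[of x a] i2[of x b]
      by (simp add: conv_def linear_add[OF smooth_linear_pd[OF sm]] distrib_left)
    show "?D (c *\<^sub>R a) = c *\<^sub>R ?D a" for c a
      by (simp add: conv_def linear_cmul[OF smooth_linear_pd[OF sm]] mult.left_commute)
  qed
  have bl: "bounded_linear ?D" using lin linear_conv_bounded_linear by blast
  have err: "\<bar>conv \<rho> f (x + h) - conv \<rho> f x - ?D h\<bar> \<le> L * ?I * (norm h)\<^sup>2" for h
  proof -
    have "conv \<rho> f (x + h) - conv \<rho> f x - ?D h =
        (\<integral>y. f y * (\<rho> ((x - y) + h) - \<rho> (x - y) - pd \<rho> (x - y) h) \<partial>lebesgue)"
      using i1[of "x + h"] i1[of x] i2[of x h]
      by (simp add: conv_def right_diff_distrib algebra_simps)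
    also have "\<bar>\<dots>\<bar> \<le> (\<integral>y. \<bar>f y\<bar> * (L * (norm h)\<^sup>2) \<partial>lebesgue)"
    proof (rule order_trans[OF integral_abs_bound], rule integral_mono)
      have "integrable lebesgue (\<lambda>y. f y * \<rho> (x + h - y) - f y * \<rho> (x - y) - f y * pd \<rho> (x - y) h)"
        using i1[of "x + h"] i1[of x] i2[of x h] by simp
      then show "integrable lebesgue (\<lambda>y. \<bar>f y * (\<rho> (x - y + h) - \<rho> (x - y) - pd \<rho> (x - y) h)\<bar>)"
        by (simp add: right_diff_distrib algebra_simps)
    qed (use f L in \<open>auto simp: abs_mult intro!: mult_left_mono\<close>)
    also have "\<dots> = L * ?I * (norm h)\<^sup>2" by simp
    finally show ?thesis .
  qed
  show ?thesis
    unfolding has_derivative_def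
  proof (intro conjI bl)
    have "((\<lambda>y. (L * ?I) * norm (y - x)) \<longlongrightarrow> (L * ?I) * norm (x - x)) (at x)"
      by (intro tendsto_intros)
    then have lim: "((\<lambda>y. (L * ?I) * norm (y - x)) \<longlongrightarrow> 0) (at x)" by simp
    have "((\<lambda>y. (conv \<rho> f y - conv \<rho> f x - ?D (y - x)) /\<^sub>R norm (y - x)) \<longlongrightarrow> 0) (at x)"
    proof (rule Lim_null_comparison[OF _ lim], rule always_eventually, rule allI)
      fix y
      show "norm ((conv \<rho> f y - conv \<rho> f x - ?D (y - x)) /\<^sub>R norm (y - x)) \<le> L * ?I * norm (y - x)"
      proof (cases "y = x")
        case False
        then show ?thesis
          using err[of "y - x"] by (simp add: divide_simps power2_eq_square mult_ac)
      qed simp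
    qed
    then show "((\<lambda>y. (conv \<rho> f y - conv \<rho> f (Lim (at x within UNIV) (\<lambda>x. x)) -
          ?D (y - Lim (at x within UNIV) (\<lambda>x. x))) /\<^sub>R norm (y - Lim (at x within UNIV) (\<lambda>x. x))) \<longlongrightarrow> 0) (at x)"
      by (simp add: netlimit_at)
  qed
qed

lemma pd_conv:
  assumes "integrable lebesgue f" "test_fun UNIV \<rho>"
  shows "pd (conv \<rho> f) x h = conv (\<lambda>z. pd \<rho> z h) f x"
  by (simp add: pd_eqI[OF conv_has_derivative[OF assms]])

lemma smooth_conv:
  fixes f :: "'a::euclidean_space \<Rightarrow> real"
  assumes f: "integrable lebesgue f" and "test_fun UNIV \<rho>"
  shows "smooth (conv \<rho> f)"
proof -
  have "Ck k (conv \<rho> f)" if "test_fun UNIV \<rho>" for k \<rho>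
    using that
  proof (induction k arbitrary: \<rho>)
    case 0
    have "continuous_on UNIV (conv \<rho> f)"
      using has_derivative_continuous[OF conv_has_derivative[OF f 0]]
      by (simp add: continuous_at_imp_continuous_on)
    then show ?case by simp
  next
    case (Suc k)
    show ?case
      by (rule Ck_SucI[OF conv_has_derivative[OF f Suc.prems]])
         (rule Suc.IH[OF test_fun_pd[OF Suc.prems]])
  qed
  then show ?thesis using assms by (simp add: smooth_def)
qed

lemma conv_support:
  assumes "\<And>x. x \<notin> cball 0 r \<Longrightarrow> f x = 0" "\<And>x. x \<notin> cball 0 \<epsilon> \<Longrightarrow> \<rho> x = 0" "x \<notin> cball 0 (r + \<epsilon>)"
  shows "conv \<rho> f x = 0"
proof -
  have "f y * \<rho> (x - y) = 0" for y
  proof (cases "y \<in> cball 0 r")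
    case True
    have "norm x \<le> norm y + norm (x - y)"
      using norm_triangle_ineq[of y "x - y"] by simp
    then have "x - y \<notin> cball 0 \<epsilon>" using True assms(3) by auto
    then show ?thesis using assms(2) by simp
  qed (use assms in simp)
  then have "(\<lambda>y. f y * \<rho> (x - y)) = (\<lambda>_. 0)" by auto
  then show ?thesis by (simp add: conv_def)
qed

text \<open>By translation invariance all difference quotients of \<open>f\<close> have vanishing integral.\<close>

lemma integral_derivative_eq_0:
  fixes f :: "'a::euclidean_space \<Rightarrow> real"
  assumes d: "\<And>x. (f has_derivative f' x) (at x)" and L: "\<And>x h. \<bar>f' x h\<bar> \<le> L * norm h"
    and supp: "\<And>x. x \<notin> cball 0 r \<Longrightarrow> f x = 0"
  shows "(\<integral>x. f' x e \<partial>lebesgue) = 0" and "integrable lebesgue (\<lambda>x. f' x e)"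
proof -
  have L0: "L \<ge> 0"
  proof -
    obtain b :: 'a where "b \<in> Basis" using nonempty_Basis by blast
    then show ?thesis using order_trans[OF abs_ge_zero L[of 0 b]] by simp
  qed
  have lip: "norm (f x - f y) \<le> L * norm (x - y)" for x y
  proof (rule differentiable_bound[of UNIV])
    show "(f has_derivative f' z) (at z within UNIV)" for z using d by simp
    show "onorm (f' z) \<le> L" for z by (rule onorm_bound) (use L L0 in auto)
  qed auto
  have fc: "continuous_on UNIV f"
    by (meson continuous_at_imp_continuous_on d has_derivative_continuous)
  have fm [measurable]: "f \<in> borel_measurable lebesgue" by (rule continuous_imp_lebesgue[OF fc])
  have fi: "integrable lebesgue f"
  proof -
    have "bounded (f ` cball 0 r)"
      by (intro compact_imp_bounded compact_continuous_image continuous_on_subset[OF fc]) auto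
    then obtain C where "\<forall>y\<in>f ` cball 0 r. norm y \<le> C" unfolding bounded_iff by blast
    then have C: "\<bar>f x\<bar> \<le> C" if "x \<in> cball 0 r" for x using that by simp
    have "L2 UNIV f"
    proof (rule L2_bounded_support[of _ "\<bar>C\<bar>" r])
      show "\<bar>f x\<bar> \<le> \<bar>C\<bar>" for x using C[of x] supp[of x] by (cases "x \<in> cball 0 r") auto
    qed (use supp in auto)
    then show ?thesis using compact_L2_integrable supp by blast
  qed
  define q where "q n x = (f (x + (1 / real (Suc n)) *\<^sub>R e) - f x) * real (Suc n)" for n x
  have shift: "(\<lambda>x. f (x + t)) \<in> borel_measurable lebesgue" "(\<integral>x. f (x + t) \<partial>lebesgue) = (\<integral>x. f x \<partial>lebesgue)" for t
  proof -
    show "(\<lambda>x. f (x + t)) \<in> borel_measurable lebesgue"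
      by (intro continuous_imp_lebesgue continuous_on_compose2[OF fc] continuous_intros) auto
    have "(\<integral>x. f (x + t) \<partial>lebesgue) = (\<integral>x. f ((0 - x) + t) \<partial>lebesgue)"
      by (rule integral_reflect[symmetric]) fact
    also have "\<dots> = (\<integral>x. f (t - x) \<partial>lebesgue)" by (simp add: algebra_simps)
    finally show "(\<integral>x. f (x + t) \<partial>lebesgue) = (\<integral>x. f x \<partial>lebesgue)"
      using integral_reflect[OF fm] by simp
  qed
  \<comment> \<open>All steps have length at most \<open>norm e\<close>, so the difference quotients
    vanish outside the ball enlarged by \<open>norm e\<close>; inside it the Lipschitz constant
    bounds them.\<close>
  let ?w = "\<lambda>x. L * norm e * indicator (cball (0::'a) (r + norm e)) x :: real"
  have w: "integrable lebesgue ?w"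
    using emeasure_lborel_cball_finite[of "0::'a" "r + norm e"]
    by (intro integrable_mult_right integrable_real_indicator) (auto simp: less_top)
  have qm: "q n \<in> borel_measurable lebesgue" for n
    unfolding q_def using shift(1) by measurable
  have bound: "norm (q n x) \<le> ?w x" for n x
  proof (cases "x \<in> cball 0 (r + norm e)")
    case True
    have "\<bar>f (x + (1 / real (Suc n)) *\<^sub>R e) - f x\<bar> * real (Suc n) \<le> (L * (norm e / real (Suc n))) * real (Suc n)"
      using lip[of "x + (1 / real (Suc n)) *\<^sub>R e" x] by (intro mult_right_mono) auto
    then show ?thesis using True by (simp add: q_def abs_mult del: of_nat_Suc)
  next
    case False
    have "norm ((1 / real (Suc n)) *\<^sub>R e) \<le> norm e"
      by (simp add: divide_simps mult_left_le_one_le del: of_nat_Suc) (simp add: mult_le_cancel_left1)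
    moreover have "norm x \<le> norm (x + (1 / real (Suc n)) *\<^sub>R e) + norm ((1 / real (Suc n)) *\<^sub>R e)"
      using norm_triangle_ineq4[of "x + (1 / real (Suc n)) *\<^sub>R e" "(1 / real (Suc n)) *\<^sub>R e"] by simp
    moreover have "norm x > r + norm e" using False by simp
    ultimately have "r < norm (x + (1 / real (Suc n)) *\<^sub>R e)" by linarith
    then have "f (x + (1 / real (Suc n)) *\<^sub>R e) = 0" by (intro supp) auto
    moreover have "f x = 0" using \<open>norm x > r + norm e\<close> norm_ge_zero[of e] by (intro supp) (auto simp del: norm_ge_zero)
    ultimately show ?thesis using L0 by (simp add: q_def)
  qed
  have lim: "(\<lambda>n. q n x) \<longlonglongrightarrow> f' x e" for x
  proof -
    have "((\<lambda>t. (f (x + t *\<^sub>R e) - f x) / t) \<longlongrightarrow> f' x e) (at 0)"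
    proof -
      have "((\<lambda>t. f (x + t *\<^sub>R e)) has_derivative (\<lambda>t. f' x (t *\<^sub>R e))) (at 0)"
        by (rule has_derivative_compose[of "\<lambda>t. x + t *\<^sub>R e" "\<lambda>t. t *\<^sub>R e" 0 UNIV f])
           (use d[of x] in \<open>auto intro!: derivative_eq_intros\<close>)
      moreover have "f' x (t *\<^sub>R e) = f' x e * t" for t
        using linear_cmul[OF has_derivative_linear[OF d[of x]], of t e] by simp
      ultimately have "((\<lambda>t. f (x + t *\<^sub>R e)) has_real_derivative f' x e) (at 0)"
        by (simp add: has_field_derivative_def)
      then show ?thesis by (simp add: DERIV_def)
    qed
    moreover have "filterlim (\<lambda>n. 1 / real (Suc n)) (at 0) sequentially"
      by (intro filterlim_atI lim_1_over_n[THEN LIMSEQ_Suc] always_eventually) auto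
    ultimately have "(\<lambda>n. (f (x + (1 / real (Suc n)) *\<^sub>R e) - f x) / (1 / real (Suc n))) \<longlonglongrightarrow> f' x e"
      by (rule filterlim_compose)
    then show ?thesis by (simp add: q_def)
  qed
  have "(\<lambda>x. f' x e) \<in> borel_measurable lebesgue"
    by (rule borel_measurable_LIMSEQ_real[OF lim qm])
  note dc = integral_dominated_convergence[where s = q, OF this qm w] integrable_dominated_convergence[where s = q, OF this qm w]
  show "integrable lebesgue (\<lambda>x. f' x e)" by (rule dc(2)) (intro AE_I2 lim bound)+
  have "(\<lambda>n. \<integral>x. q n x \<partial>lebesgue) \<longlonglongrightarrow> (\<integral>x. f' x e \<partial>lebesgue)"
    by (rule dc(1)) (intro AE_I2 lim bound)+
  moreover have "(\<integral>x. q n x \<partial>lebesgue) = 0" for n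
  proof -
    have "integrable lebesgue (\<lambda>x. f (x + t))" for t
    proof -
      have eq: "(\<lambda>x. f (x + t)) = (\<lambda>x. f (t - (0 - x)))" by (simp add: add.commute)
      have "integrable (distr lebesgue lebesgue (\<lambda>x. t + 1 *\<^sub>R x)) f"
        using fi lebesgue_eq_affine[of 1 t] by (simp add: density_1)
      then have "integrable lebesgue (\<lambda>x. f (t + 1 *\<^sub>R x))"
        by (rule integrable_distr[OF affine_measurable_lebesgue, rotated]) simp
      then show ?thesis by (simp add: add.commute)
    qed
    then have "(\<integral>x. f (x + t) - f x \<partial>lebesgue) = 0" for t
      using fi shift(2)[of t] by simp
    then show ?thesis unfolding q_def by simp
  qed
  ultimately show "(\<integral>x. f' x e \<partial>lebesgue) = 0"
    by (simp add: LIMSEQ_const_iff)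
qed

section \<open>Mollification\<close>

definition bump :: "real \<Rightarrow> 'a::euclidean_space \<Rightarrow> real" where
  "bump r x = flat 0 (r\<^sup>2 - x \<bullet> x)"

definition moll :: "nat \<Rightarrow> 'a::euclidean_space \<Rightarrow> real" where
  "moll n x = bump (1 / real (Suc n)) x / (\<integral>y. bump (1 / real (Suc n)) (y::'a) \<partial>lebesgue)"

lemma test_fun_bump: "test_fun UNIV (bump r)"
  using test_fun_flat[of 0 r] by (simp add: bump_def[abs_def])

lemma ennreal_pos_real:
  assumes "(e::ennreal) > 0"
  obtains d where "d > 0" "ennreal d < e"
proof -
  obtain z where z: "0 < z" "z < e" using assms dense by blast
  then obtain d where "z = ennreal d" "d \<ge> 0"
    by (metis ennreal_cases less_top top.not_eq_extremum top_greatest order_less_le_trans)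
  then show thesis using that[of d] z by (cases "d = 0") auto
qed

lemma moll_mass_pos:
  "(\<integral>y. bump (1 / real (Suc n)) (y::'a::euclidean_space) \<partial>lebesgue) > 0" (is "?c > 0")
proof -
  let ?r = "1 / real (Suc n)"
  let ?f = "bump ?r :: 'a \<Rightarrow> real"
  have i: "integrable lebesgue ?f"
    by (rule test_fun_integrable[OF test_fun_bump])
  have "?c \<noteq> 0"
  proof
    assume "?c = 0"
    then have "AE y in lebesgue. ?f y = 0"
      using integral_nonneg_eq_0_iff_AE[OF i] by (simp add: bump_def[abs_def] flat_nonneg)
    then have ae: "AE y in lebesgue. y \<notin> ball (0::'a) ?r"
    proof eventually_elim
      case (elim y)
      show ?case
      proof
        assume "y \<in> ball 0 ?r"
        then have "(norm y)\<^sup>2 < ?r\<^sup>2" by (intro power_strict_mono) auto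
        then show False using elim flat_pos[of "?r\<^sup>2 - y \<bullet> y" 0] by (simp add: bump_def dot_square_norm)
      qed
    qed
    have "emeasure lebesgue (ball (0::'a) ?r) = 0"
      using ae AE_iff_null_sets[of "ball (0::'a) ?r" lebesgue] by auto
    moreover have "emeasure lebesgue (ball (0::'a) ?r) > 0"
      using content_ball_pos[of ?r "0::'a"] by (simp add: measure_def zero_less_iff_neq_zero) (metis enn2real_0 less_irrefl)
    ultimately show False by simp
  qed
  moreover have "?c \<ge> 0" by (simp add: bump_def flat_nonneg)
  ultimately show ?thesis by linarith
qed

lemma test_fun_moll: "test_fun UNIV (moll n)"
proof -
  have "test_fun UNIV (\<lambda>x::'a. inverse (\<integral>y. bump (1 / real (Suc n)) (y::'a) \<partial>lebesgue) * bump (1 / real (Suc n)) x)"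
    by (intro test_fun_mult test_fun_bump smooth_const)
  then show ?thesis
    by (simp add: moll_def[abs_def] divide_inverse mult.commute)
qed

lemma moll_nonneg: "moll n x \<ge> 0"
  using moll_mass_pos[of n, where 'a='a] by (simp add: moll_def bump_def flat_nonneg less_imp_le)

lemma moll_support: "x \<notin> cball 0 (1 / real (Suc n)) \<Longrightarrow> moll n x = 0"
proof -
  assume "x \<notin> cball 0 (1 / real (Suc n))"
  then have "(1 / real (Suc n))\<^sup>2 \<le> (norm x)\<^sup>2" by (intro power_mono) auto
  then show ?thesis by (simp add: moll_def bump_def flat_0 dot_square_norm)
qed

lemma moll_measurable: "moll n \<in> borel_measurable lebesgue"
  using smooth_measurable[OF test_fun_smooth[OF test_fun_moll]] .

lemma moll_borel [measurable]: "moll n \<in> borel_measurable borel"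
  using borel_measurable_continuous_onI[OF smooth_continuous[OF test_fun_smooth[OF test_fun_moll]]] .

lemma integrable_moll: "integrable lebesgue (\<lambda>y. moll n (x - y))"
  using test_fun_integrable[OF test_fun_reflect[OF test_fun_moll]] .

lemma integral_moll: "(\<integral>y. moll n (x - y) \<partial>lebesgue) = 1"
  unfolding integral_reflect[OF moll_measurable]
  unfolding moll_def[abs_def] using moll_mass_pos[of n, where 'a='a] by simp

lemma nn_integral_moll: "(\<integral>\<^sup>+x. ennreal (moll n (x - (y::'a::euclidean_space))) \<partial>lebesgue) = 1"
proof -
  have "(\<integral>\<^sup>+x. ennreal (moll n (x - y)) \<partial>lebesgue) = (\<integral>\<^sup>+x. ennreal (moll n (x::'a)) \<partial>lebesgue)"
    using nn_integral_affine[of "\<lambda>x. ennreal (moll n (x - y))" 1 y]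
    by (simp add: borel_imp_lebesgue)
  also have "\<dots> = (\<integral>\<^sup>+x. ennreal (moll n (y - x)) \<partial>lebesgue)"
    by (rule nn_integral_reflect[of "\<lambda>x. ennreal (moll n x)" y, symmetric]) (simp add: borel_imp_lebesgue)
  also have "\<dots> = ennreal (\<integral>x. moll n (y - x) \<partial>lebesgue)"
    by (rule nn_integral_eq_integral[OF integrable_moll]) (simp add: moll_nonneg)
  finally show ?thesis by (simp add: integral_moll)
qed

lemma conv_diff:
  assumes "integrable lebesgue f" "integrable lebesgue g" "test_fun UNIV \<rho>"
  shows "conv \<rho> (\<lambda>x. f x - g x) x = conv \<rho> f x - conv \<rho> g x"
  using conv_integrable[OF assms(1,3), of x] conv_integrable[OF assms(2,3), of x]
  by (simp add: conv_def left_diff_distrib)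

text \<open>Jensen's inequality: the variance of \<open>f\<close> under the density \<open>moll n (x - \<cdot>)\<close> is nonnegative.\<close>

lemma conv_moll_square_le:
  assumes f: "L2 UNIV f"
  shows "ennreal ((conv (moll n) f x)\<^sup>2) \<le> (\<integral>\<^sup>+y. ennreal ((f y)\<^sup>2 * moll n (x - y)) \<partial>lebesgue)"
proof -
  let ?m = "conv (moll n) f x"
  have f2: "integrable lebesgue (\<lambda>y. (f y)\<^sup>2)"
    using f by (simp add: L2_def lebesgue_on_UNIV_eq)
  note i2 = conv_integrable[OF f2 test_fun_moll, of n x]
  have i1: "integrable lebesgue (\<lambda>y. f y * moll n (x - y))"
    using L2_mult_integrable[OF f test_fun_L2[OF test_fun_reflect[OF test_fun_moll]]]
    by (simp add: lebesgue_on_UNIV_eq)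
  note i0 = integrable_moll[of n x]
  have "0 \<le> (\<integral>y. (f y - ?m)\<^sup>2 * moll n (x - y) \<partial>lebesgue)"
    by (simp add: moll_nonneg)
  also have "(\<lambda>y. (f y - ?m)\<^sup>2 * moll n (x - y)) =
      (\<lambda>y. (f y)\<^sup>2 * moll n (x - y) - 2 * ?m * (f y * moll n (x - y)) + ?m\<^sup>2 * moll n (x - y))"
    by (simp add: power2_eq_square algebra_simps fun_eq_iff)
  also have "(\<integral>y. \<dots> y \<partial>lebesgue) = (\<integral>y. (f y)\<^sup>2 * moll n (x - y) \<partial>lebesgue) - 2 * ?m * ?m + ?m\<^sup>2"
    using i2 i1 i0 by (simp add: integral_moll conv_def)
  finally have "?m\<^sup>2 \<le> (\<integral>y. (f y)\<^sup>2 * moll n (x - y) \<partial>lebesgue)"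
    by (simp add: power2_eq_square)
  moreover have "(\<integral>\<^sup>+y. ennreal ((f y)\<^sup>2 * moll n (x - y)) \<partial>lebesgue) =
      ennreal (\<integral>y. (f y)\<^sup>2 * moll n (x - y) \<partial>lebesgue)"
    by (rule nn_integral_eq_integral[OF i2]) (simp add: moll_nonneg)
  ultimately show ?thesis by (simp add: ennreal_leI)
qed

text \<open>Jensen's inequality at each point, then Tonelli: the kernel
  \<open>moll n (x - y)\<close> has mass 1 in \<open>x\<close> as well as in
  \<open>y\<close>.\<close>

lemma conv_moll_contraction:
  fixes f :: "'a::euclidean_space \<Rightarrow> real"
  assumes f: "L2 UNIV f"
  shows "(\<integral>\<^sup>+x. ennreal ((conv (moll n) f x)\<^sup>2) \<partial>lebesgue) \<le> (\<integral>\<^sup>+x. ennreal ((f x)\<^sup>2) \<partial>lebesgue)"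
proof -
  have f_m [measurable]: "f \<in> borel_measurable lebesgue" using f L2_borel by blast
  have "(\<lambda>p::'a \<times> 'a. moll n (fst p - snd p)) \<in> borel_measurable (lebesgue \<Otimes>\<^sub>M lebesgue)"
    by measurable
  moreover have "(\<lambda>p::'a \<times> 'a. f (snd p)) \<in> borel_measurable (lebesgue \<Otimes>\<^sub>M lebesgue)"
    by measurable
  ultimately have m: "(\<lambda>(x, y). ennreal ((f y)\<^sup>2 * moll n (x - y))) \<in> borel_measurable (lebesgue \<Otimes>\<^sub>M lebesgue)"
    by (simp add: split_beta)
  have "(\<integral>\<^sup>+x. ennreal ((conv (moll n) f x)\<^sup>2) \<partial>lebesgue) \<le>
      (\<integral>\<^sup>+x. \<integral>\<^sup>+y. ennreal ((f y)\<^sup>2 * moll n (x - y)) \<partial>lebesgue \<partial>lebesgue)"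
    by (intro nn_integral_mono conv_moll_square_le f)
  also have "\<dots> = (\<integral>\<^sup>+y. \<integral>\<^sup>+x. ennreal ((f y)\<^sup>2 * moll n (x - y)) \<partial>lebesgue \<partial>lebesgue)"
    by (rule lebesgue_pair.Fubini'[OF m, symmetric])
  also have "\<dots> = (\<integral>\<^sup>+y. ennreal ((f y)\<^sup>2) * (\<integral>\<^sup>+x. ennreal (moll n (x - y)) \<partial>lebesgue) \<partial>lebesgue)"
  proof (intro nn_integral_cong)
    fix y :: 'a
    have "(\<lambda>x. ennreal (moll n (x - y))) \<in> borel_measurable lebesgue"
      by (intro borel_imp_lebesgue) measurable
    then show "(\<integral>\<^sup>+x. ennreal ((f y)\<^sup>2 * moll n (x - y)) \<partial>lebesgue) =
        ennreal ((f y)\<^sup>2) * (\<integral>\<^sup>+x. ennreal (moll n (x - y)) \<partial>lebesgue)"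
      by (simp add: ennreal_mult moll_nonneg nn_integral_cmult)
  qed
  finally show ?thesis by (simp add: nn_integral_moll)
qed

text \<open>The squared L2 norm, kept in \<open>ennreal\<close> so that limits and estimates carry
  no integrability side conditions.\<close>

definition n2 :: "('a::euclidean_space \<Rightarrow> real) \<Rightarrow> ennreal" where
  "n2 f = (\<integral>\<^sup>+x. ennreal ((f x)\<^sup>2) \<partial>lebesgue)"

lemma n2_L2: "L2 UNIV f \<Longrightarrow> n2 f < \<infinity>"
  by (simp add: n2_def L2_UNIV_iff)

lemma n2_triangle:
  assumes [measurable]: "f \<in> borel_measurable lebesgue" "g \<in> borel_measurable lebesgue"
    "h \<in> borel_measurable lebesgue"
  shows "n2 (\<lambda>x. f x - h x) \<le> 2 * n2 (\<lambda>x. f x - g x) + 2 * n2 (\<lambda>x. g x - h x)"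
proof -
  have "n2 (\<lambda>x. f x - h x) \<le> (\<integral>\<^sup>+x. 2 * ennreal ((f x - g x)\<^sup>2) + 2 * ennreal ((g x - h x)\<^sup>2) \<partial>lebesgue)"
    unfolding n2_def
  proof (intro nn_integral_mono)
    fix x
    have "ennreal ((f x - h x)\<^sup>2) \<le> ennreal (2 * (f x - g x)\<^sup>2 + 2 * (g x - h x)\<^sup>2)"
      using square_add_le[of "f x - g x" "g x - h x"] by (intro ennreal_leI) simp
    then show "ennreal ((f x - h x)\<^sup>2) \<le> 2 * ennreal ((f x - g x)\<^sup>2) + 2 * ennreal ((g x - h x)\<^sup>2)"
      by (simp add: ennreal_mult)
  qed
  also have "\<dots> = 2 * n2 (\<lambda>x. f x - g x) + 2 * n2 (\<lambda>x. g x - h x)"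
    unfolding n2_def by (simp add: nn_integral_add nn_integral_cmult)
  finally show ?thesis .
qed

lemma n2_minus: "n2 (\<lambda>x. f x - g x) = n2 (\<lambda>x. g x - f x)"
  unfolding n2_def by (simp add: power2_commute)

section \<open>Approximation in L2 by continuous functions and by mollification\<close>

lemma n2_tendsto_dominated:
  fixes f :: "'a::euclidean_space \<Rightarrow> real"
  assumes [measurable]: "\<And>n. F n \<in> borel_measurable lebesgue" "f \<in> borel_measurable lebesgue"
    and g: "L2 UNIV g" and b: "\<And>n x. \<bar>F n x - f x\<bar> \<le> \<bar>g x\<bar>"
    and lim: "AE x in lebesgue. (\<lambda>n. F n x) \<longlonglongrightarrow> f x"
  shows "(\<lambda>n. n2 (\<lambda>x. F n x - f x)) \<longlonglongrightarrow> 0"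
proof -
  have [measurable]: "g \<in> borel_measurable lebesgue" using g L2_borel by blast
  have "(\<lambda>n. \<integral>\<^sup>+x. ennreal ((F n x - f x)\<^sup>2) \<partial>lebesgue) \<longlonglongrightarrow> integral\<^sup>N lebesgue (\<lambda>_::'a. 0)"
  proof (rule nn_integral_dominated_convergence[where w = "\<lambda>x. ennreal ((g x)\<^sup>2)"])
    show "AE x in lebesgue. (\<lambda>n. ennreal ((F n x - f x)\<^sup>2)) \<longlonglongrightarrow> 0"
      using lim
    proof eventually_elim
      case (elim x)
      have "(\<lambda>n. (F n x - f x)\<^sup>2) \<longlonglongrightarrow> (f x - f x)\<^sup>2" by (intro tendsto_intros elim)
      then have "(\<lambda>n. ennreal ((F n x - f x)\<^sup>2)) \<longlonglongrightarrow> ennreal ((f x - f x)\<^sup>2)"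
        by (rule tendsto_ennrealI)
      then show ?case by simp
    qed
    show "AE x in lebesgue. ennreal ((F n x - f x)\<^sup>2) \<le> ennreal ((g x)\<^sup>2)" for n
      using b[of n] by (intro AE_I2 ennreal_leI) (simp add: abs_le_square_iff)
    show "(\<integral>\<^sup>+x. ennreal ((g x)\<^sup>2) \<partial>lebesgue) < \<infinity>" using n2_L2[OF g] by (simp add: n2_def)
  qed auto
  then show ?thesis by (simp add: n2_def)
qed

lemma clamp_L2_approx:
  fixes f :: "'a::euclidean_space \<Rightarrow> real"
  assumes f: "L2 UNIV f"
  shows "(\<lambda>n. n2 (\<lambda>x. max (- real n) (min (real n) (f x)) - f x)) \<longlonglongrightarrow> 0"
proof (rule n2_tendsto_dominated[OF _ _ f])
  have [measurable]: "f \<in> borel_measurable lebesgue" using f L2_borel by blast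
  show "f \<in> borel_measurable lebesgue" "(\<lambda>x. max (- real n) (min (real n) (f x))) \<in> borel_measurable lebesgue" for n
    by measurable
  show "\<bar>max (- real n) (min (real n) (f x)) - f x\<bar> \<le> \<bar>f x\<bar>" for n x
    by (auto simp: max_def min_def)
  show "AE x in lebesgue. (\<lambda>n. max (- real n) (min (real n) (f x))) \<longlonglongrightarrow> f x"
  proof (intro AE_I2 tendsto_eventually)
    fix x
    obtain N :: nat where "\<bar>f x\<bar> \<le> real N" using real_arch_simple by blast
    then show "eventually (\<lambda>n. max (- real n) (min (real n) (f x)) = f x) sequentially"
      unfolding eventually_sequentially by (intro exI[of _ N]) (auto simp: max_def min_def)
  qed
qed

text \<open>First \<open>f\<close> is clamped at a height \<open>M\<close>. A measurable function is
  an almost everywhere limit of continuous functions; clamping these at the same height and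
  multiplying by the cutoff \<open>ch\<close> makes the sequence dominated by a bounded function of
  compact support.\<close>

lemma continuous_L2_approx:
  fixes f :: "'a::euclidean_space \<Rightarrow> real"
  assumes f: "L2 UNIV f" and supp: "\<And>x. x \<notin> cball 0 r \<Longrightarrow> f x = 0" and \<delta>: "\<delta> > 0"
  obtains h where "continuous_on UNIV h" "\<And>x. x \<notin> cball 0 (r + 1) \<Longrightarrow> h x = 0" "n2 (\<lambda>x. h x - f x) < \<delta>"
proof -
  have fm [measurable]: "f \<in> borel_measurable lebesgue" using f L2_borel by blast
  obtain d0 where d0: "d0 > 0" "ennreal d0 < \<delta>"
    using ennreal_pos_real[OF \<delta>] by blast
  \<comment> \<open>The factors 2 in \<open>n2_triangle\<close> turn two errors below
    \<open>d\<close> into \<open>4 * d\<close>.\<close>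
  define d where "d = ennreal (d0 / 4)"
  have d: "d > 0" "4 * d < \<delta>"
    using d0 by (auto simp: d_def simp flip: ennreal_mult ennreal_numeral)
  have "eventually (\<lambda>n. n2 (\<lambda>x. max (- real n) (min (real n) (f x)) - f x) < d) sequentially"
    using order_tendstoD(2)[OF clamp_L2_approx[OF f] d(1)] .
  then obtain M where M: "n2 (\<lambda>x. max (- real M) (min (real M) (f x)) - f x) < d"
    using eventually_happens sequentially_bot by blast
  let ?c = "\<lambda>s. max (- real M) (min (real M) s)"
  define ch where "ch x = max 0 (min 1 (r + 1 - norm x))" for x :: 'a
  have "f measurable_on UNIV"
    using measurable_on_iff_borel_measurable[of UNIV f] by (simp add: lebesgue_on_UNIV_eq)
  then obtain N g where N: "negligible N" and g: "\<And>n::nat. continuous_on UNIV (g n)"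
      and lim: "\<And>x. x \<notin> N \<Longrightarrow> (\<lambda>n. g n x) \<longlonglongrightarrow> f x"
    unfolding measurable_on_def by auto
  define h where "h n x = ?c (g n x) * ch x" for n x
  have hc: "continuous_on UNIV (h n)" for n
    unfolding h_def ch_def by (intro continuous_intros g)
  have cf: "?c (f x) * ch x = ?c (f x)" for x
    using supp[of x] by (cases "x \<in> cball 0 r") (auto simp: ch_def max_def min_def)
  have h0: "h n x = 0" if "x \<notin> cball 0 (r + 1)" for n x
    using that by (auto simp: h_def ch_def)
  have chi: "0 \<le> ch x" "ch x \<le> 1" for x by (auto simp: ch_def)
  have cb: "\<bar>?c s\<bar> \<le> real M" for s by (auto simp: max_def min_def)
  have "(\<lambda>n. n2 (\<lambda>x. h n x - ?c (f x))) \<longlonglongrightarrow> 0"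
  proof (rule n2_tendsto_dominated)
    show "h n \<in> borel_measurable lebesgue" for n by (rule continuous_imp_lebesgue[OF hc])
    show "(\<lambda>x. ?c (f x)) \<in> borel_measurable lebesgue" by measurable
    show "L2 UNIV (\<lambda>x. indicator (cball 0 (r + 1)) x * (2 * real M) :: real)"
      by (rule L2_bounded_support[of _ "2 * real M" "r + 1"])
         (auto intro!: borel_measurable_times borel_measurable_indicator split: split_indicator)
    show "\<bar>h n x - ?c (f x)\<bar> \<le> \<bar>indicator (cball 0 (r + 1)) x * (2 * real M)\<bar>" for n x
    proof (cases "x \<in> cball 0 (r + 1)")
      case True
      have "\<bar>h n x\<bar> \<le> real M"
        using mult_mono[OF cb[of "g n x"] chi(2)[of x]] chi(1)[of x] by (simp add: h_def abs_mult)
      then have "\<bar>h n x - ?c (f x)\<bar> \<le> real M + real M"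
        using cb[of "f x"] by linarith
      then show ?thesis using True by simp
    next
      case False
      then have "f x = 0" using supp[of x] by auto
      then show ?thesis using False h0[OF False, of n] by simp
    qed
    have "AE x in lebesgue. x \<notin> N"
      using N by (simp add: negligible_iff_null_sets AE_not_in)
    then show "AE x in lebesgue. (\<lambda>n. h n x) \<longlonglongrightarrow> ?c (f x)"
    proof eventually_elim
      case (elim x)
      have "(\<lambda>n. h n x) \<longlonglongrightarrow> ?c (f x) * ch x"
        unfolding h_def by (intro tendsto_intros lim elim)
      then show ?case by (simp only: cf)
    qed
  qed
  then have "eventually (\<lambda>n. n2 (\<lambda>x. h n x - ?c (f x)) < d) sequentially"
    using order_tendstoD(2) d(1) by blast
  then obtain n where n: "n2 (\<lambda>x. h n x - ?c (f x)) < d"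
    using eventually_happens sequentially_bot by blast
  have "n2 (\<lambda>x. h n x - f x) \<le> 2 * n2 (\<lambda>x. h n x - ?c (f x)) + 2 * n2 (\<lambda>x. ?c (f x) - f x)"
    by (rule n2_triangle) (auto intro!: continuous_imp_lebesgue[OF hc])
  also have "\<dots> \<le> 2 * d + 2 * d"
    using n M by (intro add_mono mult_left_mono) auto
  also have "\<dots> = 4 * d" by (simp add: distrib_right[symmetric])
  also have "\<dots> < \<delta>" by (rule d)
  finally show thesis using that[of "h n"] hc h0 by blast
qed

lemma conv_moll_uniform:
  fixes h :: "'a::euclidean_space \<Rightarrow> real"
  assumes h: "continuous_on UNIV h" and supp: "\<And>x. x \<notin> cball 0 r \<Longrightarrow> h x = 0" and \<eta>: "\<eta> > 0"
  shows "eventually (\<lambda>n. \<forall>x. \<bar>conv (moll n) h x - h x\<bar> \<le> \<eta>) sequentially"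
proof -
  \<comment> \<open>For two points at distance at most 1, either both lie in this ball or both lie
    where \<open>h\<close> vanishes, so uniform continuity on a compact set is enough.\<close>
  have "uniformly_continuous_on (cball 0 (\<bar>r\<bar> + 2)) h"
    by (intro compact_uniformly_continuous continuous_on_subset[OF h]) auto
  then obtain d where d: "d > 0"
    "\<And>x y. x \<in> cball 0 (\<bar>r\<bar> + 2) \<Longrightarrow> y \<in> cball 0 (\<bar>r\<bar> + 2) \<Longrightarrow> dist y x < d \<Longrightarrow> dist (h y) (h x) < \<eta>"
    unfolding uniformly_continuous_on_def using \<eta> by metis
  have close: "\<bar>h y - h x\<bar> \<le> \<eta>" if "norm (x - y) < d" "norm (x - y) \<le> 1" for x y
  proof (cases "x \<in> cball 0 (\<bar>r\<bar> + 1) \<or> y \<in> cball 0 (\<bar>r\<bar> + 1)")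
    case True
    have "norm x \<le> norm y + norm (x - y)" "norm y \<le> norm x + norm (x - y)"
      using norm_triangle_ineq[of y "x - y"] norm_triangle_ineq4[of x "x - y"] by auto
    then have "x \<in> cball 0 (\<bar>r\<bar> + 2)" "y \<in> cball 0 (\<bar>r\<bar> + 2)" using True that by auto
    then show ?thesis
      using d(2)[of x y] that by (simp add: dist_norm norm_minus_commute)
  next
    case False
    then have "h x = 0" "h y = 0" using supp[of x] supp[of y] by auto
    then show ?thesis using \<eta> by simp
  qed
  obtain N :: nat where N: "inverse (real (Suc N)) < d" using d(1) reals_Archimedean by blast
  have "\<bar>conv (moll n) h x - h x\<bar> \<le> \<eta>" if "n \<ge> N" for n x
  proof -
    obtain C where C: "\<And>y. y \<in> cball 0 r \<Longrightarrow> norm (h y) \<le> C"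
    proof -
      have "bounded (h ` cball 0 r)"
        by (intro compact_imp_bounded compact_continuous_image continuous_on_subset[OF h]) auto
      then show thesis using that unfolding bounded_iff by blast
    qed
    have "L2 UNIV h"
    proof (rule L2_bounded_support[of _ "\<bar>C\<bar>" r])
      show "\<bar>h y\<bar> \<le> \<bar>C\<bar>" for y
        using C[of y] supp[of y] by (cases "y \<in> cball 0 r") auto
    qed (auto intro: continuous_imp_lebesgue h supp)
    then have "integrable lebesgue h" using compact_L2_integrable supp by blast
    then have i: "integrable lebesgue (\<lambda>y. h y * moll n (x - y))" by (rule conv_integrable[OF _ test_fun_moll])
    have "conv (moll n) h x - h x = (\<integral>y. h y * moll n (x - y) - h x * moll n (x - y) \<partial>lebesgue)"
      using i integrable_moll[of n x] by (simp add: conv_def integral_moll)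
    also have "\<bar>\<dots>\<bar> \<le> (\<integral>y. \<eta> * moll n (x - y) \<partial>lebesgue)"
    proof (rule order_trans[OF integral_abs_bound], rule integral_mono)
      show "integrable lebesgue (\<lambda>y. \<bar>h y * moll n (x - y) - h x * moll n (x - y)\<bar>)"
        using i integrable_moll[of n x] by auto
      show "integrable lebesgue (\<lambda>y. \<eta> * moll n (x - y))" using integrable_moll[of n x] by auto
      fix y
      show "\<bar>h y * moll n (x - y) - h x * moll n (x - y)\<bar> \<le> \<eta> * moll n (x - y)"
      proof (cases "x - y \<in> cball 0 (1 / real (Suc n))")
        case True
        then have n1: "norm (x - y) \<le> 1 / real (Suc n)" by simp
        also have "\<dots> \<le> inverse (real (Suc N))" using that by (simp add: divide_simps)
        finally have "norm (x - y) < d" using N by simp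
        moreover have "norm (x - y) \<le> 1" using n1 by (rule order_trans) simp
        ultimately have "\<bar>h y - h x\<bar> \<le> \<eta>" by (rule close)
        then show ?thesis
          using moll_nonneg[of n "x - y"] by (simp add: left_diff_distrib[symmetric] abs_mult mult_right_mono)
      qed (simp add: moll_support)
    qed
    also have "\<dots> = \<eta>" by (simp add: integral_moll)
    finally show ?thesis .
  qed
  then show ?thesis unfolding eventually_sequentially by blast
qed

lemma emeasure_cball_lebesgue: "emeasure lebesgue (cball (x::'a::euclidean_space) r) < \<infinity>"
  using emeasure_lborel_cball_finite[of x r] by (simp add: less_top)

lemma conv_moll_L2_continuous:
  fixes h :: "'a::euclidean_space \<Rightarrow> real"
  assumes h: "continuous_on UNIV h" and supp: "\<And>x. x \<notin> cball 0 r \<Longrightarrow> h x = 0"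
  shows "(\<lambda>n. n2 (\<lambda>x. conv (moll n) h x - h x)) \<longlonglongrightarrow> 0"
proof (rule order_tendstoI)
  fix e :: ennreal assume e: "e > 0"
  let ?V = "measure lebesgue (cball (0::'a) (r + 1))"
  obtain d :: real where d: "d > 0" "ennreal d < e"
    using ennreal_pos_real[OF e] by blast
  define \<eta> where "\<eta> = sqrt (d / (?V + 1))"
  have \<eta>: "\<eta> > 0" using d(1) by (simp add: \<eta>_def add_nonneg_pos)
  have \<eta>2: "\<eta>\<^sup>2 * ?V \<le> d"
  proof -
    have "\<eta>\<^sup>2 * ?V = d * (?V / (?V + 1))" using d(1) by (simp add: \<eta>_def add_nonneg_pos)
    also have "\<dots> \<le> d * 1" using d(1) by (intro mult_left_mono) (auto simp: divide_simps add_nonneg_pos)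
    finally show ?thesis by simp
  qed
  have "eventually (\<lambda>n. \<forall>x. \<bar>conv (moll n) h x - h x\<bar> \<le> \<eta>) sequentially"
    by (rule conv_moll_uniform[OF h supp \<eta>])
  then show "eventually (\<lambda>n. n2 (\<lambda>x. conv (moll n) h x - h x) < e) sequentially"
  proof eventually_elim
    case (elim n)
    have z: "conv (moll n) h x - h x = 0" if "x \<notin> cball 0 (r + 1)" for x
    proof -
      have "x \<notin> cball 0 (r + 1 / real (Suc n))"
      proof -
        have "1 / real (Suc n) \<le> 1" by simp
        then have "r + 1 / real (Suc n) < norm x" using that by (simp only: mem_cball dist_0_norm not_le)
        then show ?thesis by (simp only: mem_cball dist_0_norm not_le)
      qed
      then have "conv (moll n) h x = 0"
        using conv_support[of r h "1 / real (Suc n)" "moll n" x] supp moll_support by blast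
      moreover have "h x = 0" using that supp[of x] by auto
      ultimately show ?thesis by simp
    qed
    have "n2 (\<lambda>x. conv (moll n) h x - h x) \<le> (\<integral>\<^sup>+x. ennreal (\<eta>\<^sup>2) * indicator (cball (0::'a) (r + 1)) x \<partial>lebesgue)"
      unfolding n2_def
    proof (rule nn_integral_mono)
      fix x :: 'a
      have "(conv (moll n) h x - h x)\<^sup>2 \<le> \<eta>\<^sup>2"
        using elim[rule_format, of x] \<eta> by (simp add: abs_le_square_iff[symmetric])
      then show "ennreal ((conv (moll n) h x - h x)\<^sup>2) \<le> ennreal (\<eta>\<^sup>2) * indicator (cball 0 (r + 1)) x"
        using z[of x] by (auto split: split_indicator simp: ennreal_leI)
    qed
    also have "\<dots> = ennreal (\<eta>\<^sup>2) * emeasure lebesgue (cball (0::'a) (r + 1))"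
      by (rule nn_integral_cmult_indicator) auto
    also have "\<dots> = ennreal (\<eta>\<^sup>2 * ?V)"
      using emeasure_cball_lebesgue[of "0::'a" "r + 1"]
      by (simp add: emeasure_eq_ennreal_measure ennreal_mult less_top[symmetric])
    also have "\<dots> \<le> ennreal d" using \<eta>2 by (rule ennreal_leI)
    also have "\<dots> < e" by (rule d)
    finally show ?case .
  qed
qed simp

text \<open>By the contraction property, mollifying moves \<open>f\<close> and a nearby continuous
  \<open>h\<close> no further apart, so the convergence known for \<open>h\<close> carries over to
  \<open>f\<close>.\<close>

theorem conv_moll_L2:
  fixes f :: "'a::euclidean_space \<Rightarrow> real"
  assumes f: "L2 UNIV f" and supp: "\<And>x. x \<notin> cball 0 r \<Longrightarrow> f x = 0"
  shows "(\<lambda>n. n2 (\<lambda>x. conv (moll n) f x - f x)) \<longlonglongrightarrow> 0"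
proof (rule order_tendstoI)
  fix e :: ennreal assume e: "e > 0"
  obtain d :: real where d: "d > 0" "ennreal d < e"
    using ennreal_pos_real[OF e] by blast
  \<comment> \<open>Using \<open>n2_triangle\<close> twice produces 2 + 4 + 4 = 10 such errors, and
    10 / 16 < 1.\<close>
  have d': "ennreal (d / 16) > 0" using d by simp
  obtain h where h: "continuous_on UNIV h" "\<And>x. x \<notin> cball 0 (r + 1) \<Longrightarrow> h x = 0"
      "n2 (\<lambda>x. h x - f x) < ennreal (d / 16)"
    using continuous_L2_approx[OF f supp d'] by blast
  have fi: "integrable lebesgue f" using compact_L2_integrable f supp by blast
  have fm [measurable]: "f \<in> borel_measurable lebesgue" using f L2_borel by blast
  have hm [measurable]: "h \<in> borel_measurable lebesgue" using h continuous_imp_lebesgue by blast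
  have hf: "L2 UNIV (\<lambda>x. h x - f x)"
    using h(3) by (auto simp: L2_UNIV_iff n2_def intro: less_trans)
  have "L2 UNIV (\<lambda>x. (h x - f x) + f x)" by (rule L2_add[OF hf f])
  then have hL: "L2 UNIV h" by simp
  then have hi: "integrable lebesgue h" using compact_L2_integrable h by blast
  have cm: "conv (moll n) k \<in> borel_measurable lebesgue" if "integrable lebesgue k" for n k
    by (rule smooth_measurable[OF smooth_conv[OF that test_fun_moll]])
  have "eventually (\<lambda>n. n2 (\<lambda>x. conv (moll n) h x - h x) < ennreal (d / 16)) sequentially"
    using order_tendstoD(2)[OF conv_moll_L2_continuous[OF h(1,2)] d'] .
  then show "eventually (\<lambda>n. n2 (\<lambda>x. conv (moll n) f x - f x) < e) sequentially"
  proof eventually_elim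
    case (elim n)
    have "n2 (\<lambda>x. conv (moll n) h x - conv (moll n) f x) \<le> n2 (\<lambda>x. h x - f x)"
      using conv_moll_contraction[OF hf, of n] by (simp add: n2_def conv_diff[OF hi fi test_fun_moll])
    then have 1: "n2 (\<lambda>x. conv (moll n) f x - conv (moll n) h x) \<le> ennreal (d / 16)"
      using h(3) by (simp add: n2_minus[of "conv (moll n) f"])
    have "n2 (\<lambda>x. conv (moll n) f x - f x) \<le>
        2 * n2 (\<lambda>x. conv (moll n) f x - conv (moll n) h x) + 2 * n2 (\<lambda>x. conv (moll n) h x - f x)"
      by (rule n2_triangle) (use cm fi hi fm in auto)
    also have "\<dots> \<le> 2 * ennreal (d / 16) +
        2 * (2 * n2 (\<lambda>x. conv (moll n) h x - h x) + 2 * n2 (\<lambda>x. h x - f x))"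
      by (intro add_mono mult_left_mono 1 n2_triangle) (use cm hi fm hm in auto)
    also have "\<dots> \<le> 2 * ennreal (d / 16) + 2 * (2 * ennreal (d / 16) + 2 * ennreal (d / 16))"
      using elim h(3) by (intro add_mono mult_left_mono) auto
    also have "\<dots> = ennreal (10 * d / 16)"
      using d(1) by (simp flip: ennreal_plus ennreal_mult ennreal_numeral)
    also have "\<dots> < e" using d by (auto intro: le_less_trans[OF ennreal_leI d(2)])
    finally show ?case .
  qed
qed simp

section \<open>Weak gradients\<close>

lemma is_weak_grad_UNIV:
  "is_weak_grad UNIV w G \<longleftrightarrow> L2 UNIV G \<and> (\<forall>\<phi>. test_fun UNIV \<phi> \<longrightarrow> (\<forall>b\<in>Basis.
     (\<integral>x. w x * pd \<phi> x b \<partial>lebesgue) = - (\<integral>x. (G x \<bullet> b) * \<phi> x \<partial>lebesgue)))"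
  by (simp add: is_weak_grad_def lebesgue_on_UNIV_eq)

lemma weak_gradD:
  assumes "is_weak_grad UNIV w G" "test_fun UNIV \<phi>" "b \<in> Basis"
  shows "(\<integral>x. w x * pd \<phi> x b \<partial>lebesgue) = - (\<integral>x. (G x \<bullet> b) * \<phi> x \<partial>lebesgue)"
  using assms by (simp add: is_weak_grad_UNIV)

lemma weak_gradD_on:
  assumes "is_weak_grad \<Omega> w G" "test_fun \<Omega> \<phi>" "b \<in> Basis"
  shows "integral\<^sup>L (lebesgue_on \<Omega>) (\<lambda>x. w x * pd \<phi> x b) = - integral\<^sup>L (lebesgue_on \<Omega>) (\<lambda>x. (G x \<bullet> b) * \<phi> x)"
  using assms by (simp add: is_weak_grad_def)

lemma integral_on_support:
  fixes f :: "'a::euclidean_space \<Rightarrow> real"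
  assumes "\<Omega> \<in> sets lebesgue" "\<And>x. x \<notin> \<Omega> \<Longrightarrow> f x = 0"
  shows "integral\<^sup>L (lebesgue_on \<Omega>) f = (\<integral>x. f x \<partial>lebesgue)"
proof -
  have "(\<lambda>x. indicator \<Omega> x *\<^sub>R f x) = f"
    using assms(2) by (auto simp: fun_eq_iff split: split_indicator)
  then show ?thesis using assms(1) by (simp add: integral_restrict_space)
qed

lemma L2_restrict:
  assumes "L2 UNIV f" "\<Omega> \<in> sets lebesgue"
  shows "L2 \<Omega> f"
  unfolding L2_iff_indicator[OF assms(2)]
  by (rule L2_bound[OF assms(1), where C = 1])
     (use assms L2_borel[OF assms(1)] in \<open>auto intro!: borel_measurable_scaleR split: split_indicator\<close>)

lemma is_weak_grad_restrict:
  assumes w: "is_weak_grad UNIV w G" and \<Omega>: "\<Omega> \<in> sets lebesgue"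
  shows "is_weak_grad \<Omega> w G"
  unfolding is_weak_grad_def
proof (intro conjI allI impI ballI)
  show "L2 \<Omega> G" using w \<Omega> L2_restrict is_weak_grad_UNIV by blast
  fix \<phi> :: "'a \<Rightarrow> real" and b :: 'a assume \<phi>: "test_fun \<Omega> \<phi>" and b: "b \<in> Basis"
  obtain K where K: "K \<subseteq> \<Omega>" "\<And>x. x \<notin> K \<Longrightarrow> \<phi> x = 0" "\<And>x e. x \<notin> K \<Longrightarrow> pd \<phi> x e = 0"
    using \<phi> by (elim test_funE) auto
  have z: "\<phi> x = 0" "pd \<phi> x b = 0" if "x \<notin> \<Omega>" for x
    using K(2)[of x] K(3)[of x b] subsetD[OF K(1), of x] that by auto
  show "(\<integral>x. w x * pd \<phi> x b \<partial>lebesgue_on \<Omega>) = - (\<integral>x. (G x \<bullet> b) * \<phi> x \<partial>lebesgue_on \<Omega>)"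
    using weak_gradD[OF w test_fun_mono[OF \<phi>] b] z
      integral_on_support[OF \<Omega>, of "\<lambda>x. w x * pd \<phi> x b"]
      integral_on_support[OF \<Omega>, of "\<lambda>x. (G x \<bullet> b) * \<phi> x"]
    by simp
qed

lemma test_fun_L2_on: "test_fun \<Omega> \<phi> \<Longrightarrow> \<Omega>' \<in> sets lebesgue \<Longrightarrow> L2 \<Omega>' \<phi>"
  using L2_restrict test_fun_L2 by blast

lemma is_weak_grad_add:
  assumes u: "L2 \<Omega> u" "is_weak_grad \<Omega> u g" and v: "L2 \<Omega> v" "is_weak_grad \<Omega> v h"
    and \<Omega>: "\<Omega> \<in> sets lebesgue"
  shows "is_weak_grad \<Omega> (\<lambda>x. u x + v x) (\<lambda>x. g x + h x)"
  unfolding is_weak_grad_def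
proof (intro conjI allI impI ballI)
  have L: "L2 \<Omega> g" "L2 \<Omega> h" using u v by (auto simp: is_weak_grad_def)
  show "L2 \<Omega> (\<lambda>x. g x + h x)" by (rule L2_add[OF L])
  fix \<phi> :: "'a \<Rightarrow> real" and b :: 'a assume \<phi>: "test_fun \<Omega> \<phi>" and b: "b \<in> Basis"
  note t = test_fun_L2_on[OF \<phi> \<Omega>] test_fun_L2_on[OF test_fun_pd[OF \<phi>, of b] \<Omega>]
  note i = L2_mult_integrable[OF u(1) t(2)] L2_mult_integrable[OF v(1) t(2)]
    L2_mult_integrable[OF L2_inner[OF L(1), of b] t(1)] L2_mult_integrable[OF L2_inner[OF L(2), of b] t(1)]
  show "(\<integral>x. (u x + v x) * pd \<phi> x b \<partial>lebesgue_on \<Omega>) = - (\<integral>x. ((g x + h x) \<bullet> b) * \<phi> x \<partial>lebesgue_on \<Omega>)"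
    using weak_gradD_on[OF u(2) \<phi> b] weak_gradD_on[OF v(2) \<phi> b] i
    by (simp add: distrib_right inner_add_left)
qed

lemma is_weak_grad_cmult:
  assumes u: "is_weak_grad \<Omega> u g"
  shows "is_weak_grad \<Omega> (\<lambda>x. c * u x) (\<lambda>x. c *\<^sub>R g x)"
  using u by (auto simp: is_weak_grad_def L2_scaleR mult.assoc)

lemma is_weak_grad_diff:
  assumes u: "L2 \<Omega> u" "is_weak_grad \<Omega> u g" and v: "L2 \<Omega> v" "is_weak_grad \<Omega> v h"
    and \<Omega>: "\<Omega> \<in> sets lebesgue"
  shows "is_weak_grad \<Omega> (\<lambda>x. u x - v x) (\<lambda>x. g x - h x)"
  using is_weak_grad_add[OF u L2_cmult[OF v(1)] is_weak_grad_cmult[OF v(2)] \<Omega>, of "-1"] by simp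

definition grad :: "('a::euclidean_space \<Rightarrow> real) \<Rightarrow> 'a \<Rightarrow> 'a" where
  "grad f x = (\<Sum>b\<in>Basis. pd f x b *\<^sub>R b)"

lemma grad_inner_Basis: "b \<in> Basis \<Longrightarrow> grad f x \<bullet> b = pd f x b"
  by (simp add: grad_def inner_sum_left inner_Basis if_distrib sum.delta cong: if_cong)

lemma grad_inner: "smooth f \<Longrightarrow> grad f x \<bullet> e = pd f x e"
  by (subst pd_expand) (simp_all add: grad_def inner_sum_right inner_commute[of _ e] mult.commute)

lemma grad_measurable: "smooth f \<Longrightarrow> grad f \<in> borel_measurable lebesgue"
  unfolding grad_def[abs_def]
  by (intro borel_measurable_sum borel_measurable_scaleR smooth_measurable smooth_pd borel_measurable_const)

lemma L2_sum:
  assumes "finite I" "\<And>i. i \<in> I \<Longrightarrow> L2 \<Omega> (F i)"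
  shows "L2 \<Omega> (\<lambda>x. \<Sum>i\<in>I. F i x)"
  using assms
proof (induction I rule: finite_induct)
  case empty
  then show ?case by (simp add: L2_def)
next
  case (insert i I)
  then show ?case by (simp add: L2_add)
qed

lemma L2_times_const:
  fixes f :: "_ \<Rightarrow> real"
  assumes "L2 \<Omega> f"
  shows "L2 \<Omega> (\<lambda>x. f x *\<^sub>R c)"
proof -
  have "f \<in> borel_measurable (lebesgue_on \<Omega>)" "integrable (lebesgue_on \<Omega>) (\<lambda>x. (f x)\<^sup>2 * (norm c)\<^sup>2)"
    using assms by (auto simp: L2_def)
  then show ?thesis by (simp add: L2_def power_mult_distrib borel_measurable_scaleR)
qed

lemma L2_grad_test: "test_fun \<Omega> \<phi> \<Longrightarrow> L2 UNIV (grad \<phi>)"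
  unfolding grad_def[abs_def]
  by (intro L2_sum L2_times_const test_fun_L2[OF test_fun_pd]) auto

lemma test_fun_bounds:
  assumes "test_fun \<Omega> \<phi>"
  obtains C L r where "C > 0" "\<And>x. \<bar>\<phi> x\<bar> \<le> C" "L > 0" "\<And>x h. \<bar>pd \<phi> x h\<bar> \<le> L * norm h"
    "\<And>x. x \<notin> cball 0 r \<Longrightarrow> \<phi> x = 0"
proof -
  obtain C where C: "C > 0" "\<And>x. \<bar>\<phi> x\<bar> \<le> C" using test_fun_bounded[OF assms] by auto
  obtain L where L: "L > 0" "\<And>x h. \<bar>pd \<phi> x h\<bar> \<le> L * norm h" using test_fun_pd_bound[OF assms] by auto
  obtain K where K: "compact K" "\<And>x. x \<notin> K \<Longrightarrow> \<phi> x = 0"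
    using assms by (elim test_funE) auto
  obtain r where r: "K \<subseteq> cball 0 r" using compact_subset_cball[OF K(1)] by auto
  have "\<phi> x = 0" if "x \<notin> cball 0 r" for x using K(2)[of x] subsetD[OF r, of x] that by auto
  with C L show thesis by (rule that)
qed

text \<open>The product with \<open>\<phi>\<close> has compact support, so its derivative integrates
  to 0. The lemma is stated for differentiable \<open>f\<close> with bounded derivative because it
  is applied both to test functions and to \<open>ramp \<epsilon>\<close> composed with a smooth
  function.\<close>

lemma integral_by_parts_test:
  fixes f :: "'a::euclidean_space \<Rightarrow> real"
  assumes d: "\<And>x. (f has_derivative f' x) (at x)" and L: "\<And>x h. \<bar>f' x h\<bar> \<le> L * norm h"
    and B: "\<And>x. \<bar>f x\<bar> \<le> B" and m: "(\<lambda>x. f' x e) \<in> borel_measurable lebesgue" and \<phi>: "test_fun UNIV \<phi>"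
  shows "(\<integral>x. f x * pd \<phi> x e \<partial>lebesgue) = - (\<integral>x. f' x e * \<phi> x \<partial>lebesgue)"
proof -
  obtain C M r where C: "C > 0" "\<And>x. \<bar>\<phi> x\<bar> \<le> C" and M: "M > 0" "\<And>x h. \<bar>pd \<phi> x h\<bar> \<le> M * norm h"
    and r: "\<And>x. x \<notin> cball 0 r \<Longrightarrow> \<phi> x = 0"
    using test_fun_bounds[OF \<phi>] by metis
  have sm: "smooth \<phi>" by (rule test_fun_smooth[OF \<phi>])
  have fc: "continuous_on UNIV f"
    by (meson continuous_at_imp_continuous_on d has_derivative_continuous)
  have "(\<integral>x. f x * pd \<phi> x e + f' x e * \<phi> x \<partial>lebesgue) = 0"
  proof (rule integral_derivative_eq_0(1))
    show "((\<lambda>x. f x * \<phi> x) has_derivative (\<lambda>h. f x * pd \<phi> x h + f' x h * \<phi> x)) (at x)" for x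
      by (rule has_derivative_mult[OF d smooth_has_derivative[OF sm]])
    show "\<bar>f x * pd \<phi> x h + f' x h * \<phi> x\<bar> \<le> (B * M + L * C) * norm h" for x h
    proof -
      have "\<bar>f x * pd \<phi> x h\<bar> \<le> B * (M * norm h)"
        unfolding abs_mult using B M(2)[of x h] order_trans[OF abs_ge_zero B] by (intro mult_mono) auto
      moreover have "\<bar>f' x h * \<phi> x\<bar> \<le> (L * norm h) * C"
        unfolding abs_mult using L[of x h] C(2)[of x] order_trans[OF abs_ge_zero L] by (intro mult_mono) auto
      ultimately show ?thesis by (simp add: algebra_simps)
    qed
    show "f x * \<phi> x = 0" if "x \<notin> cball 0 r" for x using r that by simp
  qed
  moreover have "integrable lebesgue (\<lambda>x. f x * pd \<phi> x e)"
  proof (rule Bochner_Integration.integrable_bound[of _ "\<lambda>x. B * pd \<phi> x e"])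
    show "integrable lebesgue (\<lambda>x. B * pd \<phi> x e)"
      by (intro integrable_mult_right test_fun_integrable[OF test_fun_pd[OF \<phi>]])
    show "(\<lambda>x. f x * pd \<phi> x e) \<in> borel_measurable lebesgue"
      by (intro borel_measurable_times continuous_imp_lebesgue[OF fc] smooth_measurable smooth_pd sm)
    show "AE x in lebesgue. norm (f x * pd \<phi> x e) \<le> norm (B * pd \<phi> x e)"
    proof (intro AE_I2)
      fix x show "norm (f x * pd \<phi> x e) \<le> norm (B * pd \<phi> x e)"
        using mult_right_mono[OF order_trans[OF B[of x] abs_ge_self] abs_ge_zero, of "pd \<phi> x e"]
        by (simp add: abs_mult)
    qed
  qed
  moreover have "integrable lebesgue (\<lambda>x. f' x e * \<phi> x)"
  proof (rule Bochner_Integration.integrable_bound[of _ "\<lambda>x. (L * norm e) * \<phi> x"])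
    show "integrable lebesgue (\<lambda>x. (L * norm e) * \<phi> x)"
      by (intro integrable_mult_right test_fun_integrable[OF \<phi>])
    show "(\<lambda>x. f' x e * \<phi> x) \<in> borel_measurable lebesgue"
      by (intro borel_measurable_times m smooth_measurable sm)
    show "AE x in lebesgue. norm (f' x e * \<phi> x) \<le> norm ((L * norm e) * \<phi> x)"
    proof (intro AE_I2)
      fix x show "norm (f' x e * \<phi> x) \<le> norm ((L * norm e) * \<phi> x)"
        using mult_right_mono[OF order_trans[OF L[of x e] abs_ge_self] abs_ge_zero, of "\<phi> x"]
        by (simp add: abs_mult)
    qed
  qed
  ultimately show ?thesis by simp
qed

lemma is_weak_grad_test:
  assumes \<phi>: "test_fun \<Omega> \<phi>"
  shows "is_weak_grad UNIV \<phi> (grad \<phi>)"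
  unfolding is_weak_grad_UNIV
proof (intro conjI allI impI ballI)
  show "L2 UNIV (grad \<phi>)" by (rule L2_grad_test[OF \<phi>])
  obtain C L r where b: "C > 0" "\<And>x. \<bar>\<phi> x\<bar> \<le> C" "L > 0" "\<And>x h. \<bar>pd \<phi> x h\<bar> \<le> L * norm h"
    using test_fun_bounds[OF \<phi>] by metis
  note sm = test_fun_smooth[OF \<phi>]
  fix \<psi> :: "'a \<Rightarrow> real" and b :: 'a assume "test_fun UNIV \<psi>" "b \<in> Basis"
  then show "(\<integral>x. \<phi> x * pd \<psi> x b \<partial>lebesgue) = - (\<integral>x. (grad \<phi> x \<bullet> b) * \<psi> x \<partial>lebesgue)"
    using integral_by_parts_test[OF smooth_has_derivative[OF sm] b(4,2) smooth_measurable[OF smooth_pd[OF sm]]]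
    by (simp add: grad_inner_Basis)
qed

section \<open>Compactly supported Sobolev functions\<close>

text \<open>The working form of a Sobolev function with compact support. The gradient is carried
  along explicitly, which avoids the choice hidden in \<open>weak_grad\<close>, and both functions
  vanish at every point outside the ball, not just almost everywhere.\<close>

definition cH1 :: "real \<Rightarrow> ('a::euclidean_space \<Rightarrow> real) \<Rightarrow> ('a \<Rightarrow> 'a) \<Rightarrow> bool" where
  "cH1 r w G \<longleftrightarrow> L2 UNIV w \<and> is_weak_grad UNIV w G \<and> (\<forall>x. x \<notin> cball 0 r \<longrightarrow> w x = 0 \<and> G x = 0)"

lemma cH1D:
  assumes "cH1 r w G"
  shows "L2 UNIV w" "is_weak_grad UNIV w G" "L2 UNIV G" "\<And>x. x \<notin> cball 0 r \<Longrightarrow> w x = 0"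
    "\<And>x. x \<notin> cball 0 r \<Longrightarrow> G x = 0" "integrable lebesgue w" "w \<in> borel_measurable lebesgue"
    "G \<in> borel_measurable lebesgue"
proof -
  show a: "L2 UNIV w" "is_weak_grad UNIV w G" "L2 UNIV G" "\<And>x. x \<notin> cball 0 r \<Longrightarrow> w x = 0"
    "\<And>x. x \<notin> cball 0 r \<Longrightarrow> G x = 0"
    using assms by (auto simp: cH1_def is_weak_grad_UNIV)
  show "integrable lebesgue w" using compact_L2_integrable[OF a(1,4)] .
  show "w \<in> borel_measurable lebesgue" "G \<in> borel_measurable lebesgue"
    using a(1,3) L2_borel by blast+
qed

lemma cH1_mono: "cH1 r w G \<Longrightarrow> r \<le> r' \<Longrightarrow> cH1 r' w G"
  by (auto simp: cH1_def)

lemma cH1_add: "cH1 r w G \<Longrightarrow> cH1 r v H \<Longrightarrow> cH1 r (\<lambda>x. w x + v x) (\<lambda>x. G x + H x)"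
  by (auto simp: cH1_def intro: L2_add is_weak_grad_add)

lemma cH1_cmult: "cH1 r w G \<Longrightarrow> cH1 r (\<lambda>x. c * w x) (\<lambda>x. c *\<^sub>R G x)"
  by (auto simp: cH1_def intro: L2_cmult is_weak_grad_cmult)

lemma cH1_diff: "cH1 r w G \<Longrightarrow> cH1 r v H \<Longrightarrow> cH1 r (\<lambda>x. w x - v x) (\<lambda>x. G x - H x)"
  using cH1_add[of r w G "\<lambda>x. -1 * v x" "\<lambda>x. -1 *\<^sub>R H x"] cH1_cmult[of r v H "-1"] by simp

text \<open>For fixed \<open>x\<close> the reflected kernel \<open>\<rho> (x - y)\<close> is a test
  function of \<open>y\<close>. Its derivative in \<open>y\<close> has the opposite sign, which the
  definition of the weak gradient restores.\<close>

lemma pd_conv_weak: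
  assumes w: "cH1 r w G" and \<rho>: "test_fun UNIV \<rho>" and b: "b \<in> Basis"
  shows "pd (conv \<rho> w) x b = conv \<rho> (\<lambda>y. G y \<bullet> b) x"
proof -
  have sm: "smooth \<rho>" by (rule test_fun_smooth[OF \<rho>])
  have p: "pd (\<lambda>y. \<rho> (x - y)) y b = - pd \<rho> (x - y) b" for y
  proof -
    have "((\<lambda>y. \<rho> (x - y)) has_derivative (\<lambda>h. pd \<rho> (x - y) (- h))) (at y)"
      by (rule has_derivative_compose[of "\<lambda>y. x - y" "\<lambda>h. - h" y UNIV \<rho>])
         (use smooth_has_derivative[OF sm] in \<open>auto intro!: derivative_eq_intros\<close>)
    from pd_eqI[OF this] show ?thesis
      using linear_neg[OF smooth_linear_pd[OF sm]] by simp
  qed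
  have "(\<integral>y. w y * pd \<rho> (x - y) b \<partial>lebesgue) = - (\<integral>y. w y * pd (\<lambda>y. \<rho> (x - y)) y b \<partial>lebesgue)"
    by (simp add: p)
  also have "\<dots> = (\<integral>y. (G y \<bullet> b) * \<rho> (x - y) \<partial>lebesgue)"
    using weak_gradD[OF cH1D(2)[OF w] test_fun_reflect[OF \<rho>] b] by simp
  finally show ?thesis
    using pd_conv[OF cH1D(6)[OF w] \<rho>] by (simp add: conv_def)
qed

lemma cH1_approx:
  assumes w: "cH1 r w G"
  shows "test_fun UNIV (conv (moll n) w)"
    and "x \<notin> cball 0 (r + 1 / real (Suc n)) \<Longrightarrow> conv (moll n) w x = 0"
    and "(\<lambda>n. n2 (\<lambda>x. conv (moll n) w x - w x)) \<longlonglongrightarrow> 0"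
    and "b \<in> Basis \<Longrightarrow> (\<lambda>n. n2 (\<lambda>x. pd (conv (moll n) w) x b - G x \<bullet> b)) \<longlonglongrightarrow> 0"
proof -
  show z: "conv (moll n) w x = 0" if "x \<notin> cball 0 (r + 1 / real (Suc n))" for x
    by (rule conv_support[OF cH1D(4)[OF w] moll_support that])
  show "test_fun UNIV (conv (moll n) w)"
    by (rule test_funI[OF smooth_conv[OF cH1D(6)[OF w] test_fun_moll] compact_cball subset_UNIV z])
  show "(\<lambda>n. n2 (\<lambda>x. conv (moll n) w x - w x)) \<longlonglongrightarrow> 0"
    by (rule conv_moll_L2[OF cH1D(1,4)[OF w]])
  show "(\<lambda>n. n2 (\<lambda>x. pd (conv (moll n) w) x b - G x \<bullet> b)) \<longlonglongrightarrow> 0" if "b \<in> Basis"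
    unfolding pd_conv_weak[OF w test_fun_moll that]
    by (rule conv_moll_L2[OF L2_inner[OF cH1D(3)[OF w]], where r = r]) (simp add: cH1D(5)[OF w])
qed

section \<open>Uniqueness of the weak gradient\<close>

lemma n2_restrict_zero:
  fixes f :: "'a::euclidean_space \<Rightarrow> real"
  assumes fm: "f \<in> borel_measurable lebesgue" and lim: "(\<lambda>n. n2 (\<lambda>x. F n x - f x)) \<longlonglongrightarrow> 0"
    and z: "eventually (\<lambda>n. \<forall>x\<in>K. F n x = 0) sequentially" and K: "K \<in> sets lebesgue"
  shows "AE x in lebesgue. x \<in> K \<longrightarrow> f x = 0"
proof -
  let ?I = "\<integral>\<^sup>+x. ennreal ((f x)\<^sup>2) * indicator K x \<partial>lebesgue"
  have "eventually (\<lambda>n. ?I \<le> n2 (\<lambda>x. F n x - f x)) sequentially"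
    using z
  proof eventually_elim
    case (elim n)
    show ?case unfolding n2_def
      by (rule nn_integral_mono) (use elim in \<open>auto split: split_indicator\<close>)
  qed
  then have "?I \<le> 0"
    using lim tendsto_lowerbound[OF lim] by simp
  then have "?I = 0" by simp
  then have "AE x in lebesgue. ennreal ((f x)\<^sup>2) * indicator K x = 0"
    using fm K by (subst (asm) nn_integral_0_iff_AE) auto
  then show ?thesis
    by eventually_elim (auto split: split_indicator_asm)
qed

lemma AE_ball_exhaust:
  assumes "\<And>s. s < R \<Longrightarrow> AE x in lebesgue. x \<in> cball (0::'a::euclidean_space) s \<longrightarrow> P x"
  shows "AE x in lebesgue. x \<in> ball 0 R \<longrightarrow> P x"
proof -
  have "AE x in lebesgue. \<forall>n::nat. x \<in> cball (0::'a) (R - 1 / real (Suc n)) \<longrightarrow> P x"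
    unfolding AE_all_countable by (intro allI assms) simp
  then show ?thesis
  proof (rule eventually_mono, intro impI)
    fix x :: 'a assume x: "\<forall>n::nat. x \<in> cball 0 (R - 1 / real (Suc n)) \<longrightarrow> P x" "x \<in> ball 0 R"
    then have "R - norm x > 0" by simp
    then obtain n where "inverse (real (Suc n)) < R - norm x" using reals_Archimedean by blast
    then have "norm x \<le> R - 1 / real (Suc n)" by (simp add: inverse_eq_divide)
    then show "P x" using x(1) by auto
  qed
qed

text \<open>At points of a smaller ball the shifted mollifier is an admissible test function as soon
  as its radius is below the gap \<open>R - s\<close>. Hence the mollifications of the extension by
  zero eventually vanish there, and so does their L2 limit.\<close>

lemma fundamental_lemma:
  fixes f :: "'a::euclidean_space \<Rightarrow> real"
  assumes f: "L2 (ball 0 R) f"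
    and 0: "\<And>\<phi>. test_fun (ball 0 R) \<phi> \<Longrightarrow> integral\<^sup>L (lebesgue_on (ball 0 R)) (\<lambda>x. f x * \<phi> x) = 0"
  shows "AE x in lebesgue. x \<in> ball 0 R \<longrightarrow> f x = 0"
proof (rule AE_ball_exhaust)
  fix s assume s: "s < R"
  define F where "F x = indicator (ball 0 R) x * f x" for x
  have F: "L2 UNIV F"
    using L2_iff_indicator[THEN iffD1, OF _ f] by (simp add: F_def[abs_def])
  have Fs: "F x = 0" if "x \<notin> cball 0 R" for x
    using that by (auto simp: F_def split: split_indicator)
  have "eventually (\<lambda>n. \<forall>x\<in>cball 0 s. conv (moll n) F x = 0) sequentially"
  proof -
    obtain N where N: "inverse (real (Suc N)) < R - s" using reals_Archimedean[of "R - s"] s by auto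
    have "conv (moll n) F x = 0" if n: "n \<ge> N" and x: "x \<in> cball 0 s" for n x
    proof -
      have "1 / real (Suc n) \<le> inverse (real (Suc N))" using n by (simp add: divide_simps)
      then have small: "1 / real (Suc n) < R - s" using N by linarith
      have "test_fun (ball 0 R) (\<lambda>y. moll n (x - y))"
      proof (rule test_funI[OF test_fun_smooth[OF test_fun_reflect[OF test_fun_moll]]])
        show "compact (cball x (1 / real (Suc n)))" by simp
        show "cball x (1 / real (Suc n)) \<subseteq> ball 0 R"
        proof
          fix y assume "y \<in> cball x (1 / real (Suc n))"
          then have "norm (x - y) \<le> 1 / real (Suc n)" by (simp add: dist_norm)
          then show "y \<in> ball 0 R"
            using norm_triangle_ineq4[of x "x - y"] x small by simp
        qed
        show "moll n (x - y) = 0" if "y \<notin> cball x (1 / real (Suc n))" for y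
          using that by (intro moll_support) (simp add: dist_norm norm_minus_commute)
      qed
      from 0[OF this] show ?thesis
        by (simp add: conv_def F_def integral_restrict_space mult.assoc)
    qed
    then show ?thesis unfolding eventually_sequentially by blast
  qed
  moreover have "(\<lambda>n. n2 (\<lambda>x. conv (moll n) F x - F x)) \<longlonglongrightarrow> 0"
    by (rule conv_moll_L2[OF F Fs])
  ultimately have "AE x in lebesgue. x \<in> cball 0 s \<longrightarrow> F x = 0"
    by (intro n2_restrict_zero[OF L2_borel[OF F]]) auto
  then show "AE x in lebesgue. x \<in> cball 0 s \<longrightarrow> f x = 0"
    by (rule eventually_mono) (use s in \<open>auto simp: F_def split: split_indicator_asm\<close>)
qed

lemma weak_grad_unique:
  fixes u :: "'a::euclidean_space \<Rightarrow> real"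
  assumes g: "is_weak_grad (ball 0 R) u g" and h: "is_weak_grad (ball 0 R) u h"
  shows "AE x in lebesgue. x \<in> ball 0 R \<longrightarrow> g x = h x"
proof -
  have L: "L2 (ball 0 R) g" "L2 (ball 0 R) h" using g h by (auto simp: is_weak_grad_def)
  have "AE x in lebesgue. x \<in> ball 0 R \<longrightarrow> (g x - h x) \<bullet> b = 0" if b: "b \<in> Basis" for b
  proof (rule fundamental_lemma)
    show "L2 (ball 0 R) (\<lambda>x. (g x - h x) \<bullet> b)" by (intro L2_inner L2_diff L)
    fix \<phi> :: "'a \<Rightarrow> real" assume \<phi>: "test_fun (ball 0 R) \<phi>"
    have t: "L2 (ball 0 R) \<phi>" using test_fun_L2_on[OF \<phi>] by simp
    show "(\<integral>x. ((g x - h x) \<bullet> b) * \<phi> x \<partial>lebesgue_on (ball 0 R)) = 0"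
      using weak_gradD_on[OF g \<phi> b] weak_gradD_on[OF h \<phi> b]
        L2_mult_integrable[OF L2_inner[OF L(1), of b] t] L2_mult_integrable[OF L2_inner[OF L(2), of b] t]
      by (simp add: inner_diff_left left_diff_distrib)
  qed
  then have "AE x in lebesgue. \<forall>b\<in>Basis. x \<in> ball 0 R \<longrightarrow> (g x - h x) \<bullet> b = 0"
    by (intro AE_finite_allI) auto
  then show ?thesis
    by (rule eventually_mono) (auto simp: inner_diff_left intro: euclidean_eqI)
qed

text \<open>The bridge from the choice made in \<open>weak_grad\<close> to explicit gradients; the
  Dirichlet energies of competitors are computed through it.\<close>

lemma weak_grad_AE:
  assumes "is_weak_grad (ball 0 R) u g"
  shows "is_weak_grad (ball 0 R) u (weak_grad (ball 0 R) u)"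
    and "AE x in lebesgue. x \<in> ball 0 R \<longrightarrow> weak_grad (ball 0 R) u x = g x"
proof -
  show 1: "is_weak_grad (ball 0 R) u (weak_grad (ball 0 R) u)"
    unfolding weak_grad_def by (rule someI[of "is_weak_grad (ball 0 R) u", OF assms])
  show "AE x in lebesgue. x \<in> ball 0 R \<longrightarrow> weak_grad (ball 0 R) u x = g x"
    by (rule weak_grad_unique[OF 1 assms])
qed

lemma integral_square_le_n2:
  fixes h :: "'a::euclidean_space \<Rightarrow> real"
  assumes h: "L2 UNIV h" and \<Omega>: "\<Omega> \<in> sets lebesgue"
  shows "(\<integral>x. (h x)\<^sup>2 \<partial>lebesgue_on \<Omega>) \<le> enn2real (n2 h)"
proof -
  have i: "integrable lebesgue (\<lambda>x. (h x)\<^sup>2)"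
    using h by (simp add: L2_def lebesgue_on_UNIV_eq)
  have hm: "h \<in> borel_measurable lebesgue" by (rule L2_borel[OF h])
  have "(\<integral>x. (h x)\<^sup>2 \<partial>lebesgue_on \<Omega>) = (\<integral>x. indicator \<Omega> x * (h x)\<^sup>2 \<partial>lebesgue)"
    using \<Omega> by (simp add: integral_restrict_space)
  also have "\<dots> \<le> (\<integral>x. (h x)\<^sup>2 \<partial>lebesgue)"
  proof (rule integral_mono[OF _ i])
    show "integrable lebesgue (\<lambda>x. indicator \<Omega> x * (h x)\<^sup>2)"
      by (rule Bochner_Integration.integrable_bound[OF i])
         (use \<Omega> hm in \<open>auto split: split_indicator intro!: borel_measurable_times\<close>)
  qed (auto split: split_indicator)
  also have "\<dots> = enn2real (n2 h)"
    unfolding n2_def by (rule integral_eq_nn_integral) (use hm in auto)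
  finally show ?thesis .
qed

lemma H1_ballI:
  assumes "L2 UNIV w" "is_weak_grad UNIV w G"
  shows "w \<in> H1 (ball 0 R)"
  unfolding H1_def
  using L2_restrict[OF assms(1), of "ball 0 R"] is_weak_grad_restrict[OF assms(2), of "ball 0 R"] by auto

text \<open>Mollify. Starting the sequence at an index \<open>N\<close> with mollifier radius below
  \<open>R - r\<close> keeps every approximant supported inside the ball, and the weak gradient
  commutes with mollification, so the gradients converge too.\<close>

lemma cH1_imp_H10:
  fixes w :: "'a::euclidean_space \<Rightarrow> real"
  assumes w: "cH1 r w G" and r: "r < R"
  shows "w \<in> H10 (ball 0 R)"
proof -
  let ?\<Omega> = "ball (0::'a) R"
  obtain N where N: "inverse (real (Suc N)) < R - r" using reals_Archimedean[of "R - r"] r by auto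
  define \<phi> where "\<phi> k = conv (moll (k + N)) w" for k
  have sm: "test_fun UNIV (\<phi> k)" for k unfolding \<phi>_def by (rule cH1_approx(1)[OF w])
  have t: "test_fun ?\<Omega> (\<phi> k)" for k
  proof (rule test_funI[OF test_fun_smooth[OF sm]])
    show "compact (cball (0::'a) (r + 1 / real (Suc (k + N))))" by simp
    have "1 / real (Suc (k + N)) \<le> inverse (real (Suc N))" by (simp add: divide_simps)
    then have "1 / real (Suc (k + N)) < R - r" using N by linarith
    then show "cball (0::'a) (r + 1 / real (Suc (k + N))) \<subseteq> ?\<Omega>"
      by (auto simp del: of_nat_Suc)
    show "\<phi> k x = 0" if "x \<notin> cball 0 (r + 1 / real (Suc (k + N)))" for x
      unfolding \<phi>_def by (rule cH1_approx(2)[OF w that])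
  qed
  define d where "d k = enn2real (n2 (\<lambda>x. \<phi> k x - w x)) +
      (\<Sum>b\<in>Basis. enn2real (n2 (\<lambda>x. pd (\<phi> k) x b - G x \<bullet> b)))" for k
  have "d \<longlonglongrightarrow> 0 + (\<Sum>b\<in>(Basis::'a set). 0)"
    unfolding d_def \<phi>_def
  proof (intro tendsto_add tendsto_sum)
    have e: "(\<lambda>k. enn2real (X (k + N))) \<longlonglongrightarrow> 0" if "X \<longlonglongrightarrow> 0" for X
    proof -
      have "X \<longlonglongrightarrow> ennreal 0" using that by simp
      then have "(\<lambda>k. enn2real (X k)) \<longlonglongrightarrow> 0" by (rule tendsto_enn2real) simp
      then show ?thesis by (rule LIMSEQ_ignore_initial_segment)
    qed
    show "(\<lambda>k. enn2real (n2 (\<lambda>x. conv (moll (k + N)) w x - w x))) \<longlonglongrightarrow> 0"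
      by (rule e[OF cH1_approx(3)[OF w]])
    show "(\<lambda>k. enn2real (n2 (\<lambda>x. pd (conv (moll (k + N)) w) x b - G x \<bullet> b))) \<longlonglongrightarrow> 0" if "b \<in> Basis" for b
      by (rule e[OF cH1_approx(4)[OF w that]])
  qed
  then have d0: "d \<longlonglongrightarrow> 0" by simp
  have bound: "H1_norm ?\<Omega> (\<lambda>x. w x - \<phi> k x) \<le> sqrt (d k)" for k
    unfolding H1_norm_def
  proof (rule real_sqrt_le_mono)
    note \<phi>L = test_fun_L2[OF sm[of k]] and \<phi>g = is_weak_grad_test[OF sm[of k]]
    note GL = cH1D(3)[OF w] L2_grad_test[OF sm[of k]]
    have "is_weak_grad UNIV (\<lambda>x. w x - \<phi> k x) (\<lambda>x. G x - grad (\<phi> k) x)"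
      by (rule is_weak_grad_diff[OF cH1D(1,2)[OF w] \<phi>L \<phi>g]) simp
    then have "is_weak_grad ?\<Omega> (\<lambda>x. w x - \<phi> k x) (\<lambda>x. G x - grad (\<phi> k) x)"
      by (rule is_weak_grad_restrict) simp
    note wg = weak_grad_AE[OF this]
    have "(\<integral>x. (w x - \<phi> k x)\<^sup>2 \<partial>lebesgue_on ?\<Omega>) \<le> enn2real (n2 (\<lambda>x. w x - \<phi> k x))"
      by (rule integral_square_le_n2[OF L2_diff[OF cH1D(1)[OF w] \<phi>L]]) simp
    moreover have "(\<integral>x. (norm (weak_grad ?\<Omega> (\<lambda>x. w x - \<phi> k x) x))\<^sup>2 \<partial>lebesgue_on ?\<Omega>) \<le>
        (\<Sum>b\<in>Basis. enn2real (n2 (\<lambda>x. pd (\<phi> k) x b - G x \<bullet> b)))"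
    proof -
      have m: "(\<lambda>x. (norm (G x - grad (\<phi> k) x))\<^sup>2) \<in> borel_measurable (lebesgue_on ?\<Omega>)"
        using L2_restrict[OF L2_diff[OF GL], of ?\<Omega>] by (auto simp: L2_def dest: borel_measurable_integrable)
      have m': "(\<lambda>x. (norm (weak_grad ?\<Omega> (\<lambda>x. w x - \<phi> k x) x))\<^sup>2) \<in> borel_measurable (lebesgue_on ?\<Omega>)"
        using wg(1) by (auto simp: is_weak_grad_def L2_def dest: borel_measurable_integrable)
      have "(\<integral>x. (norm (weak_grad ?\<Omega> (\<lambda>x. w x - \<phi> k x) x))\<^sup>2 \<partial>lebesgue_on ?\<Omega>) =
          (\<integral>x. (norm (G x - grad (\<phi> k) x))\<^sup>2 \<partial>lebesgue_on ?\<Omega>)"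
        by (rule integral_cong_AE[OF m' m]) (use wg(2) in \<open>auto simp: AE_restrict_space_iff elim!: eventually_mono\<close>)
      also have "\<dots> = (\<integral>x. (\<Sum>b\<in>Basis. (G x \<bullet> b - pd (\<phi> k) x b)\<^sup>2) \<partial>lebesgue_on ?\<Omega>)"
      proof (rule Bochner_Integration.integral_cong[OF refl])
        fix x
        have "(norm (G x - grad (\<phi> k) x))\<^sup>2 = (\<Sum>b\<in>Basis. ((G x - grad (\<phi> k) x) \<bullet> b)\<^sup>2)"
          unfolding power2_norm_eq_inner by (subst euclidean_inner) (simp add: power2_eq_square)
        then show "(norm (G x - grad (\<phi> k) x))\<^sup>2 = (\<Sum>b\<in>Basis. (G x \<bullet> b - pd (\<phi> k) x b)\<^sup>2)"
          by (simp add: inner_diff_left grad_inner_Basis)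
      qed
      also have "\<dots> = (\<Sum>b\<in>Basis. \<integral>x. (G x \<bullet> b - pd (\<phi> k) x b)\<^sup>2 \<partial>lebesgue_on ?\<Omega>)"
      proof (rule Bochner_Integration.integral_sum)
        fix b :: 'a assume "b \<in> Basis"
        have "L2 ?\<Omega> (\<lambda>x. G x \<bullet> b - pd (\<phi> k) x b)"
          by (intro L2_diff L2_inner L2_restrict[OF GL(1)] test_fun_L2_on[OF test_fun_pd[OF sm]]) auto
        then show "integrable (lebesgue_on ?\<Omega>) (\<lambda>x. (G x \<bullet> b - pd (\<phi> k) x b)\<^sup>2)" by (simp add: L2_def)
      qed
      also have "\<dots> \<le> (\<Sum>b\<in>Basis. enn2real (n2 (\<lambda>x. G x \<bullet> b - pd (\<phi> k) x b)))"
        by (intro sum_mono integral_square_le_n2 L2_diff L2_inner GL test_fun_L2[OF test_fun_pd[OF sm]]) auto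
      finally show ?thesis by (subst n2_minus) 
    qed
    ultimately show "(\<integral>x. (w x - \<phi> k x)\<^sup>2 \<partial>lebesgue_on ?\<Omega>) +
        (\<integral>x. (norm (weak_grad ?\<Omega> (\<lambda>x. w x - \<phi> k x) x))\<^sup>2 \<partial>lebesgue_on ?\<Omega>) \<le> d k"
      by (simp add: d_def n2_minus[of w])
  qed
  have "(\<lambda>k. H1_norm ?\<Omega> (\<lambda>x. w x - \<phi> k x)) \<longlonglongrightarrow> 0"
  proof (rule tendsto_sandwich[OF _ _ tendsto_const])
    show "(\<lambda>k. sqrt (d k)) \<longlonglongrightarrow> 0" using tendsto_real_sqrt[OF d0] by simp
    show "eventually (\<lambda>k. 0 \<le> H1_norm ?\<Omega> (\<lambda>x. w x - \<phi> k x)) sequentially"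
      by (simp add: H1_norm_def)
    show "eventually (\<lambda>k. H1_norm ?\<Omega> (\<lambda>x. w x - \<phi> k x) \<le> sqrt (d k)) sequentially"
      using bound by simp
  qed
  then show ?thesis
    using H1_ballI[OF cH1D(1,2)[OF w], of R] t by (auto simp: H10_def)
qed

section \<open>Cutoff functions\<close>

lemma pd_bump: "pd (bump r) x a = (-2 * (x \<bullet> a)) * flat 2 (r\<^sup>2 - x \<bullet> x)"
proof -
  have "((\<lambda>x. flat 0 (r\<^sup>2 - x \<bullet> x)) has_derivative (\<lambda>h. (flat 2 (r\<^sup>2 - x \<bullet> x)) * (- (x \<bullet> h + h \<bullet> x)))) (at x)"
    by (rule has_derivative_compose[of "\<lambda>x. r\<^sup>2 - x \<bullet> x" "\<lambda>h. - (x \<bullet> h + h \<bullet> x)" x UNIV "flat 0"])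
       (use flat_has_derivative[of 0 "r\<^sup>2 - x \<bullet> x"] in
         \<open>auto intro!: derivative_eq_intros simp: has_field_derivative_def numeral_2_eq_2\<close>)
  from pd_eqI[OF this] show ?thesis
    by (simp add: bump_def[abs_def] inner_commute)
qed

text \<open>Computed explicitly because two facts are read off it: the symmetry in \<open>a\<close>
  and \<open>b\<close>, which the Piola identity needs, and the Laplacian of the test function in
  the last part.\<close>

lemma pd_pd_bump:
  "pd (\<lambda>z. pd (bump r) z a) x b = -2 * (a \<bullet> b) * flat 2 (r\<^sup>2 - x \<bullet> x) +
     4 * (x \<bullet> a) * (x \<bullet> b) * (flat 4 (r\<^sup>2 - x \<bullet> x) - 2 * flat 3 (r\<^sup>2 - x \<bullet> x))"
proof -
  let ?f' = "flat 4 (r\<^sup>2 - x \<bullet> x) - 2 * flat 3 (r\<^sup>2 - x \<bullet> x)"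
  have 2: "((\<lambda>x. flat 2 (r\<^sup>2 - x \<bullet> x)) has_derivative (\<lambda>h. ?f' * (- (x \<bullet> h + h \<bullet> x)))) (at x)"
    by (rule has_derivative_compose[of "\<lambda>x. r\<^sup>2 - x \<bullet> x" "\<lambda>h. - (x \<bullet> h + h \<bullet> x)" x UNIV "flat 2"])
       (use flat_has_derivative[of 2 "r\<^sup>2 - x \<bullet> x"] in
         \<open>auto intro!: derivative_eq_intros simp: has_field_derivative_def\<close>)
  have 1: "((\<lambda>x. -2 * (x \<bullet> a)) has_derivative (\<lambda>h. -2 * (h \<bullet> a))) (at x)"
    by (auto intro!: derivative_eq_intros)
  from pd_eqI[OF has_derivative_mult[OF 1 2]] show ?thesis
    by (simp add: pd_bump inner_commute algebra_simps)
qed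

lemma pd_cmult: "smooth f \<Longrightarrow> pd (\<lambda>x. c * f x) x a = c * pd f x a"
  by (simp add: pd_eqI[OF has_derivative_mult_right[OF smooth_has_derivative]])

lemma smooth_bump: "smooth (bump r)"
  by (rule test_fun_smooth[OF test_fun_bump])

lemma pd_pd_moll_commute: "pd (\<lambda>z. pd (moll n) z a) x b = pd (\<lambda>z. pd (moll n) z b) x a"
proof -
  let ?c = "inverse (\<integral>y. bump (1 / real (Suc n)) (y::'a) \<partial>lebesgue)"
  have m: "(moll n :: 'a \<Rightarrow> real) = (\<lambda>x. ?c * bump (1 / real (Suc n)) x)"
    by (simp add: moll_def[abs_def] divide_inverse mult.commute)
  have "pd (\<lambda>z. pd (moll n) z a) x b = ?c * pd (\<lambda>z. pd (bump (1 / real (Suc n))) z a) x b" for a b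
    unfolding m pd_cmult[OF smooth_bump] by (rule pd_cmult[OF smooth_pd[OF smooth_bump]])
  moreover have "pd (\<lambda>z. pd (bump (1 / real (Suc n))) z a) x b = pd (\<lambda>z. pd (bump (1 / real (Suc n))) z b) x a"
    unfolding pd_pd_bump by (simp add: inner_commute mult_ac)
  ultimately show ?thesis by simp
qed

text \<open>Mollify the indicator of a ball. Equality with 1 holds on an open neighbourhood of
  \<open>cball 0 r\<close>, so the derivative vanishes on the whole closed ball; the symmetry of the
  second derivatives is inherited from \<open>moll\<close>.\<close>

lemma cutoff_exists:
  fixes r R :: real
  assumes "r < R"
  obtains \<zeta> :: "'a::euclidean_space \<Rightarrow> real" and s where "r < s" "s < R" "smooth \<zeta>" "test_fun (ball 0 R) \<zeta>"
    "\<And>x. x \<in> cball 0 r \<Longrightarrow> \<zeta> x = 1" "\<And>x e. x \<in> cball 0 r \<Longrightarrow> pd \<zeta> x e = 0"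
    "\<And>x. x \<notin> cball 0 s \<Longrightarrow> \<zeta> x = 0" "\<And>x. 0 \<le> \<zeta> x" "\<And>x. \<zeta> x \<le> 1"
    "\<And>x a b. pd (\<lambda>z. pd \<zeta> z a) x b = pd (\<lambda>z. pd \<zeta> z b) x a"
proof -
  \<comment> \<open>The indicator has radius \<open>r + 2 * \<delta>\<close> and the mollifier a
    radius below \<open>\<delta>\<close>: the result is 1 up to \<open>r + \<delta>\<close> and 0
    from \<open>r + 3 * \<delta>\<close> on, which leaves one \<open>\<delta>\<close> before
    \<open>R\<close>.\<close>
  define \<delta> where "\<delta> = (R - r) / 4"
  have \<delta>: "\<delta> > 0" "R = r + 4 * \<delta>" using assms by (auto simp: \<delta>_def field_simps)
  obtain n where n: "inverse (real (Suc n)) < \<delta>" using reals_Archimedean[OF \<delta>(1)] by blast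
  define f where "f = (indicator (cball 0 (r + 2 * \<delta>)) :: 'a \<Rightarrow> real)"
  have f: "integrable lebesgue f"
    using emeasure_cball_lebesgue[of "0::'a" "r + 2 * \<delta>"] unfolding f_def
    by (intro integrable_real_indicator) auto
  have f01: "0 \<le> f y" "f y \<le> 1" for y by (auto simp: f_def split: split_indicator)
  let ?\<zeta> = "conv (moll n) f"
  have ms: "moll n z = 0" if "norm z \<ge> \<delta>" for z :: 'a
    using that n by (intro moll_support) (auto simp: inverse_eq_divide)
  have one: "?\<zeta> x = 1" if "x \<in> ball 0 (r + \<delta>)" for x
  proof -
    have "f y * moll n (x - y) = moll n (x - y)" for y
    proof (cases "norm (x - y) \<ge> \<delta>")
      case False
      then have "y \<in> cball 0 (r + 2 * \<delta>)"
        using norm_triangle_ineq4[of x "x - y"] that by simp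
      then show ?thesis by (simp add: f_def)
    qed (simp add: ms)
    then have "(\<lambda>y. f y * moll n (x - y)) = (\<lambda>y. moll n (x - y))" by (intro ext)
    then show ?thesis by (simp only: conv_def integral_moll)
  qed
  have zero: "?\<zeta> x = 0" if "x \<notin> cball 0 (r + 3 * \<delta>)" for x
  proof (rule conv_support[of "r + 2 * \<delta>" f \<delta>])
    show "f y = 0" if "y \<notin> cball 0 (r + 2 * \<delta>)" for y using that by (simp add: f_def)
    show "moll n y = 0" if "y \<notin> cball 0 \<delta>" for y :: 'a using that by (intro ms) auto
    show "x \<notin> cball 0 (r + 2 * \<delta> + \<delta>)" using that by (simp add: algebra_simps)
  qed
  note sm = smooth_conv[OF f test_fun_moll, of n]
  show thesis
  proof (rule that[of "r + 3 * \<delta>" ?\<zeta>])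
    show "r < r + 3 * \<delta>" "r + 3 * \<delta> < R" using \<delta> by auto
    show "smooth ?\<zeta>" by (rule sm)
    show "test_fun (ball 0 R) ?\<zeta>"
      by (rule test_funI[OF sm compact_cball[of 0 "r + 3 * \<delta>"] _ zero]) (use \<delta> in auto)
    show "?\<zeta> x = 1" if "x \<in> cball 0 r" for x using that \<delta> by (intro one) auto
    show "pd ?\<zeta> x e = 0" if "x \<in> cball 0 r" for x e
    proof -
      have "(?\<zeta> has_derivative (\<lambda>h. 0)) (at x)"
      proof (rule has_derivative_transform_within_open)
        show "((\<lambda>x. 1) has_derivative (\<lambda>h. 0)) (at x)" by simp
        show "open (ball (0::'a) (r + \<delta>))" "x \<in> ball 0 (r + \<delta>)" using that \<delta> by auto
        show "1 = ?\<zeta> y" if "y \<in> ball 0 (r + \<delta>)" for y using one[OF that] by simp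
      qed
      from pd_eqI[OF this] show ?thesis by simp
    qed
    show "?\<zeta> x = 0" if "x \<notin> cball 0 (r + 3 * \<delta>)" for x by (rule zero[OF that])
    show "0 \<le> ?\<zeta> x" for x unfolding conv_def using f01 by (intro Bochner_Integration.integral_nonneg mult_nonneg_nonneg moll_nonneg)
    show "?\<zeta> x \<le> 1" for x
    proof -
      have "?\<zeta> x \<le> (\<integral>y. moll n (x - y) \<partial>lebesgue)"
        unfolding conv_def
        by (rule integral_mono[OF conv_integrable[OF f test_fun_moll] integrable_moll])
           (use f01 moll_nonneg[of n "x - y" for y] in \<open>auto intro!: mult_left_le_one_le\<close>)
      then show ?thesis by (simp add: integral_moll)
    qed
    show "pd (\<lambda>z. pd ?\<zeta> z a) x b = pd (\<lambda>z. pd ?\<zeta> z b) x a" for x a b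
      by (simp add: pd_conv[OF f test_fun_moll] pd_conv[OF f test_fun_pd[OF test_fun_moll]] pd_pd_moll_commute)
  qed
qed

lemma pd_mult: "smooth f \<Longrightarrow> smooth g \<Longrightarrow> pd (\<lambda>x. f x * g x) x e = f x * pd g x e + pd f x e * g x"
  by (simp add: pd_eqI[OF has_derivative_mult[OF smooth_has_derivative smooth_has_derivative]])

section \<open>Localization and extension by zero\<close>

lemma L2_mult_bounded:
  fixes u :: "'a::euclidean_space \<Rightarrow> 'b::euclidean_space"
  assumes u: "L2 \<Omega> u" and m: "\<zeta> \<in> borel_measurable lebesgue" and C: "\<And>x. \<bar>\<zeta> x\<bar> \<le> C"
    and z: "\<And>x. x \<notin> \<Omega> \<Longrightarrow> \<zeta> x = 0" and \<Omega>: "\<Omega> \<in> sets lebesgue"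
  shows "L2 UNIV (\<lambda>x. \<zeta> x *\<^sub>R u x)"
proof -
  have U: "L2 UNIV (\<lambda>x. indicator \<Omega> x *\<^sub>R u x)" using L2_iff_indicator[OF \<Omega>] u by blast
  have eq: "\<zeta> x *\<^sub>R u x = \<zeta> x *\<^sub>R (indicator \<Omega> x *\<^sub>R u x)" for x
    using z[of x] by (cases "x \<in> \<Omega>") auto
  have "L2 UNIV (\<lambda>x. \<zeta> x *\<^sub>R (indicator \<Omega> x *\<^sub>R u x))"
  proof (rule L2_bound[OF U, where C = C])
    show "(\<lambda>x. \<zeta> x *\<^sub>R indicator \<Omega> x *\<^sub>R u x) \<in> borel_measurable lebesgue"
      by (intro borel_measurable_scaleR m L2_borel[OF U])
    show "AE x in lebesgue. norm (\<zeta> x *\<^sub>R indicator \<Omega> x *\<^sub>R u x) \<le> C * norm (indicator \<Omega> x *\<^sub>R u x)"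
      using C by (intro AE_I2) (auto intro!: mult_right_mono split: split_indicator)
  qed
  then show ?thesis by (simp only: eq[symmetric])
qed

text \<open>The product rule in weak form: \<open>u\<close> is tested against
  \<open>\<phi> x * \<zeta> x\<close>, which is supported in the ball for every test function
  \<open>\<phi>\<close> on the whole space.\<close>

lemma cH1_localize:
  fixes u :: "'a::euclidean_space \<Rightarrow> real"
  assumes u: "L2 (ball 0 R) u" "is_weak_grad (ball 0 R) u g"
    and \<zeta>: "test_fun (ball 0 R) \<zeta>" "\<And>x. x \<notin> cball 0 r \<Longrightarrow> \<zeta> x = 0" and r: "r < R"
  shows "cH1 r (\<lambda>x. \<zeta> x * u x) (\<lambda>x. \<zeta> x *\<^sub>R g x + u x *\<^sub>R grad \<zeta> x)"
proof -
  let ?\<Omega> = "ball (0::'a) R"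
  have sm: "smooth \<zeta>" by (rule test_fun_smooth[OF \<zeta>(1)])
  have gL: "L2 ?\<Omega> g" using u(2) by (simp add: is_weak_grad_def)
  obtain C where C: "\<And>x. \<bar>\<zeta> x\<bar> \<le> C" using test_fun_bounded[OF \<zeta>(1)] by auto
  have z\<Omega>: "\<zeta> x = 0" if "x \<notin> ?\<Omega>" for x using \<zeta>(2)[of x] that r by auto
  have pz: "pd \<zeta> x e = 0" if "x \<notin> cball 0 r" for x e
  proof -
    have "(\<zeta> has_derivative (\<lambda>h. 0)) (at x)"
    proof (rule has_derivative_transform_within_open)
      show "((\<lambda>x. 0) has_derivative (\<lambda>h. 0)) (at x)" by simp
      show "open (- cball (0::'a) r)" "x \<in> - cball 0 r" using that by auto
      show "0 = \<zeta> y" if "y \<in> - cball 0 r" for y using \<zeta>(2)[of y] that by simp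
    qed
    from pd_eqI[OF this] show ?thesis by simp
  qed
  have pz\<Omega>: "pd \<zeta> x e = 0" if "x \<notin> ?\<Omega>" for x e using pz[of x e] that r by auto
  have L1: "L2 UNIV (\<lambda>x. \<zeta> x * u x)"
    using L2_mult_bounded[OF u(1) smooth_measurable[OF sm] C z\<Omega>] by simp
  have La: "L2 UNIV (\<lambda>x. \<zeta> x *\<^sub>R g x)"
    using L2_mult_bounded[OF gL smooth_measurable[OF sm] C z\<Omega>] by simp
  have Lb: "L2 UNIV (\<lambda>x. u x *\<^sub>R grad \<zeta> x)"
    unfolding grad_def scaleR_sum_right scaleR_scaleR
  proof (intro L2_sum L2_times_const)
    fix b :: 'a assume "b \<in> Basis"
    obtain D where D: "\<And>x. \<bar>pd \<zeta> x b\<bar> \<le> D" using test_fun_bounded[OF test_fun_pd[OF \<zeta>(1), of b]] by auto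
    show "L2 UNIV (\<lambda>x. u x * pd \<zeta> x b)"
      using L2_mult_bounded[OF u(1) smooth_measurable[OF smooth_pd[OF sm]] D pz\<Omega>] by (simp add: mult.commute)
  qed simp
  show ?thesis
    unfolding cH1_def is_weak_grad_UNIV
  proof (intro conjI allI impI ballI)
    show "L2 UNIV (\<lambda>x. \<zeta> x * u x)" by (rule L1)
    show "L2 UNIV (\<lambda>x. \<zeta> x *\<^sub>R g x + u x *\<^sub>R grad \<zeta> x)" by (rule L2_add[OF La Lb])
    show "\<zeta> x * u x = 0" if "x \<notin> cball 0 r" for x using \<zeta>(2)[OF that] by simp
    show "\<zeta> x *\<^sub>R g x + u x *\<^sub>R grad \<zeta> x = 0" if "x \<notin> cball 0 r" for x
      using \<zeta>(2)[OF that] pz[OF that] by (simp add: grad_def)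
    fix \<phi> :: "'a \<Rightarrow> real" and b :: 'a assume \<phi>: "test_fun UNIV \<phi>" and b: "b \<in> Basis"
    have s\<phi>: "smooth \<phi>" by (rule test_fun_smooth[OF \<phi>])
    have t: "test_fun ?\<Omega> (\<lambda>x. \<phi> x * \<zeta> x)" by (rule test_fun_mult[OF \<zeta>(1) s\<phi>])
    have t1: "L2 ?\<Omega> (\<lambda>x. pd (\<lambda>x. \<phi> x * \<zeta> x) x b)" "L2 ?\<Omega> (\<lambda>x. \<phi> x * pd \<zeta> x b)" "L2 ?\<Omega> (\<lambda>x. \<phi> x * \<zeta> x)"
      by (rule test_fun_L2_on[OF test_fun_pd[OF t]], simp,
          rule test_fun_L2_on[OF test_fun_mult[OF test_fun_pd[OF \<zeta>(1)] s\<phi>]], simp,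
          rule test_fun_L2_on[OF t], simp)
    note i1 = L2_mult_integrable[OF u(1) t1(1)] and i2 = L2_mult_integrable[OF u(1) t1(2)]
      and i3 = L2_mult_integrable[OF L2_inner[OF gL, of b] t1(3)]
    have "(\<integral>x. \<zeta> x * u x * pd \<phi> x b \<partial>lebesgue) = (\<integral>x. \<zeta> x * u x * pd \<phi> x b \<partial>lebesgue_on ?\<Omega>)"
      by (rule integral_on_support[symmetric]) (use z\<Omega> in auto)
    also have "\<dots> = (\<integral>x. u x * pd (\<lambda>x. \<phi> x * \<zeta> x) x b - u x * (\<phi> x * pd \<zeta> x b) \<partial>lebesgue_on ?\<Omega>)"
      by (simp add: pd_mult[OF s\<phi> sm] algebra_simps)
    also have "\<dots> = - (\<integral>x. (g x \<bullet> b) * (\<phi> x * \<zeta> x) \<partial>lebesgue_on ?\<Omega>) - (\<integral>x. u x * (\<phi> x * pd \<zeta> x b) \<partial>lebesgue_on ?\<Omega>)"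
      using i1 i2 weak_gradD_on[OF u(2) t b] by simp
    also have "\<dots> = - (\<integral>x. (g x \<bullet> b) * (\<phi> x * \<zeta> x) + u x * (\<phi> x * pd \<zeta> x b) \<partial>lebesgue_on ?\<Omega>)"
      using i2 i3 by simp
    also have "\<dots> = - (\<integral>x. (\<zeta> x *\<^sub>R g x + u x *\<^sub>R grad \<zeta> x) \<bullet> b * \<phi> x \<partial>lebesgue_on ?\<Omega>)"
      using b by (simp add: inner_add_left grad_inner_Basis algebra_simps)
    also have "(\<integral>x. (\<zeta> x *\<^sub>R g x + u x *\<^sub>R grad \<zeta> x) \<bullet> b * \<phi> x \<partial>lebesgue_on ?\<Omega>) =
        (\<integral>x. (\<zeta> x *\<^sub>R g x + u x *\<^sub>R grad \<zeta> x) \<bullet> b * \<phi> x \<partial>lebesgue)"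
      by (rule integral_on_support) (use z\<Omega> pz\<Omega> b in \<open>auto simp: inner_add_left grad_inner_Basis\<close>)
    finally show "(\<integral>x. \<zeta> x * u x * pd \<phi> x b \<partial>lebesgue) =
        - (\<integral>x. (\<zeta> x *\<^sub>R g x + u x *\<^sub>R grad \<zeta> x) \<bullet> b * \<phi> x \<partial>lebesgue)" .
  qed
qed

text \<open>A cutoff equal to 1 on \<open>cball 0 r\<close> changes neither \<open>w\<close> nor
  \<open>G\<close>, so localizing with it already yields the extension by zero.\<close>

lemma cH1_extend:
  fixes w :: "'a::euclidean_space \<Rightarrow> real"
  assumes w: "L2 (ball 0 R) w" "is_weak_grad (ball 0 R) w G" and r: "r < R"
    and z: "\<And>x. x \<notin> cball 0 r \<Longrightarrow> w x = 0" "\<And>x. x \<notin> cball 0 r \<Longrightarrow> G x = 0"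
  shows "cH1 r w G"
proof -
  obtain \<zeta> :: "'a \<Rightarrow> real" and s where \<zeta>: "r < s" "s < R" "test_fun (ball 0 R) \<zeta>"
    "\<And>x. x \<in> cball 0 r \<Longrightarrow> \<zeta> x = 1" "\<And>x e. x \<in> cball 0 r \<Longrightarrow> pd \<zeta> x e = 0"
    "\<And>x. x \<notin> cball 0 s \<Longrightarrow> \<zeta> x = 0"
    using cutoff_exists[OF r, where 'a='a] by metis
  have c: "cH1 s (\<lambda>x. \<zeta> x * w x) (\<lambda>x. \<zeta> x *\<^sub>R G x + w x *\<^sub>R grad \<zeta> x)"
    by (rule cH1_localize[OF w \<zeta>(3,6,2)])
  have e1: "(\<lambda>x. \<zeta> x * w x) = w"
  proof
    fix x show "\<zeta> x * w x = w x" using \<zeta>(4)[of x] z(1)[of x] by (cases "x \<in> cball 0 r") auto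
  qed
  have e2: "(\<lambda>x. \<zeta> x *\<^sub>R G x + w x *\<^sub>R grad \<zeta> x) = G"
  proof
    fix x show "\<zeta> x *\<^sub>R G x + w x *\<^sub>R grad \<zeta> x = G x"
      using \<zeta>(4)[of x] \<zeta>(5)[of x] z[of x] by (cases "x \<in> cball 0 r") (auto simp: grad_def)
  qed
  show ?thesis using c z unfolding e1 e2 by (simp add: cH1_def)
qed

section \<open>Competitors\<close>

lemma minimizing_pairD:
  assumes "minimizing_pair \<sigma> (ball 0 R) u E"
  shows "L2 (ball 0 R) u" "is_weak_grad (ball 0 R) u (weak_grad (ball 0 R) u)" "E \<in> sets lebesgue"
    "AE x in lebesgue. x \<in> E \<inter> ball 0 R \<longrightarrow> u x \<ge> 0" "AE x in lebesgue. x \<in> - E \<inter> ball 0 R \<longrightarrow> u x \<le> 0"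
    "energy \<sigma> (ball 0 R) u E < \<infinity>"
proof -
  have a: "admissible (ball 0 R) u (E - ball 0 R) u E" "energy \<sigma> (ball 0 R) u E < \<infinity>"
    using assms by (auto simp: minimizing_pair_def)
  then show "L2 (ball 0 R) u" "E \<in> sets lebesgue" "AE x in lebesgue. x \<in> E \<inter> ball 0 R \<longrightarrow> u x \<ge> 0"
    "AE x in lebesgue. x \<in> - E \<inter> ball 0 R \<longrightarrow> u x \<le> 0" "energy \<sigma> (ball 0 R) u E < \<infinity>"
    unfolding admissible_def by (auto simp: H1_def)
  obtain g where "is_weak_grad (ball 0 R) u g" using a by (auto simp: admissible_def H1_def)
  from weak_grad_AE(1)[OF this] show "is_weak_grad (ball 0 R) u (weak_grad (ball 0 R) u)" .
qed

text \<open>The form in which minimality is used throughout. Competitors are written as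
  \<open>u\<close> plus a compactly supported perturbation, which gives the boundary condition and
  an explicit gradient at once.\<close>

lemma minimizing_compare:
  fixes u :: "'a::euclidean_space \<Rightarrow> real"
  assumes min: "minimizing_pair \<sigma> (ball 0 R) u E" and w: "cH1 r w G" and r: "r < R"
    and F: "F \<in> sets lebesgue" "F - ball 0 R = E - ball 0 R"
    and pos: "AE x in lebesgue. x \<in> F \<inter> ball 0 R \<longrightarrow> u x + w x \<ge> 0"
    and neg: "AE x in lebesgue. x \<in> - F \<inter> ball 0 R \<longrightarrow> u x + w x \<le> 0"
  shows "(\<integral>\<^sup>+x\<in>ball 0 R. ennreal ((norm (weak_grad (ball 0 R) u x))\<^sup>2) \<partial>lebesgue) + frac_perimeter \<sigma> E (ball 0 R)
    \<le> (\<integral>\<^sup>+x\<in>ball 0 R. ennreal ((norm (weak_grad (ball 0 R) u x + G x))\<^sup>2) \<partial>lebesgue) + frac_perimeter \<sigma> F (ball 0 R)"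
proof -
  let ?\<Omega> = "ball (0::'a) R"
  note D = minimizing_pairD[OF min]
  have uH: "u \<in> H1 ?\<Omega>" using D by (auto simp: H1_def)
  have "admissible ?\<Omega> u (E - ?\<Omega>) (\<lambda>x. u x + w x) F"
    unfolding admissible_def
  proof (intro conjI)
    show "(\<lambda>x. u x + w x - u x) \<in> H10 ?\<Omega>" using cH1_imp_H10[OF w r] by simp
    show "F \<inter> - ?\<Omega> = E - ?\<Omega>" using F(2) by auto
  qed (use uH F pos neg in auto)
  then have le: "energy \<sigma> ?\<Omega> u E \<le> energy \<sigma> ?\<Omega> (\<lambda>x. u x + w x) F"
    using min by (simp add: minimizing_pair_def)
  have "is_weak_grad ?\<Omega> w G" "L2 ?\<Omega> w"
    using is_weak_grad_restrict[OF cH1D(2)[OF w]] L2_restrict[OF cH1D(1)[OF w]] by auto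
  from is_weak_grad_add[OF D(1,2) this(2,1)]
  have "is_weak_grad ?\<Omega> (\<lambda>x. u x + w x) (\<lambda>x. weak_grad ?\<Omega> u x + G x)" by simp
  from weak_grad_AE(2)[OF this]
  have "(\<integral>\<^sup>+x\<in>?\<Omega>. ennreal ((norm (weak_grad ?\<Omega> (\<lambda>x. u x + w x) x))\<^sup>2) \<partial>lebesgue) =
      (\<integral>\<^sup>+x\<in>?\<Omega>. ennreal ((norm (weak_grad ?\<Omega> u x + G x))\<^sup>2) \<partial>lebesgue)"
    by (intro nn_integral_cong_AE) (auto elim!: eventually_mono split: split_indicator)
  then show ?thesis using le by (simp add: energy_def)
qed

section \<open>The positive part\<close>

text \<open>Cauchy-Schwarz, squared and stated in \<open>ennreal\<close>. It serves to pass to the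
  limit in products where one factor tends to 0 in L2.\<close>

lemma L2_product_limit:
  fixes k d :: "nat \<Rightarrow> 'a::euclidean_space \<Rightarrow> real"
  assumes d: "(\<lambda>n. n2 (d n)) \<longlonglongrightarrow> 0" "\<And>n. d n \<in> borel_measurable lebesgue" and g: "L2 UNIV g"
    and b: "\<And>n x. \<bar>k n x\<bar> \<le> C * (\<bar>d n x\<bar> * \<bar>g x\<bar>)" and C: "C \<ge> 0"
  shows "(\<lambda>n. \<integral>x. k n x \<partial>lebesgue) \<longlonglongrightarrow> 0"
proof -
  note [measurable] = L2_borel[OF g] d(2)
  have le: "ennreal ((\<integral>x. k n x \<partial>lebesgue)\<^sup>2) \<le> ennreal (C\<^sup>2) * n2 g * n2 (d n)" for n
  \<comment> \<open>Otherwise the integral is 0 by convention and the bound is trivial.\<close>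
  proof (cases "integrable lebesgue (k n)")
    case True
    let ?I = "\<integral>\<^sup>+x. ennreal \<bar>d n x\<bar> * ennreal \<bar>g x\<bar> \<partial>lebesgue"
    have "ennreal \<bar>\<integral>x. k n x \<partial>lebesgue\<bar> \<le> (\<integral>\<^sup>+x. ennreal \<bar>k n x\<bar> \<partial>lebesgue)"
      using integral_norm_bound_ennreal[OF True] by simp
    also have "\<dots> \<le> (\<integral>\<^sup>+x. ennreal C * (ennreal \<bar>d n x\<bar> * ennreal \<bar>g x\<bar>) \<partial>lebesgue)"
      using b[of n] C by (intro nn_integral_mono) (simp flip: ennreal_mult add: ennreal_leI)
    also have "\<dots> = ennreal C * ?I"
      by (intro nn_integral_cmult) measurable
    finally have 1: "ennreal \<bar>\<integral>x. k n x \<partial>lebesgue\<bar> \<le> ennreal C * ?I" .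
    have "?I\<^sup>2 \<le> (\<integral>\<^sup>+x. (ennreal \<bar>d n x\<bar>)\<^sup>2 \<partial>lebesgue) * (\<integral>\<^sup>+x. (ennreal \<bar>g x\<bar>)\<^sup>2 \<partial>lebesgue)"
      by (intro Cauchy_Schwarz_nn_integral) measurable
    then have CS: "?I\<^sup>2 \<le> n2 (d n) * n2 g" by (simp add: n2_def ennreal_power)
    have "ennreal ((\<integral>x. k n x \<partial>lebesgue)\<^sup>2) = (ennreal \<bar>\<integral>x. k n x \<partial>lebesgue\<bar>)\<^sup>2"
      by (simp add: ennreal_power)
    also have "\<dots> \<le> (ennreal C * ?I)\<^sup>2" by (rule power_mono[OF 1]) simp
    also have "\<dots> = ennreal (C\<^sup>2) * ?I\<^sup>2" using C by (simp add: power_mult_distrib ennreal_power)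
    also have "\<dots> \<le> ennreal (C\<^sup>2) * (n2 (d n) * n2 g)"
      by (rule mult_left_mono[OF CS]) simp
    finally show ?thesis by (simp add: mult_ac)
  qed (simp add: not_integrable_integral_eq)
  have fin: "ennreal (C\<^sup>2) * n2 g < top"
    using n2_L2[OF g] by (simp add: ennreal_mult_less_top)
  have "(\<lambda>n. ennreal (C\<^sup>2) * n2 g * n2 (d n)) \<longlonglongrightarrow> ennreal (C\<^sup>2) * n2 g * 0"
    by (rule ennreal_tendsto_cmult[OF fin d(1)])
  then have up: "(\<lambda>n. ennreal (C\<^sup>2) * n2 g * n2 (d n)) \<longlonglongrightarrow> 0" by simp
  have "(\<lambda>n. ennreal ((\<integral>x. k n x \<partial>lebesgue)\<^sup>2)) \<longlonglongrightarrow> 0"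
  proof (rule tendsto_sandwich[OF _ _ tendsto_const up])
    show "eventually (\<lambda>n. 0 \<le> ennreal ((\<integral>x. k n x \<partial>lebesgue)\<^sup>2)) sequentially" by simp
    show "eventually (\<lambda>n. ennreal ((\<integral>x. k n x \<partial>lebesgue)\<^sup>2) \<le> ennreal (C\<^sup>2) * n2 g * n2 (d n)) sequentially"
      by (rule always_eventually, rule allI, rule le)
  qed
  then have "(\<lambda>n. ennreal ((\<integral>x. k n x \<partial>lebesgue)\<^sup>2)) \<longlonglongrightarrow> ennreal 0" by simp
  then have "(\<lambda>n. (\<integral>x. k n x \<partial>lebesgue)\<^sup>2) \<longlonglongrightarrow> 0"
    by (rule tendsto_ennrealD) (auto intro!: always_eventually)
  then have "(\<lambda>n. sqrt ((\<integral>x. k n x \<partial>lebesgue)\<^sup>2)) \<longlonglongrightarrow> sqrt 0" by (rule tendsto_real_sqrt)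
  then show ?thesis by (simp add: tendsto_rabs_zero_iff)
qed

text \<open>A continuously differentiable approximation of the positive part: 0 for negative
  arguments, \<open>s\<^sup>2 / (2 * \<epsilon>)\<close> between 0 and \<open>\<epsilon>\<close>,
  and \<open>s - \<epsilon> / 2\<close> beyond. Written with squares of positive parts, it needs a
  case distinction only in \<open>max_square_has_derivative\<close>.\<close>

definition ramp :: "real \<Rightarrow> real \<Rightarrow> real" where
  "ramp \<epsilon> s = ((max 0 s)\<^sup>2 - (max 0 (s - \<epsilon>))\<^sup>2) / (2 * \<epsilon>)"

definition dramp :: "real \<Rightarrow> real \<Rightarrow> real" where
  "dramp \<epsilon> s = (max 0 s - max 0 (s - \<epsilon>)) / \<epsilon>"

lemma max_square_has_derivative: "((\<lambda>s. (max 0 s)\<^sup>2) has_real_derivative 2 * max 0 s) (at (s::real))"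
proof -
  consider "s < 0" | "s = 0" | "s > 0" by linarith
  then show ?thesis
  proof cases
    case 1
    have "((\<lambda>s. (max 0 s)\<^sup>2) has_real_derivative 0) (at s)"
      by (rule has_field_derivative_transform_within_open[of "\<lambda>_. 0" _ _ "{..<0}"]) (use 1 in auto)
    then show ?thesis using 1 by simp
  next
    case 3
    have "((\<lambda>s. (max 0 s)\<^sup>2) has_real_derivative 2 * s) (at s)"
      by (rule has_field_derivative_transform_within_open[of "\<lambda>s. s\<^sup>2" _ _ "{0<..}"])
         (use 3 in \<open>auto intro!: derivative_eq_intros\<close>)
    then show ?thesis using 3 by simp
  next
    case 2
    have "((\<lambda>h. ((max 0 (0 + h))\<^sup>2 - (max 0 0)\<^sup>2) / h) \<longlongrightarrow> 0) (at (0::real))"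
    proof (rule Lim_null_comparison)
      show "eventually (\<lambda>h. norm (((max 0 (0 + h))\<^sup>2 - (max 0 0)\<^sup>2) / h) \<le> \<bar>h\<bar>) (at (0::real))"
        by (intro always_eventually allI) (auto simp: max_def power2_eq_square)
      show "((\<lambda>h. \<bar>h\<bar>) \<longlongrightarrow> 0) (at (0::real))" by (intro tendsto_eq_intros) auto
    qed
    then show ?thesis using 2 by (simp add: DERIV_def)
  qed
qed

lemma ramp_has_derivative:
  assumes "\<epsilon> > 0" shows "(ramp \<epsilon> has_real_derivative dramp \<epsilon> s) (at s)"
proof -
  have "((\<lambda>s. (max 0 (s - \<epsilon>))\<^sup>2) has_real_derivative (2 * max 0 (s - \<epsilon>)) * 1) (at s)"
    by (rule DERIV_chain2[OF max_square_has_derivative]) (auto intro!: derivative_eq_intros)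
  from DERIV_cdivide[OF DERIV_diff[OF max_square_has_derivative this], of "2 * \<epsilon>"]
  show ?thesis
    unfolding ramp_def[abs_def] by (rule DERIV_cong) (use assms in \<open>simp add: dramp_def field_simps\<close>)
qed

lemma dramp_bounds: "\<epsilon> > 0 \<Longrightarrow> 0 \<le> dramp \<epsilon> s" "\<epsilon> > 0 \<Longrightarrow> dramp \<epsilon> s \<le> 1"
  by (auto simp: dramp_def divide_simps max_def)

lemma dramp_lipschitz: "\<epsilon> > 0 \<Longrightarrow> \<bar>dramp \<epsilon> s - dramp \<epsilon> t\<bar> \<le> \<bar>s - t\<bar> / \<epsilon>"
  by (auto simp: dramp_def diff_divide_distrib[symmetric] divide_right_mono max_def)

lemma ramp_lipschitz: "\<epsilon> > 0 \<Longrightarrow> \<bar>ramp \<epsilon> s - ramp \<epsilon> t\<bar> \<le> \<bar>s - t\<bar>"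
proof -
  assume e: "\<epsilon> > 0"
  have "norm (ramp \<epsilon> s - ramp \<epsilon> t) \<le> 1 * norm (s - t)"
    by (rule field_differentiable_bound[of UNIV _ "dramp \<epsilon>"])
       (use ramp_has_derivative[OF e] dramp_bounds[OF e] in auto)
  then show ?thesis by simp
qed

lemma ramp_0: "\<epsilon> > 0 \<Longrightarrow> ramp \<epsilon> 0 = 0"
  by (simp add: ramp_def max_def)

lemma ramp_abs: "\<epsilon> > 0 \<Longrightarrow> \<bar>ramp \<epsilon> s\<bar> \<le> \<bar>s\<bar>"
  using ramp_lipschitz[of \<epsilon> s 0] by (simp add: ramp_0)

lemma ramp_close: "\<epsilon> > 0 \<Longrightarrow> \<bar>ramp \<epsilon> s - max 0 s\<bar> \<le> \<epsilon>"
proof -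
  assume e: "\<epsilon> > 0"
  consider "s \<le> 0" | "0 < s" "s \<le> \<epsilon>" | "s > \<epsilon>" by linarith
  then show ?thesis
  proof cases
    case 2
    have "\<bar>ramp \<epsilon> s\<bar> \<le> s" "0 \<le> ramp \<epsilon> s" using ramp_abs[OF e, of s] 2 e by (auto simp: ramp_def max_def)
    then show ?thesis using 2 by auto
  next
    case 3
    have "ramp \<epsilon> s = s - \<epsilon> / 2"
      using 3 e by (simp add: ramp_def max_def power2_eq_square field_simps)
    then show ?thesis using 3 e by simp
  qed (use e in \<open>simp add: ramp_def max_def\<close>)
qed

lemma dramp_tendsto: "(\<lambda>m. dramp (1 / real (Suc m)) s) \<longlonglongrightarrow> (if s > 0 then 1 else 0)"
proof (cases "s > 0")
  case True
  obtain N where N: "inverse (real (Suc N)) < s" using reals_Archimedean[OF True] by blast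
  have "dramp (1 / real (Suc m)) s = 1" if "m \<ge> N" for m
  proof -
    have "1 / real (Suc m) \<le> inverse (real (Suc N))" using that by (simp add: divide_simps)
    then have "1 / real (Suc m) < s" using N by linarith
    then show ?thesis using True by (simp add: dramp_def max_def del: of_nat_Suc)
  qed
  then show ?thesis using True by (intro tendsto_eventually) (auto simp: eventually_sequentially)
next
  case False
  have "dramp (1 / real (Suc m)) s = 0" for m
  proof -
    have "s - 1 / real (Suc m) \<le> 0" using False by (smt (verit) divide_nonneg_nonneg of_nat_0_le_iff)
    then show ?thesis using False by (simp add: dramp_def max_def del: of_nat_Suc)
  qed
  then show ?thesis using False by simp
qed

lemma ramp_tendsto: "(\<lambda>m. ramp (1 / real (Suc m)) s) \<longlonglongrightarrow> max 0 s"
proof -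
  have "(\<lambda>m. ramp (1 / real (Suc m)) s - max 0 s) \<longlonglongrightarrow> 0"
  proof (rule Lim_null_comparison)
    show "eventually (\<lambda>m. norm (ramp (1 / real (Suc m)) s - max 0 s) \<le> 1 / real (Suc m)) sequentially"
      using ramp_close[of "1 / real (Suc m)" s for m] by (intro always_eventually) auto
    show "(\<lambda>m. 1 / real (Suc m)) \<longlonglongrightarrow> 0" by (rule LIMSEQ_Suc[OF lim_1_over_n])
  qed
  then show ?thesis using Lim_transform[OF tendsto_const] by (simp add: LIM_zero_iff)
qed

lemma dramp_borel [measurable]: "dramp \<epsilon> \<in> borel_measurable borel"
  unfolding dramp_def[abs_def] by measurable

lemma ramp_borel [measurable]: "ramp \<epsilon> \<in> borel_measurable borel"
  unfolding ramp_def[abs_def] by measurable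

text \<open>Exact for the mollifications \<open>W n\<close> by partial integration. In the limit the
  error splits in two: one part contains the error of the gradients, against the factor
  \<open>dramp\<close>, which is at most 1; the other contains a difference of values of
  \<open>dramp\<close>, which is Lipschitz with constant \<open>1 / \<epsilon>\<close>. Both are
  products that tend to 0 by \<open>L2_product_limit\<close>.\<close>

lemma ramp_chain_rule:
  fixes w :: "'a::euclidean_space \<Rightarrow> real"
  assumes w: "cH1 r w G" and \<epsilon>: "\<epsilon> > 0" and \<phi>: "test_fun UNIV \<phi>" and b: "b \<in> Basis"
  shows "(\<integral>x. ramp \<epsilon> (w x) * pd \<phi> x b \<partial>lebesgue) = - (\<integral>x. dramp \<epsilon> (w x) * (G x \<bullet> b) * \<phi> x \<partial>lebesgue)"
proof -
  define W where "W n = conv (moll n) w" for n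
  have t: "test_fun UNIV (W n)" for n unfolding W_def by (rule cH1_approx(1)[OF w])
  have lim: "(\<lambda>n. n2 (\<lambda>x. W n x - w x)) \<longlonglongrightarrow> 0" "(\<lambda>n. n2 (\<lambda>x. pd (W n) x b - G x \<bullet> b)) \<longlonglongrightarrow> 0"
    unfolding W_def by (rule cH1_approx(3)[OF w], rule cH1_approx(4)[OF w b])
  note sm = test_fun_smooth[OF t] and s\<phi> = test_fun_smooth[OF \<phi>]
  have [measurable]: "W n \<in> borel_measurable lebesgue" "(\<lambda>x. pd (W n) x b) \<in> borel_measurable lebesgue" for n
    by (rule smooth_measurable[OF sm], rule smooth_measurable[OF smooth_pd[OF sm]])
  have [measurable]: "\<phi> \<in> borel_measurable lebesgue" "(\<lambda>x. pd \<phi> x b) \<in> borel_measurable lebesgue"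
    by (rule smooth_measurable[OF s\<phi>], rule smooth_measurable[OF smooth_pd[OF s\<phi>]])
  have [measurable]: "w \<in> borel_measurable lebesgue" by (rule cH1D(7)[OF w])
  have GL: "L2 UNIV (\<lambda>x. G x \<bullet> b)" by (rule L2_inner[OF cH1D(3)[OF w]])
  have [measurable]: "(\<lambda>x. G x \<bullet> b) \<in> borel_measurable lebesgue" by (rule L2_borel[OF GL])
  have \<phi>L: "L2 UNIV \<phi>" "L2 UNIV (\<lambda>x. pd \<phi> x b)"
    by (rule test_fun_L2[OF \<phi>], rule test_fun_L2[OF test_fun_pd[OF \<phi>]])
  obtain C where C: "C > 0" "\<And>x. \<bar>\<phi> x\<bar> \<le> C" using test_fun_bounded[OF \<phi>] by auto
  note db = dramp_bounds[OF \<epsilon>] and rb = ramp_abs[OF \<epsilon>] and rl = ramp_lipschitz[OF \<epsilon>] and dl = dramp_lipschitz[OF \<epsilon>]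
  have rL: "L2 UNIV (\<lambda>x. ramp \<epsilon> (f x))" if "L2 UNIV f" for f :: "'a \<Rightarrow> real"
    by (rule L2_bound[OF that, where C = 1])
       (use L2_borel[OF that] rb in \<open>auto intro!: measurable_compose[OF _ ramp_borel]\<close>)
  have dL: "L2 UNIV (\<lambda>x. dramp \<epsilon> (f x) * h x)" if "f \<in> borel_measurable lebesgue" "L2 UNIV h" for f h :: "'a \<Rightarrow> real"
  proof (rule L2_bound[OF that(2), where C = 1])
    show "(\<lambda>x. dramp \<epsilon> (f x) * h x) \<in> borel_measurable lebesgue"
      using that(1) L2_borel[OF that(2)] by measurable
    show "AE x in lebesgue. norm (dramp \<epsilon> (f x) * h x) \<le> 1 * norm (h x)"
      using db by (intro AE_I2) (simp add: abs_mult mult_left_le_one_le)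
  qed
  have prod_int: "integrable lebesgue (\<lambda>x. f x * h x)" if "L2 UNIV f" "L2 UNIV h" for f h :: "'a \<Rightarrow> real"
    using L2_mult_integrable[OF that] by (simp add: lebesgue_on_UNIV_eq)
  have parts: "(\<integral>x. ramp \<epsilon> (W n x) * pd \<phi> x b \<partial>lebesgue) = - (\<integral>x. dramp \<epsilon> (W n x) * pd (W n) x b * \<phi> x \<partial>lebesgue)" for n
  proof -
    obtain B L where B: "B > 0" "\<And>x. \<bar>W n x\<bar> \<le> B" and L: "L > 0" "\<And>x h. \<bar>pd (W n) x h\<bar> \<le> L * norm h"
      using test_fun_bounds[OF t[of n]] by metis
    show ?thesis
    proof (rule integral_by_parts_test[where L = L and B = B])
      show "((\<lambda>x. ramp \<epsilon> (W n x)) has_derivative (\<lambda>h. dramp \<epsilon> (W n x) * pd (W n) x h)) (at x)" for x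
        using has_derivative_compose[OF smooth_has_derivative[OF sm[of n]]
            ramp_has_derivative[OF \<epsilon>, unfolded has_field_derivative_def]] by simp
      show "\<bar>dramp \<epsilon> (W n x) * pd (W n) x h\<bar> \<le> L * norm h" for x h
        using mult_left_le_one_le[of "\<bar>pd (W n) x h\<bar>" "dramp \<epsilon> (W n x)"] db[of "W n x"] L(2)[of x h]
        by (simp add: abs_mult)
      show "\<bar>ramp \<epsilon> (W n x)\<bar> \<le> B" for x using rb[of "W n x"] B(2)[of x] by linarith
    qed (use \<phi> in \<open>auto\<close>)
  qed
  have "(\<lambda>n. \<integral>x. (ramp \<epsilon> (W n x) - ramp \<epsilon> (w x)) * pd \<phi> x b \<partial>lebesgue) \<longlonglongrightarrow> 0"
    by (rule L2_product_limit[OF lim(1) _ \<phi>L(2), where C = 1])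
       (use rl in \<open>auto simp: abs_mult intro!: mult_right_mono\<close>)
  moreover have "(\<integral>x. (ramp \<epsilon> (W n x) - ramp \<epsilon> (w x)) * pd \<phi> x b \<partial>lebesgue) =
      (\<integral>x. ramp \<epsilon> (W n x) * pd \<phi> x b \<partial>lebesgue) - (\<integral>x. ramp \<epsilon> (w x) * pd \<phi> x b \<partial>lebesgue)" for n
    using prod_int[OF rL[OF test_fun_L2[OF t[of n]]] \<phi>L(2)] prod_int[OF rL[OF cH1D(1)[OF w]] \<phi>L(2)]
    by (simp add: left_diff_distrib)
  ultimately have l1: "(\<lambda>n. \<integral>x. ramp \<epsilon> (W n x) * pd \<phi> x b \<partial>lebesgue) \<longlonglongrightarrow> (\<integral>x. ramp \<epsilon> (w x) * pd \<phi> x b \<partial>lebesgue)"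
    by (simp add: LIM_zero_iff)
  have a: "(\<lambda>n. \<integral>x. dramp \<epsilon> (W n x) * (pd (W n) x b - G x \<bullet> b) * \<phi> x \<partial>lebesgue) \<longlonglongrightarrow> 0"
  proof (rule L2_product_limit[OF lim(2) _ \<phi>L(1), where C = 1])
    fix n x
    show "\<bar>dramp \<epsilon> (W n x) * (pd (W n) x b - G x \<bullet> b) * \<phi> x\<bar> \<le> 1 * (\<bar>pd (W n) x b - G x \<bullet> b\<bar> * \<bar>\<phi> x\<bar>)"
      using mult_left_le_one_le[of "\<bar>pd (W n) x b - G x \<bullet> b\<bar> * \<bar>\<phi> x\<bar>" "dramp \<epsilon> (W n x)"] db[of "W n x"]
      by (simp add: abs_mult mult.assoc)
  qed auto
  have c: "(\<lambda>n. \<integral>x. (dramp \<epsilon> (W n x) - dramp \<epsilon> (w x)) * (G x \<bullet> b) * \<phi> x \<partial>lebesgue) \<longlonglongrightarrow> 0"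
  proof (rule L2_product_limit[OF lim(1) _ GL, where C = "C / \<epsilon>"])
    fix n x
    have "\<bar>(dramp \<epsilon> (W n x) - dramp \<epsilon> (w x)) * (G x \<bullet> b) * \<phi> x\<bar> \<le> (\<bar>W n x - w x\<bar> / \<epsilon>) * \<bar>G x \<bullet> b\<bar> * C"
      unfolding abs_mult using dl[of "W n x" "w x"] C \<epsilon> by (intro mult_mono) auto
    then show "\<bar>(dramp \<epsilon> (W n x) - dramp \<epsilon> (w x)) * (G x \<bullet> b) * \<phi> x\<bar> \<le> C / \<epsilon> * (\<bar>W n x - w x\<bar> * \<bar>G x \<bullet> b\<bar>)"
      by (simp add: field_simps)
  qed (use C \<epsilon> in auto)
  have split: "(\<integral>x. dramp \<epsilon> (W n x) * pd (W n) x b * \<phi> x \<partial>lebesgue) =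
      (\<integral>x. dramp \<epsilon> (W n x) * (pd (W n) x b - G x \<bullet> b) * \<phi> x \<partial>lebesgue) +
      (\<integral>x. (dramp \<epsilon> (W n x) - dramp \<epsilon> (w x)) * (G x \<bullet> b) * \<phi> x \<partial>lebesgue) +
      (\<integral>x. dramp \<epsilon> (w x) * (G x \<bullet> b) * \<phi> x \<partial>lebesgue)" for n
  proof -
    have Wm: "W n \<in> borel_measurable lebesgue" "w \<in> borel_measurable lebesgue" by measurable
    have PL: "L2 UNIV (\<lambda>x. pd (W n) x b)" by (rule test_fun_L2[OF test_fun_pd[OF t]])
    have i: "integrable lebesgue (\<lambda>x. dramp \<epsilon> (W n x) * pd (W n) x b * \<phi> x)"
      "integrable lebesgue (\<lambda>x. dramp \<epsilon> (W n x) * (G x \<bullet> b) * \<phi> x)"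
      "integrable lebesgue (\<lambda>x. dramp \<epsilon> (w x) * (G x \<bullet> b) * \<phi> x)"
      by (rule prod_int[OF dL[OF Wm(1) PL] \<phi>L(1)], rule prod_int[OF dL[OF Wm(1) GL] \<phi>L(1)],
          rule prod_int[OF dL[OF Wm(2) GL] \<phi>L(1)])
    have "(\<integral>x. dramp \<epsilon> (W n x) * (pd (W n) x b - G x \<bullet> b) * \<phi> x \<partial>lebesgue) =
        (\<integral>x. dramp \<epsilon> (W n x) * pd (W n) x b * \<phi> x \<partial>lebesgue) - (\<integral>x. dramp \<epsilon> (W n x) * (G x \<bullet> b) * \<phi> x \<partial>lebesgue)"
      using i by (simp add: left_diff_distrib right_diff_distrib)
    moreover have "(\<integral>x. (dramp \<epsilon> (W n x) - dramp \<epsilon> (w x)) * (G x \<bullet> b) * \<phi> x \<partial>lebesgue) =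
        (\<integral>x. dramp \<epsilon> (W n x) * (G x \<bullet> b) * \<phi> x \<partial>lebesgue) - (\<integral>x. dramp \<epsilon> (w x) * (G x \<bullet> b) * \<phi> x \<partial>lebesgue)"
      using i by (simp add: left_diff_distrib)
    ultimately show ?thesis by simp
  qed
  have "(\<lambda>n. \<integral>x. dramp \<epsilon> (W n x) * pd (W n) x b * \<phi> x \<partial>lebesgue) \<longlonglongrightarrow>
      0 + 0 + (\<integral>x. dramp \<epsilon> (w x) * (G x \<bullet> b) * \<phi> x \<partial>lebesgue)"
    unfolding split by (intro tendsto_add a c tendsto_const)
  then have "(\<lambda>n. \<integral>x. ramp \<epsilon> (W n x) * pd \<phi> x b \<partial>lebesgue) \<longlonglongrightarrow> - (\<integral>x. dramp \<epsilon> (w x) * (G x \<bullet> b) * \<phi> x \<partial>lebesgue)"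
    unfolding parts by (intro tendsto_minus) simp
  then show ?thesis using l1 LIMSEQ_unique by blast
qed

text \<open>Let \<open>\<epsilon>\<close> tend to 0 in the chain rule, by dominated convergence on
  both sides. As \<open>dramp\<close> vanishes at nonpositive arguments, the limiting gradient is 0
  also where \<open>w x = 0\<close>.\<close>

theorem cH1_pos_part:
  fixes w :: "'a::euclidean_space \<Rightarrow> real"
  assumes w: "cH1 r w G"
  shows "cH1 r (\<lambda>x. max 0 (w x)) (\<lambda>x. if w x > 0 then G x else 0)"
proof -
  have wm [measurable]: "w \<in> borel_measurable lebesgue" and Gm [measurable]: "G \<in> borel_measurable lebesgue"
    using cH1D(7,8)[OF w] by auto
  let ?H = "\<lambda>x. if w x > 0 then G x else 0"
  have Hm: "?H \<in> borel_measurable lebesgue" by measurable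
  have HL: "L2 UNIV ?H"
    by (rule L2_bound[OF cH1D(3)[OF w] Hm, where C = 1]) auto
  have wL: "L2 UNIV (\<lambda>x. max 0 (w x))"
    by (rule L2_bound[OF cH1D(1)[OF w], where C = 1]) (auto simp: max_def)
  have prod_int: "integrable lebesgue (\<lambda>x. f x * h x)" if "L2 UNIV f" "L2 UNIV h" for f h :: "'a \<Rightarrow> real"
    using L2_mult_integrable[OF that] by (simp add: lebesgue_on_UNIV_eq)
  show ?thesis
    unfolding cH1_def is_weak_grad_UNIV
  proof (intro conjI allI impI ballI wL HL)
    show "max 0 (w x) = 0" "?H x = 0" if "x \<notin> cball 0 r" for x using cH1D(4)[OF w that] by auto
    fix \<phi> :: "'a \<Rightarrow> real" and b :: 'a assume \<phi>: "test_fun UNIV \<phi>" and b: "b \<in> Basis"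
    have \<phi>m [measurable]: "\<phi> \<in> borel_measurable lebesgue" "(\<lambda>x. pd \<phi> x b) \<in> borel_measurable lebesgue"
      by (rule smooth_measurable[OF test_fun_smooth[OF \<phi>]],
          rule smooth_measurable[OF smooth_pd[OF test_fun_smooth[OF \<phi>]]])
    let ?e = "\<lambda>m. 1 / real (Suc m)"
    have e: "?e m > 0" for m by simp
    have l1: "(\<lambda>m. \<integral>x. ramp (?e m) (w x) * pd \<phi> x b \<partial>lebesgue) \<longlonglongrightarrow> (\<integral>x. max 0 (w x) * pd \<phi> x b \<partial>lebesgue)"
    proof (rule integral_dominated_convergence[where w = "\<lambda>x. \<bar>w x * pd \<phi> x b\<bar>"])
      show "integrable lebesgue (\<lambda>x. \<bar>w x * pd \<phi> x b\<bar>)"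
        by (intro integrable_abs prod_int cH1D(1)[OF w] test_fun_L2[OF test_fun_pd[OF \<phi>]])
      show "AE x in lebesgue. (\<lambda>m. ramp (?e m) (w x) * pd \<phi> x b) \<longlonglongrightarrow> max 0 (w x) * pd \<phi> x b"
        by (intro AE_I2 tendsto_mult ramp_tendsto tendsto_const)
      show "AE x in lebesgue. norm (ramp (?e m) (w x) * pd \<phi> x b) \<le> \<bar>w x * pd \<phi> x b\<bar>" for m
        using ramp_abs[OF e] by (intro AE_I2) (auto simp: abs_mult intro!: mult_right_mono)
    qed measurable
    have l2: "(\<lambda>m. \<integral>x. dramp (?e m) (w x) * (G x \<bullet> b) * \<phi> x \<partial>lebesgue) \<longlonglongrightarrow> (\<integral>x. (?H x \<bullet> b) * \<phi> x \<partial>lebesgue)"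
    proof (rule integral_dominated_convergence[where w = "\<lambda>x. \<bar>(G x \<bullet> b) * \<phi> x\<bar>"])
      show "integrable lebesgue (\<lambda>x. \<bar>(G x \<bullet> b) * \<phi> x\<bar>)"
        by (intro integrable_abs prod_int L2_inner cH1D(3)[OF w] test_fun_L2[OF \<phi>])
      show "AE x in lebesgue. (\<lambda>m. dramp (?e m) (w x) * (G x \<bullet> b) * \<phi> x) \<longlonglongrightarrow> (?H x \<bullet> b) * \<phi> x"
      proof (rule AE_I2)
        fix x
        have "(\<lambda>m. dramp (?e m) (w x) * (G x \<bullet> b) * \<phi> x) \<longlonglongrightarrow> (if w x > 0 then 1 else 0) * (G x \<bullet> b) * \<phi> x"
          by (intro tendsto_mult dramp_tendsto tendsto_const)
        then show "(\<lambda>m. dramp (?e m) (w x) * (G x \<bullet> b) * \<phi> x) \<longlonglongrightarrow> (?H x \<bullet> b) * \<phi> x" by (cases "w x > 0") auto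
      qed
      show "AE x in lebesgue. norm (dramp (?e m) (w x) * (G x \<bullet> b) * \<phi> x) \<le> \<bar>(G x \<bullet> b) * \<phi> x\<bar>" for m
        using dramp_bounds[OF e] by (intro AE_I2) (simp add: abs_mult mult.assoc mult_left_le_one_le)
    qed (use Hm in measurable)
    have "(\<lambda>m. \<integral>x. ramp (?e m) (w x) * pd \<phi> x b \<partial>lebesgue) = (\<lambda>m. - (\<integral>x. dramp (?e m) (w x) * (G x \<bullet> b) * \<phi> x \<partial>lebesgue))"
      by (intro ext ramp_chain_rule[OF w e \<phi> b])
    then show "(\<integral>x. max 0 (w x) * pd \<phi> x b \<partial>lebesgue) = - (\<integral>x. (?H x \<bullet> b) * \<phi> x \<partial>lebesgue)"
      using LIMSEQ_unique[OF l1] tendsto_minus[OF l2] by simp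
  qed
qed

text \<open>Write \<open>w\<close> as the difference of the positive parts of \<open>w\<close> and
  \<open>-w\<close>. The gradient obtained in this way vanishes wherever \<open>w\<close> does, and
  the weak gradient is unique.\<close>

lemma cH1_grad_zero:
  fixes w :: "'a::euclidean_space \<Rightarrow> real"
  assumes w: "cH1 r w G"
  shows "AE x in lebesgue. w x = 0 \<longrightarrow> G x = 0"
proof -
  note p = cH1_pos_part[OF w] and m = cH1_pos_part[OF cH1_cmult[OF w, of "-1"]]
  have eq: "(\<lambda>x. max 0 (w x) - max 0 (-1 * w x)) = w" by (auto simp: max_def fun_eq_iff)
  have c: "cH1 r w (\<lambda>x. (if w x > 0 then G x else 0) - (if -1 * w x > 0 then -1 *\<^sub>R G x else 0))"
    using cH1_diff[OF p m] unfolding eq .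
  have "AE x in lebesgue. x \<in> ball 0 (\<bar>r\<bar> + 1) \<longrightarrow>
      G x = (if w x > 0 then G x else 0) - (if -1 * w x > 0 then -1 *\<^sub>R G x else 0)"
    by (rule weak_grad_unique[OF is_weak_grad_restrict[OF cH1D(2)[OF w]] is_weak_grad_restrict[OF cH1D(2)[OF c]]]) auto
  then show ?thesis
  proof (rule eventually_mono, intro impI)
    fix x assume a: "x \<in> ball 0 (\<bar>r\<bar> + 1) \<longrightarrow>
      G x = (if w x > 0 then G x else 0) - (if -1 * w x > 0 then -1 *\<^sub>R G x else 0)" and "w x = 0"
    then show "G x = 0" using cH1D(5)[OF w, of x] by (cases "x \<in> cball 0 r") auto
  qed
qed

section \<open>Shears\<close>

text \<open>A continuous preimage of a Lebesgue set need not be a Lebesgue set. For the bi-Lipschitz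
  shears below, a preimage is the image under a Lipschitz inverse, and this lemma applies.\<close>

lemma lipschitz_image_lebesgue:
  fixes f :: "'a::euclidean_space \<Rightarrow> 'a"
  assumes A: "A \<in> sets lebesgue" and L: "\<And>x y. norm (f x - f y) \<le> L * norm (x - y)"
  shows "f ` A \<in> sets lebesgue"
proof (rule sets_lebesgue_continuous_image[OF A _ _ subset_UNIV])
  have "(\<bar>L\<bar>)-lipschitz_on UNIV f"
  proof (rule lipschitz_onI)
    show "dist (f x) (f y) \<le> \<bar>L\<bar> * dist x y" for x y
      using L[of x y] mult_right_mono[OF abs_ge_self norm_ge_zero, of L "x - y"] by (simp add: dist_norm)
  qed simp
  then show "continuous_on UNIV f" by (rule lipschitz_on_continuous_on)
  show "negligible (f ` T)" if "negligible T" "T \<subseteq> UNIV" for T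
  proof (rule negligible_locally_Lipschitz_image[OF _ that(1)])
    show "\<exists>U B. open U \<and> x \<in> U \<and> (\<forall>y\<in>T \<inter> U. norm (f y - f x) \<le> B * norm (y - x))" for x
      using L by (intro exI[of _ UNIV] exI[of _ L]) auto
  qed simp
qed

text \<open>Test functions composed with a shear remain smooth; the formula for the derivative is
  the pointwise source of the Piola identity used for \<open>weak_grad_\<Psi>\<close>.\<close>

lemma smooth_compose_shear:
  assumes f: "smooth f" and \<psi>: "smooth \<psi>"
  shows "((\<lambda>x. f (x + (t * \<psi> x) *\<^sub>R e)) has_derivative
      (\<lambda>h. pd f (x + (t * \<psi> x) *\<^sub>R e) h + t * pd \<psi> x h * pd f (x + (t * \<psi> x) *\<^sub>R e) e)) (at x)"
    and "smooth (\<lambda>x. f (x + (t * \<psi> x) *\<^sub>R e))"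
proof -
  have d: "((\<lambda>x. f (x + (t * \<psi> x) *\<^sub>R e)) has_derivative
      (\<lambda>h. pd f (x + (t * \<psi> x) *\<^sub>R e) h + t * pd \<psi> x h * pd f (x + (t * \<psi> x) *\<^sub>R e) e)) (at x)"
    if f: "smooth f" for f x
  proof -
    have "((\<lambda>x. x + (t * \<psi> x) *\<^sub>R e) has_derivative (\<lambda>h. h + (t * pd \<psi> x h) *\<^sub>R e)) (at x)"
      using smooth_has_derivative[OF \<psi>, of x] by (auto intro!: derivative_eq_intros)
    from has_derivative_compose[OF this smooth_has_derivative[OF f]]
    show ?thesis
      by (simp add: linear_add[OF smooth_linear_pd[OF f]] linear_cmul[OF smooth_linear_pd[OF f]])
  qed
  have "Ck k (\<lambda>x. f (x + (t * \<psi> x) *\<^sub>R e))" if "smooth f" for f k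
    using that
  proof (induction k arbitrary: f)
    case 0
    have "continuous_on UNIV (\<lambda>x. f (x + (t * \<psi> x) *\<^sub>R e))"
      using has_derivative_continuous[OF d[OF 0]] by (simp add: continuous_at_imp_continuous_on)
    then show ?case by simp
  next
    case (Suc k)
    have "Ck k (\<lambda>x. pd f (x + (t * \<psi> x) *\<^sub>R e) c)" for c
      by (rule Suc.IH[of "\<lambda>z. pd f z c", OF smooth_pd[OF Suc.prems]])
    moreover have "Ck k (\<lambda>x. t * pd \<psi> x c)" for c
      using smooth_mult[OF smooth_const smooth_pd[OF \<psi>]] by (simp add: smooth_def)
    ultimately show ?case
      by (intro Ck_SucI[OF d[OF Suc.prems]] Ck_add Ck_mult[of k "\<lambda>x. t * pd \<psi> x b" for b])
  qed
  then show "smooth (\<lambda>x. f (x + (t * \<psi> x) *\<^sub>R e))" using f by (simp add: smooth_def)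
  show "((\<lambda>x. f (x + (t * \<psi> x) *\<^sub>R e)) has_derivative
      (\<lambda>h. pd f (x + (t * \<psi> x) *\<^sub>R e) h + t * pd \<psi> x h * pd f (x + (t * \<psi> x) *\<^sub>R e) e)) (at x)"
    by (rule d[OF f])
qed

lemma weak_gradD_dir:
  assumes u: "L2 \<Omega> u" "is_weak_grad \<Omega> u g" and \<phi>: "test_fun \<Omega> \<phi>" and \<Omega>: "\<Omega> \<in> sets lebesgue"
  shows "integral\<^sup>L (lebesgue_on \<Omega>) (\<lambda>x. u x * pd \<phi> x e) = - integral\<^sup>L (lebesgue_on \<Omega>) (\<lambda>x. (g x \<bullet> e) * \<phi> x)"
proof -
  note t = test_fun_L2_on[OF \<phi> \<Omega>] and t' = test_fun_L2_on[OF test_fun_pd[OF \<phi>] \<Omega>]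
  have gL: "L2 \<Omega> g" using u by (simp add: is_weak_grad_def)
  have 1: "(\<lambda>x. u x * pd \<phi> x e) = (\<lambda>x. \<Sum>b\<in>Basis. (e \<bullet> b) * (u x * pd \<phi> x b))"
    by (rule ext, subst pd_expand[OF test_fun_smooth[OF \<phi>]]) (simp add: sum_distrib_left mult_ac)
  have 2: "(\<lambda>x. (g x \<bullet> e) * \<phi> x) = (\<lambda>x. \<Sum>b\<in>Basis. (e \<bullet> b) * ((g x \<bullet> b) * \<phi> x))"
    by (rule ext, subst euclidean_inner) (simp add: sum_distrib_left sum_distrib_right mult_ac)
  have "integral\<^sup>L (lebesgue_on \<Omega>) (\<lambda>x. u x * pd \<phi> x e) =
      (\<Sum>b\<in>Basis. (e \<bullet> b) * integral\<^sup>L (lebesgue_on \<Omega>) (\<lambda>x. u x * pd \<phi> x b))"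
    unfolding 1 using L2_mult_integrable[OF u(1) t'] by simp
  also have "\<dots> = (\<Sum>b\<in>Basis. (e \<bullet> b) * - integral\<^sup>L (lebesgue_on \<Omega>) (\<lambda>x. (g x \<bullet> b) * \<phi> x))"
    using weak_gradD_on[OF u(2) \<phi>] by simp
  also have "\<dots> = - integral\<^sup>L (lebesgue_on \<Omega>) (\<lambda>x. (g x \<bullet> e) * \<phi> x)"
    unfolding 2 using L2_mult_integrable[OF L2_inner[OF gL] t] by (simp add: sum_negf)
  finally show ?thesis .
qed

text \<open>\<open>M\<close> bounds both the Lipschitz constant of the displacement field and the
  product of gradient and direction, and 1/16 is the margin under which the expansion of the kernel
  is carried out. \<open>t\<close> is a parameter of the locale so that the shears for
  \<open>t\<close> and \<open>-t\<close> can be interpreted side by side.\<close>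

locale shear =
  fixes \<psi> :: "real^2 \<Rightarrow> real" and e :: "real^2" and M s R t :: real
  assumes test: "test_fun (ball 0 R) \<psi>"
    and supp: "\<And>x. x \<notin> cball 0 s \<Longrightarrow> \<psi> x = 0" and sR: "s < R"
    and sym: "\<And>x a b. pd (\<lambda>z. pd \<psi> z a) x b = pd (\<lambda>z. pd \<psi> z b) x a"
    and lip: "\<And>x y. norm ((\<psi> x - \<psi> y) *\<^sub>R e) \<le> M * norm (x - y)"
    and grad_bound: "\<And>x. norm (grad \<psi> x) * norm e \<le> M"
    and small: "\<bar>t\<bar> * M \<le> 1 / 16"
begin

definition \<Phi> :: "real^2 \<Rightarrow> real^2" where "\<Phi> x = x + (t * \<psi> x) *\<^sub>R e"

text \<open>The Jacobian determinant of \<open>\<Phi>\<close>. The displacement has a fixed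
  direction, so the derivative is a rank-one perturbation of the identity and its determinant is
  affine in \<open>t\<close>: the Jacobians for \<open>t\<close> and \<open>-t\<close> add up to
  exactly 2.\<close>

definition J :: "real^2 \<Rightarrow> real" where "J x = 1 + t * pd \<psi> x e"

abbreviation \<Psi> :: "real^2 \<Rightarrow> real^2" where "\<Psi> \<equiv> inv \<Phi>"

lemma sm: "smooth \<psi>"
  by (rule test_fun_smooth[OF test])

lemma pd_bound: "\<bar>pd \<psi> x e\<bar> \<le> M"
  using order_trans[OF Cauchy_Schwarz_ineq2 grad_bound, of x] by (simp add: grad_inner[OF sm])

lemma t_pd_bound: "\<bar>t * pd \<psi> x e\<bar> \<le> 1 / 16"
  using order_trans[OF mult_left_mono[OF pd_bound abs_ge_zero] small] by (simp add: abs_mult)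

lemma J_bounds: "1 / 2 \<le> J x" "J x \<le> 2" "J x > 0"
  using t_pd_bound[of x] by (auto simp: J_def abs_le_iff)

lemma shift_lip: "norm ((t * \<psi> x) *\<^sub>R e - (t * \<psi> y) *\<^sub>R e) \<le> norm (x - y) / 16"
proof -
  have "(t * \<psi> x) *\<^sub>R e - (t * \<psi> y) *\<^sub>R e = t *\<^sub>R ((\<psi> x - \<psi> y) *\<^sub>R e)"
    by (simp add: algebra_simps)
  then have "norm ((t * \<psi> x) *\<^sub>R e - (t * \<psi> y) *\<^sub>R e) \<le> \<bar>t\<bar> * (M * norm (x - y))"
    using mult_left_mono[OF lip abs_ge_zero, of t x y] by (simp add: abs_mult)
  also have "\<dots> \<le> norm (x - y) / 16"
    using mult_right_mono[OF small norm_ge_zero, of "x - y"] by (simp add: mult.assoc)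
  finally show ?thesis .
qed

lemma \<Phi>_lower: "norm (x - y) \<le> 2 * norm (\<Phi> x - \<Phi> y)"
proof -
  have "x - y = (\<Phi> x - \<Phi> y) - ((t * \<psi> x) *\<^sub>R e - (t * \<psi> y) *\<^sub>R e)" by (simp add: \<Phi>_def)
  then have "norm (x - y) \<le> norm (\<Phi> x - \<Phi> y) + norm (x - y) / 16"
    using norm_triangle_ineq4[of "\<Phi> x - \<Phi> y" "(t * \<psi> x) *\<^sub>R e - (t * \<psi> y) *\<^sub>R e"] shift_lip[of x y] by simp
  then show ?thesis using norm_ge_zero[of "\<Phi> x - \<Phi> y"] by linarith
qed

lemma \<Phi>_upper: "norm (\<Phi> x - \<Phi> y) \<le> 2 * norm (x - y)"
proof -
  have "\<Phi> x - \<Phi> y = (x - y) + ((t * \<psi> x) *\<^sub>R e - (t * \<psi> y) *\<^sub>R e)" by (simp add: \<Phi>_def)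
  then have "norm (\<Phi> x - \<Phi> y) \<le> norm (x - y) + norm (x - y) / 16"
    using norm_triangle_ineq[of "x - y" "(t * \<psi> x) *\<^sub>R e - (t * \<psi> y) *\<^sub>R e"] shift_lip[of x y] by simp
  then show ?thesis using norm_ge_zero[of "x - y"] by linarith
qed

text \<open>Surjectivity is Banach's fixed point theorem: a preimage of \<open>y\<close> is a fixed
  point of a contraction with factor 1/16.\<close>

lemma bij_\<Phi>: "bij \<Phi>"
proof (rule bijI)
  show "inj \<Phi>"
    using \<Phi>_lower by (intro injI) (metis norm_le_zero_iff eq_iff_diff_eq_0 norm_zero mult_zero_right)
  show "surj \<Phi>"
  proof (rule surjI)
    fix y
    have "\<exists>!x. y - (t * \<psi> x) *\<^sub>R e = x"
    proof (rule banach_fix_type[of "1 / 16"])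
      show "\<forall>x z. dist (y - (t * \<psi> x) *\<^sub>R e) (y - (t * \<psi> z) *\<^sub>R e) \<le> 1 / 16 * dist x z"
        using shift_lip by (auto simp: dist_norm norm_minus_commute algebra_simps)
    qed auto
    then have "\<exists>x. \<Phi> x = y" by (auto simp: \<Phi>_def algebra_simps)
    then show "\<Phi> (SOME x. \<Phi> x = y) = y" by (rule someI_ex)
  qed
qed

lemma \<Psi>_\<Phi> [simp]: "\<Psi> (\<Phi> x) = x" and \<Phi>_\<Psi> [simp]: "\<Phi> (\<Psi> y) = y"
  using bij_\<Phi> by (simp_all add: bij_is_inj bij_is_surj surj_f_inv_f)

lemma \<Psi>_lip: "norm (\<Psi> x - \<Psi> y) \<le> 2 * norm (x - y)"
  using \<Phi>_lower[of "\<Psi> x" "\<Psi> y"] by simp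

lemma \<Phi>_measurable [measurable]: "\<Phi> \<in> lebesgue \<rightarrow>\<^sub>M lebesgue"
proof (rule measurableI)
  fix A :: "(real^2) set" assume "A \<in> sets lebesgue"
  then have "\<Psi> ` A \<in> sets lebesgue" by (rule lipschitz_image_lebesgue[OF _ \<Psi>_lip])
  moreover have "\<Psi> ` A = \<Phi> -` A" using bij_\<Phi> by (simp add: bij_vimage_eq_inv_image)
  ultimately show "\<Phi> -` A \<inter> space lebesgue \<in> sets lebesgue" by simp
qed simp

lemma \<Psi>_vimage: "\<Psi> -` A = \<Phi> ` A"
  using bij_\<Phi> by (metis bij_imp_bij_inv bij_vimage_eq_inv_image inv_inv_eq)

lemma image_measurable: "A \<in> sets lebesgue \<Longrightarrow> \<Phi> ` A \<in> sets lebesgue"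
  by (rule lipschitz_image_lebesgue[OF _ \<Phi>_upper])

lemma \<Psi>_measurable [measurable]: "\<Psi> \<in> lebesgue \<rightarrow>\<^sub>M lebesgue"
  by (rule measurableI) (auto simp: \<Psi>_vimage image_measurable)

lemma mem_image_\<Phi>: "\<Phi> x \<in> \<Phi> ` A \<longleftrightarrow> x \<in> A"
  using bij_\<Phi> by (simp add: bij_is_inj inj_image_mem_iff)

lemma mem_image_\<Psi>: "y \<in> \<Phi> ` A \<longleftrightarrow> \<Psi> y \<in> A"
  by (metis \<Phi>_\<Psi> mem_image_\<Phi>)

lemma \<Phi>_outside: "x \<notin> cball 0 s \<Longrightarrow> \<Phi> x = x"
  by (simp add: \<Phi>_def supp)

lemma \<Psi>_outside: "x \<notin> cball 0 s \<Longrightarrow> \<Psi> x = x"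
  using \<Phi>_outside[of x] \<Psi>_\<Phi>[of x] by simp

lemma \<Phi>_ball_iff: "\<Phi> x \<in> ball 0 R \<longleftrightarrow> x \<in> ball 0 R"
proof
  assume a: "\<Phi> x \<in> ball 0 R"
  show "x \<in> ball 0 R"
  proof (rule ccontr)
    assume n: "x \<notin> ball 0 R"
    then have "\<Phi> x = x" using sR by (intro \<Phi>_outside) auto
    then show False using a n by simp
  qed
next
  assume a: "x \<in> ball 0 R"
  show "\<Phi> x \<in> ball 0 R"
  proof (rule ccontr)
    assume n: "\<Phi> x \<notin> ball 0 R"
    then have "\<Psi> (\<Phi> x) = \<Phi> x" using sR by (intro \<Psi>_outside) auto
    then show False using a n by simp
  qed
qed

lemma \<Psi>_ball_iff: "\<Psi> x \<in> ball 0 R \<longleftrightarrow> x \<in> ball 0 R"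
  using \<Phi>_ball_iff[of "\<Psi> x"] by simp

lemma image_outside: "\<Phi> ` A - ball 0 R = A - ball 0 R"
proof -
  have "\<Psi> x = x" if "x \<notin> ball 0 R" for x using that sR by (intro \<Psi>_outside) auto
  then show ?thesis by (auto simp: mem_image_\<Psi> set_eq_iff)
qed

lemma \<Phi>_has_derivative: "(\<Phi> has_derivative (\<lambda>h. h + (t * pd \<psi> x h) *\<^sub>R e)) (at x)"
  unfolding \<Phi>_def[abs_def]
  using smooth_has_derivative[OF sm, of x] by (auto intro!: derivative_eq_intros)

lemma det_\<Phi>: "det (matrix (\<lambda>h. h + (t * pd \<psi> x h) *\<^sub>R e)) = J x"
proof -
  have "e = (e $ 1) *\<^sub>R axis 1 1 + (e $ 2) *\<^sub>R axis 2 1"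
    by (simp add: vec_eq_iff forall_2 axis_def)
  then have "pd \<psi> x e = pd \<psi> x ((e $ 1) *\<^sub>R axis 1 1 + (e $ 2) *\<^sub>R axis 2 1)" by (rule arg_cong)
  also have "\<dots> = e $ 1 * pd \<psi> x (axis 1 1) + e $ 2 * pd \<psi> x (axis 2 1)"
    by (simp add: linear_add[OF smooth_linear_pd[OF sm]] linear_cmul[OF smooth_linear_pd[OF sm]])
  finally have "J x = 1 + t * (e $ 1 * pd \<psi> x (axis 1 1) + e $ 2 * pd \<psi> x (axis 2 1))"
    by (simp add: J_def)
  then show ?thesis
    by (simp add: det_2 matrix_def axis_def algebra_simps)
qed

lemma J_smooth: "smooth J"
  unfolding J_def[abs_def] by (intro smooth_add smooth_mult smooth_const smooth_pd sm)

lemma J_measurable [measurable]: "J \<in> borel_measurable lebesgue"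
  by (rule smooth_measurable[OF J_smooth])

text \<open>The change of variables theorem is applied to sets of finite measure; exhaustion by
  balls extends the formula to all Lebesgue sets.\<close>

lemma emeasure_\<Phi>:
  assumes A: "A \<in> sets lebesgue"
  shows "emeasure lebesgue A = (\<integral>\<^sup>+x. ennreal (J x) * indicator A (\<Phi> x) \<partial>lebesgue)"
proof -
  have bdd: "emeasure lebesgue A = (\<integral>\<^sup>+x. ennreal (J x) * indicator A (\<Phi> x) \<partial>lebesgue)"
    if A: "A \<in> lmeasurable" for A
  proof -
    let ?B = "\<Phi> -` A"
    have im: "\<Phi> ` ?B = A" using bij_\<Phi> by (simp add: bij_is_surj surj_image_vimage_eq)
    have B: "?B \<in> sets lebesgue" using measurable_sets[OF \<Phi>_measurable, of A] A by (simp add: fmeasurableD)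
    have "\<Phi> ` ?B \<in> lmeasurable \<and> measure lebesgue (\<Phi> ` ?B) = measure lebesgue A \<longleftrightarrow>
        ((\<lambda>x. \<bar>det (matrix (\<lambda>h. h + (t * pd \<psi> x h) *\<^sub>R e))\<bar>) has_integral measure lebesgue A) ?B"
      proof (rule has_measure_differentiable_image[OF B])
      show "(\<Phi> has_derivative (\<lambda>h. h + (t * pd \<psi> x h) *\<^sub>R e)) (at x within ?B)" for x
        by (rule has_derivative_at_withinI[OF \<Phi>_has_derivative])
      show "inj_on \<Phi> ?B" using bij_\<Phi> bij_is_inj inj_on_subset by blast
    qed
    then have hi: "((\<lambda>x. \<bar>det (matrix (\<lambda>h. h + (t * pd \<psi> x h) *\<^sub>R e))\<bar>) has_integral measure lebesgue A) ?B"
      using A unfolding im by blast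
    have "(J has_integral measure lebesgue A) ?B"
      using hi J_bounds(3) unfolding det_\<Phi> by (simp add: abs_of_pos)
    then have "(\<integral>\<^sup>+x. ennreal (indicator ?B x * J x) \<partial>lborel) = ennreal (measure lebesgue A)"
      by (intro nn_integral_has_integral_lebesgue) (use J_bounds(3) in \<open>auto simp: less_imp_le\<close>)
    moreover have "(\<lambda>x. ennreal (indicator ?B x * J x)) = (\<lambda>x. ennreal (J x) * indicator A (\<Phi> x))"
      by (auto simp: fun_eq_iff split: split_indicator)
    ultimately show ?thesis
      using A by (simp add: nn_integral_completion emeasure_eq_measure2)
  qed
  let ?M = "distr (density lebesgue (\<lambda>x. ennreal (J x))) lebesgue \<Phi>"
  have Mm: "emeasure ?M A = (\<integral>\<^sup>+x. ennreal (J x) * indicator A (\<Phi> x) \<partial>lebesgue)" if "A \<in> sets lebesgue" for A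
    using that measurable_sets[OF \<Phi>_measurable that]
    by (simp add: emeasure_distr emeasure_density indicator_vimage[symmetric])
  let ?A = "\<lambda>n::nat. A \<inter> cball 0 (real n)"
  have inc: "incseq ?A" by (auto simp: incseq_def)
  have un: "(\<Union>n. ?A n) = A"
    using real_arch_simple by auto
  have r: "range ?A \<subseteq> sets lebesgue" using A by auto
  have "?A n \<in> lmeasurable" for n
    using fmeasurable_Int_fmeasurable[OF lmeasurable_cball A] by (simp add: Int_commute)
  then have "emeasure lebesgue (?A n) = emeasure ?M (?A n)" for n
    using bdd[of "?A n"] Mm[of "?A n"] by (simp add: fmeasurableD)
  moreover have "(\<lambda>n. emeasure lebesgue (?A n)) \<longlonglongrightarrow> emeasure lebesgue A"
    using Lim_emeasure_incseq[OF r inc] unfolding un .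
  moreover have "(\<lambda>n. emeasure ?M (?A n)) \<longlonglongrightarrow> emeasure ?M A"
    using Lim_emeasure_incseq[of ?A ?M, OF _ inc] r unfolding un by simp
  ultimately have "emeasure lebesgue A = emeasure ?M A"
    using LIMSEQ_unique by simp
  then show ?thesis using Mm[OF A] by simp
qed

lemma lebesgue_eq_distr: "lebesgue = distr (density lebesgue (\<lambda>x. ennreal (J x))) lebesgue \<Phi>"
proof (rule measure_eqI)
  fix A :: "(real^2) set" assume A: "A \<in> sets lebesgue"
  then show "emeasure lebesgue A = emeasure (distr (density lebesgue (\<lambda>x. ennreal (J x))) lebesgue \<Phi>) A"
    using emeasure_\<Phi>[OF A] measurable_sets[OF \<Phi>_measurable A]
    by (simp add: emeasure_distr emeasure_density indicator_vimage[symmetric])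
qed simp

lemma nn_integral_\<Phi>:
  assumes [measurable]: "f \<in> borel_measurable lebesgue"
  shows "(\<integral>\<^sup>+y. f y \<partial>lebesgue) = (\<integral>\<^sup>+x. ennreal (J x) * f (\<Phi> x) \<partial>lebesgue)"
  by (subst lebesgue_eq_distr) (simp add: nn_integral_distr nn_integral_density)

lemma integral_\<Phi>:
  fixes f :: "real^2 \<Rightarrow> real"
  assumes [measurable]: "f \<in> borel_measurable lebesgue"
  shows "(\<integral>y. f y \<partial>lebesgue) = (\<integral>x. J x * f (\<Phi> x) \<partial>lebesgue)"
  by (subst lebesgue_eq_distr) (simp add: integral_distr integral_density J_bounds less_imp_le)

lemma AE_\<Psi>:
  assumes "AE x in lebesgue. P x"
  shows "AE y in lebesgue. P (\<Psi> y)"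
proof -
  obtain N where N: "N \<in> null_sets lebesgue" "{x. \<not> P x} \<subseteq> N"
    using assms by (auto simp: eventually_ae_filter)
  have "negligible (\<Phi> ` N)"
    by (rule negligible_locally_Lipschitz_image)
       (use N \<Phi>_upper in \<open>auto simp: negligible_iff_null_sets intro!: exI[of _ UNIV] exI[of _ 2]\<close>)
  then have "AE y in lebesgue. y \<notin> \<Phi> ` N" by (simp add: negligible_iff_null_sets AE_not_in)
  then show ?thesis
    by (rule eventually_mono) (use N(2) in \<open>auto simp: mem_image_\<Psi>\<close>)
qed

text \<open>The value at \<open>\<Phi> x\<close> of the gradient of \<open>u\<close> composed with
  \<open>\<Psi>\<close>: the inverse transpose of the derivative of \<open>\<Phi>\<close> applied to
  \<open>g x\<close>. The inverse of this rank-one perturbation is the Sherman-Morrison formula,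
  with \<open>J x\<close> as its denominator.\<close>

definition push_grad :: "(real^2 \<Rightarrow> real^2) \<Rightarrow> real^2 \<Rightarrow> real^2" where
  "push_grad g x = g x - (t * (g x \<bullet> e) / J x) *\<^sub>R grad \<psi> x"

lemma push_grad_bound: "norm (push_grad g x) \<le> 2 * norm (g x)"
proof -
  have "norm (push_grad g x) \<le> norm (g x) + \<bar>t * (g x \<bullet> e) / J x\<bar> * norm (grad \<psi> x)"
    unfolding push_grad_def by (rule order_trans[OF norm_triangle_ineq4]) simp
  also have "\<bar>t * (g x \<bullet> e) / J x\<bar> * norm (grad \<psi> x) \<le> \<bar>t\<bar> * (norm (g x) * norm e) * 2 * norm (grad \<psi> x)"
  proof (rule mult_right_mono[OF _ norm_ge_zero])
    have "1 / J x \<le> 2" using J_bounds[of x] by (simp add: divide_simps)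
    then show "\<bar>t * (g x \<bullet> e) / J x\<bar> \<le> \<bar>t\<bar> * (norm (g x) * norm e) * 2"
      using mult_mono[OF mult_left_mono[OF Cauchy_Schwarz_ineq2[of "g x" e] abs_ge_zero[of t]], of "1 / J x" 2] J_bounds(3)[of x]
      by (simp add: abs_mult)
  qed
  also have "\<bar>t\<bar> * (norm (g x) * norm e) * 2 * norm (grad \<psi> x) = (2 * \<bar>t\<bar> * norm (g x)) * (norm (grad \<psi> x) * norm e)"
    by simp
  also have "\<dots> \<le> (2 * \<bar>t\<bar> * norm (g x)) * M" by (rule mult_left_mono[OF grad_bound]) simp
  also have "\<dots> \<le> norm (g x)"
    using mult_left_mono[OF small, of "2 * norm (g x)"] norm_ge_zero[of "g x"] by (simp only: mult_ac) linarith
  finally show ?thesis by simp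
qed

lemma grad_\<psi>_measurable [measurable]: "grad \<psi> \<in> borel_measurable lebesgue"
  by (rule grad_measurable[OF sm])

lemma L2_\<Psi>:
  fixes f :: "real^2 \<Rightarrow> 'b::euclidean_space"
  assumes f: "L2 UNIV f"
  shows "L2 UNIV (\<lambda>y. f (\<Psi> y))"
proof -
  have [measurable]: "f \<in> borel_measurable lebesgue" by (rule L2_borel[OF f])
  have m: "(\<lambda>y. f (\<Psi> y)) \<in> borel_measurable lebesgue" by measurable
  have "(\<integral>\<^sup>+y. ennreal ((norm (f (\<Psi> y)))\<^sup>2) \<partial>lebesgue) = (\<integral>\<^sup>+x. ennreal (J x) * ennreal ((norm (f x))\<^sup>2) \<partial>lebesgue)"
    using m by (subst nn_integral_\<Phi>) auto
  also have "\<dots> \<le> (\<integral>\<^sup>+x. 2 * ennreal ((norm (f x))\<^sup>2) \<partial>lebesgue)"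
    using J_bounds(2) by (intro nn_integral_mono mult_right_mono) (auto simp: ennreal_leI simp flip: ennreal_numeral)
  also have "\<dots> = 2 * (\<integral>\<^sup>+x. ennreal ((norm (f x))\<^sup>2) \<partial>lebesgue)" by (rule nn_integral_cmult) measurable
  also have "\<dots> < \<infinity>" using f by (simp add: L2_UNIV_iff ennreal_mult_less_top)
  finally show ?thesis using m by (simp add: L2_UNIV_iff)
qed

lemma L2_\<Psi>_ball:
  fixes f :: "real^2 \<Rightarrow> 'b::euclidean_space"
  assumes f: "L2 (ball 0 R) f"
  shows "L2 (ball 0 R) (\<lambda>y. f (\<Psi> y))"
proof -
  have "L2 UNIV (\<lambda>x. indicator (ball 0 R) x *\<^sub>R f x)" using L2_iff_indicator[of "ball 0 R" f] f by simp
  from L2_\<Psi>[OF this] have "L2 UNIV (\<lambda>y. indicator (ball 0 R) y *\<^sub>R f (\<Psi> y))"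
    using \<Psi>_ball_iff by (simp add: indicator_def)
  then show ?thesis using L2_iff_indicator[of "ball 0 R" "\<lambda>y. f (\<Psi> y)"] by simp
qed

lemma L2_push_grad:
  assumes g: "L2 (ball 0 R) g"
  shows "L2 (ball 0 R) (push_grad g)"
proof -
  have g': "L2 UNIV (\<lambda>x. indicator (ball 0 R) x *\<^sub>R g x)" using L2_iff_indicator[of "ball 0 R" g] g by simp
  have eq: "push_grad (\<lambda>x. indicator (ball 0 R) x *\<^sub>R g x) = (\<lambda>x. indicator (ball 0 R) x *\<^sub>R push_grad g x)"
    by (auto simp: push_grad_def fun_eq_iff split: split_indicator)
  have [measurable]: "(\<lambda>x. indicator (ball 0 R) x *\<^sub>R g x) \<in> borel_measurable lebesgue" by (rule L2_borel[OF g'])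
  have "L2 UNIV (push_grad (\<lambda>x. indicator (ball 0 R) x *\<^sub>R g x))"
  proof (rule L2_bound[OF g', where C = 2])
    show "push_grad (\<lambda>x. indicator (ball 0 R) x *\<^sub>R g x) \<in> borel_measurable lebesgue"
      unfolding push_grad_def[abs_def] by measurable
    show "AE x in lebesgue. norm (push_grad (\<lambda>x. indicator (ball 0 R) x *\<^sub>R g x) x) \<le> 2 * norm (indicator (ball 0 R) x *\<^sub>R g x)"
      by (intro AE_I2 push_grad_bound)
  qed
  then show ?thesis unfolding eq using L2_iff_indicator[of "ball 0 R" "push_grad g"] by simp
qed

text \<open>The chain rule is dual to the Piola identity
  \<open>(\<partial>\<^sub>b\<phi> \<circ> \<Phi>) J = \<partial>\<^sub>b(\<phi> \<circ> \<Phi>) + t (\<partial>\<^sub>b((\<phi> \<circ> \<Phi>) \<partial>\<^sub>e\<psi>) - \<partial>\<^sub>e((\<phi> \<circ> \<Phi>) \<partial>\<^sub>b\<psi>))\<close>.\<close>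

lemma weak_grad_\<Psi>:
  assumes u: "L2 (ball 0 R) u" "is_weak_grad (ball 0 R) u g"
  shows "is_weak_grad (ball 0 R) (\<lambda>y. u (\<Psi> y)) (\<lambda>y. push_grad g (\<Psi> y))"
  unfolding is_weak_grad_def
proof (intro conjI allI impI ballI)
  let ?\<Omega> = "ball (0::real^2) R"
  have \<Omega>: "?\<Omega> \<in> sets lebesgue" by simp
  have gL: "L2 ?\<Omega> g" using u by (simp add: is_weak_grad_def)
  note pL = L2_\<Psi>_ball[OF L2_push_grad[OF gL]]
  show "L2 ?\<Omega> (\<lambda>y. push_grad g (\<Psi> y))" by (rule pL)
  fix \<phi> :: "real^2 \<Rightarrow> real" and b :: "real^2" assume \<phi>: "test_fun ?\<Omega> \<phi>" and b: "b \<in> Basis"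
  have s\<phi>: "smooth \<phi>" by (rule test_fun_smooth[OF \<phi>])
  define f where "f x = \<phi> (\<Phi> x)" for x
  have sf: "smooth f" unfolding f_def \<Phi>_def by (rule smooth_compose_shear(2)[OF s\<phi> sm])
  have pf: "pd f x h = pd \<phi> (\<Phi> x) h + t * pd \<psi> x h * pd \<phi> (\<Phi> x) e" for x h
    using pd_eqI[OF smooth_compose_shear(1)[OF s\<phi> sm, of t e x]]
    unfolding f_def[abs_def] \<Phi>_def[symmetric] by simp
  obtain K where K: "compact K" "K \<subseteq> ?\<Omega>" "\<And>x. x \<notin> K \<Longrightarrow> \<phi> x = 0"
    using \<phi> by (elim test_funE) auto
  have tf: "test_fun ?\<Omega> f"
  proof (rule test_funI[OF sf])
    have "continuous_on UNIV \<Psi>"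
      by (rule lipschitz_on_continuous_on[of 2]) (auto intro!: lipschitz_onI simp: dist_norm \<Psi>_lip)
    then show "compact (\<Psi> ` K)" using K(1) continuous_on_subset by (intro compact_continuous_image) auto
    show "\<Psi> ` K \<subseteq> ?\<Omega>" using K(2) \<Psi>_ball_iff by auto
    show "f x = 0" if "x \<notin> \<Psi> ` K" for x
      unfolding f_def using that by (intro K(3)) (metis \<Psi>_\<Phi> image_eqI)
  qed
  have t1: "test_fun ?\<Omega> (\<lambda>x. pd \<psi> x c * f x)" for c by (rule test_fun_mult[OF tf smooth_pd[OF sm]])
  have pm: "pd (\<lambda>x. pd \<psi> x c * f x) x h = pd \<psi> x c * pd f x h + pd (\<lambda>z. pd \<psi> z c) x h * f x" for c x h
    by (rule pd_mult[OF smooth_pd[OF sm] sf])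
  have key: "J x * pd \<phi> (\<Phi> x) b = pd f x b + t * (pd (\<lambda>x. pd \<psi> x e * f x) x b - pd (\<lambda>x. pd \<psi> x b * f x) x e)" for x
    unfolding pm sym[of e x b] by (simp add: pf J_def algebra_simps)
  \<comment> \<open>Multiplying by \<open>J x\<close> clears the denominator of
    \<open>push_grad\<close>. What remains has the same three terms as the Piola identity, so each
    can be matched with one partial integration.\<close>
  have key2: "J x * ((push_grad g x \<bullet> b) * f x) =
      (g x \<bullet> b) * f x + t * ((g x \<bullet> b) * (pd \<psi> x e * f x) - (g x \<bullet> e) * (pd \<psi> x b * f x))" for x
    using J_bounds(3)[of x] b
    by (simp add: push_grad_def inner_diff_left grad_inner_Basis field_simps) (simp add: J_def algebra_simps)
  have um: "(\<lambda>x. indicator ?\<Omega> x * u x) \<in> borel_measurable lebesgue"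
    using L2_iff_indicator[OF \<Omega>, of u] u(1) L2_borel by fastforce
  have gm: "(\<lambda>x. indicator ?\<Omega> x *\<^sub>R push_grad g x) \<in> borel_measurable lebesgue"
    using L2_iff_indicator[OF \<Omega>, of "push_grad g"] L2_push_grad[OF gL] L2_borel by blast
  have i1: "integrable (lebesgue_on ?\<Omega>) (\<lambda>x. u x * pd f x b)"
    "integrable (lebesgue_on ?\<Omega>) (\<lambda>x. u x * pd (\<lambda>x. pd \<psi> x e * f x) x b)"
    "integrable (lebesgue_on ?\<Omega>) (\<lambda>x. u x * pd (\<lambda>x. pd \<psi> x b * f x) x e)"
    by (rule L2_mult_integrable[OF u(1) test_fun_L2_on[OF test_fun_pd[OF tf] \<Omega>]],
        (rule L2_mult_integrable[OF u(1) test_fun_L2_on[OF test_fun_pd[OF t1] \<Omega>]])+)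
  have i2: "integrable (lebesgue_on ?\<Omega>) (\<lambda>x. (g x \<bullet> b) * f x)"
    "integrable (lebesgue_on ?\<Omega>) (\<lambda>x. (g x \<bullet> c) * (pd \<psi> x d * f x))" for c d
    by (rule L2_mult_integrable[OF L2_inner[OF gL] test_fun_L2_on[OF tf \<Omega>]],
        rule L2_mult_integrable[OF L2_inner[OF gL] test_fun_L2_on[OF t1 \<Omega>]])
  have "(\<integral>y. u (\<Psi> y) * pd \<phi> y b \<partial>lebesgue_on ?\<Omega>) = (\<integral>y. indicator ?\<Omega> y * (u (\<Psi> y) * pd \<phi> y b) \<partial>lebesgue)"
    by (simp add: integral_restrict_space)
  also have "\<dots> = (\<integral>y. (indicator ?\<Omega> (\<Psi> y) * u (\<Psi> y)) * pd \<phi> y b \<partial>lebesgue)"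
    using \<Psi>_ball_iff by (simp add: indicator_def mult.assoc)
  also have "\<dots> = (\<integral>x. J x * ((indicator ?\<Omega> x * u x) * pd \<phi> (\<Phi> x) b) \<partial>lebesgue)"
  proof (subst integral_\<Phi>)
    show "(\<lambda>y. indicator ?\<Omega> (\<Psi> y) * u (\<Psi> y) * pd \<phi> y b) \<in> borel_measurable lebesgue"
      by (rule borel_measurable_times[OF measurable_compose[OF \<Psi>_measurable um] smooth_measurable[OF smooth_pd[OF s\<phi>]]])
  qed simp
  also have "\<dots> = (\<integral>x. indicator ?\<Omega> x *\<^sub>R (u x * (J x * pd \<phi> (\<Phi> x) b)) \<partial>lebesgue)"
    by (simp add: mult_ac)
  also have "\<dots> = (\<integral>x. u x * (J x * pd \<phi> (\<Phi> x) b) \<partial>lebesgue_on ?\<Omega>)"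
    by (simp add: integral_restrict_space)
  also have "\<dots> = (\<integral>x. u x * pd f x b + t * (u x * pd (\<lambda>x. pd \<psi> x e * f x) x b - u x * pd (\<lambda>x. pd \<psi> x b * f x) x e) \<partial>lebesgue_on ?\<Omega>)"
    unfolding key by (simp add: algebra_simps)
  also have "\<dots> = (\<integral>x. u x * pd f x b \<partial>lebesgue_on ?\<Omega>) +
      t * ((\<integral>x. u x * pd (\<lambda>x. pd \<psi> x e * f x) x b \<partial>lebesgue_on ?\<Omega>) - (\<integral>x. u x * pd (\<lambda>x. pd \<psi> x b * f x) x e \<partial>lebesgue_on ?\<Omega>))"
    using i1 by simp
  also have "\<dots> = - ((\<integral>x. (g x \<bullet> b) * f x \<partial>lebesgue_on ?\<Omega>) +
      t * ((\<integral>x. (g x \<bullet> b) * (pd \<psi> x e * f x) \<partial>lebesgue_on ?\<Omega>) - (\<integral>x. (g x \<bullet> e) * (pd \<psi> x b * f x) \<partial>lebesgue_on ?\<Omega>)))"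
    unfolding weak_gradD_dir[OF u tf \<Omega>] weak_gradD_dir[OF u t1 \<Omega>] by (simp add: right_diff_distrib)
  also have "\<dots> = - (\<integral>x. J x * ((push_grad g x \<bullet> b) * f x) \<partial>lebesgue_on ?\<Omega>)"
    unfolding key2 using i2 by simp
  also have "(\<integral>x. J x * ((push_grad g x \<bullet> b) * f x) \<partial>lebesgue_on ?\<Omega>) =
      (\<integral>x. J x * (((indicator ?\<Omega> x *\<^sub>R push_grad g x) \<bullet> b) * \<phi> (\<Phi> x)) \<partial>lebesgue)"
    by (simp add: integral_restrict_space f_def mult_ac)
  also have "\<dots> = (\<integral>y. ((indicator ?\<Omega> (\<Psi> y) *\<^sub>R push_grad g (\<Psi> y)) \<bullet> b) * \<phi> y \<partial>lebesgue)"
  proof (subst integral_\<Phi>[of "\<lambda>y. ((indicator ?\<Omega> (\<Psi> y) *\<^sub>R push_grad g (\<Psi> y)) \<bullet> b) * \<phi> y"])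
    show "(\<lambda>y. ((indicator ?\<Omega> (\<Psi> y) *\<^sub>R push_grad g (\<Psi> y)) \<bullet> b) * \<phi> y) \<in> borel_measurable lebesgue"
      by (rule borel_measurable_times[OF borel_measurable_inner[OF measurable_compose[OF \<Psi>_measurable gm] borel_measurable_const]
            smooth_measurable[OF s\<phi>]])
  qed simp
  also have "\<dots> = (\<integral>y. (push_grad g (\<Psi> y) \<bullet> b) * \<phi> y \<partial>lebesgue_on ?\<Omega>)"
    using \<Psi>_ball_iff by (simp add: integral_restrict_space indicator_def mult.assoc)
  finally show "(\<integral>y. u (\<Psi> y) * pd \<phi> y b \<partial>lebesgue_on ?\<Omega>) = - (\<integral>y. (push_grad g (\<Psi> y) \<bullet> b) * \<phi> y \<partial>lebesgue_on ?\<Omega>)" .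
qed

lemma grad_outside: "x \<notin> cball 0 s \<Longrightarrow> grad \<psi> x = 0"
proof -
  assume x: "x \<notin> cball 0 s"
  have "(\<psi> has_derivative (\<lambda>h. 0)) (at x)"
  proof (rule has_derivative_transform_within_open)
    show "((\<lambda>x. 0) has_derivative (\<lambda>h. 0)) (at x)" by simp
    show "open (- cball (0::real^2) s)" "x \<in> - cball 0 s" using x by auto
    show "0 = \<psi> y" if "y \<in> - cball 0 s" for y using supp[of y] that by simp
  qed
  from pd_eqI[OF this] show ?thesis by (simp add: grad_def)
qed

lemma cH1_shear_diff:
  assumes u: "L2 (ball 0 R) u" "is_weak_grad (ball 0 R) u g"
  shows "cH1 s (\<lambda>y. u (\<Psi> y) - u y) (\<lambda>y. push_grad g (\<Psi> y) - g y)"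
proof (rule cH1_extend[OF _ _ sR])
  show "L2 (ball 0 R) (\<lambda>y. u (\<Psi> y) - u y)" by (rule L2_diff[OF L2_\<Psi>_ball[OF u(1)] u(1)])
  show "is_weak_grad (ball 0 R) (\<lambda>y. u (\<Psi> y) - u y) (\<lambda>y. push_grad g (\<Psi> y) - g y)"
    by (rule is_weak_grad_diff[OF L2_\<Psi>_ball[OF u(1)] weak_grad_\<Psi>[OF u] u]) simp
  show "u (\<Psi> y) - u y = 0" "push_grad g (\<Psi> y) - g y = 0" if "y \<notin> cball 0 s" for y
    using \<Psi>_outside[OF that] grad_outside[OF that] by (auto simp: push_grad_def)
qed

lemma dirichlet_shear:
  assumes g: "L2 (ball 0 R) g"
  shows "(\<integral>\<^sup>+y\<in>ball 0 R. ennreal ((norm (push_grad g (\<Psi> y)))\<^sup>2) \<partial>lebesgue) =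
    (\<integral>\<^sup>+x\<in>ball 0 R. ennreal (J x * (norm (push_grad g x))\<^sup>2) \<partial>lebesgue)"
proof -
  have eq: "ennreal ((norm (push_grad g (\<Psi> y)))\<^sup>2) * indicator (ball 0 R) y =
      ennreal ((norm (indicator (ball 0 R) (\<Psi> y) *\<^sub>R push_grad g (\<Psi> y)))\<^sup>2)" for y
    using \<Psi>_ball_iff[of y] by (auto split: split_indicator)
  have gm: "(\<lambda>x. indicator (ball 0 R) x *\<^sub>R push_grad g x) \<in> borel_measurable lebesgue"
    using L2_iff_indicator[of "ball 0 R" "push_grad g"] L2_push_grad[OF g] L2_borel by auto
  have m: "(\<lambda>y. ennreal ((norm (indicator (ball 0 R) (\<Psi> y) *\<^sub>R push_grad g (\<Psi> y)))\<^sup>2)) \<in> borel_measurable lebesgue"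
    using measurable_compose[OF \<Psi>_measurable gm] by measurable
  show ?thesis
    unfolding eq by (subst nn_integral_\<Phi>[OF m])
      (auto intro!: nn_integral_cong simp: ennreal_mult J_bounds less_imp_le split: split_indicator)
qed

end

section \<open>The second variation of the interaction kernel\<close>

lemma Bernoulli_powr:
  fixes q x :: real
  assumes "q \<ge> 1" "x > - 1" shows "1 + q * x \<le> (1 + x) powr q"
proof -
  have "(1 + x) powr q - 1 powr q \<ge> q * ((1 + x) - 1)"
  proof (rule convex_on_imp_above_tangent[where A = "{0<..}" and f = "\<lambda>x. x powr q" and c = 1 and x = "1 + x"])
    show "convex_on {0<..} (\<lambda>x. x powr q)" using powr_convex[OF assms(1)] .
    show "((\<lambda>x. x powr q) has_real_derivative q) (at 1 within {0<..})"
      by (auto intro!: derivative_eq_intros)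
  qed (use assms in \<open>auto simp: interior_open\<close>)
  then show ?thesis by simp
qed

text \<open>Multiplied out, \<open>(1 - y + 4 * y\<^sup>2) * (1 + y)\<close> is
  \<open>1 + y\<^sup>2 * (3 + 4 * y)\<close>, which explains the threshold -3/4.\<close>

lemma inverse_le_quadratic:
  assumes "(y::real) \<ge> - 3 / 4" shows "1 / (1 + y) \<le> 1 - y + 4 * y\<^sup>2"
proof -
  have "0 \<le> y\<^sup>2 * (3 + 4 * y)" using assms by (intro mult_nonneg_nonneg) auto
  then have "1 \<le> (1 - y + 4 * y\<^sup>2) * (1 + y)" by (simp add: algebra_simps power2_eq_square)
  then show ?thesis using assms by (simp add: divide_le_eq)
qed

text \<open>The squared norm of \<open>z + t *\<^sub>R v\<close> is that of \<open>z\<close> times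
  \<open>1 + x\<close>, where \<open>x\<close> is the linear term \<open>s\<close> plus a
  nonnegative quadratic term \<open>r\<close>. Bernoulli's inequality with exponent
  \<open>q = p / 2\<close> requires \<open>p \<ge> 2\<close>. It is followed by
  \<open>inverse_le_quadratic\<close>. The bound 9/2 for \<open>q * x\<close> in units of
  \<open>\<bar>t\<bar> * M\<close> gives the constant: 4 times the square of 9/2 is 81.\<close>

lemma kernel_first_order:
  fixes z v :: "'a::real_inner"
  assumes p: "2 \<le> p" "p \<le> 3" and z: "z \<noteq> 0" and v: "norm v \<le> M * norm z" and t: "\<bar>t\<bar> * M \<le> 1 / 16" and M: "M \<ge> 0"
  shows "1 / norm (z + t *\<^sub>R v) powr p \<le>
    (1 - p / 2 * (2 * t * (z \<bullet> v) / (norm z)\<^sup>2) + 81 * (t * M)\<^sup>2) / norm z powr p"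
proof -
  define \<epsilon> where "\<epsilon> = \<bar>t\<bar> * M"
  define s where "s = 2 * t * (z \<bullet> v) / (norm z)\<^sup>2"
  define r where "r = t\<^sup>2 * (norm v)\<^sup>2 / (norm z)\<^sup>2"
  define x where "x = s + r"
  define q where "q = p / 2"
  have \<epsilon>: "0 \<le> \<epsilon>" "\<epsilon> \<le> 1 / 16" "\<epsilon>\<^sup>2 = (t * M)\<^sup>2"
    using t M by (auto simp: \<epsilon>_def power_mult_distrib)
  have nz: "norm z > 0" using z by simp
  have zv: "\<bar>z \<bullet> v\<bar> \<le> M * (norm z)\<^sup>2"
  proof -
    have "\<bar>z \<bullet> v\<bar> \<le> norm z * norm v" by (rule Cauchy_Schwarz_ineq2)
    also have "\<dots> \<le> norm z * (M * norm z)" by (rule mult_left_mono[OF v]) simp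
    finally show ?thesis by (simp add: power2_eq_square mult_ac)
  qed
  have s: "\<bar>s\<bar> \<le> 2 * \<epsilon>"
  proof -
    have "\<bar>s\<bar> = 2 * \<bar>t\<bar> * \<bar>z \<bullet> v\<bar> / (norm z)\<^sup>2" by (simp add: s_def abs_mult)
    also have "\<dots> \<le> 2 * \<bar>t\<bar> * (M * (norm z)\<^sup>2) / (norm z)\<^sup>2"
      by (intro divide_right_mono mult_left_mono zv) auto
    also have "\<dots> = 2 * \<epsilon>" using nz by (simp add: \<epsilon>_def)
    finally show ?thesis .
  qed
  have r: "0 \<le> r" "r \<le> \<epsilon>\<^sup>2"
  proof -
    show "0 \<le> r" by (simp add: r_def)
    have "r \<le> t\<^sup>2 * (M * norm z)\<^sup>2 / (norm z)\<^sup>2"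
      unfolding r_def by (intro divide_right_mono mult_left_mono power_mono v) auto
    also have "\<dots> = \<epsilon>\<^sup>2" using nz by (simp add: \<epsilon>_def power_mult_distrib)
    finally show "r \<le> \<epsilon>\<^sup>2" .
  qed
  have "\<epsilon>\<^sup>2 \<le> \<epsilon>" unfolding power2_eq_square using \<epsilon>(1,2) by (intro mult_left_le_one_le) auto
  then have x: "\<bar>x\<bar> \<le> 3 * \<epsilon>" using s r unfolding x_def by linarith
  have q: "1 \<le> q" "q \<le> 3 / 2" using p by (auto simp: q_def)
  have qx: "\<bar>q * x\<bar> \<le> 9 / 2 * \<epsilon>"
    using mult_mono[OF q(2) x] q by (simp add: abs_mult)
  have "(norm (z + t *\<^sub>R v))\<^sup>2 = (norm z)\<^sup>2 + 2 * t * (z \<bullet> v) + t\<^sup>2 * (norm v)\<^sup>2"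
    unfolding power2_norm_eq_inner by (simp add: inner_add_left inner_add_right inner_commute algebra_simps power2_eq_square)
  also have "\<dots> = (norm z)\<^sup>2 * (1 + x)"
    using nz by (simp add: x_def s_def r_def field_simps)
  finally have sq: "(norm (z + t *\<^sub>R v))\<^sup>2 = (norm z)\<^sup>2 * (1 + x)" .
  have x1: "1 + x > 0" using x \<epsilon> by linarith
  have powr2: "a powr p = (a\<^sup>2) powr q" if "a > 0" for a :: real
  proof -
    have "a\<^sup>2 = a powr 2" using that by simp
    then show ?thesis by (simp add: powr_powr q_def)
  qed
  have "norm (z + t *\<^sub>R v) > 0"
  proof (rule ccontr)
    assume "\<not> ?thesis"
    then have "(norm z)\<^sup>2 * (1 + x) = 0" using sq by simp
    then show False using nz x1 by simp
  qed
  then have pw: "norm (z + t *\<^sub>R v) powr p = norm z powr p * (1 + x) powr q"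
    using powr2[of "norm (z + t *\<^sub>R v)"] powr2[OF nz] sq x1 by (simp add: powr_mult)
  have q0: "1 + q * x > 0" using qx \<epsilon> by linarith
  have "1 / (1 + x) powr q \<le> 1 / (1 + q * x)"
    using Bernoulli_powr[OF q(1), of x] q0 x1 by (intro divide_left_mono) auto
  also have "\<dots> \<le> 1 - q * x + 4 * (q * x)\<^sup>2"
    using qx \<epsilon> by (intro inverse_le_quadratic) linarith
  also have "(q * x)\<^sup>2 \<le> (9 / 2 * \<epsilon>)\<^sup>2" using power_mono[OF qx, of 2] by simp
  also have "1 - q * x + 4 * (9 / 2 * \<epsilon>)\<^sup>2 \<le> 1 - q * s + 81 * \<epsilon>\<^sup>2"
    using mult_nonneg_nonneg[OF _ r(1), of q] q by (simp add: x_def algebra_simps power2_eq_square)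
  finally have "1 / (1 + x) powr q \<le> 1 - q * s + 81 * \<epsilon>\<^sup>2" by simp
  then have "1 / (1 + x) powr q / norm z powr p \<le> (1 - q * s + 81 * \<epsilon>\<^sup>2) / norm z powr p"
    by (rule divide_right_mono) simp
  then show ?thesis by (simp add: pw q_def s_def \<epsilon>(3) mult.commute)
qed

text \<open>With \<open>S\<close> from the kernel and \<open>A\<close> from the Jacobians, the terms
  linear in \<open>t\<close> have opposite signs in the two summands and cancel. What is left is of
  second order: the error 81 of each summand, the product \<open>B\<close> and the cross term
  \<open>2 * S * A\<close>, which together stay below 200.\<close>

lemma kernel_second_difference:
  fixes z v :: "'a::real_inner"
  assumes p: "2 \<le> p" "p \<le> 3" and v: "norm v \<le> M * norm z" and t: "\<bar>t\<bar> * M \<le> 1 / 16"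
    and ab: "\<bar>a\<bar> \<le> M" "\<bar>b\<bar> \<le> M"
  shows "(1 + t * a) * (1 + t * b) / norm (z + t *\<^sub>R v) powr p +
      (1 - t * a) * (1 - t * b) / norm (z - t *\<^sub>R v) powr p \<le> (2 + 200 * (t * M)\<^sup>2) / norm z powr p"
proof (cases "z = 0")
  \<comment> \<open>Then \<open>v = 0\<close> as well, and all three quotients are divisions by zero
    with value 0.\<close>
  case True
  then show ?thesis using v by simp
next
  case False
  have M: "M \<ge> 0" using ab by linarith
  define \<epsilon> where "\<epsilon> = \<bar>t\<bar> * M"
  have \<epsilon>: "0 \<le> \<epsilon>" "\<epsilon> \<le> 1 / 16" "\<epsilon>\<^sup>2 = (t * M)\<^sup>2"
    using t M by (auto simp: \<epsilon>_def power_mult_distrib)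
  define S where "S = p / 2 * (2 * t * (z \<bullet> v) / (norm z)\<^sup>2)"
  have S: "\<bar>S\<bar> \<le> 3 * \<epsilon>"
  proof -
    have nz: "norm z > 0" using False by simp
    have "\<bar>z \<bullet> v\<bar> \<le> norm z * (M * norm z)"
      by (rule order_trans[OF Cauchy_Schwarz_ineq2 mult_left_mono[OF v norm_ge_zero]])
    then have zv: "\<bar>z \<bullet> v\<bar> / (norm z)\<^sup>2 \<le> M"
      using nz by (simp add: divide_le_eq power2_eq_square mult_ac)
    have "\<bar>S\<bar> = p * (\<bar>t\<bar> * (\<bar>z \<bullet> v\<bar> / (norm z)\<^sup>2))" using p by (simp add: S_def abs_mult)
    also have "\<dots> \<le> 3 * (\<bar>t\<bar> * M)" using p zv by (intro mult_mono mult_left_mono) auto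
    finally show ?thesis by (simp add: \<epsilon>_def)
  qed
  have ta: "\<bar>t * a\<bar> \<le> \<epsilon>" "\<bar>t * b\<bar> \<le> \<epsilon>"
    using mult_left_mono[OF ab(1), of "\<bar>t\<bar>"] mult_left_mono[OF ab(2), of "\<bar>t\<bar>"] by (auto simp: \<epsilon>_def abs_mult)
  define A where "A = t * a + t * b"
  define B where "B = (t * a) * (t * b)"
  have A: "\<bar>A\<bar> \<le> 2 * \<epsilon>" using ta by (auto simp: A_def)
  have B: "\<bar>B\<bar> \<le> \<epsilon>\<^sup>2" using mult_mono[OF ta \<epsilon>(1)] by (simp add: B_def abs_mult power2_eq_square)
  have f: "(1 + t * a) * (1 + t * b) = 1 + A + B" "(1 - t * a) * (1 - t * b) = 1 - A + B"
    by (simp_all add: A_def B_def algebra_simps)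
  have f0: "0 \<le> 1 + A + B" "0 \<le> 1 - A + B"
    unfolding f[symmetric] using ta \<epsilon> by (intro mult_nonneg_nonneg; linarith)+
  let ?N = "norm z powr p"
  have 1: "1 / norm (z + t *\<^sub>R v) powr p \<le> (1 - S + 81 * \<epsilon>\<^sup>2) / ?N"
    using kernel_first_order[OF p False v t M] by (simp add: S_def \<epsilon>(3))
  have 2: "1 / norm (z - t *\<^sub>R v) powr p \<le> (1 + S + 81 * \<epsilon>\<^sup>2) / ?N"
    using kernel_first_order[OF p False v _ M, of "- t"] t by (simp add: S_def \<epsilon>(3))
  have "(1 + A + B) * (1 / norm (z + t *\<^sub>R v) powr p) + (1 - A + B) * (1 / norm (z - t *\<^sub>R v) powr p)
      \<le> (1 + A + B) * ((1 - S + 81 * \<epsilon>\<^sup>2) / ?N) + (1 - A + B) * ((1 + S + 81 * \<epsilon>\<^sup>2) / ?N)"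
    by (intro add_mono mult_left_mono 1 2 f0)
  also have "\<dots> = (2 * (1 + 81 * \<epsilon>\<^sup>2) * (1 + B) - 2 * S * A) / ?N"
    by (simp add: add_divide_distrib[symmetric] algebra_simps)
  also have "\<dots> \<le> (2 + 200 * \<epsilon>\<^sup>2) / ?N"
  proof (rule divide_right_mono)
    have "\<bar>S * A\<bar> \<le> 6 * \<epsilon>\<^sup>2" using mult_mono[OF S A] \<epsilon> by (simp add: abs_mult power2_eq_square)
    then have a: "- 2 * S * A \<le> 12 * \<epsilon>\<^sup>2" unfolding abs_le_iff by linarith
    have b: "2 * (1 + 81 * \<epsilon>\<^sup>2) * (1 + B) \<le> 2 * (1 + 81 * \<epsilon>\<^sup>2) * (1 + \<epsilon>\<^sup>2)"
      using B by (intro mult_left_mono) auto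
    have "\<epsilon>\<^sup>2 \<le> 1 / 256" using power_mono[OF \<epsilon>(2,1), of 2] by (simp add: power_divide)
    then have "\<epsilon>\<^sup>2 * \<epsilon>\<^sup>2 \<le> 1 / 256 * \<epsilon>\<^sup>2" by (intro mult_right_mono) auto
    moreover have "2 * (1 + 81 * \<epsilon>\<^sup>2) * (1 + \<epsilon>\<^sup>2) = 2 + 164 * \<epsilon>\<^sup>2 + 162 * (\<epsilon>\<^sup>2 * \<epsilon>\<^sup>2)"
      by (simp add: algebra_simps)
    ultimately have "2 * (1 + 81 * \<epsilon>\<^sup>2) * (1 + \<epsilon>\<^sup>2) \<le> 2 + 165 * \<epsilon>\<^sup>2"
      using zero_le_power2[of \<epsilon>] by linarith
    then show "2 * (1 + 81 * \<epsilon>\<^sup>2) * (1 + B) - 2 * S * A \<le> 2 + 200 * \<epsilon>\<^sup>2"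
      using a b zero_le_power2[of \<epsilon>] by linarith
  qed simp
  finally show ?thesis unfolding f \<epsilon>(3) by simp
qed

section \<open>The fractional perimeter\<close>

definition kern :: "real \<Rightarrow> 'a::euclidean_space \<times> 'a \<Rightarrow> ennreal" where
  "kern \<sigma> p = ennreal (1 / norm (fst p - snd p) powr (real DIM('a) + \<sigma>))"

abbreviation leb2 :: "('a::euclidean_space \<times> 'a) measure" where
  "leb2 \<equiv> lebesgue \<Otimes>\<^sub>M lebesgue"

lemma kern_measurable [measurable]: "kern \<sigma> \<in> borel_measurable leb2"
  unfolding kern_def[abs_def] by measurable

lemma indicator_fst_measurable [measurable]:
  "A \<in> sets lebesgue \<Longrightarrow> (\<lambda>p. indicator A (fst p) :: ennreal) \<in> borel_measurable leb2"
  and indicator_snd_measurable [measurable]: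
  "A \<in> sets lebesgue \<Longrightarrow> (\<lambda>p. indicator A (snd p) :: ennreal) \<in> borel_measurable leb2"
  by (auto intro!: measurable_compose[OF measurable_fst] measurable_compose[OF measurable_snd])

lemma nn_integral_leb2:
  fixes h :: "'a::euclidean_space \<times> 'a \<Rightarrow> ennreal"
  assumes "h \<in> borel_measurable leb2"
  shows "(\<integral>\<^sup>+x. \<integral>\<^sup>+y. h (x, y) \<partial>lebesgue \<partial>lebesgue) = (\<integral>\<^sup>+p. h p \<partial>leb2)"
  by (rule lebesgue.nn_integral_fst[OF assms])

lemma interaction_leb2:
  assumes [measurable]: "A \<in> sets lebesgue" "B \<in> sets lebesgue"
  shows "interaction \<sigma> A B = (\<integral>\<^sup>+p. kern \<sigma> p * (indicator A (fst p) * indicator B (snd p)) \<partial>leb2)"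
proof -
  have "interaction \<sigma> A B = (\<integral>\<^sup>+x. \<integral>\<^sup>+y. kern \<sigma> (x, y) * (indicator A x * indicator B y) \<partial>lebesgue \<partial>lebesgue)"
    unfolding interaction_def
  proof (rule nn_integral_cong)
    fix x
    show "(\<integral>\<^sup>+y\<in>B. ennreal (1 / norm (x - y) powr (real DIM('a) + \<sigma>)) \<partial>lebesgue) * indicator A x =
        (\<integral>\<^sup>+y. kern \<sigma> (x, y) * (indicator A x * indicator B y) \<partial>lebesgue)"
      by (cases "x \<in> A") (simp_all add: kern_def)
  qed
  also have "\<dots> = (\<integral>\<^sup>+p. kern \<sigma> p * (indicator A (fst p) * indicator B (snd p)) \<partial>leb2)"
    using nn_integral_leb2[of "\<lambda>p. kern \<sigma> p * (indicator A (fst p) * indicator B (snd p))"] by simp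
  finally show ?thesis .
qed

text \<open>The pairs that contribute to the fractional perimeter. With this set the two
  interactions become one integral, and inequalities between perimeters reduce to pointwise ones
  between indicators.\<close>

definition crossing :: "'a set \<Rightarrow> 'a set \<Rightarrow> ('a \<times> 'a) set" where
  "crossing E \<Omega> = {(x, y). x \<in> E \<and> y \<notin> E \<and> (x \<in> \<Omega> \<or> y \<in> \<Omega>)}"

lemma crossing_indicator:
  "indicator (crossing E \<Omega>) p = (indicator (E \<inter> \<Omega>) (fst p) * indicator (- E) (snd p) +
    indicator (E - \<Omega>) (fst p) * indicator (\<Omega> - E) (snd p) :: ennreal)"
  by (cases p) (auto simp: crossing_def split: split_indicator)

lemma crossing_measurable [measurable]:
  assumes "E \<in> sets lebesgue" "\<Omega> \<in> sets lebesgue"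
  shows "(\<lambda>p. indicator (crossing E \<Omega>) p :: ennreal) \<in> borel_measurable leb2"
  unfolding crossing_indicator using assms Compl_in_sets_lebesgue by measurable

lemma frac_perimeter_leb2:
  assumes E [measurable]: "E \<in> sets lebesgue" and \<Omega> [measurable]: "\<Omega> \<in> sets lebesgue"
  shows "frac_perimeter \<sigma> E \<Omega> = (\<integral>\<^sup>+p. kern \<sigma> p * indicator (crossing E \<Omega>) p \<partial>leb2)"
proof -
  have [measurable]: "- E \<in> sets lebesgue" using E by (rule Compl_in_sets_lebesgue[THEN iffD2])
  have [measurable]: "E - \<Omega> \<in> sets lebesgue" "\<Omega> - E \<in> sets lebesgue" "E \<inter> \<Omega> \<in> sets lebesgue" by measurable
  show ?thesis
    unfolding frac_perimeter_def crossing_indicator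
    by (subst (1 2) interaction_leb2; (simp add: distrib_left nn_integral_add)?)
qed

text \<open>True pointwise for the indicators. A pair from \<open>A - B\<close> to
  \<open>B - A\<close> crosses \<open>A\<close> but neither the union nor the intersection, and
  \<open>A - B \<subseteq> \<Omega>\<close> ensures that it is counted; this gain is the third term
  on the left.\<close>

lemma frac_perimeter_submodular:
  fixes A B \<Omega> :: "'a::euclidean_space set"
  assumes [measurable]: "A \<in> sets lebesgue" "B \<in> sets lebesgue" "\<Omega> \<in> sets lebesgue" and sub: "A - B \<subseteq> \<Omega>"
  shows "frac_perimeter \<sigma> (A \<union> B) \<Omega> + frac_perimeter \<sigma> (A \<inter> B) \<Omega> + interaction \<sigma> (A - B) (B - A)
    \<le> frac_perimeter \<sigma> A \<Omega> + frac_perimeter \<sigma> B \<Omega>"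
proof -
  have [measurable]: "A \<union> B \<in> sets lebesgue" "A \<inter> B \<in> sets lebesgue" "A - B \<in> sets lebesgue" "B - A \<in> sets lebesgue"
    by measurable
  have pt: "indicator (crossing (A \<union> B) \<Omega>) p + indicator (crossing (A \<inter> B) \<Omega>) p +
      indicator (A - B) (fst p) * indicator (B - A) (snd p) \<le>
      (indicator (crossing A \<Omega>) p + indicator (crossing B \<Omega>) p :: ennreal)" for p
    using sub by (cases p) (auto simp: crossing_def indicator_def)
  have "frac_perimeter \<sigma> (A \<union> B) \<Omega> + frac_perimeter \<sigma> (A \<inter> B) \<Omega> + interaction \<sigma> (A - B) (B - A) =
      (\<integral>\<^sup>+p. kern \<sigma> p * (indicator (crossing (A \<union> B) \<Omega>) p + indicator (crossing (A \<inter> B) \<Omega>) p +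
        indicator (A - B) (fst p) * indicator (B - A) (snd p)) \<partial>leb2)"
    by (simp add: frac_perimeter_leb2 interaction_leb2 distrib_left nn_integral_add)
  also have "\<dots> \<le> (\<integral>\<^sup>+p. kern \<sigma> p * (indicator (crossing A \<Omega>) p + indicator (crossing B \<Omega>) p) \<partial>leb2)"
    by (intro nn_integral_mono mult_left_mono pt) simp
  also have "\<dots> = frac_perimeter \<sigma> A \<Omega> + frac_perimeter \<sigma> B \<Omega>"
    by (simp add: frac_perimeter_leb2 distrib_left nn_integral_add)
  finally show ?thesis .
qed

section \<open>Transport of the energy by a shear, to second order\<close>

context shear
begin

lemma nn_integral_leb2_\<Phi>:
  assumes h [measurable]: "h \<in> borel_measurable leb2"
  shows "(\<integral>\<^sup>+p. h p \<partial>leb2) = (\<integral>\<^sup>+p. ennreal (J (fst p)) * ennreal (J (snd p)) * h (\<Phi> (fst p), \<Phi> (snd p)) \<partial>leb2)"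
proof -
  have J1 [measurable]: "(\<lambda>p::(real^2) \<times> (real^2). J (fst p)) \<in> borel_measurable leb2"
    and J2 [measurable]: "(\<lambda>p::(real^2) \<times> (real^2). J (snd p)) \<in> borel_measurable leb2"
    by (rule measurable_compose[OF measurable_fst J_measurable], rule measurable_compose[OF measurable_snd J_measurable])
  have P1 [measurable]: "(\<lambda>p::(real^2) \<times> (real^2). (fst p, \<Phi> (snd p))) \<in> leb2 \<rightarrow>\<^sub>M leb2"
    and P2 [measurable]: "(\<lambda>p::(real^2) \<times> (real^2). (\<Phi> (fst p), \<Phi> (snd p))) \<in> leb2 \<rightarrow>\<^sub>M leb2"
    by (auto intro!: measurable_Pair measurable_compose[OF measurable_fst \<Phi>_measurable] measurable_compose[OF measurable_snd \<Phi>_measurable])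
  have sec: "(\<lambda>y. f (x, y)) \<in> borel_measurable lebesgue" if "f \<in> borel_measurable leb2"
    for f :: "(real^2) \<times> (real^2) \<Rightarrow> ennreal" and x
    using that by (rule measurable_compose[OF measurable_Pair1', rotated]) simp
  let ?h1 = "\<lambda>p. ennreal (J (snd p)) * h (fst p, \<Phi> (snd p))"
  let ?h2 = "\<lambda>p. ennreal (J (snd p)) * h (\<Phi> (fst p), \<Phi> (snd p))"
  have m1: "?h1 \<in> borel_measurable leb2" using measurable_compose[OF P1 h] by measurable
  have m2: "?h2 \<in> borel_measurable leb2" using measurable_compose[OF P2 h] by measurable
  have "(\<integral>\<^sup>+p. h p \<partial>leb2) = (\<integral>\<^sup>+x. \<integral>\<^sup>+y. h (x, y) \<partial>lebesgue \<partial>lebesgue)"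
    by (rule nn_integral_leb2[OF h, symmetric])
  also have "\<dots> = (\<integral>\<^sup>+x. \<integral>\<^sup>+y. ?h1 (x, y) \<partial>lebesgue \<partial>lebesgue)"
    by (subst nn_integral_\<Phi>[OF sec[OF h]]) simp
  also have "\<dots> = (\<integral>\<^sup>+x. ennreal (J x) * (\<integral>\<^sup>+y. ?h1 (\<Phi> x, y) \<partial>lebesgue) \<partial>lebesgue)"
    by (rule nn_integral_\<Phi>) (rule lebesgue.borel_measurable_nn_integral_fst[OF m1])
  also have "\<dots> = (\<integral>\<^sup>+x. \<integral>\<^sup>+y. ennreal (J (fst (x, y))) * ?h2 (x, y) \<partial>lebesgue \<partial>lebesgue)"
    using sec[OF m2] by (intro nn_integral_cong) (simp add: nn_integral_cmult)
  also have "\<dots> = (\<integral>\<^sup>+p. ennreal (J (fst p)) * ?h2 p \<partial>leb2)"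
    by (rule nn_integral_leb2) (use m2 in measurable)
  finally show ?thesis by (simp add: mult.assoc)
qed

lemma frac_perimeter_\<Phi>:
  assumes E: "E \<in> sets lebesgue"
  shows "frac_perimeter \<sigma> (\<Phi> ` E) (ball 0 R) =
    (\<integral>\<^sup>+p. ennreal (J (fst p)) * ennreal (J (snd p)) * kern \<sigma> (\<Phi> (fst p), \<Phi> (snd p)) * indicator (crossing E (ball 0 R)) p \<partial>leb2)"
proof -
  have c: "indicator (crossing (\<Phi> ` E) (ball 0 R)) (\<Phi> (fst p), \<Phi> (snd p)) = (indicator (crossing E (ball 0 R)) p :: ennreal)" for p
    using \<Phi>_ball_iff[of "fst p"] \<Phi>_ball_iff[of "snd p"]
    by (cases p) (simp add: crossing_def mem_image_\<Phi> indicator_def)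
  have m: "(\<lambda>p. kern \<sigma> p * indicator (crossing (\<Phi> ` E) (ball 0 R)) p) \<in> borel_measurable leb2"
    by (intro borel_measurable_times_ennreal kern_measurable crossing_measurable image_measurable[OF E]) simp
  show ?thesis
    using nn_integral_leb2_\<Phi>[OF m] frac_perimeter_leb2[OF image_measurable[OF E], of "ball 0 R" \<sigma>]
    by (simp add: c mult.assoc)
qed

lemma opposite: "shear \<psi> e M s R (- t)"
proof
  show "\<bar>- t\<bar> * M \<le> 1 / 16" using small by simp
qed (fact test supp sR sym lip grad_bound)+

lemma pulled_kern_measurable:
  "(\<lambda>p. ennreal (J (fst p)) * ennreal (J (snd p)) * kern \<sigma> (\<Phi> (fst p), \<Phi> (snd p))) \<in> borel_measurable leb2"
proof -
  have [measurable]: "(\<lambda>p::(real^2) \<times> (real^2). J (fst p)) \<in> borel_measurable leb2"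
    "(\<lambda>p::(real^2) \<times> (real^2). J (snd p)) \<in> borel_measurable leb2"
    by (rule measurable_compose[OF measurable_fst J_measurable], rule measurable_compose[OF measurable_snd J_measurable])
  have "(\<lambda>p::(real^2) \<times> (real^2). (\<Phi> (fst p), \<Phi> (snd p))) \<in> leb2 \<rightarrow>\<^sub>M leb2"
    by (auto intro!: measurable_Pair measurable_compose[OF measurable_fst \<Phi>_measurable] measurable_compose[OF measurable_snd \<Phi>_measurable])
  then have [measurable]: "(\<lambda>p. kern \<sigma> (\<Phi> (fst p), \<Phi> (snd p))) \<in> borel_measurable leb2"
    by (rule measurable_compose) (rule kern_measurable)
  show ?thesis by measurable
qed

lemma pulled_kern:
  "ennreal (J x) * ennreal (J y) * kern \<sigma> (\<Phi> x, \<Phi> y) =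
    ennreal ((1 + t * pd \<psi> x e) * (1 + t * pd \<psi> y e) / norm ((x - y) + t *\<^sub>R ((\<psi> x - \<psi> y) *\<^sub>R e)) powr (2 + \<sigma>))"
proof -
  have "\<Phi> x - \<Phi> y = (x - y) + t *\<^sub>R ((\<psi> x - \<psi> y) *\<^sub>R e)" by (simp add: \<Phi>_def algebra_simps)
  then show ?thesis
    using J_bounds(3)[of x] J_bounds(3)[of y]
    by (simp add: kern_def J_def[symmetric] ennreal_mult'[symmetric])
qed

text \<open>Expanding the square exactly leaves a middle term that is odd in \<open>t\<close>, kept
  for cancellation against \<open>-t\<close>, and a last term divided by \<open>J x\<close>, where
  \<open>J x \<ge> 1 / 2\<close> accounts for the factor 2.\<close>

lemma push_grad_square:
  "J x * (norm (push_grad g x))\<^sup>2 \<le> J x * (norm (g x))\<^sup>2 - 2 * t * (g x \<bullet> e) * (g x \<bullet> grad \<psi> x) + 2 * (t * M)\<^sup>2 * (norm (g x))\<^sup>2"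
proof -
  let ?a = "g x \<bullet> e" and ?p = "grad \<psi> x"
  have "J x * (norm (push_grad g x))\<^sup>2 = J x * (norm (g x))\<^sup>2 - 2 * t * ?a * (g x \<bullet> ?p) + t\<^sup>2 * ?a\<^sup>2 * (norm ?p)\<^sup>2 / J x"
  proof -
    define c where "c = t * ?a / J x"
    have eq: "(norm (push_grad g x))\<^sup>2 = (norm (g x))\<^sup>2 - 2 * c * (g x \<bullet> ?p) + c\<^sup>2 * (norm ?p)\<^sup>2"
      unfolding push_grad_def c_def[symmetric] power2_norm_eq_inner
      by (simp add: inner_diff_left inner_diff_right inner_commute algebra_simps power2_eq_square)
    have "J x * (norm (push_grad g x))\<^sup>2 =
        J x * (norm (g x))\<^sup>2 - 2 * (J x * c) * (g x \<bullet> ?p) + (J x * c\<^sup>2) * (norm ?p)\<^sup>2"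
      unfolding eq by (simp add: algebra_simps)
    moreover have "J x * c = t * ?a" "J x * c\<^sup>2 = t\<^sup>2 * ?a\<^sup>2 / J x"
      using J_bounds(3)[of x] by (simp_all add: c_def power2_eq_square)
    ultimately show ?thesis by simp
  qed
  moreover have "t\<^sup>2 * ?a\<^sup>2 * (norm ?p)\<^sup>2 / J x \<le> 2 * (t * M)\<^sup>2 * (norm (g x))\<^sup>2"
  proof -
    have "\<bar>?a\<bar> * norm ?p \<le> norm (g x) * norm e * norm ?p"
      by (rule mult_right_mono[OF Cauchy_Schwarz_ineq2 norm_ge_zero])
    also have "\<dots> = norm (g x) * (norm ?p * norm e)" by simp
    also have "\<dots> \<le> norm (g x) * M" by (rule mult_left_mono[OF grad_bound norm_ge_zero])
    finally have "(\<bar>?a\<bar> * norm ?p)\<^sup>2 \<le> (norm (g x) * M)\<^sup>2" by (rule power_mono) simp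
    then have "t\<^sup>2 * ?a\<^sup>2 * (norm ?p)\<^sup>2 \<le> t\<^sup>2 * (norm (g x) * M)\<^sup>2"
      by (simp add: power_mult_distrib mult.assoc mult_left_mono)
    then have "t\<^sup>2 * ?a\<^sup>2 * (norm ?p)\<^sup>2 * (1 / J x) \<le> t\<^sup>2 * (norm (g x) * M)\<^sup>2 * 2"
      by (rule mult_mono) (use J_bounds[of x] in \<open>auto simp: divide_simps\<close>)
    then show ?thesis by (simp add: power_mult_distrib mult_ac)
  qed
  ultimately show ?thesis by simp
qed

end

text \<open>Pulled back by the two shears, both perimeters are integrals over the same pairs
  crossing \<open>E\<close>. Hence \<open>kernel_second_difference\<close> applies under the
  integral, whatever \<open>E\<close> looks like.\<close>

lemma frac_perimeter_second_variation:
  assumes "shear \<psi> e M s R t" and \<sigma>: "0 < \<sigma>" "\<sigma> < 1" and E: "E \<in> sets lebesgue"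
  shows "frac_perimeter \<sigma> (shear.\<Phi> \<psi> e t ` E) (ball 0 R) + frac_perimeter \<sigma> (shear.\<Phi> \<psi> e (- t) ` E) (ball 0 R)
    \<le> ennreal (2 + 200 * (t * M)\<^sup>2) * frac_perimeter \<sigma> E (ball 0 R)"
proof -
  interpret P: shear \<psi> e M s R t by fact
  interpret N: shear \<psi> e M s R "- t" by (rule P.opposite)
  let ?I = "\<lambda>p. indicator (crossing E (ball (0::real^2) R)) p :: ennreal"
  let ?f = "\<lambda>p. ennreal (P.J (fst p)) * ennreal (P.J (snd p)) * kern \<sigma> (P.\<Phi> (fst p), P.\<Phi> (snd p))"
  let ?g = "\<lambda>p. ennreal (N.J (fst p)) * ennreal (N.J (snd p)) * kern \<sigma> (N.\<Phi> (fst p), N.\<Phi> (snd p))"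
  let ?c = "2 + 200 * (t * M)\<^sup>2"
  note [measurable] = P.pulled_kern_measurable N.pulled_kern_measurable
  have [measurable]: "?I \<in> borel_measurable leb2" by (rule crossing_measurable[OF E]) simp
  have pt: "?f p + ?g p \<le> ennreal ?c * kern \<sigma> p" for p
  proof -
    let ?x = "fst p" and ?y = "snd p"
    let ?v = "(\<psi> ?x - \<psi> ?y) *\<^sub>R e"
    have "(1 + t * pd \<psi> ?x e) * (1 + t * pd \<psi> ?y e) / norm ((?x - ?y) + t *\<^sub>R ?v) powr (2 + \<sigma>) +
        (1 - t * pd \<psi> ?x e) * (1 - t * pd \<psi> ?y e) / norm ((?x - ?y) - t *\<^sub>R ?v) powr (2 + \<sigma>)
        \<le> ?c / norm (?x - ?y) powr (2 + \<sigma>)"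
      by (rule kernel_second_difference[OF _ _ P.lip P.small P.pd_bound P.pd_bound]) (use \<sigma> in auto)
    moreover have "(1 + t * pd \<psi> ?x e) * (1 + t * pd \<psi> ?y e) \<ge> 0" "(1 - t * pd \<psi> ?x e) * (1 - t * pd \<psi> ?y e) \<ge> 0"
      using P.J_bounds(3)[of ?x] P.J_bounds(3)[of ?y] N.J_bounds(3)[of ?x] N.J_bounds(3)[of ?y]
      by (auto simp: P.J_def N.J_def)
    ultimately show ?thesis
      unfolding P.pulled_kern N.pulled_kern unfolding kern_def
      by (simp add: ennreal_plus[symmetric] ennreal_mult'[symmetric] ennreal_leI del: ennreal_plus)
  qed
  have "frac_perimeter \<sigma> (P.\<Phi> ` E) (ball 0 R) + frac_perimeter \<sigma> (N.\<Phi> ` E) (ball 0 R) =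
      (\<integral>\<^sup>+p. (?f p + ?g p) * ?I p \<partial>leb2)"
    unfolding P.frac_perimeter_\<Phi>[OF E] N.frac_perimeter_\<Phi>[OF E]
    by (subst nn_integral_add[symmetric]) (auto simp: distrib_right)
  also have "\<dots> \<le> (\<integral>\<^sup>+p. ennreal ?c * (kern \<sigma> p * ?I p) \<partial>leb2)"
    using mult_right_mono[OF pt] by (intro nn_integral_mono) (simp add: mult.assoc)
  also have "\<dots> = ennreal ?c * frac_perimeter \<sigma> E (ball 0 R)"
    by (subst frac_perimeter_leb2[OF E]) (simp_all add: nn_integral_cmult)
  finally show ?thesis .
qed

text \<open>The odd terms cancel and the Jacobians add up to 2, which leaves the factor
  \<open>2 + 4 * (t * M)\<^sup>2\<close>. The larger constant 200 is that of the perimeter, so that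
  both parts of the energy carry the same factor.\<close>

lemma dirichlet_second_variation:
  assumes "shear \<psi> e M s R t" and g: "L2 (ball 0 R) g"
  shows "(\<integral>\<^sup>+y\<in>ball 0 R. ennreal ((norm (shear.push_grad \<psi> e t g (inv (shear.\<Phi> \<psi> e t) y)))\<^sup>2) \<partial>lebesgue) +
      (\<integral>\<^sup>+y\<in>ball 0 R. ennreal ((norm (shear.push_grad \<psi> e (- t) g (inv (shear.\<Phi> \<psi> e (- t)) y)))\<^sup>2) \<partial>lebesgue)
    \<le> ennreal (2 + 200 * (t * M)\<^sup>2) * (\<integral>\<^sup>+x\<in>ball 0 R. ennreal ((norm (g x))\<^sup>2) \<partial>lebesgue)"
proof -
  interpret P: shear \<psi> e M s R t by fact
  interpret N: shear \<psi> e M s R "- t" by (rule P.opposite)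
  let ?c = "2 + 200 * (t * M)\<^sup>2"
  define h where "h x = indicator (ball 0 R) x *\<^sub>R g x" for x
  have h [measurable]: "h \<in> borel_measurable lebesgue"
    using L2_iff_indicator[of "ball 0 R" g] g L2_borel by (auto simp: h_def[abs_def])
  have [measurable]: "P.push_grad h \<in> borel_measurable lebesgue" "N.push_grad h \<in> borel_measurable lebesgue"
    unfolding P.push_grad_def[abs_def] N.push_grad_def[abs_def] by measurable
  have eqP: "ennreal (P.J x * (norm (P.push_grad g x))\<^sup>2) * indicator (ball 0 R) x = ennreal (P.J x * (norm (P.push_grad h x))\<^sup>2)" for x
    by (auto simp: h_def P.push_grad_def split: split_indicator)
  have eqN: "ennreal (N.J x * (norm (N.push_grad g x))\<^sup>2) * indicator (ball 0 R) x = ennreal (N.J x * (norm (N.push_grad h x))\<^sup>2)" for x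
    by (auto simp: h_def N.push_grad_def split: split_indicator)
  have eqh: "ennreal ((norm (g x))\<^sup>2) * indicator (ball 0 R) x = ennreal ((norm (h x))\<^sup>2)" for x
    by (auto simp: h_def split: split_indicator)
  have pt: "ennreal (P.J x * (norm (P.push_grad h x))\<^sup>2) + ennreal (N.J x * (norm (N.push_grad h x))\<^sup>2) \<le>
      ennreal ?c * ennreal ((norm (h x))\<^sup>2)" for x
  proof -
    have "P.J x * (norm (P.push_grad h x))\<^sup>2 + N.J x * (norm (N.push_grad h x))\<^sup>2 \<le>
        (P.J x + N.J x) * (norm (h x))\<^sup>2 + 4 * (t * M)\<^sup>2 * (norm (h x))\<^sup>2"
      using P.push_grad_square[of x h] N.push_grad_square[of x h] by (simp add: algebra_simps)
    also have "\<dots> \<le> ?c * (norm (h x))\<^sup>2"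
      by (simp add: P.J_def N.J_def algebra_simps)
    finally show ?thesis
      using P.J_bounds(3)[of x] N.J_bounds(3)[of x]
      by (simp add: ennreal_plus[symmetric] ennreal_mult'[symmetric] ennreal_leI del: ennreal_plus)
  qed
  show ?thesis
    unfolding P.dirichlet_shear[OF g] N.dirichlet_shear[OF g] eqP eqN eqh
    by (subst nn_integral_add[symmetric], measurable, subst nn_integral_cmult[symmetric], measurable,
        rule nn_integral_mono, rule pt)
qed

section \<open>Translates of the cone are ordered\<close>

lemma ennreal_add_left_leD: "a < (\<infinity>::ennreal) \<Longrightarrow> a + b \<le> a + c \<Longrightarrow> b \<le> c"
  by (auto simp: ennreal_add_left_cancel_le)

lemma indicator_square_eq:
  "(\<lambda>x. ennreal ((norm (g x))\<^sup>2) * indicator \<Omega> x) = (\<lambda>x. ennreal ((norm (indicator \<Omega> x *\<^sub>R g x))\<^sup>2))"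
  by (auto simp: fun_eq_iff split: split_indicator)

text \<open>The maximum is paired with the union and the minimum with the intersection, which
  preserves the sign conditions. Writing L for the interaction, these two competitors give 2 J + L
  \<le> J + J(t), where J(t) is the energy transported by \<open>t\<close>, while the third one
  gives J \<le> J(-t). Adding up and cancelling the finite J leaves L on one side and the
  second-order error on the other.\<close>

lemma ordering_estimate:
  fixes u :: "real^2 \<Rightarrow> real"
  assumes min: "minimizing_pair \<sigma> (ball 0 R) u E" and sh: "shear \<psi> e M s R t" and \<sigma>: "0 < \<sigma>" "\<sigma> < 1"
  shows "interaction \<sigma> (E - shear.\<Phi> \<psi> e t ` E) (shear.\<Phi> \<psi> e t ` E - E) \<le>
    ennreal (200 * (t * M)\<^sup>2) * energy \<sigma> (ball 0 R) u E"
proof -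
  interpret P: shear \<psi> e M s R t by fact
  interpret N: shear \<psi> e M s R "- t" by (rule P.opposite)
  let ?\<Omega> = "ball (0::real^2) R"
  define g where "g = weak_grad ?\<Omega> u"
  note D = minimizing_pairD[OF min, folded g_def]
  have gL: "L2 ?\<Omega> g" using D(2) by (simp add: is_weak_grad_def)
  let ?F = "P.\<Phi> ` E" and ?F' = "N.\<Phi> ` E"
  note E = D(3)
  have Fm: "?F \<in> sets lebesgue" "?F' \<in> sets lebesgue"
    by (rule P.image_measurable[OF E], rule N.image_measurable[OF E])
  define w where "w y = u (P.\<Psi> y) - u y" for y
  define G where "G y = P.push_grad g (P.\<Psi> y) - g y" for y
  define H where "H y = (if w y > 0 then G y else 0)" for y
  have wc: "cH1 s w G" unfolding w_def[abs_def] G_def[abs_def] by (rule P.cH1_shear_diff[OF D(1,2)])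
  have wc': "cH1 s (\<lambda>y. u (N.\<Psi> y) - u y) (\<lambda>y. N.push_grad g (N.\<Psi> y) - g y)"
    by (rule N.cH1_shear_diff[OF D(1,2)])
  have mc: "cH1 s (\<lambda>y. max 0 (w y)) H" unfolding H_def[abs_def] by (rule cH1_pos_part[OF wc])
  have nc: "cH1 s (\<lambda>y. w y - max 0 (w y)) (\<lambda>y. G y - H y)" by (rule cH1_diff[OF wc mc])
  let ?D = "\<lambda>f. \<integral>\<^sup>+x\<in>?\<Omega>. ennreal ((norm (f x))\<^sup>2) \<partial>lebesgue"
  let ?P = "\<lambda>E. frac_perimeter \<sigma> E ?\<Omega>"
  let ?J = "?D g + ?P E"
  have J: "?J = energy \<sigma> ?\<Omega> u E" by (simp add: energy_def g_def)
  have fin: "?J < \<infinity>" unfolding J by (rule D(6))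
  have signs: "AE y in lebesgue. y \<in> ?F \<inter> ?\<Omega> \<longrightarrow> u (P.\<Psi> y) \<ge> 0" "AE y in lebesgue. y \<in> - ?F \<inter> ?\<Omega> \<longrightarrow> u (P.\<Psi> y) \<le> 0"
    by (rule eventually_mono[OF P.AE_\<Psi>[OF D(4)]], use P.\<Psi>_ball_iff P.mem_image_\<Psi> in auto,
        rule eventually_mono[OF P.AE_\<Psi>[OF D(5)]], use P.\<Psi>_ball_iff P.mem_image_\<Psi> in auto)
  have signs': "AE y in lebesgue. y \<in> ?F' \<inter> ?\<Omega> \<longrightarrow> u (N.\<Psi> y) \<ge> 0" "AE y in lebesgue. y \<in> - ?F' \<inter> ?\<Omega> \<longrightarrow> u (N.\<Psi> y) \<le> 0"
    by (rule eventually_mono[OF N.AE_\<Psi>[OF D(4)]], use N.\<Psi>_ball_iff N.mem_image_\<Psi> in auto,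
        rule eventually_mono[OF N.AE_\<Psi>[OF D(5)]], use N.\<Psi>_ball_iff N.mem_image_\<Psi> in auto)
  let ?DP = "?D (\<lambda>y. P.push_grad g (P.\<Psi> y))" and ?DN = "?D (\<lambda>y. N.push_grad g (N.\<Psi> y))"
  have 1: "?J \<le> ?DN + ?P ?F'"
    using minimizing_compare[OF min wc' P.sR Fm(2) N.image_outside] signs' by (simp add: g_def)
  have "?J \<le> ?D (\<lambda>y. g y + H y) + ?P (E \<union> ?F)"
    unfolding g_def
  proof (rule minimizing_compare[OF min mc P.sR])
    show "E \<union> ?F \<in> sets lebesgue" using E Fm by auto
    show "E \<union> ?F - ?\<Omega> = E - ?\<Omega>" using P.image_outside[of E] by auto
    show "AE x in lebesgue. x \<in> (E \<union> ?F) \<inter> ?\<Omega> \<longrightarrow> u x + max 0 (w x) \<ge> 0"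
      using D(4) signs(1) by eventually_elim (auto simp: w_def max_def)
    show "AE x in lebesgue. x \<in> - (E \<union> ?F) \<inter> ?\<Omega> \<longrightarrow> u x + max 0 (w x) \<le> 0"
      using D(5) signs(2) by eventually_elim (auto simp: w_def max_def)
  qed
  moreover have "?J \<le> ?D (\<lambda>y. g y + (G y - H y)) + ?P (E \<inter> ?F)"
    unfolding g_def
  proof (rule minimizing_compare[OF min nc P.sR])
    show "E \<inter> ?F \<in> sets lebesgue" using E Fm by auto
    show "E \<inter> ?F - ?\<Omega> = E - ?\<Omega>" using P.image_outside[of E] by auto
    show "AE x in lebesgue. x \<in> (E \<inter> ?F) \<inter> ?\<Omega> \<longrightarrow> u x + (w x - max 0 (w x)) \<ge> 0"
      using D(4) signs(1) by eventually_elim (auto simp: w_def max_def)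
    show "AE x in lebesgue. x \<in> - (E \<inter> ?F) \<inter> ?\<Omega> \<longrightarrow> u x + (w x - max 0 (w x)) \<le> 0"
      using D(5) signs(2) by eventually_elim (auto simp: w_def max_def)
  qed
  \<comment> \<open>At each point \<open>H\<close> is either 0 or \<open>G\<close>, so the two
    gradients on the left are those on the right, possibly interchanged.\<close>
  moreover have "?D (\<lambda>y. g y + H y) + ?D (\<lambda>y. g y + (G y - H y)) = ?D g + ?DP"
  proof -
    have gi: "(\<lambda>x. indicator ?\<Omega> x *\<^sub>R g x) \<in> borel_measurable lebesgue"
      using L2_iff_indicator[of ?\<Omega> g] gL L2_borel by auto
    have Gi: "(\<lambda>x. indicator ?\<Omega> x *\<^sub>R G x) \<in> borel_measurable lebesgue"
      and Hi: "(\<lambda>x. indicator ?\<Omega> x *\<^sub>R H x) \<in> borel_measurable lebesgue"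
      using cH1D(8)[OF wc] cH1D(8)[OF mc] by (auto intro!: borel_measurable_scaleR borel_measurable_indicator)
    have m1: "(\<lambda>x. indicator ?\<Omega> x *\<^sub>R (g x + H x)) \<in> borel_measurable lebesgue"
      unfolding scaleR_add_right by (rule borel_measurable_add[OF gi Hi])
    have m2: "(\<lambda>x. indicator ?\<Omega> x *\<^sub>R (g x + (G x - H x))) \<in> borel_measurable lebesgue"
      unfolding scaleR_add_right scaleR_diff_right by (rule borel_measurable_add[OF gi borel_measurable_diff[OF Gi Hi]])
    have m3: "(\<lambda>x. indicator ?\<Omega> x *\<^sub>R (g x + G x)) \<in> borel_measurable lebesgue"
      unfolding scaleR_add_right by (rule borel_measurable_add[OF gi Gi])
    have gG: "P.push_grad g (P.\<Psi> y) = g y + G y" for y by (simp add: G_def)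
    have nm: "(\<lambda>x. ennreal ((norm (f x))\<^sup>2)) \<in> borel_measurable lebesgue" if "f \<in> borel_measurable lebesgue" for f :: "real^2 \<Rightarrow> real^2"
      using that by measurable
    show ?thesis
      unfolding gG indicator_square_eq
        nn_integral_add[OF nm[OF m1] nm[OF m2], symmetric] nn_integral_add[OF nm[OF gi] nm[OF m3], symmetric]
      by (intro nn_integral_cong) (auto simp: H_def add.commute)
  qed
  moreover have "?P (E \<union> ?F) + ?P (E \<inter> ?F) + interaction \<sigma> (E - ?F) (?F - E) \<le> ?P E + ?P ?F"
    by (rule frac_perimeter_submodular) (use E Fm P.image_outside[of E] in auto)
  ultimately have "?J + ?J + interaction \<sigma> (E - ?F) (?F - E) \<le> ?D g + ?DP + (?P E + ?P ?F)"
  proof -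
    assume a: "?J \<le> ?D (\<lambda>y. g y + H y) + ?P (E \<union> ?F)" and b: "?J \<le> ?D (\<lambda>y. g y + (G y - H y)) + ?P (E \<inter> ?F)"
      and c: "?D (\<lambda>y. g y + H y) + ?D (\<lambda>y. g y + (G y - H y)) = ?D g + ?DP"
      and d: "?P (E \<union> ?F) + ?P (E \<inter> ?F) + interaction \<sigma> (E - ?F) (?F - E) \<le> ?P E + ?P ?F"
    have "?J + ?J + interaction \<sigma> (E - ?F) (?F - E) \<le>
        (?D (\<lambda>y. g y + H y) + ?P (E \<union> ?F)) + (?D (\<lambda>y. g y + (G y - H y)) + ?P (E \<inter> ?F)) + interaction \<sigma> (E - ?F) (?F - E)"
      by (intro add_mono a b order_refl)
    also have "\<dots> = (?D g + ?DP) + (?P (E \<union> ?F) + ?P (E \<inter> ?F) + interaction \<sigma> (E - ?F) (?F - E))"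
      unfolding c[symmetric] by (simp only: ac_simps)
    also have "\<dots> \<le> ?D g + ?DP + (?P E + ?P ?F)" by (intro add_mono d order_refl)
    finally show ?thesis .
  qed
  then have "?J + (?J + interaction \<sigma> (E - ?F) (?F - E)) \<le> ?J + (?DP + ?P ?F)"
    by (simp add: ac_simps)
  then have 2: "?J + interaction \<sigma> (E - ?F) (?F - E) \<le> ?DP + ?P ?F"
    by (rule ennreal_add_left_leD[OF fin])
  have "(?J + interaction \<sigma> (E - ?F) (?F - E)) + ?J \<le> (?DP + ?P ?F) + (?DN + ?P ?F')"
    by (rule add_mono[OF 2 1])
  also have "\<dots> = (?DP + ?DN) + (?P ?F + ?P ?F')" by (simp add: ac_simps)
  also have "\<dots> \<le> ennreal (2 + 200 * (t * M)\<^sup>2) * ?D g + ennreal (2 + 200 * (t * M)\<^sup>2) * ?P E"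
    by (rule add_mono[OF dirichlet_second_variation[OF sh gL] frac_perimeter_second_variation[OF sh \<sigma> E]])
  also have "\<dots> = ennreal (2 + 200 * (t * M)\<^sup>2) * ?J" by (simp add: distrib_left)
  also have "\<dots> = ?J + (?J + ennreal (200 * (t * M)\<^sup>2) * ?J)"
  proof -
    have "ennreal (2 + 200 * (t * M)\<^sup>2) = 1 + (1 + ennreal (200 * (t * M)\<^sup>2))"
      by (simp flip: ennreal_plus ennreal_1)
    then show ?thesis by (simp only: distrib_right mult_1)
  qed
  finally have "?J + (?J + interaction \<sigma> (E - ?F) (?F - E)) \<le> ?J + (?J + ennreal (200 * (t * M)\<^sup>2) * ?J)"
    by (simp add: ac_simps)
  from ennreal_add_left_leD[OF fin ennreal_add_left_leD[OF fin this]]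
  show ?thesis unfolding J[symmetric] .
qed

section \<open>Blow-up at the vertex of the cone\<close>

lemma interaction_lower_bound:
  fixes X Y :: "'a::euclidean_space set"
  assumes [measurable]: "X \<in> sets lebesgue" "Y \<in> sets lebesgue" and disj: "X \<inter> Y = {}"
    and d: "\<And>x y. x \<in> X \<Longrightarrow> y \<in> Y \<Longrightarrow> norm (x - y) \<le> d" and \<sigma>: "\<sigma> > 0"
  shows "ennreal (1 / d powr (real DIM('a) + \<sigma>)) * emeasure lebesgue X * emeasure lebesgue Y \<le> interaction \<sigma> X Y"
proof -
  let ?k = "ennreal (1 / d powr (real DIM('a) + \<sigma>))"
  have "(\<integral>\<^sup>+x\<in>X. (?k * emeasure lebesgue Y) \<partial>lebesgue) \<le> interaction \<sigma> X Y"
    unfolding interaction_def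
  proof (rule nn_integral_mono)
    fix x :: 'a
    have "?k * emeasure lebesgue Y \<le> (\<integral>\<^sup>+y\<in>Y. ennreal (1 / norm (x - y) powr (real DIM('a) + \<sigma>)) \<partial>lebesgue)" if x: "x \<in> X"
    proof -
      have "?k * emeasure lebesgue Y = (\<integral>\<^sup>+y\<in>Y. ?k \<partial>lebesgue)" by (rule nn_integral_cmult_indicator[symmetric]) simp
      also have "\<dots> \<le> (\<integral>\<^sup>+y\<in>Y. ennreal (1 / norm (x - y) powr (real DIM('a) + \<sigma>)) \<partial>lebesgue)"
      proof (rule nn_integral_mono)
        fix y
        have "1 / d powr (real DIM('a) + \<sigma>) \<le> 1 / norm (x - y) powr (real DIM('a) + \<sigma>)" if y: "y \<in> Y"
        proof -
          \<comment> \<open>On the diagonal the kernel has the value 0 and the bound would fail;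
            disjointness excludes it.\<close>
          have "norm (x - y) > 0" using disj x y by auto
          then show ?thesis using d[OF x y] \<sigma> by (intro divide_left_mono powr_mono2 mult_pos_pos) auto
        qed
        then show "?k * indicator Y y \<le> ennreal (1 / norm (x - y) powr (real DIM('a) + \<sigma>)) * indicator Y y"
          by (auto split: split_indicator intro: ennreal_leI)
      qed
      finally show ?thesis .
    qed
    then show "?k * emeasure lebesgue Y * indicator X x \<le>
        (\<integral>\<^sup>+y\<in>Y. ennreal (1 / norm (x - y) powr (real DIM('a) + \<sigma>)) \<partial>lebesgue) * indicator X x"
      by (auto split: split_indicator)
  qed
  then show ?thesis
    by (subst (asm) nn_integral_cmult_indicator) (auto simp: mult_ac)
qed

text \<open>\<open>\<psi>\<close> and \<open>M\<close> are fixed before \<open>t\<close>, because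
  the estimate is used with \<open>t\<close> tending to 0 for a fixed direction
  \<open>e\<close>.\<close>

lemma shear_exists:
  fixes e :: "real^2"
  obtains \<psi> M s where "M > 0" "\<And>t. \<bar>t\<bar> * M \<le> 1 / 16 \<Longrightarrow> shear \<psi> e M s 2 t" "\<And>x. x \<in> cball 0 1 \<Longrightarrow> \<psi> x = 1"
proof -
  obtain \<psi> :: "real^2 \<Rightarrow> real" and s where \<psi>: "s < 2" "smooth \<psi>" "test_fun (ball 0 2) \<psi>"
    "\<And>x. x \<in> cball 0 1 \<Longrightarrow> \<psi> x = 1" "\<And>x. x \<notin> cball 0 s \<Longrightarrow> \<psi> x = 0"
    "\<And>x a b. pd (\<lambda>z. pd \<psi> z a) x b = pd (\<lambda>z. pd \<psi> z b) x a"
    by (rule cutoff_exists[of 1 2, where 'a="real^2"]) auto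
  obtain L where L: "L > 0" "\<And>x y. \<bar>\<psi> x - \<psi> y\<bar> \<le> L * norm (x - y)" using test_fun_lipschitz[OF \<psi>(3)] by auto
  obtain B where B: "B > 0" "\<And>x h. \<bar>pd \<psi> x h\<bar> \<le> B * norm h" using test_fun_pd_bound[OF \<psi>(3)] by auto
  define M where "M = (L + B + 1) * (norm e + 1)"
  have gb: "norm (grad \<psi> x) \<le> B" for x
  proof (cases "grad \<psi> x = 0")
    case False
    have "(norm (grad \<psi> x))\<^sup>2 = pd \<psi> x (grad \<psi> x)"
      by (simp add: power2_norm_eq_inner grad_inner[OF \<psi>(2)])
    also have "\<dots> \<le> B * norm (grad \<psi> x)" using B(2)[of x "grad \<psi> x"] by linarith
    finally show ?thesis using False by (simp add: power2_eq_square)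
  qed (use B in simp)
  show thesis
  proof (rule that[of M \<psi> s])
    show "M > 0" unfolding M_def using L(1) B(1) by (intro mult_pos_pos) (auto intro: add_nonneg_pos)
    show "\<psi> x = 1" if "x \<in> cball 0 1" for x by (rule \<psi>(4)[OF that])
    fix t assume t: "\<bar>t\<bar> * M \<le> 1 / 16"
    show "shear \<psi> e M s 2 t"
    proof
      show "test_fun (ball 0 2) \<psi>" "s < 2" "\<bar>t\<bar> * M \<le> 1 / 16" by fact+
      show "\<psi> x = 0" if "x \<notin> cball 0 s" for x by (rule \<psi>(5)[OF that])
      show "pd (\<lambda>z. pd \<psi> z a) x b = pd (\<lambda>z. pd \<psi> z b) x a" for x a b by (rule \<psi>(6))
      show "norm ((\<psi> x - \<psi> y) *\<^sub>R e) \<le> M * norm (x - y)" for x y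
      proof -
        have "norm ((\<psi> x - \<psi> y) *\<^sub>R e) \<le> (L * norm (x - y)) * norm e"
          using mult_right_mono[OF L(2) norm_ge_zero, of x y e] by simp
        also have "\<dots> = (L * norm e) * norm (x - y)" by simp
        also have "\<dots> \<le> M * norm (x - y)"
          unfolding M_def using L B by (intro mult_right_mono mult_mono) auto
        finally show ?thesis .
      qed
      show "norm (grad \<psi> x) * norm e \<le> M" for x
        unfolding M_def using gb[of x] L B by (intro mult_mono) auto
    qed
  qed
qed

text \<open>Near the origin \<open>\<Phi>\<close> is the translation by
  \<open>t *\<^sub>R e\<close>, and as \<open>E\<close> is a cone, \<open>E\<close> and its
  translate at scale \<open>t\<close> are \<open>E\<close> and \<open>T\<close> shrunk by
  \<open>t\<close>. The shrunken sets have measures \<open>t\<^sup>2 * ?a\<close> and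
  \<open>t\<^sup>2 * ?b\<close> and mutual distances at most \<open>2 * t * \<rho>\<close>. The
  ordering estimate then bounds \<open>?a * ?b\<close> by a multiple of
  \<open>t powr \<sigma>\<close>, which tends to 0.\<close>

lemma cone_translate_product_null:
  fixes u :: "real^2 \<Rightarrow> real" and e :: "real^2"
  assumes min: "minimizing_pair \<sigma> (ball 0 2) u E" and \<sigma>: "0 < \<sigma>" "\<sigma> < 1"
    and cone: "\<And>t. t > 0 \<Longrightarrow> (\<lambda>x. t *\<^sub>R x) ` E = E" and \<rho>: "\<rho> > 0"
  defines "T \<equiv> (\<lambda>x. x + e) ` E"
  shows "measure lebesgue ((E - T) \<inter> ball 0 \<rho>) * measure lebesgue ((T - E) \<inter> ball 0 \<rho>) = 0"
proof -
  obtain \<psi> M s where M: "M > 0" and sh: "\<And>t. \<bar>t\<bar> * M \<le> 1 / 16 \<Longrightarrow> shear \<psi> e M s 2 t"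
    and one: "\<And>x. x \<in> cball 0 1 \<Longrightarrow> \<psi> x = 1"
    using shear_exists[of e] by metis
  have E [measurable]: "E \<in> sets lebesgue" by (rule minimizing_pairD(3)[OF min])
  have T [measurable]: "T \<in> sets lebesgue"
    using lebesgue_sets_translation[OF E, of e] by (simp add: T_def add.commute)
  let ?A = "(E - T) \<inter> ball 0 \<rho>" and ?B = "(T - E) \<inter> ball 0 \<rho>"
  have ABm: "?A \<in> sets lebesgue" "?B \<in> sets lebesgue" by auto
  have lm: "?A \<in> lmeasurable" "?B \<in> lmeasurable"
    using fmeasurable_Int_fmeasurable[OF lmeasurable_ball, of "E - T" 0 \<rho>]
      fmeasurable_Int_fmeasurable[OF lmeasurable_ball, of "T - E" 0 \<rho>] E T
    by (auto simp: Int_commute)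
  let ?a = "measure lebesgue ?A" and ?b = "measure lebesgue ?B"
  let ?e = "energy \<sigma> (ball 0 2) u E"
  obtain c where c: "?e = ennreal c" "c \<ge> 0"
    using minimizing_pairD(6)[OF min] by (cases ?e) auto
  \<comment> \<open>Three requirements: the shear is admissible, the shrunken ball lies in the ball
    of radius 1/2, and \<open>t *\<^sub>R e\<close> has length at most 1/2. By the last two, points
    and their preimages stay where \<open>\<psi>\<close> is 1. The summand 1 covers
    \<open>e = 0\<close>.\<close>
  define t1 where "t1 = min (1 / (16 * M)) (min (1 / (2 * \<rho>)) (1 / (2 * (norm e + 1))))"
  have t1: "t1 > 0" using M \<rho> by (auto simp: t1_def intro!: divide_pos_pos mult_pos_pos add_nonneg_pos)
  \<comment> \<open>What is left of the right side once both sides are divided by the fourth power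
    of \<open>t\<close>.\<close>
  define C where "C = 200 * M\<^sup>2 * c * (2 * \<rho>) powr (2 + \<sigma>)"
  have key: "?a * ?b \<le> C * t powr \<sigma>" if t: "0 < t" "t \<le> t1" for t
  proof -
    have tM: "\<bar>t\<bar> * M \<le> 1 / 16" and t\<rho>: "t * \<rho> \<le> 1 / 2" and te: "t * norm e \<le> 1 / 2"
    proof -
      have "t \<le> 1 / (16 * M)" "t \<le> 1 / (2 * \<rho>)" "t \<le> 1 / (2 * (norm e + 1))" using t by (auto simp: t1_def)
      then have b: "t * (16 * M) \<le> 1" "t * (2 * \<rho>) \<le> 1" "t * (2 * (norm e + 1)) \<le> 1"
        using M \<rho> by (simp_all add: pos_le_divide_eq add_nonneg_pos)
      show "\<bar>t\<bar> * M \<le> 1 / 16" "t * \<rho> \<le> 1 / 2" using b(1,2) t by auto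
      have "2 * (t * norm e) + 2 * t \<le> 1" using b(3) by (simp add: algebra_simps)
      then show "t * norm e \<le> 1 / 2" using t by linarith
    qed
    interpret S: shear \<psi> e M s 2 t by (rule sh[OF tM])
    have \<Psi>: "S.\<Psi> y = y - t *\<^sub>R e" if "norm y \<le> 1 / 2" for y
    proof -
      have "norm (y - t *\<^sub>R e) \<le> 1" using norm_triangle_ineq4[of y "t *\<^sub>R e"] that te t by simp
      then have "S.\<Phi> (y - t *\<^sub>R e) = y" using one[of "y - t *\<^sub>R e"] by (simp add: S.\<Phi>_def)
      then show ?thesis using S.\<Psi>_\<Phi>[of "y - t *\<^sub>R e"] by simp
    qed
    have E_iff: "t *\<^sub>R x \<in> E \<longleftrightarrow> x \<in> E" for x
    proof
      assume "t *\<^sub>R x \<in> E"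
      then have "t *\<^sub>R x \<in> (\<lambda>x. t *\<^sub>R x) ` E" using cone[OF t(1)] by simp
      then show "x \<in> E" using t by auto
    next
      assume "x \<in> E" then show "t *\<^sub>R x \<in> E" using cone[OF t(1)] by blast
    qed
    have T_iff: "t *\<^sub>R x \<in> S.\<Phi> ` E \<longleftrightarrow> x \<in> T" if "x \<in> ball 0 \<rho>" for x
    proof -
      have "t * norm x \<le> t * \<rho>" using that t by (intro mult_left_mono) auto
      moreover have "norm (t *\<^sub>R x) = t * norm x" using t by simp
      ultimately have "norm (t *\<^sub>R x) \<le> 1 / 2" using t\<rho> by linarith
      from \<Psi>[OF this] have "t *\<^sub>R x \<in> S.\<Phi> ` E \<longleftrightarrow> t *\<^sub>R (x - e) \<in> E"
        by (simp add: S.mem_image_\<Psi> scaleR_diff_right)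
      also have "\<dots> \<longleftrightarrow> x \<in> T" unfolding E_iff T_def by (force simp: image_iff algebra_simps)
      finally show ?thesis .
    qed
    let ?X = "(\<lambda>x. t *\<^sub>R x) ` ?A" and ?Y = "(\<lambda>x. t *\<^sub>R x) ` ?B"
    have XY: "?X \<subseteq> E - S.\<Phi> ` E" "?Y \<subseteq> S.\<Phi> ` E - E"
    proof -
      have "t *\<^sub>R x \<in> E - S.\<Phi> ` E" if "x \<in> ?A" for x using E_iff[of x] T_iff[of x] that by blast
      then show "?X \<subseteq> E - S.\<Phi> ` E" by (rule image_subsetI)
      have "t *\<^sub>R x \<in> S.\<Phi> ` E - E" if "x \<in> ?B" for x using E_iff[of x] T_iff[of x] that by blast
      then show "?Y \<subseteq> S.\<Phi> ` E - E" by (rule image_subsetI)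
    qed
    have XYm: "?X \<in> sets lebesgue" "?Y \<in> sets lebesgue"
    proof -
      have "norm (t *\<^sub>R x - t *\<^sub>R y) = norm (t *\<^sub>R (x - y))" for x y :: "real^2"
        by (simp only: scaleR_diff_right)
      then have l: "norm (t *\<^sub>R x - t *\<^sub>R y) \<le> t * norm (x - y)" for x y :: "real^2" using t by simp
      show "?X \<in> sets lebesgue" "?Y \<in> sets lebesgue"
        by (rule lipschitz_image_lebesgue[OF ABm(1) l], rule lipschitz_image_lebesgue[OF ABm(2) l])
    qed
    have em: "emeasure lebesgue ?X = ennreal (t\<^sup>2 * ?a)" "emeasure lebesgue ?Y = ennreal (t\<^sup>2 * ?b)"
      using emeasure_lebesgue_affine[of t 0 ?A] emeasure_lebesgue_affine[of t 0 ?B] t lm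
      by (simp_all add: emeasure_eq_measure2 ennreal_mult)
    have "ennreal (1 / (2 * t * \<rho>) powr (2 + \<sigma>)) * emeasure lebesgue ?X * emeasure lebesgue ?Y \<le> interaction \<sigma> ?X ?Y"
    proof -
      have "norm (x - y) \<le> 2 * t * \<rho>" if xy: "x \<in> ?X" "y \<in> ?Y" for x y
      proof -
        obtain a b where ab: "x = t *\<^sub>R a" "y = t *\<^sub>R b" "norm a < \<rho>" "norm b < \<rho>"
        proof -
          obtain a where "x = t *\<^sub>R a" "a \<in> ?A" using xy(1) by (rule imageE)
          moreover obtain b where "y = t *\<^sub>R b" "b \<in> ?B" using xy(2) by (rule imageE)
          ultimately show thesis using that[of a b] by simp
        qed
        have "norm (x - y) = t * norm (a - b)" using t by (simp add: ab scaleR_diff_right[symmetric])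
        also have "\<dots> \<le> t * (\<rho> + \<rho>)"
          using norm_triangle_ineq4[of a b] ab t by (intro mult_left_mono) auto
        finally show ?thesis by simp
      qed
      moreover have "?X \<inter> ?Y = {}" using XY by blast
      ultimately show ?thesis
        using interaction_lower_bound[OF XYm, of "2 * t * \<rho>" \<sigma>] \<sigma> by simp
    qed
    also have "\<dots> \<le> interaction \<sigma> (E - S.\<Phi> ` E) (S.\<Phi> ` E - E)"
      unfolding interaction_def using XY
      by (intro nn_integral_mono mult_mono nn_integral_mono) (auto split: split_indicator)
    also have "\<dots> \<le> ennreal (200 * (t * M)\<^sup>2) * ?e" by (rule ordering_estimate[OF min S.shear_axioms \<sigma>])
    finally have le: "ennreal (1 / (2 * t * \<rho>) powr (2 + \<sigma>)) * ennreal (t\<^sup>2 * ?a) * ennreal (t\<^sup>2 * ?b) \<le>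
        ennreal (200 * (t * M)\<^sup>2) * ennreal c"
      unfolding em c(1) .
    have e3: "ennreal (k * x * y) = ennreal k * ennreal x * ennreal y" if "k \<ge> 0" "x \<ge> 0" "y \<ge> 0" for k x y
      using that by (simp add: ennreal_mult)
    have e2: "ennreal (x * y) = ennreal x * ennreal y" if "x \<ge> 0" "y \<ge> 0" for x y
      using that by (rule ennreal_mult)
    have "ennreal (1 / (2 * t * \<rho>) powr (2 + \<sigma>) * (t\<^sup>2 * ?a) * (t\<^sup>2 * ?b)) \<le> ennreal (200 * (t * M)\<^sup>2 * c)"
    proof -
      have "ennreal (1 / (2 * t * \<rho>) powr (2 + \<sigma>) * (t\<^sup>2 * ?a) * (t\<^sup>2 * ?b)) =
          ennreal (1 / (2 * t * \<rho>) powr (2 + \<sigma>)) * ennreal (t\<^sup>2 * ?a) * ennreal (t\<^sup>2 * ?b)"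
        by (rule e3) auto
      moreover have "ennreal (200 * (t * M)\<^sup>2 * c) = ennreal (200 * (t * M)\<^sup>2) * ennreal c"
        by (rule e2) (use c in auto)
      ultimately show ?thesis using le by (simp only:)
    qed
    then have "1 / (2 * t * \<rho>) powr (2 + \<sigma>) * (t\<^sup>2 * ?a) * (t\<^sup>2 * ?b) \<le> 200 * (t * M)\<^sup>2 * c"
      using c by (subst (asm) ennreal_le_iff) auto
    moreover have pw: "(2 * t * \<rho>) powr (2 + \<sigma>) = (2 * \<rho>) powr (2 + \<sigma>) * t\<^sup>2 * t powr \<sigma>"
    proof -
      have "(2 * t * \<rho>) powr (2 + \<sigma>) = (2 * \<rho>) powr (2 + \<sigma>) * t powr (2 + \<sigma>)"
        using t \<rho> by (simp add: powr_mult[symmetric] mult_ac)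
      also have "t powr (2 + \<sigma>) = t\<^sup>2 * t powr \<sigma>" using t by (simp add: powr_add)
      finally show ?thesis by simp
    qed
    ultimately have "(t\<^sup>2 * ?a) * (t\<^sup>2 * ?b) \<le> 200 * (t * M)\<^sup>2 * c * ((2 * \<rho>) powr (2 + \<sigma>) * t\<^sup>2 * t powr \<sigma>)"
      using t \<rho> by (simp add: divide_le_eq mult_ac)
    then have "(t\<^sup>2 * t\<^sup>2) * (?a * ?b) \<le> (t\<^sup>2 * t\<^sup>2) * (C * t powr \<sigma>)"
      by (simp add: C_def power_mult_distrib mult_ac)
    then show ?thesis using t by (simp add: mult_le_cancel_left)
  qed
  have "?a * ?b \<le> 0"
  proof (rule tendsto_lowerbound)
    have "((\<lambda>t. C * t powr \<sigma>) \<longlongrightarrow> C * 0 powr \<sigma>) (at_right 0)"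
      using \<sigma> by (intro tendsto_mult tendsto_const tendsto_powr' tendsto_ident_at) (auto simp: eventually_at_right_field intro!: exI[of _ 1])
    then show "((\<lambda>t. C * t powr \<sigma>) \<longlongrightarrow> 0) (at_right 0)" using \<sigma> by simp
    show "eventually (\<lambda>t. ?a * ?b \<le> C * t powr \<sigma>) (at_right 0)"
      unfolding eventually_at_right_field using t1 key by (intro exI[of _ t1]) auto
  qed simp
  moreover have "?a * ?b \<ge> 0" by simp
  ultimately show ?thesis by linarith
qed

lemma AE_of_balls_null:
  fixes A :: "'a::euclidean_space set"
  assumes "A \<in> sets lebesgue" "\<And>n::nat. measure lebesgue (A \<inter> ball 0 (real (Suc n))) = 0"
  shows "AE x in lebesgue. x \<notin> A"
proof -
  have "A \<inter> ball 0 (real (Suc n)) \<in> null_sets lebesgue" for n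
  proof -
    have "A \<inter> ball 0 (real (Suc n)) \<in> lmeasurable"
      using fmeasurable_Int_fmeasurable[OF lmeasurable_ball assms(1)] by (simp add: Int_commute)
    then show ?thesis using assms(2)[of n] by (simp add: emeasure_eq_measure2 null_setsI fmeasurableD)
  qed
  then have "AE x in lebesgue. \<forall>n::nat. x \<notin> A \<inter> ball 0 (real (Suc n))"
    unfolding AE_all_countable by (intro allI AE_not_in)
  then show ?thesis
  proof (rule eventually_mono)
    fix x assume a: "\<forall>n::nat. x \<notin> A \<inter> ball 0 (real (Suc n))"
    obtain n :: nat where "norm x < real n" using reals_Archimedean2 by blast
    then have "x \<in> ball 0 (real (Suc n))" by simp
    then show "x \<notin> A" using a by blast
  qed
qed

text \<open>For each radius one of the two differences is null in the ball. Which one might depend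
  on the radius, but both measures grow with it, so a single alternative holds for all
  radii.\<close>

lemma cone_translate_ordered:
  fixes u :: "real^2 \<Rightarrow> real" and e :: "real^2"
  assumes min: "minimizing_pair \<sigma> (ball 0 2) u E" and \<sigma>: "0 < \<sigma>" "\<sigma> < 1"
    and cone: "\<And>t. t > 0 \<Longrightarrow> (\<lambda>x. t *\<^sub>R x) ` E = E"
  shows "(AE x in lebesgue. x \<in> E \<longrightarrow> x + e \<in> E) \<or> (AE x in lebesgue. x \<in> E \<longrightarrow> x - e \<in> E)"
proof -
  define T where "T = (\<lambda>x. x + e) ` E"
  have E: "E \<in> sets lebesgue" by (rule minimizing_pairD(3)[OF min])
  have T: "T \<in> sets lebesgue"
    using lebesgue_sets_translation[OF E, of e] by (simp add: T_def add.commute)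
  have T_iff: "x \<in> T \<longleftrightarrow> x - e \<in> E" for x by (force simp: T_def image_iff algebra_simps)
  let ?a = "\<lambda>n::nat. measure lebesgue ((E - T) \<inter> ball 0 (real (Suc n)))"
  let ?b = "\<lambda>n::nat. measure lebesgue ((T - E) \<inter> ball 0 (real (Suc n)))"
  have prod: "?a n * ?b n = 0" for n
    unfolding T_def by (rule cone_translate_product_null[OF min \<sigma> cone]) auto
  have lm: "S \<inter> ball 0 r \<in> lmeasurable" if "S \<in> sets lebesgue" for S :: "(real^2) set" and r
    using fmeasurable_Int_fmeasurable[OF lmeasurable_ball that] by (simp add: Int_commute)
  have mono: "?b m \<le> ?b n" if "m \<le> n" for m n
    using that E T by (intro measure_mono_fmeasurable[OF _ fmeasurableD[OF lm] lm]) auto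
  have mono': "?a m \<le> ?a n" if "m \<le> n" for m n
    using that E T by (intro measure_mono_fmeasurable[OF _ fmeasurableD[OF lm] lm]) auto
  have "(\<forall>n. ?a n = 0) \<or> (\<forall>n. ?b n = 0)"
  proof (rule ccontr)
    assume "\<not> ?thesis"
    then obtain m n where mn: "?a m \<noteq> 0" "?b n \<noteq> 0" by blast
    have "?a (max m n) > 0" "?b (max m n) > 0"
      using mono'[of m "max m n"] mono[of n "max m n"] mn
      by (smt (verit) max.cobounded1 measure_nonneg, smt (verit) max.cobounded2 measure_nonneg)
    then show False using prod[of "max m n"] by simp
  qed
  then show ?thesis
  proof
    assume "\<forall>n. ?a n = 0"
    then have "AE x in lebesgue. x \<notin> E - T" using E T by (intro AE_of_balls_null) auto
    then have "AE x in lebesgue. x \<in> E \<longrightarrow> x - e \<in> E" by (rule eventually_mono) (auto simp: T_iff)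
    then show ?thesis ..
  next
    assume "\<forall>n. ?b n = 0"
    then have "AE x in lebesgue. x \<notin> T - E" using E T by (intro AE_of_balls_null) auto
    then have "AE x in lebesgue. e + 1 *\<^sub>R x \<notin> T - E" by (rule AE_affine) simp
    then have "AE x in lebesgue. x \<in> E \<longrightarrow> x + e \<in> E"
      by (rule eventually_mono) (auto simp: T_iff add.commute)
    then show ?thesis ..
  qed
qed

section \<open>Cones with ordered translates are half-planes\<close>

lemma lebesgue_borel_representative:
  fixes E :: "'a::euclidean_space set"
  assumes "E \<in> sets lebesgue"
  obtains S where "S \<in> sets borel" "AE x in lebesgue. x \<in> E \<longleftrightarrow> x \<in> S"
proof -
  obtain S N N' where S: "E = S \<union> N" "N \<subseteq> N'" "N' \<in> null_sets lborel" "S \<in> sets lborel"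
    using assms by (rule sets_completionE)
  have "AE x in lebesgue. x \<notin> N'"
    by (intro AE_not_in null_sets_completionI S(3))
  then have "AE x in lebesgue. x \<in> E \<longleftrightarrow> x \<in> S"
    by (rule eventually_mono) (use S in auto)
  then show thesis using that S(4) by simp
qed

lemma emeasure_0_AE: "A \<in> sets M \<Longrightarrow> AE x in M. x \<notin> A \<Longrightarrow> emeasure M A = 0"
  using AE_iff_null_sets[of A M] by auto

text \<open>The measurable set on which Fubini is applied is built from a Borel representative of \<open>E\<close>,
  as the preimage of a Lebesgue set under addition need not lie in the product sigma-algebra.\<close>

lemma exists_translate_subset:
  fixes E H :: "'a::euclidean_space set"
  assumes E: "E \<in> sets lebesgue" and H: "open H" and \<delta>: "emeasure lebesgue (E \<inter> ball 0 \<delta>) > 0"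
    and K: "\<And>k. k \<in> H \<Longrightarrow> AE x in lebesgue. x \<in> E \<longrightarrow> x + k \<in> E"
  obtains x where "norm x < \<delta>" "AE y in lebesgue. y \<in> H \<longrightarrow> x + y \<in> E"
proof -
  obtain S where S [measurable]: "S \<in> sets borel" and SE: "AE x in lebesgue. x \<in> E \<longleftrightarrow> x \<in> S"
    using lebesgue_borel_representative[OF E] by blast
  have shift: "AE x in lebesgue. x + k \<in> E \<longleftrightarrow> x + k \<in> S" for k
    using AE_affine[OF SE, of 1 k] by (simp add: add.commute)
  have [measurable]: "H \<in> sets borel" using H by simp
  have "AE x in lborel. k \<in> H \<longrightarrow> x \<in> S \<longrightarrow> x + k \<in> S" for k
  proof (cases "k \<in> H")
    case True
    have "AE x in lebesgue. k \<in> H \<longrightarrow> x \<in> S \<longrightarrow> x + k \<in> S"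
      using K[OF True] SE shift[of k] by eventually_elim auto
    then show ?thesis by (simp add: AE_completion_iff)
  qed simp
  \<comment> \<open>What holds for every \<open>k\<close> and almost every \<open>x\<close> holds,
    by Fubini, for almost every \<open>x\<close> and almost every \<open>k\<close>. As
    \<open>E\<close> has positive measure near 0, one such \<open>x\<close> can be chosen
    there.\<close>
  then have "AE k in lborel. AE x in lborel. k \<in> H \<longrightarrow> x \<in> S \<longrightarrow> x + k \<in> S" by simp
  moreover have "Measurable.pred (lborel \<Otimes>\<^sub>M lborel) (\<lambda>p::'a \<times> 'a. snd p \<in> H \<longrightarrow> fst p \<in> S \<longrightarrow> fst p + snd p \<in> S)"
    by measurable
  ultimately have "AE x in lborel. AE k in lborel. k \<in> H \<longrightarrow> x \<in> S \<longrightarrow> x + k \<in> S"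
    by (subst lborel_pair.AE_commute) (auto simp: pred_def)
  then have ae: "AE x in lebesgue. x \<in> S \<longrightarrow> (AE k in lebesgue. k \<in> H \<longrightarrow> x + k \<in> S)"
    by (simp add: AE_completion_iff) (auto elim!: eventually_mono)
  have "\<exists>x\<in>S \<inter> ball 0 \<delta>. AE k in lebesgue. k \<in> H \<longrightarrow> x + k \<in> S"
  proof (rule ccontr)
    assume n: "\<not> ?thesis"
    have "AE x in lebesgue. x \<notin> E \<inter> ball 0 \<delta>"
      using ae SE by eventually_elim (use n in auto)
    then have "emeasure lebesgue (E \<inter> ball 0 \<delta>) = 0"
      using E by (intro emeasure_0_AE) auto
    then show False using \<delta> by simp
  qed
  then obtain x where x: "x \<in> ball 0 \<delta>" "AE k in lebesgue. k \<in> H \<longrightarrow> x + k \<in> S" by blast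
  have "AE k in lebesgue. x + k \<in> E \<longleftrightarrow> x + k \<in> S"
    using AE_affine[OF SE, of 1 x] by simp
  then have "AE y in lebesgue. y \<in> H \<longrightarrow> x + y \<in> E"
    using x(2) by eventually_elim auto
  then show thesis using that x(1) by simp
qed

text \<open>There are points \<open>x\<close> arbitrarily close to 0 such that \<open>x\<close> plus
  the open half-space lies in \<open>E\<close> almost everywhere. With \<open>x\<close> of norm
  below \<open>1 / real (Suc n)\<close> this covers the half-space at height
  \<open>norm a / real (Suc n)\<close>, and \<open>n\<close> tends to infinity.\<close>

lemma AE_halfspace_of_translates:
  fixes E :: "'a::euclidean_space set"
  assumes E: "E \<in> sets lebesgue" and pos: "\<And>\<delta>. \<delta> > 0 \<Longrightarrow> emeasure lebesgue (E \<inter> ball 0 \<delta>) > 0"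
    and K: "\<And>k. a \<bullet> k > 0 \<Longrightarrow> AE x in lebesgue. x \<in> E \<longrightarrow> x + k \<in> E"
  shows "AE x in lebesgue. a \<bullet> x > 0 \<longrightarrow> x \<in> E"
proof -
  have "AE z in lebesgue. a \<bullet> z > norm a / real (Suc n) \<longrightarrow> z \<in> E" for n
  proof -
    have H: "open {k. a \<bullet> k > 0}" by (rule open_halfspace_gt)
    have K': "\<And>k. k \<in> {k. a \<bullet> k > 0} \<Longrightarrow> AE x in lebesgue. x \<in> E \<longrightarrow> x + k \<in> E" using K by simp
    obtain x where x: "norm x < 1 / real (Suc n)" "AE y in lebesgue. y \<in> {k. a \<bullet> k > 0} \<longrightarrow> x + y \<in> E"
      by (rule exists_translate_subset[OF E H pos[of "1 / real (Suc n)"] K']) auto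
    have "AE z in lebesgue. - x + 1 *\<^sub>R z \<in> {k. a \<bullet> k > 0} \<longrightarrow> x + (- x + 1 *\<^sub>R z) \<in> E"
      by (rule AE_affine[OF x(2)]) simp
    then show ?thesis
    proof (rule eventually_mono, intro impI)
      fix z assume z: "- x + 1 *\<^sub>R z \<in> {k. a \<bullet> k > 0} \<longrightarrow> x + (- x + 1 *\<^sub>R z) \<in> E" "a \<bullet> z > norm a / real (Suc n)"
      have "a \<bullet> x \<le> norm a * norm x" by (rule norm_cauchy_schwarz)
      also have "\<dots> \<le> norm a * (1 / real (Suc n))" using x(1) by (intro mult_left_mono) auto
      finally have "a \<bullet> (- x + z) > 0" using z(2) by (simp add: inner_add_right inner_diff_right)
      then show "z \<in> E" using z(1) by (simp add: inner_diff_right)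
    qed
  qed
  then have "AE z in lebesgue. \<forall>n. a \<bullet> z > norm a / real (Suc n) \<longrightarrow> z \<in> E"
    by (simp only: AE_all_countable) blast
  then show ?thesis
  proof (rule eventually_mono, intro impI)
    fix z assume z: "\<forall>n. a \<bullet> z > norm a / real (Suc n) \<longrightarrow> z \<in> E" "a \<bullet> z > 0"
    obtain n :: nat where n: "norm a / (a \<bullet> z) < real n" using reals_Archimedean2 by blast
    then have "norm a < real n * (a \<bullet> z)" using z(2) by (simp add: pos_divide_less_eq)
    also have "\<dots> \<le> real (Suc n) * (a \<bullet> z)" using z(2) by (intro mult_right_mono) auto
    finally have "norm a / real (Suc n) < a \<bullet> z" by (simp add: pos_divide_less_eq mult.commute)
    then show "z \<in> E" using z(1) by blast
  qed
qed

text \<open>\<open>K\<close> is not the whole space, since otherwise \<open>E\<close> would have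
  full measure in the unit ball. Hence \<open>K\<close> lies in a closed half-space, and the
  dichotomy for \<open>x\<close> and \<open>- x\<close> turns this upper bound for \<open>K\<close>
  into the lower one. The complement of \<open>E\<close> is treated in the same way with
  \<open>- a\<close>.\<close>

lemma ordered_cone_half_plane:
  fixes E :: "'a::euclidean_space set"
  assumes E: "E \<in> sets lebesgue"
    and pos: "\<And>\<delta>. \<delta> > 0 \<Longrightarrow> 0 < emeasure lebesgue (E \<inter> ball 0 \<delta>)"
    and less: "\<And>\<delta>. \<delta> > 0 \<Longrightarrow> emeasure lebesgue (E \<inter> ball 0 \<delta>) < emeasure lebesgue (ball (0::'a) \<delta>)"
    and cone: "\<And>t. t > 0 \<Longrightarrow> (\<lambda>x. t *\<^sub>R x) ` E = E"
    and ord: "\<And>e. (AE x in lebesgue. x \<in> E \<longrightarrow> x + e \<in> E) \<or> (AE x in lebesgue. x \<in> E \<longrightarrow> x - e \<in> E)"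
  obtains a where "a \<noteq> 0" "AE x in lebesgue. a \<bullet> x > 0 \<longrightarrow> x \<in> E" "AE x in lebesgue. a \<bullet> x < 0 \<longrightarrow> x \<notin> E"
proof -
  define K where "K = {e. AE x in lebesgue. x \<in> E \<longrightarrow> x + e \<in> E}"
  have E_iff: "t *\<^sub>R x \<in> E \<longleftrightarrow> x \<in> E" if t: "t > 0" for t x
  proof
    assume "t *\<^sub>R x \<in> E"
    then have "t *\<^sub>R x \<in> (\<lambda>x. t *\<^sub>R x) ` E" using cone[OF t] by simp
    then show "x \<in> E" using t by auto
  next
    assume "x \<in> E"
    then have "t *\<^sub>R x \<in> (\<lambda>x. t *\<^sub>R x) ` E" by (rule imageI)
    then show "t *\<^sub>R x \<in> E" using cone[OF t] by simp
  qed
  have K0: "0 \<in> K" by (simp add: K_def)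
  have K_add: "a + b \<in> K" if "a \<in> K" "b \<in> K" for a b
  proof -
    have 1: "AE x in lebesgue. x \<in> E \<longrightarrow> x + a \<in> E" using that by (simp add: K_def)
    have "AE x in lebesgue. x \<in> E \<longrightarrow> x + b \<in> E" using that by (simp add: K_def)
    from AE_affine[OF this, of 1 a] have 2: "AE x in lebesgue. x + a \<in> E \<longrightarrow> x + a + b \<in> E" by (simp add: add_ac)
    have "AE x in lebesgue. x \<in> E \<longrightarrow> x + (a + b) \<in> E"
      using 1 2 by eventually_elim (simp add: add_ac)
    then show ?thesis by (simp add: K_def)
  qed
  have K_scale: "c *\<^sub>R a \<in> K" if "a \<in> K" "c \<ge> 0" for a c
  proof (cases "c = 0")
    case False
    then have c: "c > 0" using that by simp
    have "AE x in lebesgue. x \<in> E \<longrightarrow> x + a \<in> E" using that by (simp add: K_def)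
    then have "AE x in lebesgue. 0 + (1 / c) *\<^sub>R x \<in> E \<longrightarrow> 0 + (1 / c) *\<^sub>R x + a \<in> E"
      by (rule AE_affine) (use c in simp)
    then have "AE x in lebesgue. x \<in> E \<longrightarrow> x + c *\<^sub>R a \<in> E"
    proof (rule eventually_mono)
      fix x assume *: "0 + (1 / c) *\<^sub>R x \<in> E \<longrightarrow> 0 + (1 / c) *\<^sub>R x + a \<in> E"
      have "c *\<^sub>R ((1 / c) *\<^sub>R x + a) = x + c *\<^sub>R a" using c by (simp add: scaleR_add_right)
      then show "x \<in> E \<longrightarrow> x + c *\<^sub>R a \<in> E"
        using * E_iff[of "1 / c" x] E_iff[of c "(1 / c) *\<^sub>R x + a"] c by simp
    qed
    then show ?thesis by (simp add: K_def)
  qed (simp add: K0)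
  have convex: "convex K"
    by (rule convexI) (intro K_add K_scale)
  have dich: "e \<in> K \<or> - e \<in> K" for e using ord[of e] by (simp add: K_def)
  have Kn: "K \<noteq> UNIV"
  proof
    assume "K = UNIV"
    then have k: "\<And>k. k \<in> UNIV \<Longrightarrow> AE x in lebesgue. x \<in> E \<longrightarrow> x + k \<in> E" by (auto simp: K_def)
    obtain x where "AE y in lebesgue. y \<in> UNIV \<longrightarrow> x + y \<in> E"
      by (rule exists_translate_subset[OF E open_UNIV pos[of 1] k]) auto
    then have "AE y in lebesgue. x + y \<in> E" by simp
    from AE_affine[OF this, of 1 "- x"] have "AE y in lebesgue. y \<in> E" by simp
    then have "emeasure lebesgue (E \<inter> ball 0 1) = emeasure lebesgue (ball (0::'a) 1)"
      using E by (intro emeasure_eq_AE) (auto elim: eventually_mono)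
    then show False using less[of 1] by simp
  qed
  then obtain e0 where e0: "e0 \<notin> K" by blast
  \<comment> \<open>A hyperplane separates \<open>e0\<close> from the convex set \<open>K\<close>.
    Since \<open>K\<close> is closed under scaling, the constant \<open>b\<close> can then be
    replaced by 0.\<close>
  have "\<exists>a b. a \<noteq> 0 \<and> (\<forall>x\<in>{e0}. a \<bullet> x \<le> b) \<and> (\<forall>x\<in>K. a \<bullet> x \<ge> b)"
    using e0 K0 by (intro separating_hyperplane_sets convex) auto
  then obtain a b where ab: "a \<noteq> 0" "\<And>x. x \<in> K \<Longrightarrow> a \<bullet> x \<ge> b" by blast
  have Ka: "a \<bullet> x \<ge> 0" if "x \<in> K" for x
  proof (rule ccontr)
    assume n: "\<not> a \<bullet> x \<ge> 0"
    define c where "c = (\<bar>b\<bar> + 1) / (- (a \<bullet> x))"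
    have "c \<ge> 0" unfolding c_def using n by (intro divide_nonneg_nonneg) auto
    from ab(2)[OF K_scale[OF that this]] have "c * (a \<bullet> x) \<ge> b" by simp
    moreover have "c * (a \<bullet> x) = - (\<bar>b\<bar> + 1)" using n by (simp add: c_def)
    ultimately show False by linarith
  qed
  \<comment> \<open>\<open>- x\<close> lies on the wrong side of the hyperplane and so outside
    \<open>K\<close>; the dichotomy leaves \<open>x\<close>.\<close>
  have HK: "x \<in> K" if "a \<bullet> x > 0" for x
    using dich[of x] Ka[of "- x"] that by auto
  have 1: "AE x in lebesgue. a \<bullet> x > 0 \<longrightarrow> x \<in> E"
    using HK by (intro AE_halfspace_of_translates[OF E pos]) (auto simp: K_def)
  have "AE x in lebesgue. (- a) \<bullet> x > 0 \<longrightarrow> x \<in> - E"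
  proof (rule AE_halfspace_of_translates)
    show Em: "- E \<in> sets lebesgue" using E by (rule Compl_in_sets_lebesgue[THEN iffD2])
    show "emeasure lebesgue (- E \<inter> ball 0 \<delta>) > 0" if "\<delta> > 0" for \<delta>
    proof (rule ccontr)
      assume "\<not> ?thesis"
      then have "emeasure lebesgue (- E \<inter> ball 0 \<delta>) = 0" by simp
      then have "- E \<inter> ball 0 \<delta> \<in> null_sets lebesgue" using Em by (intro null_setsI) auto
      then have "AE x in lebesgue. x \<notin> - E \<inter> ball 0 \<delta>" by (rule AE_not_in)
      then have "emeasure lebesgue (E \<inter> ball 0 \<delta>) = emeasure lebesgue (ball (0::'a) \<delta>)"
        using E by (intro emeasure_eq_AE) (auto elim: eventually_mono)
      then show False using less[OF that] by simp
    qed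
    show "AE x in lebesgue. x \<in> - E \<longrightarrow> x + k \<in> - E" if "- a \<bullet> k > 0" for k
    proof -
      have "- k \<in> K" using that by (intro HK) simp
      then have "AE x in lebesgue. x \<in> E \<longrightarrow> x - k \<in> E" by (simp add: K_def)
      from AE_affine[OF this, of 1 k] have "AE x in lebesgue. x + k \<in> E \<longrightarrow> x \<in> E" by (simp add: add.commute)
      then show ?thesis by (rule eventually_mono) auto
    qed
  qed
  then have 2: "AE x in lebesgue. a \<bullet> x < 0 \<longrightarrow> x \<notin> E" by (rule eventually_mono) auto
  show thesis by (rule that[OF ab(1) 1 2])
qed

text \<open>By normalization the frontier of \<open>E\<close> misses both open half-spaces, for near
  their points \<open>E\<close> has full or zero measure. Each half-space is connected, hence lies
  in \<open>E\<close> or in its complement, and the almost everywhere information decides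
  which.\<close>

lemma normalized_half_plane:
  fixes E :: "'a::euclidean_space set"
  assumes E: "E \<in> sets lebesgue" and nE: "normalized E" and a: "a \<noteq> 0"
    and 1: "AE x in lebesgue. a \<bullet> x > 0 \<longrightarrow> x \<in> E" and 2: "AE x in lebesgue. a \<bullet> x < 0 \<longrightarrow> x \<notin> E"
  shows "is_halfspace E"
proof -
  let ?H = "{x. a \<bullet> x > 0}" and ?H' = "{x. a \<bullet> x < 0}"
  have H: "open ?H" "open ?H'" "convex ?H" "convex ?H'"
    by (rule open_halfspace_gt, rule open_halfspace_lt, rule convex_halfspace_gt, rule convex_halfspace_lt)
  have ne: "a \<in> ?H" "- a \<in> ?H'" using a by auto
  have no_AE: "\<not> (AE x in lebesgue. x \<in> U \<longrightarrow> False)" if "open U" "z \<in> U" for U :: "'a set" and z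
  proof
    assume "AE x in lebesgue. x \<in> U \<longrightarrow> False"
    then have "emeasure lebesgue U = 0"
      using that(1) AE_iff_null_sets[of U lebesgue] by auto
    then have "negligible U" using that(1) by (simp add: negligible_iff_null_sets null_setsI)
    then show False using open_not_negligible that by blast
  qed
  have fr: "frontier E = {x. \<forall>r>0. 0 < emeasure lebesgue (E \<inter> ball x r) \<and>
      emeasure lebesgue (E \<inter> ball x r) < emeasure lebesgue (ball x r)}"
    using nE by (simp add: normalized_def)
  have f1: "z \<notin> frontier E" if z: "z \<in> ?H" for z
  proof -
    obtain r where r: "r > 0" "ball z r \<subseteq> ?H" by (rule openE[OF H(1) z])
    have "emeasure lebesgue (E \<inter> ball z r) = emeasure lebesgue (ball z r)"
      using E 1 r(2) by (intro emeasure_eq_AE) (auto elim!: eventually_mono)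
    then have "\<not> emeasure lebesgue (E \<inter> ball z r) < emeasure lebesgue (ball z r)" by simp
    then show ?thesis using r(1) unfolding fr mem_Collect_eq by blast
  qed
  have f2: "z \<notin> frontier E" if z: "z \<in> ?H'" for z
  proof -
    obtain r where r: "r > 0" "ball z r \<subseteq> ?H'" by (rule openE[OF H(2) z])
    have "emeasure lebesgue (E \<inter> ball z r) = 0"
      using E 2 r(2) by (intro emeasure_0_AE) (auto elim!: eventually_mono)
    then have "\<not> 0 < emeasure lebesgue (E \<inter> ball z r)" by simp
    then show ?thesis using r(1) unfolding fr mem_Collect_eq by blast
  qed
  have "?H - E = {}"
  proof (rule ccontr)
    assume n: "?H - E \<noteq> {}"
    have "?H \<inter> E \<noteq> {}"
    proof
      assume "?H \<inter> E = {}"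
      then have "AE x in lebesgue. x \<in> ?H \<longrightarrow> False" using 1 by (auto elim!: eventually_mono)
      then show False using no_AE[OF H(1) ne(1)] by blast
    qed
    then have "?H \<inter> frontier E \<noteq> {}" using n convex_connected[OF H(3)] by (intro connected_Int_frontier)
    then show False using f1 by blast
  qed
  moreover have "?H' \<inter> E = {}"
  proof (rule ccontr)
    assume n: "?H' \<inter> E \<noteq> {}"
    have "?H' - E \<noteq> {}"
    proof
      assume "?H' - E = {}"
      then have "AE x in lebesgue. x \<in> ?H' \<longrightarrow> False" using 2 by (auto elim!: eventually_mono)
      then show False using no_AE[OF H(2) ne(2)] by blast
    qed
    then have "?H' \<inter> frontier E \<noteq> {}" using n convex_connected[OF H(4)] by (intro connected_Int_frontier)
    then show False using f2 by blast
  qed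
  ultimately have "{x. a \<bullet> x > 0} \<subseteq> E" "E \<subseteq> {x. a \<bullet> x \<ge> 0}" by (auto simp: not_less[symmetric])
  then show ?thesis unfolding is_halfspace_def using a by blast
qed

section \<open>Vanishing of the function\<close>

lemma integral_affine:
  fixes f :: "'a::euclidean_space \<Rightarrow> real"
  assumes f [measurable]: "f \<in> borel_measurable lebesgue" and c: "c \<noteq> 0"
  shows "(\<integral>x. f x \<partial>lebesgue) = \<bar>c\<bar> ^ DIM('a) * (\<integral>x. f (t + c *\<^sub>R x) \<partial>lebesgue)"
proof -
  note [measurable] = affine_measurable_lebesgue[OF c, of t]
  have "(\<integral>x. f x \<partial>lebesgue) = (\<integral>x. \<bar>c\<bar> ^ DIM('a) *\<^sub>R f x \<partial>distr lebesgue lebesgue (\<lambda>x. t + c *\<^sub>R x))"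
    by (subst lebesgue_eq_affine[OF c, of t], subst integral_density) auto
  also have "\<dots> = (\<integral>x. \<bar>c\<bar> ^ DIM('a) *\<^sub>R f (t + c *\<^sub>R x) \<partial>lebesgue)"
    by (rule integral_distr) auto
  finally show ?thesis by simp
qed

lemma L2_inner_integrable:
  fixes G H :: "'a::euclidean_space \<Rightarrow> 'b::euclidean_space"
  assumes G: "L2 UNIV G" and H: "L2 UNIV H"
  shows "integrable lebesgue (\<lambda>x. G x \<bullet> H x)"
proof -
  have [measurable]: "G \<in> borel_measurable lebesgue" "H \<in> borel_measurable lebesgue"
    using G H L2_borel by blast+
  have "integrable lebesgue (\<lambda>x. (norm (G x))\<^sup>2 + (norm (H x))\<^sup>2)"
    using G H by (simp add: L2_def lebesgue_on_UNIV_eq)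
  then show ?thesis
  proof (rule Bochner_Integration.integrable_bound)
    have "\<bar>G x \<bullet> H x\<bar> \<le> (norm (G x))\<^sup>2 + (norm (H x))\<^sup>2" for x
    proof -
      have "2 * (norm (G x) * norm (H x)) \<le> (norm (G x))\<^sup>2 + (norm (H x))\<^sup>2"
        using zero_le_power2[of "norm (G x) - norm (H x)"] by (simp add: power2_diff)
      moreover have "0 \<le> norm (G x) * norm (H x)" by simp
      ultimately show ?thesis using Cauchy_Schwarz_ineq2[of "G x" "H x"] by linarith
    qed
    then show "AE x in lebesgue. norm (G x \<bullet> H x) \<le> norm ((norm (G x))\<^sup>2 + (norm (H x))\<^sup>2)"
      by (intro AE_I2) simp
  qed measurable
qed

lemma AE_hyperplane:
  fixes a :: "'a::euclidean_space"
  assumes "a \<noteq> 0" shows "AE x in lebesgue. a \<bullet> x \<noteq> 0"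
proof -
  have "negligible {x. a \<bullet> x = 0}" using assms by (intro negligible_hyperplane) auto
  then have "{x. a \<bullet> x = 0} \<in> null_sets lebesgue" by (simp add: negligible_iff_null_sets)
  from AE_not_in[OF this] show ?thesis by simp
qed

lemma flat_bounded:
  obtains C where "C \<ge> 0" "\<And>s. s \<le> 1 \<Longrightarrow> \<bar>flat m s\<bar> \<le> C"
proof -
  have "continuous_on {0..1} (flat m)"
    using flat_has_derivative DERIV_isCont by (intro continuous_at_imp_continuous_on) blast
  then have "bounded (flat m ` {0..1})" by (intro compact_imp_bounded compact_continuous_image) auto
  then obtain C where C: "\<forall>y\<in>flat m ` {0..1}. norm y \<le> C" unfolding bounded_iff by blast
  have "\<bar>flat m s\<bar> \<le> \<bar>C\<bar>" if "s \<le> 1" for s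
  proof (cases "s \<ge> 0")
    case True
    then have "norm (flat m s) \<le> C" using C that by auto
    then show ?thesis by simp
  qed (simp add: flat_0)
  then show thesis using that[of "\<bar>C\<bar>"] by simp
qed

lemma flat_lipschitz:
  obtains L where "L \<ge> 0" "\<And>p q. p \<le> 1 \<Longrightarrow> q \<le> 1 \<Longrightarrow> \<bar>flat m p - flat m q\<bar> \<le> L * \<bar>p - q\<bar>"
proof -
  obtain A where A: "A \<ge> 0" "\<And>s. s \<le> 1 \<Longrightarrow> \<bar>flat (m + 2) s\<bar> \<le> A" using flat_bounded by metis
  obtain B where B: "B \<ge> 0" "\<And>s. s \<le> 1 \<Longrightarrow> \<bar>flat (m + 1) s\<bar> \<le> B" using flat_bounded by metis
  have "norm (flat m p - flat m q) \<le> (A + real m * B) * norm (p - q)" if "p \<le> 1" "q \<le> 1" for p q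
  proof (rule field_differentiable_bound[of "{..1}"])
    show "(flat m has_field_derivative flat (m + 2) s - m * flat (m + 1) s) (at s within {..1})" for s
      using flat_has_derivative has_field_derivative_at_within by blast
    show "norm (flat (m + 2) s - m * flat (m + 1) s) \<le> A + real m * B" if "s \<in> {..1}" for s
    proof -
      have "norm (flat (m + 2) s - m * flat (m + 1) s) \<le> \<bar>flat (m + 2) s\<bar> + real m * \<bar>flat (m + 1) s\<bar>"
        using abs_triangle_ineq4[of "flat (m + 2) s" "m * flat (m + 1) s"] by (simp add: abs_mult)
      also have "\<dots> \<le> A + real m * B" using A(2)[of s] B(2)[of s] that by (intro add_mono mult_left_mono) auto
      finally show ?thesis .
    qed
  qed (use that in auto)
  then show thesis using that[of "A + real m * B"] A B by simp
qed

text \<open>Once the set is known to be a half-plane it can be kept fixed, and minimality becomes a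
  Dirichlet problem for \<open>u\<close> alone with sign constraints. The assumptions are invariant
  under changing the signs of \<open>u\<close>, \<open>g\<close> and \<open>a\<close> together, so a
  result for one side of the line yields the other.\<close>

locale half_minimizer =
  fixes u :: "real^2 \<Rightarrow> real" and g :: "real^2 \<Rightarrow> real^2" and a :: "real^2" and \<alpha> :: real
  assumes a: "a \<noteq> 0"
    and u: "L2 (ball 0 2) u" "is_weak_grad (ball 0 2) u g"
    and pos: "AE x in lebesgue. x \<in> ball 0 2 \<longrightarrow> a \<bullet> x > 0 \<longrightarrow> u x \<ge> 0"
    and neg: "AE x in lebesgue. x \<in> ball 0 2 \<longrightarrow> a \<bullet> x < 0 \<longrightarrow> u x \<le> 0"
    and min: "\<And>s w G. s < 2 \<Longrightarrow> cH1 s w G \<Longrightarrow>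
      (AE x in lebesgue. x \<in> ball 0 2 \<longrightarrow> a \<bullet> x > 0 \<longrightarrow> u x + w x \<ge> 0) \<Longrightarrow>
      (AE x in lebesgue. x \<in> ball 0 2 \<longrightarrow> a \<bullet> x < 0 \<longrightarrow> u x + w x \<le> 0) \<Longrightarrow>
      (\<integral>\<^sup>+x\<in>ball 0 2. ennreal ((norm (g x))\<^sup>2) \<partial>lebesgue) \<le> (\<integral>\<^sup>+x\<in>ball 0 2. ennreal ((norm (g x + G x))\<^sup>2) \<partial>lebesgue)"
    and hom: "\<And>t. t > 0 \<Longrightarrow> AE x in lebesgue. u (t *\<^sub>R x) = t powr \<alpha> * u x"
    and \<alpha>: "\<alpha> < 1"
begin

text \<open>The linear function vanishing on the boundary line, cut off by a radial bump. With a
  radial cutoff the Laplacian is again \<open>x \<bullet> a\<close> times a radial function, which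
  is what lets homogeneity evaluate the integral against it.\<close>

definition \<phi> :: "real^2 \<Rightarrow> real" where "\<phi> x = (x \<bullet> a) * bump 1 x"

lemma test_\<phi>: "test_fun UNIV \<phi>"
  unfolding \<phi>_def[abs_def] by (rule test_fun_mult[OF test_fun_bump smooth_inner])

lemma pd_\<phi>: "pd \<phi> x e = (x \<bullet> a) * pd (bump 1) x e + (e \<bullet> a) * bump 1 x"
proof -
  have "((\<lambda>x. x \<bullet> a) has_derivative (\<lambda>h. h \<bullet> a)) (at x)" by (auto intro!: derivative_eq_intros)
  from pd_eqI[OF has_derivative_mult[OF this smooth_has_derivative[OF smooth_bump]]]
  show ?thesis by (simp add: \<phi>_def[abs_def])
qed

lemma \<phi>_outside:
  assumes "norm x \<ge> 1" shows "\<phi> x = 0" "grad \<phi> x = 0"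
proof -
  have q: "1 - x \<bullet> x \<le> 0" using power_mono[OF assms, of 2] by (simp add: dot_square_norm)
  then show "\<phi> x = 0" by (simp add: \<phi>_def bump_def flat_0)
  show "grad \<phi> x = 0" using q by (simp add: grad_def pd_\<phi> pd_bump bump_def flat_0)
qed

lemma \<phi>_inside:
  assumes "norm x < 1" shows "a \<bullet> x > 0 \<Longrightarrow> \<phi> x > 0" "a \<bullet> x < 0 \<Longrightarrow> \<phi> x < 0"
proof -
  have "(norm x)\<^sup>2 < 1" using assms by (simp add: abs_square_less_1)
  then have "bump 1 x > 0" by (simp add: bump_def dot_square_norm flat_pos)
  then show "a \<bullet> x > 0 \<Longrightarrow> \<phi> x > 0" "a \<bullet> x < 0 \<Longrightarrow> \<phi> x < 0"
    by (auto simp: \<phi>_def inner_commute mult_neg_pos)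
qed

text \<open>The 8 is twice the dimension, from the Laplacian of the bump, plus 4 from the cross term
  of \<open>x \<bullet> a\<close> with the gradient of the bump. The difference of
  \<open>flat 4\<close> and twice \<open>flat 3\<close> is the derivative of
  \<open>flat 2\<close>.\<close>

lemma laplace_\<phi>:
  "(\<Sum>b\<in>Basis. pd (\<lambda>z. pd \<phi> z b) x b) =
    - (x \<bullet> a) * (8 * flat 2 (1 - x \<bullet> x) - 4 * (x \<bullet> x) * (flat 4 (1 - x \<bullet> x) - 2 * flat 3 (1 - x \<bullet> x)))"
proof -
  let ?h = "flat 4 (1 - x \<bullet> x) - 2 * flat 3 (1 - x \<bullet> x)" and ?f = "flat 2 (1 - x \<bullet> x)"
  have i: "((\<lambda>x. x \<bullet> a) has_derivative (\<lambda>h. h \<bullet> a)) (at x)" by (auto intro!: derivative_eq_intros)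
  have "pd (\<lambda>z. pd \<phi> z b) x b = (x \<bullet> a) * (-2 * ?f + 4 * (x \<bullet> b) * (x \<bullet> b) * ?h) - 4 * ((a \<bullet> b) * (x \<bullet> b)) * ?f"
    if b: "b \<in> Basis" for b
  proof -
    have "((\<lambda>z. (z \<bullet> a) * pd (bump 1) z b + (b \<bullet> a) * bump 1 z) has_derivative
        (\<lambda>h. ((x \<bullet> a) * pd (\<lambda>z. pd (bump 1) z b) x h + (h \<bullet> a) * pd (bump 1) x b) + (b \<bullet> a) * pd (bump 1) x h)) (at x)"
      by (intro has_derivative_add has_derivative_mult i has_derivative_mult_right
          smooth_has_derivative[OF smooth_bump] smooth_has_derivative[OF smooth_pd[OF smooth_bump]])
    from pd_eqI[OF this] have "pd (\<lambda>z. pd \<phi> z b) x b =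
        (x \<bullet> a) * pd (\<lambda>z. pd (bump 1) z b) x b + 2 * ((b \<bullet> a) * pd (bump 1) x b)"
      by (simp add: pd_\<phi>)
    then show ?thesis
      unfolding pd_pd_bump unfolding pd_bump using b by (simp add: inner_commute algebra_simps)
  qed
  then have "(\<Sum>b\<in>Basis. pd (\<lambda>z. pd \<phi> z b) x b) =
      (\<Sum>b\<in>Basis. (x \<bullet> a) * (-2 * ?f + 4 * (x \<bullet> b) * (x \<bullet> b) * ?h) - 4 * ((a \<bullet> b) * (x \<bullet> b)) * ?f)"
    by (rule sum.cong[OF refl])
  also have "\<dots> = (x \<bullet> a) * (-2 * ?f * real DIM(real^2) + 4 * (\<Sum>b\<in>Basis. (x \<bullet> b) * (x \<bullet> b)) * ?h) - 4 * (\<Sum>b\<in>Basis. (a \<bullet> b) * (x \<bullet> b)) * ?f"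
    by (simp add: sum_subtractf sum.distrib sum_distrib_left sum_distrib_right algebra_simps)
  also have "(\<Sum>b\<in>Basis. (x \<bullet> b) * (x \<bullet> b)) = x \<bullet> x" by (rule euclidean_inner[symmetric])
  also have "(\<Sum>b\<in>Basis. (a \<bullet> b) * (x \<bullet> b)) = x \<bullet> a" by (subst inner_commute, rule euclidean_inner[symmetric])
  finally show ?thesis by (simp add: algebra_simps)
qed

text \<open>On the side where \<open>u\<close> is nonnegative the gradient of the positive part
  equals \<open>g\<close> even on the zero set of \<open>u\<close>, since there the gradient
  vanishes almost everywhere by \<open>cH1_grad_zero\<close>.\<close>

lemma pos_part_exists:
  obtains s Up Gp where "1 < s" "s < 2" "cH1 s Up Gp" "\<And>x. Up x \<ge> 0"
    "\<And>x. x \<in> cball 0 1 \<Longrightarrow> Up x = max 0 (u x)"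
    "AE x in lebesgue. x \<in> cball 0 1 \<longrightarrow> a \<bullet> x > 0 \<longrightarrow> Gp x = g x"
    "AE x in lebesgue. x \<in> cball 0 1 \<longrightarrow> a \<bullet> x < 0 \<longrightarrow> Up x = 0 \<and> Gp x = 0"
proof -
  obtain \<zeta> :: "real^2 \<Rightarrow> real" and s where \<zeta>: "1 < s" "s < 2" "smooth \<zeta>" "test_fun (ball 0 2) \<zeta>"
    "\<And>x. x \<in> cball 0 1 \<Longrightarrow> \<zeta> x = 1" "\<And>x e. x \<in> cball 0 1 \<Longrightarrow> pd \<zeta> x e = 0"
    "\<And>x. x \<notin> cball 0 s \<Longrightarrow> \<zeta> x = 0"
    by (rule cutoff_exists[of 1 2, where 'a="real^2"]) auto
  define U where "U x = \<zeta> x * u x" for x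
  define GU where "GU x = \<zeta> x *\<^sub>R g x + u x *\<^sub>R grad \<zeta> x" for x
  have c: "cH1 s U GU"
    unfolding U_def[abs_def] GU_def[abs_def] by (rule cH1_localize[OF u \<zeta>(4,7,2)])
  have in1: "U x = u x" "GU x = g x" if "x \<in> cball 0 1" for x
    using \<zeta>(5)[OF that] \<zeta>(6)[OF that] by (auto simp: U_def GU_def grad_def)
  show thesis
  proof (rule that[OF \<zeta>(1,2) cH1_pos_part[OF c]])
    show "max 0 (U x) = max 0 (u x)" if "x \<in> cball 0 1" for x using in1[OF that] by simp
    show "AE x in lebesgue. x \<in> cball 0 1 \<longrightarrow> a \<bullet> x > 0 \<longrightarrow> (if U x > 0 then GU x else 0) = g x"
      using pos cH1_grad_zero[OF c]
    proof eventually_elim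
      case (elim x)
      show ?case
      proof (intro impI)
        assume x: "x \<in> cball 0 1" "a \<bullet> x > 0"
        then have "x \<in> ball 0 2" by auto
        then have "U x \<ge> 0" using elim x in1 by auto
        then show "(if U x > 0 then GU x else 0) = g x" using in1[OF x(1)] elim(2) by auto
      qed
    qed
    show "AE x in lebesgue. x \<in> cball 0 1 \<longrightarrow> a \<bullet> x < 0 \<longrightarrow> max 0 (U x) = 0 \<and> (if U x > 0 then GU x else 0) = 0"
      using neg
    proof eventually_elim
      case (elim x)
      show ?case
      proof (intro impI)
        assume x: "x \<in> cball 0 1" "a \<bullet> x < 0"
        then have "x \<in> ball 0 2" by auto
        then have "U x \<le> 0" using elim x in1 by auto
        then show "max 0 (U x) = 0 \<and> (if U x > 0 then GU x else 0) = 0" by auto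
      qed
    qed
  qed auto
qed

text \<open>\<open>u\<close> is subharmonic on the half-plane where it is nonnegative: compare with
  \<open>u - min u\<^sup>+ (\<epsilon> \<phi>\<^sup>+)\<close> and let \<open>\<epsilon>\<close> tend to 0.\<close>

lemma variational_inequality:
  assumes s: "1 < s" "s < 2" and c: "cH1 s Up Gp" and Up0: "\<And>x. Up x \<ge> 0"
    and Up1: "\<And>x. x \<in> cball 0 1 \<Longrightarrow> Up x = max 0 (u x)"
    and Gp1: "AE x in lebesgue. x \<in> cball 0 1 \<longrightarrow> a \<bullet> x > 0 \<longrightarrow> Gp x = g x"
    and Gp2: "AE x in lebesgue. x \<in> cball 0 1 \<longrightarrow> a \<bullet> x < 0 \<longrightarrow> Up x = 0 \<and> Gp x = 0"
  shows "(\<integral>x. Gp x \<bullet> grad \<phi> x \<partial>lebesgue) \<le> 0"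
proof -
  let ?\<Omega> = "ball (0::real^2) 2"
  define f where "f x = max 0 (\<phi> x)" for x
  define F where "F x = (if \<phi> x > 0 then grad \<phi> x else 0)" for x
  have "cH1 1 \<phi> (grad \<phi>)"
    unfolding cH1_def using test_fun_L2[OF test_\<phi>] is_weak_grad_test[OF test_\<phi>] \<phi>_outside by auto
  then have fc: "cH1 s f F"
    unfolding f_def[abs_def] F_def[abs_def] using s by (intro cH1_pos_part) (auto intro: cH1_mono)
  have f_out: "f x = 0" "F x = 0" if "x \<notin> cball 0 1" for x
    using \<phi>_outside[of x] that by (auto simp: f_def F_def)
  have f_neg: "f x = 0" "F x = 0" if "a \<bullet> x < 0" for x
    using \<phi>_outside[of x] \<phi>_inside(2)[of x] that by (cases "norm x < 1"; auto simp: f_def F_def)+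
  define gi where "gi x = indicator ?\<Omega> x *\<^sub>R g x" for x
  have gi: "L2 UNIV gi"
    using L2_iff_indicator[of ?\<Omega> g] u(2) by (simp add: gi_def[abs_def] is_weak_grad_def)
  have FL: "L2 UNIV F" by (rule cH1D(3)[OF fc])
  let ?I = "\<integral>x. gi x \<bullet> F x \<partial>lebesgue" and ?Q = "\<integral>x. (norm (F x))\<^sup>2 \<partial>lebesgue"
  have sq: "integrable lebesgue (\<lambda>x. (norm (h x))\<^sup>2)" if "L2 UNIV h" for h :: "real^2 \<Rightarrow> real^2"
    using that by (simp add: L2_def lebesgue_on_UNIV_eq)
  have step: "2 * ?I \<le> \<epsilon> * ?Q" if \<epsilon>: "\<epsilon> > 0" for \<epsilon>
  proof -
    define h where "h x = \<epsilon> * f x - Up x" for x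
    define H where "H x = \<epsilon> *\<^sub>R F x - Gp x" for x
    have hc: "cH1 s h H"
      unfolding h_def[abs_def] H_def[abs_def] by (rule cH1_diff[OF cH1_cmult[OF fc] c])
    \<comment> \<open>This is minus the minimum of \<open>\<epsilon> * f x\<close> and
      \<open>Up x\<close>, written through a positive part so that \<open>cH1_pos_part\<close>
      supplies the gradient. Subtracting at most \<open>Up\<close> preserves the sign of
      \<open>u\<close>.\<close>
    define w where "w x = max 0 (h x) - \<epsilon> * f x" for x
    define W where "W x = (if h x > 0 then H x else 0) - \<epsilon> *\<^sub>R F x" for x
    have wc: "cH1 s w W"
      unfolding w_def[abs_def] W_def[abs_def] by (rule cH1_diff[OF cH1_pos_part[OF hc] cH1_cmult[OF fc]])
    have w_min: "w x = - min (\<epsilon> * f x) (Up x)" for x by (auto simp: w_def h_def max_def min_def)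
    have "(\<integral>\<^sup>+x\<in>?\<Omega>. ennreal ((norm (g x))\<^sup>2) \<partial>lebesgue) \<le> (\<integral>\<^sup>+x\<in>?\<Omega>. ennreal ((norm (g x + W x))\<^sup>2) \<partial>lebesgue)"
    proof (rule min[OF s(2) wc])
      show "AE x in lebesgue. x \<in> ?\<Omega> \<longrightarrow> a \<bullet> x > 0 \<longrightarrow> u x + w x \<ge> 0"
        using pos
      proof eventually_elim
        case (elim x)
        show ?case
        proof (intro impI)
          assume x: "x \<in> ?\<Omega>" "a \<bullet> x > 0"
          then have u0: "u x \<ge> 0" using elim by simp
          show "u x + w x \<ge> 0"
          proof (cases "x \<in> cball 0 1")
            case True
            then show ?thesis using u0 Up1[OF True] by (simp add: w_min min_le_iff_disj)
          next
            case False
            then show ?thesis using u0 f_out(1)[OF False] Up0[of x] by (simp add: w_min)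
          qed
        qed
      qed
      show "AE x in lebesgue. x \<in> ?\<Omega> \<longrightarrow> a \<bullet> x < 0 \<longrightarrow> u x + w x \<le> 0"
        using neg
      proof eventually_elim
        case (elim x)
        then show ?case using f_neg(1)[of x] Up0[of x] by (auto simp: w_min)
      qed
    qed
    \<comment> \<open>Where the minimum is \<open>Up\<close> with \<open>h x > 0\<close>, the
      gradient of the competitor is 0; elsewhere it is
      \<open>g x - \<epsilon> *\<^sub>R F x\<close>. In both cases its square is at most that of the
      latter.\<close>
    also have "\<dots> \<le> (\<integral>\<^sup>+x. ennreal ((norm (gi x - \<epsilon> *\<^sub>R F x))\<^sup>2) \<partial>lebesgue)"
    proof (rule nn_integral_mono_AE)
      show "AE x in lebesgue. ennreal ((norm (g x + W x))\<^sup>2) * indicator ?\<Omega> x \<le> ennreal ((norm (gi x - \<epsilon> *\<^sub>R F x))\<^sup>2)"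
        using Gp1 AE_hyperplane[OF a]
      proof eventually_elim
        case (elim x)
        show ?case
        proof (cases "x \<in> ?\<Omega>")
          case True
          show ?thesis
          proof (cases "h x > 0")
            case h: True
            then have "f x \<noteq> 0" using Up0[of x] by (auto simp: h_def)
            then have "x \<in> cball 0 1" "a \<bullet> x > 0"
              using f_out(1)[of x] f_neg(1)[of x] elim(2) by (auto simp: not_less[symmetric] linorder_neq_iff)
            then have "Gp x = g x" using elim(1) by simp
            then have "g x + W x = 0" using h by (simp add: W_def H_def)
            then show ?thesis by simp
          next
            case False
            then show ?thesis using True by (simp add: W_def gi_def)
          qed
        qed simp
      qed
    qed
    finally have le: "(\<integral>\<^sup>+x. ennreal ((norm (gi x))\<^sup>2) \<partial>lebesgue) \<le> (\<integral>\<^sup>+x. ennreal ((norm (gi x - \<epsilon> *\<^sub>R F x))\<^sup>2) \<partial>lebesgue)"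
      unfolding indicator_square_eq gi_def .
    have dL: "L2 UNIV (\<lambda>x. gi x - \<epsilon> *\<^sub>R F x)" by (rule L2_diff[OF gi L2_scaleR[OF FL]])
    have e1: "(\<integral>\<^sup>+x. ennreal ((norm (gi x))\<^sup>2) \<partial>lebesgue) = ennreal (\<integral>x. (norm (gi x))\<^sup>2 \<partial>lebesgue)"
      by (rule nn_integral_eq_integral[OF sq[OF gi]]) simp
    have e2: "(\<integral>\<^sup>+x. ennreal ((norm (gi x - \<epsilon> *\<^sub>R F x))\<^sup>2) \<partial>lebesgue) = ennreal (\<integral>x. (norm (gi x - \<epsilon> *\<^sub>R F x))\<^sup>2 \<partial>lebesgue)"
      by (rule nn_integral_eq_integral[OF sq[OF dL]]) simp
    have "(\<integral>x. (norm (gi x))\<^sup>2 \<partial>lebesgue) \<le> (\<integral>x. (norm (gi x - \<epsilon> *\<^sub>R F x))\<^sup>2 \<partial>lebesgue)"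
      using le unfolding e1 e2 by (subst (asm) ennreal_le_iff) auto
    also have "(\<lambda>x. (norm (gi x - \<epsilon> *\<^sub>R F x))\<^sup>2) = (\<lambda>x. (norm (gi x))\<^sup>2 - 2 * \<epsilon> * (gi x \<bullet> F x) + \<epsilon>\<^sup>2 * (norm (F x))\<^sup>2)"
      unfolding power2_norm_eq_inner
      by (simp add: inner_diff_left inner_diff_right inner_commute algebra_simps power2_eq_square)
    also have "(\<integral>x. (norm (gi x))\<^sup>2 - 2 * \<epsilon> * (gi x \<bullet> F x) + \<epsilon>\<^sup>2 * (norm (F x))\<^sup>2 \<partial>lebesgue) =
        (\<integral>x. (norm (gi x))\<^sup>2 \<partial>lebesgue) - 2 * \<epsilon> * ?I + \<epsilon>\<^sup>2 * ?Q"
      using sq[OF gi] sq[OF FL] L2_inner_integrable[OF gi FL] by simp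
    finally have "\<epsilon> * (2 * ?I) \<le> \<epsilon> * (\<epsilon> * ?Q)" by (simp add: power2_eq_square algebra_simps)
    then show ?thesis using \<epsilon> by (simp only: mult_le_cancel_left_pos)
  qed
  have "?I \<le> 0"
  proof (rule ccontr)
    assume n: "\<not> ?I \<le> 0"
    have Q: "?Q \<ge> 0" by simp
    \<comment> \<open>The choice of \<open>\<epsilon>\<close> is \<open>?I / (?Q + 1)\<close>, where
      the 1 covers \<open>?Q = 0\<close>.\<close>
    have 1: "2 * ?I \<le> ?I / (?Q + 1) * ?Q" using n Q by (intro step divide_pos_pos) linarith+
    have "i / (q + 1) * q \<le> i" if "i > 0" "q \<ge> 0" for i q :: real
      using that by (simp add: pos_divide_le_eq algebra_simps)
    from this[of ?I ?Q] have "?I / (?Q + 1) * ?Q \<le> ?I" using n Q by linarith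
    with 1 show False using n by linarith
  qed
  moreover have "?I = (\<integral>x. Gp x \<bullet> grad \<phi> x \<partial>lebesgue)"
  proof (rule integral_cong_AE)
    show "(\<lambda>x. gi x \<bullet> F x) \<in> borel_measurable lebesgue" by (intro borel_measurable_inner L2_borel gi FL)
    show "(\<lambda>x. Gp x \<bullet> grad \<phi> x) \<in> borel_measurable lebesgue"
      by (intro borel_measurable_inner cH1D(8)[OF c] L2_borel[OF L2_grad_test[OF test_\<phi>]])
    show "AE x in lebesgue. gi x \<bullet> F x = Gp x \<bullet> grad \<phi> x"
      using Gp1 Gp2 AE_hyperplane[OF a]
    proof eventually_elim
      case (elim x)
      consider "norm x \<ge> 1" | "norm x < 1" "a \<bullet> x > 0" | "norm x < 1" "a \<bullet> x < 0" using elim(3) by linarith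
      then show ?case
      proof cases
        case 1
        then show ?thesis using \<phi>_outside[OF 1] by (simp add: F_def)
      next
        case 2
        then show ?thesis using elim(1) \<phi>_inside(1)[OF 2] by (simp add: F_def gi_def)
      next
        case 3
        then show ?thesis using elim(2) f_neg(2)[OF 3(2)] by simp
      qed
    qed
  qed
  ultimately show ?thesis by simp
qed

text \<open>The variational inequality bounds the integral of \<open>u\<^sup>+ \<Delta>\<phi>\<close> from below.  Homogeneity, in the form of
  the derivative at \<open>lam = 1\<close> of \<open>\<integral> u\<^sup>+ (x \<bullet> a) k (lam \<bar>x\<bar>\<^sup>2)\<close>, evaluates it as
  \<open>- 2 (1 - \<alpha>)\<close> times an integral that is positive unless \<open>u\<^sup>+ = 0\<close>.\<close>

lemma half_zero_ball: "AE x in lebesgue. norm x < 1 \<longrightarrow> a \<bullet> x > 0 \<longrightarrow> u x = 0"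
proof -
  obtain s Up Gp where s: "1 < s" "s < 2" and c: "cH1 s Up Gp" and Up0: "\<And>x. Up x \<ge> 0"
    and Up1: "\<And>x. x \<in> cball 0 1 \<Longrightarrow> Up x = max 0 (u x)"
    and Gp1: "AE x in lebesgue. x \<in> cball 0 1 \<longrightarrow> a \<bullet> x > 0 \<longrightarrow> Gp x = g x"
    and Gp2: "AE x in lebesgue. x \<in> cball 0 1 \<longrightarrow> a \<bullet> x < 0 \<longrightarrow> Up x = 0 \<and> Gp x = 0"
    using pos_part_exists by blast
  have vi: "(\<integral>x. Gp x \<bullet> grad \<phi> x \<partial>lebesgue) \<le> 0"
    by (rule variational_inequality[OF s c Up0 Up1 Gp1 Gp2])
  have [measurable]: "Up \<in> borel_measurable lebesgue" by (rule cH1D(7)[OF c])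
  have UpL: "L2 UNIV Up" and Upi: "integrable lebesgue Up" and GpL: "L2 UNIV Gp"
    using cH1D[OF c] by auto
  have [measurable]: "(\<lambda>x::real^2. x \<bullet> a) \<in> borel_measurable lebesgue"
    by (intro continuous_imp_lebesgue continuous_intros)
  have fm [measurable]: "(\<lambda>x::real^2. flat m (1 - lam * (x \<bullet> x))) \<in> borel_measurable lebesgue" for m lam
    by (intro smooth_measurable smooth_flat smooth_diff smooth_mult smooth_const smooth_inner_self)
  have fm1 [measurable]: "(\<lambda>x::real^2. flat m (1 - x \<bullet> x)) \<in> borel_measurable lebesgue" for m
    using fm[of m 1] by simp
  define T where "T lam = (\<integral>x. Up x * (x \<bullet> a) * flat 2 (1 - lam * (x \<bullet> x)) \<partial>lebesgue)" for lam
  let ?h = "\<lambda>x::real^2. flat 4 (1 - x \<bullet> x) - 2 * flat 3 (1 - x \<bullet> x)"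
  \<comment> \<open>The derivative of \<open>T\<close> at 1, taken under the integral.\<close>
  define D where "D = (\<integral>x. Up x * (x \<bullet> a) * (- (x \<bullet> x) * ?h x) \<partial>lebesgue)"
  have bound_int: "integrable lebesgue (\<lambda>x. Up x * (x \<bullet> a) * k x)"
    if k: "k \<in> borel_measurable lebesgue" "\<And>x. norm x \<le> 2 \<Longrightarrow> \<bar>k x\<bar> \<le> C" for k C
  proof (rule Bochner_Integration.integrable_bound)
    show "integrable lebesgue (\<lambda>x. Up x * (2 * norm a * \<bar>C\<bar>))" using Upi by (rule integrable_mult_left)
    show "(\<lambda>x. Up x * (x \<bullet> a) * k x) \<in> borel_measurable lebesgue" using k(1) by measurable
    show "AE x in lebesgue. norm (Up x * (x \<bullet> a) * k x) \<le> norm (Up x * (2 * norm a * \<bar>C\<bar>))"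
    proof (rule AE_I2)
      fix x
      show "norm (Up x * (x \<bullet> a) * k x) \<le> norm (Up x * (2 * norm a * \<bar>C\<bar>))"
      proof (cases "norm x \<le> 2")
        case True
        have "\<bar>x \<bullet> a\<bar> \<le> 2 * norm a"
          using order_trans[OF Cauchy_Schwarz_ineq2 mult_right_mono[OF True norm_ge_zero]] .
        then have "\<bar>x \<bullet> a\<bar> * \<bar>k x\<bar> \<le> (2 * norm a) * \<bar>C\<bar>" using k(2)[OF True] by (intro mult_mono) auto
        then show ?thesis using mult_left_mono[of "\<bar>x \<bullet> a\<bar> * \<bar>k x\<bar>" "2 * norm a * \<bar>C\<bar>" "\<bar>Up x\<bar>"]
          by (simp add: abs_mult mult.assoc)
      next
        case False
        then show ?thesis using cH1D(4)[OF c, of x] s by simp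
      qed
    qed
  qed
  obtain C2 where C2: "\<And>s. s \<le> 1 \<Longrightarrow> \<bar>flat 2 s\<bar> \<le> C2" using flat_bounded[of 2] by metis
  obtain C3 where C3: "\<And>s. s \<le> 1 \<Longrightarrow> \<bar>flat 3 s\<bar> \<le> C3" using flat_bounded[of 3] by metis
  obtain C4 where C4: "\<And>s. s \<le> 1 \<Longrightarrow> \<bar>flat 4 s\<bar> \<le> C4" using flat_bounded[of 4] by metis
  obtain L where L: "L \<ge> 0" "\<And>p q. p \<le> 1 \<Longrightarrow> q \<le> 1 \<Longrightarrow> \<bar>flat 2 p - flat 2 q\<bar> \<le> L * \<bar>p - q\<bar>"
    using flat_lipschitz[of 2] by metis
  have xx: "0 \<le> x \<bullet> x" "norm x \<le> 2 \<Longrightarrow> x \<bullet> x \<le> 4" for x :: "real^2"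
    using power_mono[of "norm x" 2 2] by (auto simp: dot_square_norm)
  have Ti: "integrable lebesgue (\<lambda>x. Up x * (x \<bullet> a) * flat 2 (1 - lam * (x \<bullet> x)))" if "lam \<ge> 0" for lam
    by (rule bound_int[of _ C2]) (use that xx in \<open>auto intro!: C2\<close>)
  have hb: "\<bar>- (x \<bullet> x) * ?h x\<bar> \<le> 4 * (C4 + 2 * C3)" if "norm x \<le> 2" for x :: "real^2"
  proof -
    have "\<bar>?h x\<bar> \<le> C4 + 2 * C3" using C4[of "1 - x \<bullet> x"] C3[of "1 - x \<bullet> x"] xx(1)[of x] by (simp add: abs_le_iff)
    then show ?thesis unfolding abs_mult using xx[of x] that by (intro mult_mono) auto
  qed
  have Di: "integrable lebesgue (\<lambda>x. Up x * (x \<bullet> a) * (- (x \<bullet> x) * ?h x))"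
  proof (rule bound_int[OF _ hb])
    have "(\<lambda>x::real^2. x \<bullet> x) \<in> borel_measurable lebesgue" by (rule smooth_measurable[OF smooth_inner_self])
    then show "(\<lambda>x. - (x \<bullet> x) * ?h x) \<in> borel_measurable lebesgue"
      by (intro borel_measurable_times borel_measurable_uminus borel_measurable_diff fm1 borel_measurable_const)
  qed
  \<comment> \<open>The left side is the integral of \<open>Up\<close> times minus the Laplacian of
    \<open>\<phi>\<close>. One partial integration turns it into the integral of
    \<open>Gp x \<bullet> grad \<phi> x\<close>, which the variational inequality bounds by
    0.\<close>
  have I: "8 * T 1 + 4 * D \<le> 0"
  proof -
    have tp: "test_fun UNIV (\<lambda>z. pd \<phi> z b)" for b by (rule test_fun_pd[OF test_\<phi>])
    have i1: "integrable lebesgue (\<lambda>x. Up x * pd (\<lambda>z. pd \<phi> z b) x b)" for b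
      using L2_mult_integrable[OF UpL test_fun_L2[OF test_fun_pd[OF tp]]] by (simp add: lebesgue_on_UNIV_eq)
    have i2: "integrable lebesgue (\<lambda>x. (Gp x \<bullet> b) * pd \<phi> x b)" for b
      using L2_mult_integrable[OF L2_inner[OF GpL] test_fun_L2[OF tp]] by (simp add: lebesgue_on_UNIV_eq)
    have "(\<integral>x. Gp x \<bullet> grad \<phi> x \<partial>lebesgue) = (\<integral>x. (\<Sum>b\<in>Basis. (Gp x \<bullet> b) * pd \<phi> x b) \<partial>lebesgue)"
      by (simp add: grad_def inner_sum_right mult.commute)
    also have "\<dots> = (\<Sum>b\<in>Basis. \<integral>x. (Gp x \<bullet> b) * pd \<phi> x b \<partial>lebesgue)"
      by (rule Bochner_Integration.integral_sum) (rule i2)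
    also have "\<dots> = (\<Sum>b\<in>Basis. - (\<integral>x. Up x * pd (\<lambda>z. pd \<phi> z b) x b \<partial>lebesgue))"
      using weak_gradD[OF cH1D(2)[OF c] tp] by (intro sum.cong) auto
    also have "\<dots> = - (\<integral>x. (\<Sum>b\<in>Basis. Up x * pd (\<lambda>z. pd \<phi> z b) x b) \<partial>lebesgue)"
      by (subst Bochner_Integration.integral_sum[OF i1]) (simp add: sum_negf)
    also have "(\<lambda>x. \<Sum>b\<in>Basis. Up x * pd (\<lambda>z. pd \<phi> z b) x b) =
        (\<lambda>x. - (8 * (Up x * (x \<bullet> a) * flat 2 (1 - 1 * (x \<bullet> x))) + 4 * (Up x * (x \<bullet> a) * (- (x \<bullet> x) * ?h x))))"
      unfolding sum_distrib_left[symmetric] laplace_\<phi> by (simp add: algebra_simps)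
    also have "- (\<integral>x. - (8 * (Up x * (x \<bullet> a) * flat 2 (1 - 1 * (x \<bullet> x))) + 4 * (Up x * (x \<bullet> a) * (- (x \<bullet> x) * ?h x))) \<partial>lebesgue) = 8 * T 1 + 4 * D"
      unfolding T_def D_def
      using integrable_mult_right[OF Ti[of 1], of 8] integrable_mult_right[OF Di, of 4]
      by (simp only: integral_minus minus_minus Bochner_Integration.integral_add integral_mult_right_zero zero_le_one)
    finally show ?thesis using vi by simp
  qed
  \<comment> \<open>Degree \<open>\<alpha>\<close> from \<open>u\<close>, 1 from
    \<open>x \<bullet> a\<close> and 2 from the Jacobian in the plane; halved, because
    \<open>lam\<close> multiplies the square of the norm.\<close>
  define \<beta> where "\<beta> = (\<alpha> + 3) / 2"
  have scaling: "T lam = lam powr (- \<beta>) * T 1" if lam: "lam \<ge> 1" for lam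
  proof -
    define r where "r = lam powr (- 1 / 2)"
    have r: "r > 0" "r \<le> 1" using lam powr_mono[of "- 1 / 2" 0 lam] by (auto simp: r_def)
    have "r\<^sup>2 = lam powr (- 1)" using lam by (simp add: r_def powr_powr flip: powr_numeral)
    then have r2: "lam * r\<^sup>2 = 1" using lam by (simp add: powr_minus)
    have "T lam = \<bar>r\<bar> ^ DIM(real^2) * (\<integral>x. Up (0 + r *\<^sub>R x) * ((0 + r *\<^sub>R x) \<bullet> a) * flat 2 (1 - lam * ((0 + r *\<^sub>R x) \<bullet> (0 + r *\<^sub>R x))) \<partial>lebesgue)"
      unfolding T_def by (rule integral_affine) (use r in auto)
    also have "(\<integral>x. Up (0 + r *\<^sub>R x) * ((0 + r *\<^sub>R x) \<bullet> a) * flat 2 (1 - lam * ((0 + r *\<^sub>R x) \<bullet> (0 + r *\<^sub>R x))) \<partial>lebesgue) =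
        (\<integral>x. r powr \<alpha> * r * (Up x * (x \<bullet> a) * flat 2 (1 - 1 * (x \<bullet> x))) \<partial>lebesgue)"
    proof (rule integral_cong_AE)
      have "(\<lambda>x. Up (0 + r *\<^sub>R x)) \<in> borel_measurable lebesgue"
        by (rule measurable_compose[OF affine_measurable_lebesgue]) (use r in auto)
      moreover have "(\<lambda>x::real^2. (0 + r *\<^sub>R x) \<bullet> a) \<in> borel_measurable lebesgue"
        by (intro continuous_imp_lebesgue continuous_intros)
      moreover have "(\<lambda>x::real^2. flat 2 (1 - lam * ((0 + r *\<^sub>R x) \<bullet> (0 + r *\<^sub>R x)))) \<in> borel_measurable lebesgue"
        using fm[of 2 "lam * r\<^sup>2"] by (simp add: power2_eq_square mult.assoc)
      ultimately show "(\<lambda>x. Up (0 + r *\<^sub>R x) * ((0 + r *\<^sub>R x) \<bullet> a) * flat 2 (1 - lam * ((0 + r *\<^sub>R x) \<bullet> (0 + r *\<^sub>R x)))) \<in> borel_measurable lebesgue"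
        by (intro borel_measurable_times)
      show "(\<lambda>x. r powr \<alpha> * r * (Up x * (x \<bullet> a) * flat 2 (1 - 1 * (x \<bullet> x)))) \<in> borel_measurable lebesgue"
        by (intro borel_measurable_times fm) measurable
      show "AE x in lebesgue. Up (0 + r *\<^sub>R x) * ((0 + r *\<^sub>R x) \<bullet> a) * flat 2 (1 - lam * ((0 + r *\<^sub>R x) \<bullet> (0 + r *\<^sub>R x))) =
          r powr \<alpha> * r * (Up x * (x \<bullet> a) * flat 2 (1 - 1 * (x \<bullet> x)))"
        using hom[OF r(1)]
      proof eventually_elim
        case (elim x)
        have e: "lam * ((0 + r *\<^sub>R x) \<bullet> (0 + r *\<^sub>R x)) = x \<bullet> x"
          using r2 by (simp add: power2_eq_square mult.assoc[symmetric])
        show ?case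
        proof (cases "norm x < 1")
          case True
          then have "norm (r *\<^sub>R x) \<le> 1" using r mult_le_one[of r "norm x"] by simp
          then have "Up (r *\<^sub>R x) = r powr \<alpha> * Up x"
            using Up1[of "r *\<^sub>R x"] Up1[of x] True elim
            by (simp add: max_def zero_le_mult_iff mult_le_0_iff)
          then show ?thesis unfolding e by simp
        next
          case False
          then have "1 - x \<bullet> x \<le> 0" using power_mono[of 1 "norm x" 2] by (simp add: dot_square_norm)
          then show ?thesis unfolding e by (simp add: flat_0)
        qed
      qed
    qed
    also have "\<dots> = r powr \<alpha> * r * T 1" unfolding T_def by (rule integral_mult_right_zero)
    finally have "T lam = r\<^sup>2 * (r powr \<alpha> * r) * T 1" using r by simp
    also have "r\<^sup>2 * (r powr \<alpha> * r) = r powr (\<alpha> + 3)"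
    proof -
      have "r powr (\<alpha> + 3) = r powr \<alpha> * r powr 3" by (rule powr_add)
      also have "r powr 3 = r ^ 3" using r by simp
      finally show ?thesis by (simp add: power2_eq_square power3_eq_cube mult_ac)
    qed
    also have "r powr (\<alpha> + 3) = lam powr (- \<beta>)" by (simp add: r_def powr_powr \<beta>_def)
    finally show ?thesis .
  qed
  \<comment> \<open>The same difference quotients of \<open>T\<close> at 1 are evaluated twice:
    under the integral by dominated convergence, and from the power law
    \<open>scaling\<close>.\<close>
  have "D = - \<beta> * T 1"
  proof -
    \<comment> \<open>The sequence approaches 1 from above. For \<open>lam \<ge> 1\<close> the
      dilation factor is at most 1, so points of the unit ball stay in the region where
      \<open>Up\<close> is the positive part of \<open>u\<close>.\<close>
    define l where "l n = 1 + 1 / real (Suc n)" for n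
    have l: "l n \<ge> 1" "(l n - 1) * real (Suc n) = 1" for n by (auto simp: l_def simp del: of_nat_Suc)
    have fl: "filterlim (\<lambda>n. 1 / real (Suc n)) (at 0) sequentially"
      by (intro filterlim_atI lim_1_over_n[THEN LIMSEQ_Suc] always_eventually) auto
    have "(\<lambda>n. \<integral>x. Up x * (x \<bullet> a) * ((flat 2 (1 - l n * (x \<bullet> x)) - flat 2 (1 - 1 * (x \<bullet> x))) * real (Suc n)) \<partial>lebesgue) \<longlonglongrightarrow> D"
      unfolding D_def
    proof (rule integral_dominated_convergence)
      show "integrable lebesgue (\<lambda>x. norm (Up x * (2 * norm a * (L * 4))))"
        using integrable_mult_left[OF Upi] by (intro integrable_norm) blast
      show "(\<lambda>x. Up x * (x \<bullet> a) * (- (x \<bullet> x) * ?h x)) \<in> borel_measurable lebesgue"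
        by (rule borel_measurable_integrable[OF Di])
      show "(\<lambda>x. Up x * (x \<bullet> a) * ((flat 2 (1 - l n * (x \<bullet> x)) - flat 2 (1 - 1 * (x \<bullet> x))) * real (Suc n))) \<in> borel_measurable lebesgue" for n
        by (intro borel_measurable_times borel_measurable_diff fm) measurable
      show "AE x in lebesgue. (\<lambda>n. Up x * (x \<bullet> a) * ((flat 2 (1 - l n * (x \<bullet> x)) - flat 2 (1 - 1 * (x \<bullet> x))) * real (Suc n)))
          \<longlonglongrightarrow> Up x * (x \<bullet> a) * (- (x \<bullet> x) * ?h x)"
      proof (intro AE_I2 tendsto_mult_left)
        fix x :: "real^2"
        have "((\<lambda>lam. flat 2 (1 - lam * (x \<bullet> x))) has_real_derivative (flat (2 + 2) (1 - 1 * (x \<bullet> x)) - real 2 * flat (2 + 1) (1 - 1 * (x \<bullet> x))) * (- (x \<bullet> x))) (at 1)"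
          by (rule DERIV_chain2[OF flat_has_derivative]) (auto intro!: derivative_eq_intros)
        then have "((\<lambda>h. (flat 2 (1 - (1 + h) * (x \<bullet> x)) - flat 2 (1 - 1 * (x \<bullet> x))) / h) \<longlongrightarrow> - (x \<bullet> x) * ?h x) (at 0)"
          by (simp add: DERIV_def mult.commute)
        from filterlim_compose[OF this fl]
        show "(\<lambda>n. (flat 2 (1 - l n * (x \<bullet> x)) - flat 2 (1 - 1 * (x \<bullet> x))) * real (Suc n)) \<longlonglongrightarrow> - (x \<bullet> x) * ?h x"
          by (simp add: l_def del: of_nat_Suc)
      qed
      show "AE x in lebesgue. norm (Up x * (x \<bullet> a) * ((flat 2 (1 - l n * (x \<bullet> x)) - flat 2 (1 - 1 * (x \<bullet> x))) * real (Suc n)))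
          \<le> norm (Up x * (2 * norm a * (L * 4)))" for n
      proof (rule AE_I2)
        fix x
        show "norm (Up x * (x \<bullet> a) * ((flat 2 (1 - l n * (x \<bullet> x)) - flat 2 (1 - 1 * (x \<bullet> x))) * real (Suc n)))
          \<le> norm (Up x * (2 * norm a * (L * 4)))"
        proof (cases "norm x \<le> 2")
          case True
          have a1: "\<bar>x \<bullet> a\<bar> \<le> 2 * norm a"
            using order_trans[OF Cauchy_Schwarz_ineq2 mult_right_mono[OF True norm_ge_zero]] .
          have "\<bar>flat 2 (1 - l n * (x \<bullet> x)) - flat 2 (1 - 1 * (x \<bullet> x))\<bar> \<le> L * \<bar>(1 - l n * (x \<bullet> x)) - (1 - 1 * (x \<bullet> x))\<bar>"
            using xx(1)[of x] l(1)[of n] by (intro L(2)) auto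
          also have "(1 - l n * (x \<bullet> x)) - (1 - 1 * (x \<bullet> x)) = - ((l n - 1) * (x \<bullet> x))" by (simp add: algebra_simps)
          also have "\<bar>- ((l n - 1) * (x \<bullet> x))\<bar> = (l n - 1) * (x \<bullet> x)" using xx(1)[of x] l(1)[of n] by simp
          finally have "\<bar>flat 2 (1 - l n * (x \<bullet> x)) - flat 2 (1 - 1 * (x \<bullet> x))\<bar> * real (Suc n) \<le> L * ((l n - 1) * (x \<bullet> x)) * real (Suc n)"
            by (rule mult_right_mono) simp
          also have "\<dots> = L * (x \<bullet> x) * ((l n - 1) * real (Suc n))" by (simp only: mult_ac)
          also have "\<dots> \<le> L * 4" unfolding l(2) using xx(2)[OF True] L(1) by (simp add: mult_left_mono)
          finally have b1: "\<bar>(flat 2 (1 - l n * (x \<bullet> x)) - flat 2 (1 - 1 * (x \<bullet> x))) * real (Suc n)\<bar> \<le> L * 4"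
            by (simp only: abs_mult abs_of_nat)
          have "\<bar>x \<bullet> a\<bar> * \<bar>(flat 2 (1 - l n * (x \<bullet> x)) - flat 2 (1 - 1 * (x \<bullet> x))) * real (Suc n)\<bar> \<le> 2 * norm a * (L * 4)"
            by (rule mult_mono[OF a1 b1]) auto
          then have "\<bar>Up x\<bar> * (\<bar>x \<bullet> a\<bar> * \<bar>(flat 2 (1 - l n * (x \<bullet> x)) - flat 2 (1 - 1 * (x \<bullet> x))) * real (Suc n)\<bar>) \<le> \<bar>Up x\<bar> * (2 * norm a * (L * 4))"
            by (rule mult_left_mono) simp
          then show ?thesis using L(1) by (simp only: real_norm_def abs_mult mult.assoc abs_norm_cancel abs_of_nonneg abs_numeral)
        next
          case False
          then show ?thesis using cH1D(4)[OF c, of x] s by simp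
        qed
      qed
    qed
    moreover have "(\<integral>x. Up x * (x \<bullet> a) * ((flat 2 (1 - l n * (x \<bullet> x)) - flat 2 (1 - 1 * (x \<bullet> x))) * real (Suc n)) \<partial>lebesgue) =
        ((1 + 1 / real (Suc n)) powr (- \<beta>) - 1) / (1 / real (Suc n)) * T 1" for n
    proof -
      have "(\<integral>x. Up x * (x \<bullet> a) * ((flat 2 (1 - l n * (x \<bullet> x)) - flat 2 (1 - 1 * (x \<bullet> x))) * real (Suc n)) \<partial>lebesgue) =
          (\<integral>x. real (Suc n) * (Up x * (x \<bullet> a) * flat 2 (1 - l n * (x \<bullet> x)) - Up x * (x \<bullet> a) * flat 2 (1 - 1 * (x \<bullet> x))) \<partial>lebesgue)"
        by (simp only: algebra_simps)
      also have "\<dots> = real (Suc n) * (T (l n) - T 1)"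
        unfolding T_def using Ti[of "l n"] Ti[of 1] l(1)[of n]
        by (subst integral_mult_right_zero, subst Bochner_Integration.integral_diff) auto
      also have "T (l n) = l n powr (- \<beta>) * T 1" by (rule scaling[OF l(1)])
      also have "real (Suc n) * (l n powr (- \<beta>) * T 1 - T 1) = ((1 + 1 / real (Suc n)) powr (- \<beta>) - 1) / (1 / real (Suc n)) * T 1"
        by (simp add: l_def algebra_simps del: of_nat_Suc)
      finally show ?thesis .
    qed
    ultimately have d: "(\<lambda>n. ((1 + 1 / real (Suc n)) powr (- \<beta>) - 1) / (1 / real (Suc n)) * T 1) \<longlonglongrightarrow> D" by simp
    have "((\<lambda>x. x powr (- \<beta>)) has_real_derivative - \<beta>) (at 1)"
      by (auto intro!: derivative_eq_intros)
    then have "((\<lambda>h. ((1 + h) powr (- \<beta>) - 1) / h) \<longlongrightarrow> - \<beta>) (at 0)"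
      by (simp add: DERIV_def)
    from tendsto_mult[OF filterlim_compose[OF this fl] tendsto_const]
    have "(\<lambda>n. ((1 + 1 / real (Suc n)) powr (- \<beta>) - 1) / (1 / real (Suc n)) * T 1) \<longlonglongrightarrow> - \<beta> * T 1" .
    then show ?thesis using LIMSEQ_unique[OF d] by simp
  qed
  \<comment> \<open>The factor is \<open>8 - 4 * \<beta>\<close>; it is positive because the degree
    is less than 1.\<close>
  then have "2 * (1 - \<alpha>) * T 1 \<le> 0" using I by (simp add: \<beta>_def algebra_simps)
  then have T0: "T 1 \<le> 0" using \<alpha> by (simp add: mult_le_0_iff)
  have nn: "AE x in lebesgue. 0 \<le> Up x * (x \<bullet> a) * flat 2 (1 - 1 * (x \<bullet> x))"
    using Gp2 AE_hyperplane[OF a]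
  proof eventually_elim
    case (elim x)
    show ?case
    proof (cases "norm x \<le> 1 \<and> a \<bullet> x < 0")
      case True
      then show ?thesis using elim by simp
    next
      case False
      then consider "norm x > 1" | "a \<bullet> x > 0" using elim by linarith
      then show ?thesis
      proof cases
        case 1
        then have "1 - x \<bullet> x \<le> 0" using power_mono[of 1 "norm x" 2] by (simp add: dot_square_norm)
        then show ?thesis by (simp add: flat_0)
      next
        case 2
        then show ?thesis using Up0[of x] flat_nonneg by (simp add: inner_commute)
      qed
    qed
  qed
  have "T 1 = 0" using T0 integral_nonneg_AE[OF nn] unfolding T_def by linarith
  then have "AE x in lebesgue. Up x * (x \<bullet> a) * flat 2 (1 - 1 * (x \<bullet> x)) = 0"
    using integral_nonneg_eq_0_iff_AE[OF Ti[of 1] nn] by (simp add: T_def)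
  then show ?thesis
    using pos
  proof eventually_elim
    case (elim x)
    show ?case
    proof (intro impI)
      assume x: "norm x < 1" "a \<bullet> x > 0"
      have "(norm x)\<^sup>2 < 1" using x(1) by (simp add: abs_square_less_1)
      then have "flat 2 (1 - x \<bullet> x) > 0" by (simp add: dot_square_norm flat_pos)
      then have "Up x = 0" using elim(1) x(2) by (auto simp: inner_commute)
      then have "u x \<le> 0" using Up1[of x] x(1) by (simp add: max_def split: if_splits)
      then show "u x = 0" using elim(2) x by simp
    qed
  qed
qed

text \<open>Homogeneity spreads the vanishing from the unit half-disc to balls of every
  radius.\<close>

lemma half_zero: "AE x in lebesgue. a \<bullet> x > 0 \<longrightarrow> u x = 0"
proof -
  have "AE x in lebesgue. \<forall>n::nat. norm x < real (Suc n) \<longrightarrow> a \<bullet> x > 0 \<longrightarrow> u x = 0"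
    unfolding AE_all_countable
  proof
    fix n :: nat
    let ?t = "1 / real (Suc n)"
    have t: "?t > 0" by simp
    have "AE x in lebesgue. norm (0 + ?t *\<^sub>R x) < 1 \<longrightarrow> a \<bullet> (0 + ?t *\<^sub>R x) > 0 \<longrightarrow> u (0 + ?t *\<^sub>R x) = 0"
      by (rule AE_affine[OF half_zero_ball]) (use t in linarith)
    then show "AE x in lebesgue. norm x < real (Suc n) \<longrightarrow> a \<bullet> x > 0 \<longrightarrow> u x = 0"
      using hom[OF t]
    proof eventually_elim
      case (elim x)
      show ?case
      proof (intro impI)
        assume x: "norm x < real (Suc n)" "a \<bullet> x > 0"
        have "norm (?t *\<^sub>R x) < 1" using x(1) by (simp add: divide_less_eq del: of_nat_Suc)
        moreover have "a \<bullet> (?t *\<^sub>R x) > 0" using x(2) by (simp del: of_nat_Suc)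
        ultimately have "u (?t *\<^sub>R x) = 0" using elim(1) by simp
        moreover have "?t powr \<alpha> > 0" by simp
        ultimately show "u x = 0" using elim(2) by (metis mult_eq_0_iff less_irrefl)
      qed
    qed
  qed
  then show ?thesis
  proof (rule eventually_mono, intro impI)
    fix x assume x: "\<forall>n::nat. norm x < real (Suc n) \<longrightarrow> a \<bullet> x > 0 \<longrightarrow> u x = 0" "a \<bullet> x > 0"
    obtain n :: nat where "norm x < real n" using reals_Archimedean2 by blast
    then have "norm x < real (Suc n)" by simp
    then show "u x = 0" using x by blast
  qed
qed

end

lemma half_minimizer_neg:
  assumes "half_minimizer u g a \<alpha>"
    shows "half_minimizer (\<lambda>x. - u x) (\<lambda>x. - g x) (- a) \<alpha>"
proof -
  interpret half_minimizer u g a \<alpha> by fact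
  show ?thesis
  proof
    show "- a \<noteq> 0" using a by simp
    show "L2 (ball 0 2) (\<lambda>x. - u x)" using L2_cmult[OF u(1), of "-1"] by simp
    show "is_weak_grad (ball 0 2) (\<lambda>x. - u x) (\<lambda>x. - g x)" using is_weak_grad_cmult[OF u(2), of "-1"] by simp
    show "AE x in lebesgue. x \<in> ball 0 2 \<longrightarrow> - a \<bullet> x > 0 \<longrightarrow> - u x \<ge> 0"
      using neg by (rule eventually_mono) auto
    show "AE x in lebesgue. x \<in> ball 0 2 \<longrightarrow> - a \<bullet> x < 0 \<longrightarrow> - u x \<le> 0"
      using pos by (rule eventually_mono) auto
    show "AE x in lebesgue. - u (t *\<^sub>R x) = t powr \<alpha> * - u x" if "t > 0" for t
      using hom[OF that] by (rule eventually_mono) auto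
    show "\<alpha> < 1" by (rule \<alpha>)
    fix s w G
    assume s: "s < 2" and w: "cH1 s w G"
      and 1: "AE x in lebesgue. x \<in> ball 0 2 \<longrightarrow> - a \<bullet> x > 0 \<longrightarrow> - u x + w x \<ge> 0"
      and 2: "AE x in lebesgue. x \<in> ball 0 2 \<longrightarrow> - a \<bullet> x < 0 \<longrightarrow> - u x + w x \<le> 0"
    have eq: "norm (- g x + G x) = norm (g x + -1 *\<^sub>R G x)" for x
      using norm_minus_cancel[of "- g x + G x"] by simp
    show "(\<integral>\<^sup>+x\<in>ball 0 2. ennreal ((norm (- g x))\<^sup>2) \<partial>lebesgue) \<le>
        (\<integral>\<^sup>+x\<in>ball 0 2. ennreal ((norm (- g x + G x))\<^sup>2) \<partial>lebesgue)"
      unfolding eq norm_minus_cancel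
      by (rule min[OF s cH1_cmult[OF w, of "-1"]])
         (rule eventually_mono[OF 2], simp, rule eventually_mono[OF 1], simp)
  qed
qed

theorem proposition6p2:
  fixes \<sigma> :: real and u :: "real^2 \<Rightarrow> real" and E :: "(real^2) set"
  assumes "0 < \<sigma>" and "\<sigma> < 1"
    and "minimizing_cone \<sigma> u E"
  shows "is_halfspace E \<and> (AE x in lebesgue. u x = 0)"
proof -
  have mg: "minimizing_global \<sigma> u E" and nE: "normalized E" and 0: "0 \<in> frontier E"
    and hom: "\<And>t. t > 0 \<Longrightarrow> AE x in lebesgue. u (t *\<^sub>R x) = t powr (1 - \<sigma> / 2) * u x"
    and cone: "\<And>t. t > 0 \<Longrightarrow> (\<lambda>x. t *\<^sub>R x) ` E = E"
    using assms(3) by (auto simp: minimizing_cone_def)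
  \<comment> \<open>The radius 2 fits the cutoff of \<open>shear_exists\<close>, which is 1 on the
    unit ball and supported in this ball.\<close>
  have min: "minimizing_pair \<sigma> (ball 0 2) u E"
    using mg by (simp add: minimizing_global_def)
  note D = minimizing_pairD[OF min]
  have fr: "0 < emeasure lebesgue (E \<inter> ball 0 \<delta>)" "emeasure lebesgue (E \<inter> ball 0 \<delta>) < emeasure lebesgue (ball (0::real^2) \<delta>)"
    if "\<delta> > 0" for \<delta>
    using nE 0 that by (auto simp: normalized_def)
  obtain a where a: "a \<noteq> 0" "AE x in lebesgue. a \<bullet> x > 0 \<longrightarrow> x \<in> E" "AE x in lebesgue. a \<bullet> x < 0 \<longrightarrow> x \<notin> E"
    by (rule ordered_cone_half_plane[OF D(3) fr cone cone_translate_ordered[OF min assms(1,2) cone]]) auto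
  have half: "is_halfspace E" by (rule normalized_half_plane[OF D(3) nE a])
  let ?g = "weak_grad (ball 0 2) u"
  \<comment> \<open>The competitors keep the set \<open>E\<close>, which agrees almost everywhere
    with the half-plane; its perimeter is finite and cancels from both energies.\<close>
  have hm: "half_minimizer u ?g a (1 - \<sigma> / 2)"
  proof
    show "AE x in lebesgue. x \<in> ball 0 2 \<longrightarrow> a \<bullet> x > 0 \<longrightarrow> u x \<ge> 0"
      using D(4) a(2) by eventually_elim auto
    show "AE x in lebesgue. x \<in> ball 0 2 \<longrightarrow> a \<bullet> x < 0 \<longrightarrow> u x \<le> 0"
      using D(5) a(3) by eventually_elim auto
    show "1 - \<sigma> / 2 < 1" using assms by simp
    fix s w G
    assume s: "s < 2" and w: "cH1 s w G"
      and 1: "AE x in lebesgue. x \<in> ball 0 2 \<longrightarrow> a \<bullet> x > 0 \<longrightarrow> u x + w x \<ge> 0"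
      and 2: "AE x in lebesgue. x \<in> ball 0 2 \<longrightarrow> a \<bullet> x < 0 \<longrightarrow> u x + w x \<le> 0"
    have p: "AE x in lebesgue. x \<in> E \<inter> ball 0 2 \<longrightarrow> u x + w x \<ge> 0"
      using 1 a(3) AE_hyperplane[OF a(1)] by eventually_elim (auto simp: linorder_neq_iff)
    have n: "AE x in lebesgue. x \<in> - E \<inter> ball 0 2 \<longrightarrow> u x + w x \<le> 0"
      using 2 a(2) AE_hyperplane[OF a(1)] by eventually_elim (auto simp: linorder_neq_iff)
    have "(\<integral>\<^sup>+x\<in>ball 0 2. ennreal ((norm (?g x))\<^sup>2) \<partial>lebesgue) + frac_perimeter \<sigma> E (ball 0 2) \<le>
        (\<integral>\<^sup>+x\<in>ball 0 2. ennreal ((norm (?g x + G x))\<^sup>2) \<partial>lebesgue) + frac_perimeter \<sigma> E (ball 0 2)"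
      by (rule minimizing_compare[OF min w s D(3) refl p n])
    then have le: "frac_perimeter \<sigma> E (ball 0 2) + (\<integral>\<^sup>+x\<in>ball 0 2. ennreal ((norm (?g x))\<^sup>2) \<partial>lebesgue) \<le>
        frac_perimeter \<sigma> E (ball 0 2) + (\<integral>\<^sup>+x\<in>ball 0 2. ennreal ((norm (?g x + G x))\<^sup>2) \<partial>lebesgue)"
      by (subst (1 2) add.commute)
    have "frac_perimeter \<sigma> E (ball 0 2) < \<infinity>" using D(6) by (simp add: energy_def)
    from ennreal_add_left_leD[OF this le]
    show "(\<integral>\<^sup>+x\<in>ball 0 2. ennreal ((norm (?g x))\<^sup>2) \<partial>lebesgue) \<le>
        (\<integral>\<^sup>+x\<in>ball 0 2. ennreal ((norm (?g x + G x))\<^sup>2) \<partial>lebesgue)" .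
  qed (fact a(1) D(1) D(2) hom)+
  have "AE x in lebesgue. u x = 0"
    using half_minimizer.half_zero[OF hm] half_minimizer.half_zero[OF half_minimizer_neg[OF hm]] AE_hyperplane[OF a(1)]
    by eventually_elim (auto simp: linorder_neq_iff)
  with half show ?thesis ..
qed

end
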